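(* Let $d\ge1$ and $p,p',q,r\in[1,\infty]$ with $\frac1p+\frac1{p'}=\frac1r$. Let $\rho:\mathbb{R}^d\to\mathbb{R}$ with $\rho\in L^{p'}(\mathbb{R}^d;\mathbb{R})\cap\dot B^0_{p',q}(\mathbb{R}^d;\mathbb{R})$, and let $u:\mathbb{R}^d\to\mathbb{R}^d$ be divergence-free with $\nabla u\in L^p(\mathbb{R}^d;\mathbb{R}^{d\times d})\cap\dot B^0_{p,q}(\mathbb{R}^d;\mathbb{R}^{d\times d})$. Let $\varphi\in\mathcal{S}(\mathbb{R}^d;\mathbb{R})$ with $\int\varphi=1$, $\varphi_\delta(x)=\delta^{-d}\varphi(x/\delta)$, and $$R_\delta(u,\rho)(x)=u(x)\cdot\nabla(\rho*\varphi_\delta)(x)-\nabla\cdot((u\rho)*\varphi_\delta)(x).$$ Then $$\left(\int_0^\infty\|R_\delta(u,\rho)\|_{L^r_x}^q\,\frac{d\delta}{\delta}\right)^{1/q}\le C\left(\|\nabla u\|_{\dot B^0_{p,q}}\|\rho\|_{L^{p'}_x}+\|\nabla u\|_{L^p_x}\|\rho\|_{\dot B^0_{p',q}}\right),$$ where $C>0$ depends only on $d$ and on $\|(1+|x|^2)\nabla\varphi\|_{L^1_x}+\||x|\nabla^2\varphi\|_{L^1_x}$, and in particular not on $p,p',q,r$ (with the usual modification for $q=\infty$).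
   Context: The homogeneous Besov space $\dot B^s_{p,q}(\mathbb{R}^d;\mathbb{R}^{d'})$ consists of the Schwartz distributions $f$ with finite norm $\|f\|_{\dot B^s_{p,q}}=\left(\sum_{n\in\mathbb{Z}}2^{ns}\|\psi_n*f\|_{L^p}^q\right)^{1/q}$ (supremum if $q=\infty$), where $\hat\psi_n(\xi)=\chi(2^{-n}\xi)$ for a fixed $\chi\in C_c^\infty(\mathbb{R}^d)$ with $\mathrm{supp}\,\chi=\{\frac12\le|\xi|\le2\}$, $\chi>0$ on $\{\frac12<|\xi|<2\}$, and $\sum_{n\in\mathbb{Z}}\chi(2^{-n}\xi)=1$ for $\xi\ne0$. *)

theory Defs
  imports "HOL-Analysis.Analysis" "HOL-Probability.Essential_Supremum"
begin

fun dir_deriv :: "(real^'n \<Rightarrow> real) \<Rightarrow> (real^'n) list \<Rightarrow> real^'n \<Rightarrow> real" where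
  "dir_deriv f [] = f"
| "dir_deriv f (v # vs) = (\<lambda>x. frechet_derivative (dir_deriv f vs) (at x) v)"

definition smooth_fun :: "(real^'n \<Rightarrow> real) \<Rightarrow> bool" where
  "smooth_fun f \<longleftrightarrow> (\<forall>vs. set vs \<subseteq> Basis \<longrightarrow> (\<forall>x. dir_deriv f vs differentiable (at x)))"

definition fsupport :: "(real^'n \<Rightarrow> real) \<Rightarrow> (real^'n) set" where
  "fsupport f = closure {x. f x \<noteq> 0}"

definition test_fun :: "(real^'n \<Rightarrow> real) \<Rightarrow> bool" where
  "test_fun f \<longleftrightarrow> smooth_fun f \<and> compact (fsupport f)"

definition schwartz :: "(real^'n \<Rightarrow> real) \<Rightarrow> bool" where
  "schwartz f \<longleftrightarrow> smooth_fun f \<and>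
     (\<forall>vs. set vs \<subseteq> Basis \<longrightarrow> (\<forall>k::nat. bounded (range (\<lambda>x. (1 + norm x) ^ k * dir_deriv f vs x))))"

definition partial :: "(real^'n \<Rightarrow> real) \<Rightarrow> 'n \<Rightarrow> real^'n \<Rightarrow> real" where
  "partial f i = (\<lambda>x. frechet_derivative f (at x) (axis i 1))"

definition loc_integrable :: "(real^'n \<Rightarrow> real) \<Rightarrow> bool" where
  "loc_integrable f \<longleftrightarrow> (\<forall>K. compact K \<longrightarrow> set_integrable lebesgue K f)"

definition weak_grad :: "(real^'n \<Rightarrow> real^'n) \<Rightarrow> (real^'n \<Rightarrow> real^'n^'n) \<Rightarrow> bool" where
  "weak_grad u G \<longleftrightarrow>
     (\<forall>i. loc_integrable (\<lambda>x. u x $ i)) \<and> (\<forall>i j. loc_integrable (\<lambda>x. G x $ i $ j)) \<and>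
     (\<forall>\<zeta>. test_fun \<zeta> \<longrightarrow> (\<forall>i j.
        (\<integral>x. u x $ i * partial \<zeta> j x \<partial>lebesgue) = - (\<integral>x. G x $ i $ j * \<zeta> x \<partial>lebesgue)))"

definition div_free :: "(real^'n \<Rightarrow> real^'n) \<Rightarrow> bool" where
  "div_free u \<longleftrightarrow> (\<forall>\<zeta>. test_fun \<zeta> \<longrightarrow> (\<integral>x. (\<Sum>i\<in>UNIV. u x $ i * partial \<zeta> i x) \<partial>lebesgue) = 0)"

definition enn_powr :: "ennreal \<Rightarrow> real \<Rightarrow> ennreal" where
  "enn_powr a t = (if a = top then top else ennreal (enn2real a powr t))"

text \<open>L^p norm of a nonnegative (pointwise norm) function.\<close>
definition Lp_norm :: "ennreal \<Rightarrow> (real^'n \<Rightarrow> real) \<Rightarrow> ennreal" where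
  "Lp_norm p g = (if p = top then esssup lebesgue (\<lambda>x. ennreal (g x))
     else enn_powr (\<integral>\<^sup>+ x. ennreal (g x powr enn2real p) \<partial>lebesgue) (1 / enn2real p))"

definition LP_symbol :: "(real^'n \<Rightarrow> real) \<Rightarrow> bool" where
  "LP_symbol chi \<longleftrightarrow> test_fun chi \<and>
     fsupport chi = {\<xi>. 1/2 \<le> norm \<xi> \<and> norm \<xi> \<le> 2} \<and>
     (\<forall>\<xi>. 1/2 < norm \<xi> \<and> norm \<xi> < 2 \<longrightarrow> chi \<xi> > 0) \<and>
     (\<forall>\<xi>. \<xi> \<noteq> 0 \<longrightarrow> ((\<lambda>n::int. chi ((2 powr (- real_of_int n)) *\<^sub>R \<xi>)) has_sum 1) UNIV)"

text \<open>psi_n = inverse Fourier transform of chi(2^-n .), convention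
  hat f(xi) = int f(x) e^(-2 pi i x.xi) dx.\<close>
definition LP_psi :: "(real^'n \<Rightarrow> real) \<Rightarrow> int \<Rightarrow> real^'n \<Rightarrow> complex" where
  "LP_psi chi n x = (\<integral>\<xi>. complex_of_real (chi ((2 powr (- real_of_int n)) *\<^sub>R \<xi>)) * cis (2 * pi * (x \<bullet> \<xi>)) \<partial>lebesgue)"

definition LP_block :: "(real^'n \<Rightarrow> real) \<Rightarrow> int \<Rightarrow> (real^'n \<Rightarrow> 'b::euclidean_space) \<Rightarrow> real^'n \<Rightarrow> real" where
  "LP_block chi n f x = sqrt (\<Sum>b\<in>Basis.
      (cmod (\<integral>y. LP_psi chi n (x - y) * complex_of_real (f y \<bullet> b) \<partial>lebesgue))\<^sup>2)"

definition besov_norm :: "(real^'n \<Rightarrow> real) \<Rightarrow> real \<Rightarrow> ennreal \<Rightarrow> ennreal \<Rightarrow> (real^'n \<Rightarrow> 'b::euclidean_space) \<Rightarrow> ennreal" where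
  "besov_norm chi s p q f = (if q = top
     then (SUP n::int. ennreal (2 powr (real_of_int n * s)) * Lp_norm p (LP_block chi n f))
     else enn_powr (\<Sum>\<^sub>\<infinity> n::int. enn_powr (ennreal (2 powr (real_of_int n * s)) * Lp_norm p (LP_block chi n f)) (enn2real q))
            (1 / enn2real q))"

definition conv :: "(real^'n \<Rightarrow> real) \<Rightarrow> (real^'n \<Rightarrow> real) \<Rightarrow> real^'n \<Rightarrow> real" where
  "conv f g x = (\<integral>y. f y * g (x - y) \<partial>lebesgue)"

definition mollifier :: "(real^'n \<Rightarrow> real) \<Rightarrow> real \<Rightarrow> real^'n \<Rightarrow> real" where
  "mollifier \<phi> \<delta> x = \<delta> powr (- real CARD('n)) * \<phi> ((1 / \<delta>) *\<^sub>R x)"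

definition commutator :: "(real^'n \<Rightarrow> real) \<Rightarrow> real \<Rightarrow> (real^'n \<Rightarrow> real^'n) \<Rightarrow> (real^'n \<Rightarrow> real) \<Rightarrow> real^'n \<Rightarrow> real" where
  "commutator \<phi> \<delta> u \<rho> x =
     frechet_derivative (conv \<rho> (mollifier \<phi> \<delta>)) (at x) (u x)
     - (\<Sum>i\<in>UNIV. partial (conv (\<lambda>y. u y $ i * \<rho> y) (mollifier \<phi> \<delta>)) i x)"

definition phi_quantity :: "(real^'n \<Rightarrow> real) \<Rightarrow> ennreal" where
  "phi_quantity \<phi> =
     (\<integral>\<^sup>+ x. ennreal ((1 + (norm x)\<^sup>2) * sqrt (\<Sum>i\<in>UNIV. (partial \<phi> i x)\<^sup>2)) \<partial>lebesgue)
   + (\<integral>\<^sup>+ x. ennreal (norm x * sqrt (\<Sum>i\<in>UNIV. \<Sum>j\<in>UNIV. (partial (partial \<phi> j) i x)\<^sup>2)) \<partial>lebesgue)"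

definition dlog_norm :: "ennreal \<Rightarrow> (real \<Rightarrow> ennreal) \<Rightarrow> ennreal" where
  "dlog_norm q a = (if q = top then (SUP \<delta>\<in>{0<..}. a \<delta>)
     else enn_powr (\<integral>\<^sup>+ \<delta>\<in>{0<..}. enn_powr (a \<delta>) (enn2real q) * ennreal (1 / \<delta>) \<partial>lborel) (1 / enn2real q))"

end

theory Submission
  imports Defs "HOL-Probability.Probability"
begin

text \<open>
  For \<open>\<delta>\<close> comparable to \<open>2 powr -n\<close>, the commutator is the integral of
  \<open>\<rho> (x - \<delta>z) ((u x - u (x - \<delta>z)) / \<delta>) \<bullet> \<nabla>\<phi> z\<close> over \<open>z\<close>. Replace the difference quotient of \<open>u\<close> by
  \<open>(P\<^sub>n \<nabla>u x) z\<close>, where \<open>P\<^sub>n\<close> cuts off the frequencies above \<open>2^n\<close>. The error consists of the high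
  frequencies of \<open>u\<close>, whose block at frequency \<open>2^m\<close> gains \<open>2^-m\<close>, and of a Taylor remainder of the low
  frequencies, whose block at frequency \<open>2^m\<close> costs \<open>2^m\<close>. In the main term, the moments
  \<open>\<integral> z\<^sub>j \<partial>\<^sub>i\<phi>\<close> form minus the identity matrix, so that the trace of \<open>\<nabla>u\<close> appears when \<open>\<rho>\<close> is replaced by
  \<open>P\<^sub>n \<rho> x\<close>; it vanishes, and the same frequency splitting applies to what is left of \<open>\<rho>\<close>. All three
  contributions are bounded by \<open>\<Sum>m. 2^-|m-n| (\<parallel>\<rho>\<parallel> \<parallel>\<psi>\<^sub>m * \<nabla>u\<parallel> + \<parallel>\<nabla>u\<parallel> \<parallel>\<psi>\<^sub>m * \<rho>\<parallel>)\<close>, and the \<open>q\<close>-norm in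
  \<open>n\<close> is controlled by Young's inequality for this convolution.
\<close>

subsection \<open>Integral inequalities of Minkowski and Hoelder\<close>

text \<open>Nothing is assumed about the size of \<open>u\<close>; only its weak gradient lies in a
  Lebesgue space. Hence \<open>u\<close> is handled through its increments, written as averages of
  the gradient along segments, and the same representation yields the growth bound that gives a
  meaning to the mollification of the product of \<open>u\<close> and \<open>\<rho>\<close>. The
  Littlewood-Paley series is never summed: between two cut-offs M and N all decompositions are
  finite telescoping sums, and what lies beyond the cut-offs is bounded by the plain Lebesgue norms
  of the gradient and of \<open>\<rho>\<close>, with weights 2^-|M-n| and 2^-|N-n| that vanish as
  the cut-offs recede. This costs a real limit at the end, but no convergence of distributions. The
  two summands of \<open>phi_quantity\<close> bound the moments of the kernels d_i \<phi> and z_j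
  d_i \<phi> and of the gradients of the latter. The statement speaks of Lebesgue measurable
  functions, while all estimates are made for Borel functions and \<open>lborel\<close>, where
  Fubini's theorem is at hand; the passage to Borel representatives comes last.\<close>

lemma enn_powr_ennreal [simp]: "0 \<le> a \<Longrightarrow> enn_powr (ennreal a) t = ennreal (a powr t)"
  by (simp add: enn_powr_def)

lemma enn_powr_0 [simp]: "enn_powr 0 t = 0"
  by (simp add: enn_powr_def)

lemma enn_powr_1 [simp]: "enn_powr 1 t = 1"
  by (simp add: enn_powr_def)

lemma enn_powr_top [simp]: "enn_powr top t = top"
  by (simp add: enn_powr_def)

lemma enn_powr_mono: "0 \<le> t \<Longrightarrow> a \<le> b \<Longrightarrow> enn_powr a t \<le> enn_powr b t"
  by (auto simp: enn_powr_def top_unique intro!: ennreal_leI powr_mono2 enn2real_mono simp: less_top)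

lemma enn_powr_mult: "0 < t \<Longrightarrow> enn_powr (a * b) t = enn_powr a t * enn_powr b t"
  by (cases a; cases b)
     (auto simp: ennreal_mult[symmetric] powr_mult ennreal_top_mult ennreal_mult_top)

lemma enn_powr_powr: "s \<noteq> 0 \<Longrightarrow> enn_powr (enn_powr a s) t = enn_powr a (s * t)"
  by (cases a) (auto simp: powr_powr)

lemma enn_powr_one [simp]: "enn_powr a 1 = a"
  by (cases a) auto

lemma enn_powr_measurable [measurable]: "(\<lambda>x. enn_powr x t) \<in> borel_measurable borel"
  unfolding enn_powr_def by measurable

lemma Young_weighted:
  fixes a b \<alpha> :: real
  assumes "0 \<le> a" "0 \<le> b" "0 < \<alpha>" "\<alpha> < 1"
  shows "a powr \<alpha> * b powr (1 - \<alpha>) \<le> \<alpha> * a + (1 - \<alpha>) * b"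
proof (cases "a = 0 \<or> b = 0")
  case True then show ?thesis using assms by auto
next
  case False then show ?thesis
    using Youngs_inequality_0[of \<alpha> "1 - \<alpha>" a b] assms by auto
qed

text \<open>The tangent of y^t at c lies below the graph; the inequality is arranged without
  subtraction so that it carries over to \<open>ennreal\<close>. It is Young's weighted inequality
  for y^t and c^t with weights 1/t and 1 - 1/t.\<close>

lemma powr_tangent_le:
  fixes y c t :: real
  assumes "0 \<le> y" "0 \<le> c" "1 \<le> t"
  shows "t * c powr (t - 1) * y \<le> y powr t + (t - 1) * c powr t"
proof (cases "t = 1")
  case True then show ?thesis using assms by auto
next
  case False
  then have t: "1 < t" using assms by simp
  have "(y powr t) powr (1/t) * (c powr t) powr (1 - 1/t) \<le> 1/t * y powr t + (1 - 1/t) * c powr t"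
    using t by (intro Young_weighted) auto
  moreover have "(y powr t) powr (1/t) = y" "(c powr t) powr (1 - 1/t) = c powr (t - 1)"
  proof -
    show "(y powr t) powr (1/t) = y" using t assms by (simp add: powr_powr)
    have "t * (1 - 1/t) = t - 1" using t by (simp add: right_diff_distrib)
    then show "(c powr t) powr (1 - 1/t) = c powr (t - 1)" by (simp only: powr_powr)
  qed
  ultimately have "t * (y * c powr (t - 1)) \<le> t * (1/t * y powr t + (1 - 1/t) * c powr t)"
    using t by (intro mult_left_mono) auto
  also have "\<dots> = (t * (1/t)) * y powr t + (t * (1 - 1/t)) * c powr t"
    by (simp only: distrib_left mult.assoc)
  also have "\<dots> = y powr t + (t - 1) * c powr t"
    using t by (simp add: right_diff_distrib)
  finally show ?thesis by (simp only: mult_ac)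
qed

lemma enn_powr_tangent_le:
  fixes c t :: real and y :: ennreal
  assumes "0 \<le> c" "1 \<le> t"
  shows "ennreal (t * c powr (t - 1)) * y \<le> enn_powr y t + ennreal ((t - 1) * c powr t)"
proof (cases y)
  case (real z)
  then show ?thesis using powr_tangent_le[of z c t] assms
    by (simp add: ennreal_mult[symmetric] ennreal_plus[symmetric] ennreal_leI del: ennreal_plus)
qed (use assms in auto)

text \<open>Integrate the tangent inequality with \<open>c\<close> equal to the weighted mean. Mass
  at most 1 suffices, since the constant term of the tangent stands on the right with the
  nonnegative coefficient t - 1. If the mean is infinite, the tangent at c = 1 makes the right side
  infinite too.\<close>

lemma nn_integral_Jensen_powr:
  assumes [measurable]: "w \<in> borel_measurable N" "F \<in> borel_measurable N"
    and W: "(\<integral>\<^sup>+s. w s \<partial>N) \<le> 1" and t: "1 \<le> t"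
  shows "enn_powr (\<integral>\<^sup>+s. w s * F s \<partial>N) t \<le> (\<integral>\<^sup>+s. w s * enn_powr (F s) t \<partial>N)"
proof -
  have *: "ennreal (t * c powr (t - 1)) * (\<integral>\<^sup>+s. w s * F s \<partial>N)
      \<le> (\<integral>\<^sup>+s. w s * enn_powr (F s) t \<partial>N) + ennreal ((t - 1) * c powr t)" if c: "0 \<le> c" for c
  proof -
    have "ennreal (t * c powr (t - 1)) * (\<integral>\<^sup>+s. w s * F s \<partial>N)
       = (\<integral>\<^sup>+s. w s * (ennreal (t * c powr (t - 1)) * F s) \<partial>N)"
      by (subst nn_integral_cmult[symmetric]) (auto simp: mult_ac)
    also have "\<dots> \<le> (\<integral>\<^sup>+s. w s * (enn_powr (F s) t + ennreal ((t - 1) * c powr t)) \<partial>N)"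
      by (intro nn_integral_mono mult_left_mono enn_powr_tangent_le c t) auto
    also have "\<dots> = (\<integral>\<^sup>+s. w s * enn_powr (F s) t \<partial>N) + (\<integral>\<^sup>+s. w s \<partial>N) * ennreal ((t - 1) * c powr t)"
      by (simp add: distrib_left nn_integral_add nn_integral_multc)
    also have "\<dots> \<le> (\<integral>\<^sup>+s. w s * enn_powr (F s) t \<partial>N) + 1 * ennreal ((t - 1) * c powr t)"
      by (intro add_left_mono mult_right_mono W) auto
    finally show ?thesis by simp
  qed
  show ?thesis
  proof (cases "\<integral>\<^sup>+s. w s * F s \<partial>N")
    case (real h)
    show ?thesis
    proof (cases "\<integral>\<^sup>+s. w s * enn_powr (F s) t \<partial>N")
      case (real J)
      note J = this
      have "t * h powr (t - 1) * h \<le> J + (t - 1) * h powr t"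
        using *[of h] \<open>0 \<le> h\<close> \<open>0 \<le> J\<close> \<open>(\<integral>\<^sup>+s. w s * F s \<partial>N) = ennreal h\<close> J t
        by (simp add: ennreal_mult[symmetric] ennreal_plus[symmetric] del: ennreal_plus)
      moreover have "h powr (t - 1) * h = h powr t"
        using \<open>0 \<le> h\<close> by (cases "h = 0") (auto simp: powr_diff)
      ultimately have "t * h powr t \<le> J + (t - 1) * h powr t" by (simp only: mult.assoc)
      then have "h powr t \<le> J" by (simp add: left_diff_distrib)
      then show ?thesis using \<open>0 \<le> h\<close> \<open>(\<integral>\<^sup>+s. w s * F s \<partial>N) = ennreal h\<close> J by (simp add: ennreal_leI)
    qed simp
  next
    case top
    have "(\<integral>\<^sup>+s. w s * enn_powr (F s) t \<partial>N) = top"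
      using *[of 1] t top by (auto simp: ennreal_mult_top top_unique ennreal_add_eq_top)
    then show ?thesis by simp
  qed
qed

text \<open>The numbers r/p and r/p' are positive and add up to 1, so this is Young's weighted
  inequality for f^p and g^p'.\<close>

lemma enn_powr_mult_le_Young:
  fixes p p' r :: real and f g :: ennreal
  assumes "0 < p" "0 < p'" "0 < r" "1/p + 1/p' = 1/r"
  shows "enn_powr (f * g) r \<le> ennreal (r/p) * enn_powr f p + ennreal (r/p') * enn_powr g p'"
proof (cases "f = top \<or> g = top")
  case True
  then show ?thesis using assms by (auto simp: ennreal_mult_top)
next
  case False
  then obtain a b where ab: "f = ennreal a" "g = ennreal b" "0 \<le> a" "0 \<le> b"
    by (cases f; cases g) auto
  have rp: "r / p' = 1 - r / p" "0 < r / p" "r / p < 1"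
  proof -
    have "r * (1/p + 1/p') = 1" using assms by simp
    then show "r / p' = 1 - r / p" by (simp add: distrib_left)
    moreover have "0 < r / p'" using assms by simp
    ultimately show "r / p < 1" by simp
    show "0 < r / p" using assms by simp
  qed
  have "(a * b) powr r = (a powr p) powr (r/p) * (b powr p') powr (1 - r/p)"
    using assms ab unfolding rp(1)[symmetric] by (simp add: powr_powr powr_mult)
  also have "\<dots> \<le> r/p * a powr p + (1 - r/p) * b powr p'"
    using rp by (intro Young_weighted) auto
  finally show ?thesis using assms ab
    by (simp add: ennreal_mult[symmetric] ennreal_plus[symmetric] rp(1)[symmetric] ennreal_leI del: ennreal_plus)
qed

text \<open>Serves the exponent relation: if p or p' is infinite, the relation says that the other
  exponent has the same inverse as r, hence equals r.\<close>

lemma inverse_ennreal_inject: "inverse a = inverse b \<longleftrightarrow> a = (b :: ennreal)"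
proof -
  have inv: "inverse (inverse x) = x" for x :: ennreal
    by (cases "x = 0"; cases x) (auto simp: inverse_ennreal)
  show ?thesis
  proof
    assume "inverse a = inverse b"
    then have "inverse (inverse a) = inverse (inverse b)" by (rule arg_cong)
    then show "a = b" by (simp only: inv)
  qed simp
qed

text \<open>The bound of an L^p norm, encoded as an inequality of p-th powers so that no root has to
  be taken. For p = \<open>top\<close> it is an almost everywhere bound, which avoids the default
  value of \<open>esssup\<close> for functions that are not measurable.\<close>

definition Lp_le :: "'a measure \<Rightarrow> ennreal \<Rightarrow> ('a \<Rightarrow> ennreal) \<Rightarrow> ennreal \<Rightarrow> bool" where
  "Lp_le M p f A \<longleftrightarrow> (if p = top then AE x in M. f x \<le> A
     else (\<integral>\<^sup>+x. enn_powr (f x) (enn2real p) \<partial>M) \<le> enn_powr A (enn2real p))"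

lemma enn2real_ge_1: "1 \<le> p \<Longrightarrow> p \<noteq> top \<Longrightarrow> 1 \<le> enn2real p"
  using enn2real_mono[of 1 p] by (auto simp: less_top)

lemma Lp_le_mono_AE:
  assumes "1 \<le> p" "Lp_le M p f A" "AE x in M. g x \<le> f x" "A \<le> B"
  shows "Lp_le M p g B"
proof (cases "p = top")
  case True
  have "AE x in M. f x \<le> A" using assms(2) True by (simp add: Lp_le_def)
  with assms(3) have "AE x in M. g x \<le> B"
    by eventually_elim (use assms(4) order_trans in blast)
  then show ?thesis using True by (simp add: Lp_le_def)
next
  case False
  note t = enn2real_ge_1[OF assms(1) False]
  have "(\<integral>\<^sup>+x. enn_powr (g x) (enn2real p) \<partial>M) \<le> (\<integral>\<^sup>+x. enn_powr (f x) (enn2real p) \<partial>M)"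
    using assms(3) by (intro nn_integral_mono_AE) (auto elim!: eventually_mono intro!: enn_powr_mono)
  also have "\<dots> \<le> enn_powr A (enn2real p)" using assms(2) False by (simp add: Lp_le_def)
  also have "\<dots> \<le> enn_powr B (enn2real p)" using t assms by (intro enn_powr_mono) auto
  finally show ?thesis using False by (simp add: Lp_le_def)
qed

lemma Lp_le_mono:
  assumes "1 \<le> p" "Lp_le M p f A" "\<And>x. x \<in> space M \<Longrightarrow> g x \<le> f x" "A \<le> B"
  shows "Lp_le M p g B"
  by (rule Lp_le_mono_AE[OF assms(1,2) _ assms(4)]) (use assms(3) in auto)

lemma Lp_le_cmult:
  assumes p: "1 \<le> p" and [measurable]: "f \<in> borel_measurable M" and f: "Lp_le M p f A"
  shows "Lp_le M p (\<lambda>x. c * f x) (c * A)"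
proof (cases "p = top")
  case True
  have "AE x in M. f x \<le> A" using f True by (simp add: Lp_le_def)
  then have "AE x in M. c * f x \<le> c * A"
    by eventually_elim (auto intro: mult_left_mono)
  then show ?thesis using True by (simp add: Lp_le_def)
next
  case False
  note t = enn2real_ge_1[OF p False]
  then show ?thesis using f False
    by (auto simp: Lp_le_def enn_powr_mult nn_integral_cmult intro: mult_left_mono)
qed

text \<open>Closedness in the bound. It permits every estimate to be proved with strictly positive
  constants, by which one may divide, and later removes the frequency cut-offs. For p =
  \<open>top\<close> countably many null sets are united; otherwise the p-th power is
  continuous.\<close>

lemma Lp_le_limit:
  assumes p: "1 \<le> p" and A: "A \<noteq> top" and le: "\<And>e::real. 0 < e \<Longrightarrow> Lp_le M p f (A + ennreal e)"
  shows "Lp_le M p f A"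
proof (cases "p = top")
  case True
  have "AE x in M. \<forall>n. f x \<le> A + ennreal (1 / Suc n)"
    using le True by (auto simp: Lp_le_def AE_all_countable)
  then have "AE x in M. f x \<le> A"
  proof eventually_elim
    fix x assume *: "\<forall>n. f x \<le> A + ennreal (1 / Suc n)"
    have "(\<lambda>n. A + ennreal (1 / Suc n)) \<longlonglongrightarrow> A + ennreal 0"
      by (intro tendsto_add tendsto_const tendsto_ennrealI LIMSEQ_Suc lim_1_over_n)
    then show "f x \<le> A" using * by (intro LIMSEQ_le_const[of _ A]) (auto simp del: of_nat_Suc)
  qed
  then show ?thesis using True by (simp add: Lp_le_def)
next
  case False
  note t = enn2real_ge_1[OF p False]
  obtain a where a: "A = ennreal a" "0 \<le> a" using A by (cases A) auto
  have "(\<integral>\<^sup>+x. enn_powr (f x) (enn2real p) \<partial>M) \<le> ennreal ((a + 1 / Suc n) powr enn2real p)" for n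
    using le[of "1 / Suc n"] False a t
    by (auto simp: Lp_le_def ennreal_plus[symmetric] simp del: ennreal_plus)
  moreover have "(\<lambda>n. ennreal ((a + 1 / Suc n) powr enn2real p)) \<longlonglongrightarrow> ennreal ((a + 0) powr enn2real p)"
    using t a by (intro tendsto_ennrealI tendsto_powr2 tendsto_add tendsto_const LIMSEQ_Suc lim_1_over_n)
       (auto intro!: eventuallyI)
  ultimately show ?thesis using False a
    by (auto simp: Lp_le_def intro!: LIMSEQ_le_const)
qed

text \<open>Minkowski's integral inequality and Hoelder's inequality in one statement. After
  normalisation it follows from Jensen's and Young's inequalities.\<close>
lemma Lp_le_bilinear_normalized:
  assumes "sigma_finite_measure M" "sigma_finite_measure N"
    and p: "1 \<le> p" "1 \<le> p'" "1 \<le> r" "inverse p + inverse p' = inverse r"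
    and [measurable]: "w \<in> borel_measurable N"
      "(\<lambda>(s,x). f s x) \<in> borel_measurable (N \<Otimes>\<^sub>M M)" "(\<lambda>(s,x). g s x) \<in> borel_measurable (N \<Otimes>\<^sub>M M)"
    and f: "\<And>s. s \<in> space N \<Longrightarrow> Lp_le M p (f s) 1"
    and g: "\<And>s. s \<in> space N \<Longrightarrow> Lp_le M p' (g s) 1"
    and w: "(\<integral>\<^sup>+s. w s \<partial>N) \<le> 1"
  shows "Lp_le M r (\<lambda>x. \<integral>\<^sup>+s. w s * (f s x * g s x) \<partial>N) 1"
proof -
  interpret M: sigma_finite_measure M by fact
  interpret N: sigma_finite_measure N by fact
  interpret NM: pair_sigma_finite N M ..
  interpret MN: pair_sigma_finite M N ..
  have prod: "Lp_le M r (\<lambda>x. f s x * g s x) 1" if s: "s \<in> space N" for s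
  proof -
    have [measurable]: "f s \<in> borel_measurable M" "g s \<in> borel_measurable M"
      using s by measurable
    \<comment> \<open>Injectivity of \<open>inverse\<close> on \<open>ennreal\<close> settles the
      infinite exponents; if both are finite, \<open>inverse r\<close> is positive and so
      \<open>r\<close> is finite.\<close>
    consider "r = top" "p = top" "p' = top" | "p = top" "p' = r" "r \<noteq> top" | "p' = top" "p = r" "r \<noteq> top"
      | "p \<noteq> top" "p' \<noteq> top" "r \<noteq> top"
    proof (cases "p = top"; cases "p' = top")
      assume "p = top" "p' = top"
      moreover have "r = top" using p(4) calculation inverse_ennreal_inject[of r top] by simp
      ultimately show thesis using that(1) by blast
    next
      assume "p = top" "p' \<noteq> top"
      moreover have "p' = r" using p(4) calculation inverse_ennreal_inject[of p' r] by simp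
      ultimately show thesis using that(2) by blast
    next
      assume "p \<noteq> top" "p' = top"
      moreover have "p = r" using p(4) calculation inverse_ennreal_inject[of p r] by simp
      ultimately show thesis using that(3) by blast
    next
      assume "p \<noteq> top" "p' \<noteq> top"
      moreover have "r \<noteq> top"
        using p(4) calculation by (auto simp: add_eq_0_iff_both_eq_0)
      ultimately show thesis using that(4) by blast
    qed
    then show ?thesis
    proof cases
      case 1
      have "AE x in M. f s x \<le> 1" "AE x in M. g s x \<le> 1" using f[OF s] g[OF s] 1 by (auto simp: Lp_le_def)
      then have "AE x in M. f s x * g s x \<le> 1"
      proof eventually_elim
        case (elim x) then show ?case using mult_mono[of "f s x" 1 "g s x" 1] by simp
      qed
      then show ?thesis using 1 by (simp add: Lp_le_def)
    next
      case 2
      have "AE x in M. f s x \<le> 1" using f[OF s] 2 by (auto simp: Lp_le_def)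
      then have le: "AE x in M. f s x * g s x \<le> g s x"
        by eventually_elim (use mult_right_mono[of _ 1] in fastforce)
      show ?thesis using Lp_le_mono_AE[OF p(3) _ le] g[OF s] 2 by simp
    next
      case 3
      have "AE x in M. g s x \<le> 1" using g[OF s] 3 by (auto simp: Lp_le_def)
      then have le: "AE x in M. f s x * g s x \<le> f s x"
        by eventually_elim (use mult_left_mono[of _ 1] in fastforce)
      show ?thesis using Lp_le_mono_AE[OF p(3) _ le] f[OF s] 3 by simp
    next
      case 4
      note t = enn2real_ge_1[OF p(1) 4(1)] enn2real_ge_1[OF p(2) 4(2)] enn2real_ge_1[OF p(3) 4(3)]
      obtain a b c where abc: "p = ennreal a" "p' = ennreal b" "r = ennreal c" "0 \<le> a" "0 \<le> b" "0 \<le> c"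
        using 4 by (cases p; cases p'; cases r) auto
      have rel: "1/a + 1/b = 1/c"
        using p(4) t abc
        by (simp add: inverse_ennreal ennreal_plus[symmetric] divide_inverse del: ennreal_plus)
      have "(\<integral>\<^sup>+x. enn_powr (f s x * g s x) c \<partial>M)
         \<le> (\<integral>\<^sup>+x. ennreal (c/a) * enn_powr (f s x) a + ennreal (c/b) * enn_powr (g s x) b \<partial>M)"
        using t abc rel by (intro nn_integral_mono enn_powr_mult_le_Young) auto
      also have "\<dots> = ennreal (c/a) * (\<integral>\<^sup>+x. enn_powr (f s x) a \<partial>M) + ennreal (c/b) * (\<integral>\<^sup>+x. enn_powr (g s x) b \<partial>M)"
        by (simp add: nn_integral_add nn_integral_cmult)
      also have "\<dots> \<le> ennreal (c/a) * 1 + ennreal (c/b) * 1"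
        using f[OF s] g[OF s] 4 abc by (intro add_mono mult_left_mono) (auto simp: Lp_le_def)
      also have "\<dots> = 1"
      proof -
        have "c * (1/a + 1/b) = 1" using rel t abc by simp
        then have "c/a + c/b = 1" by (simp add: distrib_left)
        then show ?thesis using t abc by (simp add: ennreal_plus[symmetric] del: ennreal_plus)
      qed
      finally show ?thesis using 4 abc by (simp add: Lp_le_def)
    qed
  qed
  show ?thesis
  proof (cases "r = top")
    case True
    have "AE s in N. AE x in M. f s x * g s x \<le> 1"
      using prod True by (auto simp: Lp_le_def)
    then have "AE x in M. AE s in N. f s x * g s x \<le> 1"
      by (subst NM.AE_commute[symmetric]) measurable
    then have "AE x in M. (\<integral>\<^sup>+s. w s * (f s x * g s x) \<partial>N) \<le> 1"
    proof eventually_elim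
      fix x assume *: "AE s in N. f s x * g s x \<le> 1"
      have "(\<integral>\<^sup>+s. w s * (f s x * g s x) \<partial>N) \<le> (\<integral>\<^sup>+s. w s \<partial>N)"
        using * by (intro nn_integral_mono_AE) (auto elim!: eventually_mono simp: mult_left_le)
      then show "(\<integral>\<^sup>+s. w s * (f s x * g s x) \<partial>N) \<le> 1" using w by simp
    qed
    then show ?thesis using True by (simp add: Lp_le_def)
  next
    case False
    note t = enn2real_ge_1[OF p(3) False]
    let ?c = "enn2real r"
    have "(\<integral>\<^sup>+x. enn_powr (\<integral>\<^sup>+s. w s * (f s x * g s x) \<partial>N) ?c \<partial>M)
       \<le> (\<integral>\<^sup>+x. \<integral>\<^sup>+s. w s * enn_powr (f s x * g s x) ?c \<partial>N \<partial>M)"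
      by (intro nn_integral_mono nn_integral_Jensen_powr w t) measurable
    also have "\<dots> = (\<integral>\<^sup>+s. \<integral>\<^sup>+x. w s * enn_powr (f s x * g s x) ?c \<partial>M \<partial>N)"
      by (rule NM.Fubini') measurable
    also have "\<dots> = (\<integral>\<^sup>+s. w s * (\<integral>\<^sup>+x. enn_powr (f s x * g s x) ?c \<partial>M) \<partial>N)"
      by (intro nn_integral_cong nn_integral_cmult) measurable
    also have "\<dots> \<le> (\<integral>\<^sup>+s. w s * 1 \<partial>N)"
      using prod False by (intro nn_integral_mono mult_left_mono) (auto simp: Lp_le_def)
    finally show ?thesis using False w by (simp add: Lp_le_def)
  qed
qed

lemma Lp_le_scale_down:
  assumes "1 \<le> p" "f \<in> borel_measurable M" "Lp_le M p f (ennreal A)" "0 < A"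
  shows "Lp_le M p (\<lambda>x. ennreal (1/A) * f x) 1"
  using Lp_le_cmult[OF assms(1-3), of "ennreal (1/A)"] assms(4)
  by (simp add: ennreal_mult[symmetric])

text \<open>Since \<open>A\<close>, \<open>B\<close> and \<open>W\<close> may be zero, the
  normalisation divides by strictly larger numbers, and \<open>Lp_le_limit\<close> lets these
  decrease to the given ones.\<close>

lemma Lp_le_bilinear:
  fixes A B W :: real
  assumes M: "sigma_finite_measure M" "sigma_finite_measure N"
    and p: "1 \<le> p" "1 \<le> p'" "1 \<le> r" "inverse p + inverse p' = inverse r"
    and [measurable]: "w \<in> borel_measurable N"
      "(\<lambda>(s,x). f s x) \<in> borel_measurable (N \<Otimes>\<^sub>M M)" "(\<lambda>(s,x). g s x) \<in> borel_measurable (N \<Otimes>\<^sub>M M)"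
    and f: "\<And>s. s \<in> space N \<Longrightarrow> Lp_le M p (f s) (ennreal A)"
    and g: "\<And>s. s \<in> space N \<Longrightarrow> Lp_le M p' (g s) (ennreal B)"
    and w: "(\<integral>\<^sup>+s. w s \<partial>N) \<le> ennreal W"
    and pos: "0 \<le> A" "0 \<le> B" "0 \<le> W"
  shows "Lp_le M r (\<lambda>x. \<integral>\<^sup>+s. w s * (f s x * g s x) \<partial>N) (ennreal (W * A * B))"
proof -
  interpret N: sigma_finite_measure N by fact
  let ?I = "\<lambda>x. \<integral>\<^sup>+s. w s * (f s x * g s x) \<partial>N"
  have *: "Lp_le M r ?I (ennreal (W' * A' * B'))" if "A < A'" "B < B'" "W < W'" for A' B' W'
  proof -
    have pos': "0 < A'" "0 < B'" "0 < W'" using that pos by auto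
    have "Lp_le M r (\<lambda>x. \<integral>\<^sup>+s. (ennreal (1/W') * w s) *
          ((ennreal (1/A') * f s x) * (ennreal (1/B') * g s x)) \<partial>N) 1"
    proof (rule Lp_le_bilinear_normalized[OF M p])
      fix s assume s[measurable]: "s \<in> space N"
      have [measurable]: "f s \<in> borel_measurable M" "g s \<in> borel_measurable M"
        using s by measurable
      show "Lp_le M p (\<lambda>x. ennreal (1/A') * f s x) 1"
        using that pos' by (intro Lp_le_scale_down p Lp_le_mono[OF p(1) f[OF s]]) (auto intro: ennreal_leI)
      show "Lp_le M p' (\<lambda>x. ennreal (1/B') * g s x) 1"
        using that pos' by (intro Lp_le_scale_down p Lp_le_mono[OF p(2) g[OF s]]) (auto intro: ennreal_leI)
    next
      have "(\<integral>\<^sup>+s. ennreal (1/W') * w s \<partial>N) = ennreal (1/W') * (\<integral>\<^sup>+s. w s \<partial>N)"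
        by (simp add: nn_integral_cmult)
      also have "\<dots> \<le> ennreal (1/W') * ennreal W'"
        using that by (intro mult_left_mono order_trans[OF w] ennreal_leI) auto
      also have "\<dots> = 1" using pos' by (simp add: ennreal_mult[symmetric])
      finally show "(\<integral>\<^sup>+s. ennreal (1/W') * w s \<partial>N) \<le> 1" .
    qed measurable
    then have "Lp_le M r (\<lambda>x. ennreal (W' * A' * B') * (\<integral>\<^sup>+s. (ennreal (1/W') * w s) *
          ((ennreal (1/A') * f s x) * (ennreal (1/B') * g s x)) \<partial>N)) (ennreal (W' * A' * B') * 1)"
      by (intro Lp_le_cmult p) measurable
    from Lp_le_mono[OF p(3) this, of ?I "ennreal (W' * A' * B')"]
    show ?thesis
    proof -
      assume *: "(\<And>x. x \<in> space M \<Longrightarrow> ?I x \<le> ennreal (W' * A' * B') * (\<integral>\<^sup>+s. (ennreal (1/W') * w s) *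
          ((ennreal (1/A') * f s x) * (ennreal (1/B') * g s x)) \<partial>N)) \<Longrightarrow>
          ennreal (W' * A' * B') * 1 \<le> ennreal (W' * A' * B') \<Longrightarrow> Lp_le M r ?I (ennreal (W' * A' * B'))"
    have "ennreal (W' * A' * B') * (\<integral>\<^sup>+s. (ennreal (1/W') * w s) *
          ((ennreal (1/A') * f s x) * (ennreal (1/B') * g s x)) \<partial>N) = ?I x" if x[measurable]: "x \<in> space M" for x
    proof -
      have "ennreal (W' * A' * B') * (\<integral>\<^sup>+s. (ennreal (1/W') * w s) * ((ennreal (1/A') * f s x) * (ennreal (1/B') * g s x)) \<partial>N)
        = (\<integral>\<^sup>+s. ennreal (W' * A' * B') * ((ennreal (1/W') * w s) * ((ennreal (1/A') * f s x) * (ennreal (1/B') * g s x))) \<partial>N)"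
        by (rule nn_integral_cmult[symmetric]) measurable
      also have "\<dots> = (\<integral>\<^sup>+s. (ennreal (W' * A' * B') * ennreal (1/W') * ennreal (1/A') * ennreal (1/B')) * (w s * (f s x * g s x)) \<partial>N)"
        by (simp only: mult_ac)
      also have "ennreal (W' * A' * B') * ennreal (1/W') * ennreal (1/A') * ennreal (1/B') = 1"
        using pos' by (simp add: ennreal_mult[symmetric])
      finally show ?thesis by simp
    qed
    then show ?thesis
      by (intro *) simp_all
    qed
  qed
  show ?thesis
  proof (rule Lp_le_limit[OF p(3)])
    fix e :: real assume e: "0 < e"
    \<comment> \<open>One common enlargement \<open>h\<close> of the three constants is chosen so
      small, by continuity of the product, that the bound grows by less than
      \<open>e\<close>.\<close>
    have "((\<lambda>h. (W + h) * (A + h) * (B + h)) \<longlongrightarrow> (W + 0) * (A + 0) * (B + 0)) (at_right 0)"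
      by (intro tendsto_intros)
    then have "\<forall>\<^sub>F h in at_right 0. (W + h) * (A + h) * (B + h) < W * A * B + e"
      using e by (intro order_tendstoD) auto
    moreover have "\<forall>\<^sub>F h in at_right (0::real). 0 < h" by (simp add: eventually_at_right_less)
    ultimately have "\<forall>\<^sub>F h in at_right 0. 0 < h \<and> (W + h) * (A + h) * (B + h) < W * A * B + e"
      by eventually_elim simp
    then obtain h where h: "0 < h" "(W + h) * (A + h) * (B + h) < W * A * B + e"
      using eventually_happens'[OF trivial_limit_at_right_real] by blast
    have "Lp_le M r ?I (ennreal (W * A * B + e))"
      by (rule Lp_le_mono[OF p(3) *[of "A + h" "B + h" "W + h"]]) (use h in \<open>auto intro!: ennreal_leI\<close>)
    then show "Lp_le M r ?I (ennreal (W * A * B) + ennreal e)"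
      using pos e by (simp add: ennreal_plus[symmetric] del: ennreal_plus)
  qed simp
qed

lemma Lp_le_top_const: "Lp_le M top (\<lambda>x. 1) (ennreal 1)"
  by (simp add: Lp_le_def)

text \<open>The bilinear estimate with second exponent \<open>top\<close> and second factor
  1.\<close>

lemma Lp_le_Minkowski:
  fixes A W :: real
  assumes M: "sigma_finite_measure M" "sigma_finite_measure N"
    and p: "1 \<le> p"
    and [measurable]: "w \<in> borel_measurable N" "(\<lambda>(s,x). f s x) \<in> borel_measurable (N \<Otimes>\<^sub>M M)"
    and f: "\<And>s. s \<in> space N \<Longrightarrow> Lp_le M p (f s) (ennreal A)"
    and w: "(\<integral>\<^sup>+s. w s \<partial>N) \<le> ennreal W"
    and pos: "0 \<le> A" "0 \<le> W"
  shows "Lp_le M p (\<lambda>x. \<integral>\<^sup>+s. w s * f s x \<partial>N) (ennreal (W * A))"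
proof -
  have "Lp_le M p (\<lambda>x. \<integral>\<^sup>+s. w s * (f s x * 1) \<partial>N) (ennreal (W * A * 1))"
    by (rule Lp_le_bilinear[OF M p _ p, where p'=top]) (use assms Lp_le_top_const[of M] in simp_all)
  then show ?thesis by simp
qed

text \<open>The bilinear estimate over a parameter space consisting of one point of mass 1.\<close>

lemma Lp_le_Holder:
  fixes A B :: real
  assumes M: "sigma_finite_measure M"
    and p: "1 \<le> p" "1 \<le> p'" "1 \<le> r" "inverse p + inverse p' = inverse r"
    and [measurable]: "f \<in> borel_measurable M" "g \<in> borel_measurable M"
    and f: "Lp_le M p f (ennreal A)" "Lp_le M p' g (ennreal B)"
    and pos: "0 \<le> A" "0 \<le> B"
  shows "Lp_le M r (\<lambda>x. f x * g x) (ennreal (A * B))"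
proof -
  have "sigma_finite_measure (count_space (UNIV :: unit set))"
    by (rule sigma_finite_measure_count_space_finite) simp
  from Lp_le_bilinear[OF M this p, of "\<lambda>_. 1" "\<lambda>_. f" "\<lambda>_. g" A B 1] f pos
  show ?thesis by (simp add: nn_integral_count_space_finite)
qed

text \<open>Minkowski's integral inequality over a two-point space: the weights are the two bounds
  and the functions are divided by them. Adding e/2 to each bound keeps the divisors
  positive.\<close>

lemma Lp_le_add:
  fixes A B :: real
  assumes M: "sigma_finite_measure M" and p: "1 \<le> p"
    and [measurable]: "f \<in> borel_measurable M" "g \<in> borel_measurable M"
    and f: "Lp_le M p f (ennreal A)" "Lp_le M p g (ennreal B)"
    and pos: "0 \<le> A" "0 \<le> B"
  shows "Lp_le M p (\<lambda>x. f x + g x) (ennreal (A + B))"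
proof (rule Lp_le_limit[OF p])
  fix e :: real assume e: "0 < e"
  have sf: "sigma_finite_measure (count_space (UNIV :: bool set))"
    by (rule sigma_finite_measure_count_space_finite) simp
  define w where "w b = (if b then ennreal (A + e/2) else ennreal (B + e/2))" for b
  define h where "h b x = (if b then ennreal (1/(A + e/2)) * f x else ennreal (1/(B + e/2)) * g x)" for b x
  have pos': "0 < A + e/2" "0 < B + e/2" using pos e by auto
  have [measurable]: "(\<lambda>(b, x). h b x) \<in> borel_measurable (count_space UNIV \<Otimes>\<^sub>M M)"
    unfolding h_def by measurable
  have h: "Lp_le M p (h b) (ennreal 1)" for b
  proof -
    have "Lp_le M p f (ennreal (A + e/2))" "Lp_le M p g (ennreal (B + e/2))"
      using e by (auto intro: Lp_le_mono[OF p f(1)] Lp_le_mono[OF p f(2)] intro!: ennreal_leI)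
    then show ?thesis
      unfolding h_def using pos' by (cases b) (auto intro!: Lp_le_scale_down p)
  qed
  have "(\<integral>\<^sup>+b. w b \<partial>count_space UNIV) \<le> ennreal (A + B + e)"
    using pos e by (simp add: nn_integral_count_space_finite UNIV_bool w_def ennreal_plus[symmetric] del: ennreal_plus)
  then have "Lp_le M p (\<lambda>x. \<integral>\<^sup>+b. w b * h b x \<partial>count_space UNIV) (ennreal ((A + B + e) * 1))"
    using pos e h by (intro Lp_le_Minkowski[OF M sf p]) auto
  moreover have "(\<integral>\<^sup>+b. w b * h b x \<partial>count_space UNIV) = f x + g x" for x :: 'a
    using pos' by (simp add: nn_integral_count_space_finite UNIV_bool w_def h_def
        mult.assoc[symmetric] ennreal_mult[symmetric] add.commute)
  ultimately show "Lp_le M p (\<lambda>x. f x + g x) (ennreal (A + B) + ennreal e)"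
    using pos e by (simp add: ennreal_plus[symmetric] del: ennreal_plus)
qed simp

lemma Lp_le_sum:
  fixes A :: "'i \<Rightarrow> real"
  assumes M: "sigma_finite_measure M" and p: "1 \<le> p" and "finite I"
    and meas: "\<And>i. i \<in> I \<Longrightarrow> f i \<in> borel_measurable M"
    and f: "\<And>i. i \<in> I \<Longrightarrow> Lp_le M p (f i) (ennreal (A i))"
    and pos: "\<And>i. i \<in> I \<Longrightarrow> 0 \<le> A i"
  shows "Lp_le M p (\<lambda>x. \<Sum>i\<in>I. f i x) (ennreal (\<Sum>i\<in>I. A i))"
  using \<open>finite I\<close> meas f pos
proof (induction I rule: finite_induct)
  case empty
  then show ?case by (simp add: Lp_le_def)
next
  case (insert i I)
  have "Lp_le M p (\<lambda>x. f i x + (\<Sum>i\<in>I. f i x)) (ennreal (A i + (\<Sum>i\<in>I. A i)))"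
    using insert by (intro Lp_le_add M p) (auto intro!: sum_nonneg)
  then show ?case using insert by simp
qed

subsection \<open>Rapidly decreasing kernels acting on tempered functions\<close>

lemma nn_integral_lborel_affine:
  fixes f :: "'a::euclidean_space \<Rightarrow> ennreal"
  assumes [measurable]: "f \<in> borel_measurable borel" and c: "c \<noteq> 0"
  shows "(\<integral>\<^sup>+x. f x \<partial>lborel) = ennreal (\<bar>c\<bar> ^ DIM('a)) * (\<integral>\<^sup>+x. f (t + c *\<^sub>R x) \<partial>lborel)"
  by (subst lborel_affine[OF c, of t])
     (simp add: nn_integral_density nn_integral_distr nn_integral_cmult)

lemma integrable_lborel_affine:
  fixes f :: "'a::euclidean_space \<Rightarrow> 'b::{banach, second_countable_topology}"
  assumes f: "integrable lborel f" and c: "c \<noteq> 0"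
  shows "integrable lborel (\<lambda>x. f (t + c *\<^sub>R x))"
  using f f[THEN borel_measurable_integrable] c unfolding integrable_iff_bounded
  by (subst (asm) nn_integral_lborel_affine[where c=c and t=t]) (auto simp: ennreal_mult_less_top)

lemma integrable_lborel_affine_iff:
  fixes f :: "'a::euclidean_space \<Rightarrow> 'b::{banach, second_countable_topology}"
  assumes c: "c \<noteq> 0"
  shows "integrable lborel (\<lambda>x. f (t + c *\<^sub>R x)) \<longleftrightarrow> integrable lborel f"
  using integrable_lborel_affine[of f c t] c
    integrable_lborel_affine[of "\<lambda>x. f (t + c *\<^sub>R x)" "1/c" "- (1/c) *\<^sub>R t"]
  by (auto simp: algebra_simps)

lemma integral_lborel_affine:
  fixes f :: "'a::euclidean_space \<Rightarrow> 'b::{banach, second_countable_topology}"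
  assumes c: "c \<noteq> 0"
  shows "(\<integral>x. f (t + c *\<^sub>R x) \<partial>lborel) = (1 / \<bar>c\<bar> ^ DIM('a)) *\<^sub>R (\<integral>x. f x \<partial>lborel)"
proof (cases "integrable lborel f")
  case True
  then have [measurable]: "f \<in> borel_measurable borel" by (auto dest: borel_measurable_integrable)
  have "(\<integral>x. f x \<partial>lborel) = (\<integral>x. f x \<partial>density (distr lborel borel (\<lambda>x. t + c *\<^sub>R x)) (\<lambda>_. ennreal (\<bar>c\<bar>^DIM('a))))"
    using lborel_affine[OF c, of t] by simp
  also have "\<dots> = \<bar>c\<bar>^DIM('a) *\<^sub>R (\<integral>x. f (t + c *\<^sub>R x) \<partial>lborel)"
    by (subst integral_density) (auto simp: integral_distr)
  finally show ?thesis using c by simp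
next
  case False
  then show ?thesis using integrable_lborel_affine_iff[OF c, of f t]
    by (simp add: not_integrable_integral_eq)
qed

lemma AE_lborel_affine:
  fixes t :: "'a::euclidean_space"
  assumes c: "c \<noteq> 0" and P: "AE x in lborel. P x"
  shows "AE x in lborel. P (t + c *\<^sub>R x)"
proof -
  have "AE x in density (distr lborel borel (\<lambda>x. t + c *\<^sub>R x)) (\<lambda>_. ennreal (\<bar>c\<bar>^DIM('a))). P x"
    using P by (subst lborel_affine[OF c, of t, symmetric])
  then have *: "AE x in distr lborel borel (\<lambda>x. t + c *\<^sub>R x). P x"
    using c by (subst (asm) AE_density) auto
  from AE_distrD[OF _ this] show ?thesis by simp
qed

lemma AE_lborel_diff_scale:
  "e \<noteq> 0 \<Longrightarrow> AE x in lborel. P x \<Longrightarrow> AE z in lborel. P (x - e *\<^sub>R z :: 'a::euclidean_space)"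
  using AE_lborel_affine[of "-e" P x] by simp

lemma AE_lborel_shift:
  "AE x in lborel. P x \<Longrightarrow> AE x in lborel. P (x - c :: 'a::euclidean_space)"
  using AE_lborel_affine[of 1 P "-c"] by (simp add: algebra_simps)

lemma nn_integral_lborel_diff_scale:
  fixes f :: "'a::euclidean_space \<Rightarrow> ennreal"
  assumes [measurable]: "f \<in> borel_measurable borel" and e: "0 < e"
  shows "(\<integral>\<^sup>+z. f (x - e *\<^sub>R z) \<partial>lborel) = ennreal (1 / e ^ DIM('a)) * (\<integral>\<^sup>+x. f x \<partial>lborel)"
  using e by (subst (2) nn_integral_lborel_affine[where c="-e" and t=x])
    (auto simp: mult.assoc[symmetric] ennreal_mult[symmetric])

lemma nn_integral_lborel_shift:
  fixes f :: "'a::euclidean_space \<Rightarrow> ennreal"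
  assumes [measurable]: "f \<in> borel_measurable borel"
  shows "(\<integral>\<^sup>+x. f (x - c) \<partial>lborel) = (\<integral>\<^sup>+x. f x \<partial>lborel)"
  by (subst (2) nn_integral_lborel_affine[where c=1 and t="-c"]) (auto simp: algebra_simps)

lemma integral_lborel_shift:
  fixes f :: "'a::euclidean_space \<Rightarrow> 'b::{banach, second_countable_topology}"
  shows "(\<integral>x. f (x - c) \<partial>lborel) = (\<integral>x. f x \<partial>lborel)"
  using integral_lborel_affine[of 1 f "-c"] by (simp add: algebra_simps)

lemma integrable_lborel_shift:
  fixes f :: "'a::euclidean_space \<Rightarrow> 'b::{banach, second_countable_topology}"
  shows "integrable lborel f \<Longrightarrow> integrable lborel (\<lambda>x. f (x - c))"
  using integrable_lborel_affine[of f 1 "-c"] by (simp add: algebra_simps)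

lemma Lp_le_shift:
  fixes F :: "'a::euclidean_space \<Rightarrow> ennreal"
  assumes [measurable]: "F \<in> borel_measurable borel" and F: "Lp_le lborel p F A"
  shows "Lp_le lborel p (\<lambda>x. F (x - c)) A"
  using F nn_integral_lborel_shift[of "\<lambda>x. enn_powr (F x) (enn2real p)" c] AE_lborel_shift[of "\<lambda>x. F x \<le> A" c]
  by (auto simp: Lp_le_def split: if_splits)

text \<open>One family of weights measures both the decay of kernels (\<open>rapid\<close>) and the
  admissible growth of functions (\<open>tempered\<close>).\<close>

definition wt :: "nat \<Rightarrow> 'a::euclidean_space \<Rightarrow> real" where
  "wt N x = 1 / (1 + norm x) ^ N"

lemma wt_pos: "0 < wt N x"
  by (simp add: wt_def add_pos_nonneg)

lemma wt_nonneg [simp]: "0 \<le> wt N x"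
  using wt_pos[of N x] by simp

lemma wt_le_1: "wt N x \<le> 1"
  unfolding wt_def by (subst divide_le_eq_1_pos) (auto intro!: zero_less_power add_pos_nonneg one_le_power)

lemma wt_measurable [measurable]: "wt N \<in> borel_measurable borel"
  unfolding wt_def by measurable

lemma wt_add: "wt (M + N) x = wt M x * wt N x"
  by (simp add: wt_def power_add)

lemma wt_mono: "M \<le> N \<Longrightarrow> wt N x \<le> wt M x"
  unfolding wt_def by (intro divide_left_mono power_increasing mult_pos_pos zero_less_power) (auto intro!: add_pos_nonneg)

lemma power_mult_wt: "(1 + norm x) ^ N * wt N x = 1"
  using norm_ge_zero[of x] by (simp add: wt_def add_nonneg_eq_0_iff)

text \<open>A form of Peetre's inequality: 1 + |x - e z| is at most (1 + |x|)(1 + e)(1 + |z|). It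
  moves the decay of a kernel in \<open>z\<close> to the argument x - e z of the function, at the
  price of a polynomial in \<open>x\<close>.\<close>

lemma wt_diff_scale:
  fixes x z :: "'a::euclidean_space"
  assumes e: "0 \<le> e"
  shows "wt N z \<le> ((1 + norm x) * (1 + e)) ^ N * wt N (x - e *\<^sub>R z)"
proof -
  have "norm (x - e *\<^sub>R z) \<le> norm x + e * norm z"
    using norm_triangle_ineq4[of x "e *\<^sub>R z"] e by simp
  moreover have "norm x + e * norm z + 1 \<le> (1 + norm x) * (1 + e) * (1 + norm z)"
    using e by (auto simp: algebra_simps intro!: add_nonneg_nonneg)
  ultimately have le: "1 + norm (x - e *\<^sub>R z) \<le> (1 + norm x) * (1 + e) * (1 + norm z)" by simp
  have "wt N z = (1 + norm (x - e *\<^sub>R z)) ^ N * wt N (x - e *\<^sub>R z) * wt N z"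
    by (simp add: power_mult_wt)
  also have "\<dots> \<le> ((1 + norm x) * (1 + e) * (1 + norm z)) ^ N * wt N (x - e *\<^sub>R z) * wt N z"
    by (intro mult_right_mono power_mono le) (auto intro: add_nonneg_nonneg)
  also have "\<dots> = ((1 + norm x) * (1 + e)) ^ N * wt N (x - e *\<^sub>R z) * ((1 + norm z) ^ N * wt N z)"
    by (simp only: power_mult_distrib mult_ac)
  finally show ?thesis by (simp add: power_mult_wt)
qed

text \<open>With k the integer part of |x|, the weight is at most (1 + k)^-(d+2) and x lies in the
  ball of radius k + 1, whose volume grows like (k + 1)^d. The two spare powers leave the convergent
  series of inverse squares.\<close>

lemma wt_integrable:
  assumes N: "DIM('a::euclidean_space) + 2 \<le> N"
  shows "integrable lborel (wt N :: 'a \<Rightarrow> real)"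
proof -
  let ?d = "DIM('a)"
  let ?c = "unit_ball_vol (real ?d)"
  have le: "ennreal (wt N x) \<le> (\<Sum>k. ennreal (1 / (1 + real k) ^ (?d + 2)) * indicator (cball 0 (real (Suc k))) x)" for x :: 'a
  proof -
    define k where "k = nat \<lfloor>norm x\<rfloor>"
    have k: "real k \<le> norm x" "norm x \<le> real (Suc k)"
      unfolding k_def by (auto intro: less_imp_le simp: of_nat_floor) linarith
    have "wt N x \<le> wt (?d + 2) x" by (rule wt_mono[OF N])
    also have "\<dots> \<le> 1 / (1 + real k) ^ (?d + 2)"
      unfolding wt_def using k by (intro divide_left_mono power_mono) (auto intro!: mult_pos_pos zero_less_power add_pos_nonneg)
    finally have "ennreal (wt N x) \<le> (\<Sum>k\<in>{k}. ennreal (1 / (1 + real k) ^ (?d + 2)) * indicator (cball 0 (real (Suc k))) x)"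
      using k by (auto simp: indicator_def intro!: ennreal_leI)
    also have "\<dots> \<le> (\<Sum>k. ennreal (1 / (1 + real k) ^ (?d + 2)) * indicator (cball 0 (real (Suc k))) x)"
      by (rule sum_le_suminf) auto
    finally show ?thesis .
  qed
  have "(\<integral>\<^sup>+(x::'a). ennreal (wt N x) \<partial>lborel)
     \<le> (\<integral>\<^sup>+(x::'a). (\<Sum>k. ennreal (1 / (1 + real k) ^ (?d + 2)) * indicator (cball 0 (real (Suc k))) x) \<partial>lborel)"
    by (intro nn_integral_mono le)
  also have "\<dots> = (\<Sum>k. \<integral>\<^sup>+(x::'a). ennreal (1 / (1 + real k) ^ (?d + 2)) * indicator (cball 0 (real (Suc k))) x \<partial>lborel)"
    by (rule nn_integral_suminf) (auto intro!: borel_measurable_times_ennreal borel_measurable_indicator)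
  also have "\<dots> = (\<Sum>k. ennreal (?c * (1 / (real k + 1) ^ 2)))"
  proof (intro arg_cong[where f=suminf] ext)
    fix k
    have "(\<integral>\<^sup>+(x::'a). ennreal (1 / (1 + real k) ^ (?d + 2)) * indicator (cball 0 (real (Suc k))) x \<partial>lborel)
      = ennreal (1 / (1 + real k) ^ (?d + 2)) * emeasure lborel (cball (0::'a) (real (Suc k)))"
      by (subst nn_integral_cmult_indicator) auto
    also have "\<dots> = ennreal (1 / (1 + real k) ^ (?d + 2) * (?c * (1 + real k) ^ ?d))"
      by (subst emeasure_cball) (auto simp: ennreal_mult[symmetric] unit_ball_vol_nonneg algebra_simps)
    also have "1 / (1 + real k) ^ (?d + 2) * (?c * (1 + real k) ^ ?d) = ?c * (1 / (real k + 1) ^ 2)"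
    proof -
      have "1 / b ^ (?d + 2) * (?c * b ^ ?d) = ?c * (1 / b ^ 2)" if "0 < b" for b :: real
        using that by (simp add: power_add power2_eq_square)
      from this[of "1 + real k"] show ?thesis by (simp only: add.commute[of "real k" 1])
    qed
    finally show "(\<integral>\<^sup>+(x::'a). ennreal (1 / (1 + real k) ^ (?d + 2)) * indicator (cball 0 (real (Suc k))) x \<partial>lborel)
      = ennreal (?c * (1 / (real k + 1) ^ 2))" .
  qed
  also have "\<dots> < top"
  proof -
    have "summable (\<lambda>k. ?c * (1 / (real k + 1) ^ 2))"
      using inverse_squares_sums by (intro summable_mult) (simp add: sums_iff add.commute)
    then have "(\<Sum>k. ennreal (?c * (1 / (real k + 1) ^ 2))) = ennreal (\<Sum>k. ?c * (1 / (real k + 1) ^ 2))"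
      by (intro suminf_ennreal2) (auto simp: unit_ball_vol_nonneg)
    then show ?thesis by simp
  qed
  finally show ?thesis
    by (intro integrableI_bounded) auto
qed

text \<open>Schwartz decay without smoothness, so that the absolute value of a kernel or a bound for
  its gradient belongs to the class as well.\<close>

definition rapid :: "('a::euclidean_space \<Rightarrow> real) \<Rightarrow> bool" where
  "rapid K \<longleftrightarrow> K \<in> borel_measurable borel \<and> (\<forall>N. \<exists>C. \<forall>x. \<bar>K x\<bar> \<le> C * wt N x)"

text \<open>Growth is measured in the mean: every \<open>rapid\<close> kernel acts on such a
  function by an integral that converges absolutely at every point. Borel functions in some L^p and
  those of polynomial growth are of this kind.\<close>

definition tempered :: "('a::euclidean_space \<Rightarrow> real) \<Rightarrow> bool" where
  "tempered f \<longleftrightarrow> f \<in> borel_measurable borel \<and> (\<exists>N. integrable lborel (\<lambda>x. f x * wt N x))"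

lemma rapid_measurable [measurable_dest]: "rapid K \<Longrightarrow> K \<in> borel_measurable borel"
  by (simp add: rapid_def)

lemma tempered_measurable [measurable_dest]: "tempered f \<Longrightarrow> f \<in> borel_measurable borel"
  by (simp add: tempered_def)

lemma rapidD:
  fixes K :: "'a::euclidean_space \<Rightarrow> real"
  assumes "rapid K" obtains C where "0 \<le> C" "\<And>x. \<bar>K x\<bar> \<le> C * wt N x"
proof -
  obtain C where C: "\<And>x. \<bar>K x\<bar> \<le> C * wt N x" using assms unfolding rapid_def by blast
  have "0 \<le> C * wt N (0::'a)" using order_trans[OF abs_ge_zero C[of 0]] .
  then have "0 \<le> C" using wt_pos[of N "0::'a"] by (simp add: zero_le_mult_iff)
  with C that show thesis by blast
qed

lemma rapid_integrable: "rapid K \<Longrightarrow> integrable lborel K"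
proof -
  assume K: "rapid K"
  note [measurable] = rapid_measurable[OF K]
  obtain C where C: "0 \<le> C" "\<And>x. \<bar>K x\<bar> \<le> C * wt (DIM('a) + 2) x" using rapidD[OF K] by blast
  show ?thesis
    by (rule Bochner_Integration.integrable_bound[of _ "\<lambda>x. C * wt (DIM('a) + 2) x"])
       (use C wt_integrable[where 'a='a] in auto)
qed

lemma rapid_abs: "rapid K \<Longrightarrow> rapid (\<lambda>x. \<bar>K x\<bar>)"
  by (auto simp: rapid_def)

lemma rapid_add: assumes "rapid K" "rapid L" shows "rapid (\<lambda>x. K x + L x)"
  unfolding rapid_def
proof (intro conjI allI)
  note [measurable] = rapid_measurable[OF assms(1)] rapid_measurable[OF assms(2)]
  show "(\<lambda>x. K x + L x) \<in> borel_measurable borel" by measurable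
  fix N obtain C D where "\<And>x. \<bar>K x\<bar> \<le> C * wt N x" "\<And>x. \<bar>L x\<bar> \<le> D * wt N x"
    using rapidD[OF assms(1)] rapidD[OF assms(2)] by metis
  then show "\<exists>C. \<forall>x. \<bar>K x + L x\<bar> \<le> C * wt N x"
    by (intro exI[of _ "C + D"]) (auto simp: distrib_right intro!: order_trans[OF abs_triangle_ineq] add_mono)
qed

lemma rapid_sum: "finite I \<Longrightarrow> (\<And>i. i \<in> I \<Longrightarrow> rapid (K i)) \<Longrightarrow> rapid (\<lambda>x. \<Sum>i\<in>I. K i x)"
proof (induction I rule: finite_induct)
  case empty then show ?case by (auto simp: rapid_def intro!: exI[of _ 0])
next
  case (insert i I) then show ?case by (simp add: rapid_add)
qed

lemma rapid_poly_mult: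
  assumes K: "rapid K" and g: "g \<in> borel_measurable borel" "\<And>x. \<bar>g x\<bar> \<le> C * (1 + norm x) ^ m"
  shows "rapid (\<lambda>x. g x * K x)"
  unfolding rapid_def
proof (intro conjI allI)
  note [measurable] = rapid_measurable[OF K] g(1)
  show "(\<lambda>x. g x * K x) \<in> borel_measurable borel" by measurable
  fix N obtain D where D: "\<And>x. \<bar>K x\<bar> \<le> D * wt (m + N) x" using rapidD[OF K] by metis
  have "\<bar>g x * K x\<bar> \<le> C * D * wt N x" for x
  proof -
    have "\<bar>g x * K x\<bar> \<le> (C * (1 + norm x) ^ m) * (D * wt (m + N) x)"
      unfolding abs_mult by (intro mult_mono g D) (use order_trans[OF abs_ge_zero g(2)] in auto)
    also have "\<dots> = C * D * wt N x * ((1 + norm x) ^ m * wt m x)" by (simp add: wt_add)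
    finally show ?thesis by (simp add: power_mult_wt)
  qed
  then show "\<exists>C. \<forall>x. \<bar>g x * K x\<bar> \<le> C * wt N x" by blast
qed

lemma rapid_norm_mult: "rapid K \<Longrightarrow> rapid (\<lambda>x. norm x * K x)"
  by (rule rapid_poly_mult[where C=1 and m=1]) auto

lemma rapid_bound: "rapid K \<Longrightarrow> L \<in> borel_measurable borel \<Longrightarrow> (\<And>x. \<bar>L x\<bar> \<le> \<bar>K x\<bar>) \<Longrightarrow> rapid L"
  unfolding rapid_def by (meson order_trans)

section \<open>Tempered functions and their pairing with rapid kernels\<close>

lemma tempered_raise:
  assumes "f \<in> borel_measurable borel" "integrable lborel (\<lambda>x. f x * wt M x)" "M \<le> N"
  shows "integrable lborel (\<lambda>x. f x * wt N x)"
  by (rule Bochner_Integration.integrable_bound[OF assms(2)])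
     (use assms in \<open>auto simp: abs_mult intro!: mult_left_mono wt_mono\<close>)

lemma tempered_common:
  assumes "tempered f" "tempered g"
  obtains N where "integrable lborel (\<lambda>x. f x * wt N x)" "integrable lborel (\<lambda>x. g x * wt N x)"
proof -
  obtain M N where "integrable lborel (\<lambda>x. f x * wt M x)" "integrable lborel (\<lambda>x. g x * wt N x)"
    using assms unfolding tempered_def by blast
  then show thesis using that[of "max M N"] assms tempered_raise unfolding tempered_def
    by (metis max.cobounded1 max.cobounded2)
qed

lemma tempered_add: assumes "tempered f" "tempered g" shows "tempered (\<lambda>x. f x + g x)"
proof -
  obtain N where "integrable lborel (\<lambda>x. f x * wt N x)" "integrable lborel (\<lambda>x. g x * wt N x)"
    by (rule tempered_common[OF assms])
  then have "integrable lborel (\<lambda>x. (f x + g x) * wt N x)" by (simp add: distrib_right)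
  then show ?thesis using assms unfolding tempered_def by auto
qed

lemma tempered_poly:
  fixes f :: "'a::euclidean_space \<Rightarrow> real"
  assumes [measurable]: "f \<in> borel_measurable borel" and f: "\<And>x. \<bar>f x\<bar> \<le> C * (1 + norm x) ^ N"
  shows "tempered f"
  unfolding tempered_def
proof (intro conjI exI)
  show "integrable lborel (\<lambda>x. f x * wt (N + (DIM('a) + 2)) x)"
  proof (rule Bochner_Integration.integrable_bound)
    show "integrable lborel (\<lambda>x::'a. C * wt (DIM('a) + 2) x)"
      using wt_integrable by auto
    show "AE x in lborel. norm (f x * wt (N + (DIM('a) + 2)) x) \<le> norm (C * wt (DIM('a) + 2) x)"
    proof (rule AE_I2)
      fix x :: 'a
      have "\<bar>f x * wt (N + (DIM('a) + 2)) x\<bar> \<le> (C * (1 + norm x) ^ N) * wt (N + (DIM('a) + 2)) x"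
        unfolding abs_mult using f[of x] by (intro mult_mono) (auto intro: order_trans[OF abs_ge_zero])
      also have "\<dots> = C * wt (DIM('a) + 2) x * ((1 + norm x) ^ N * wt N x)" by (simp only: wt_add mult_ac)
      finally show "norm (f x * wt (N + (DIM('a) + 2)) x) \<le> norm (C * wt (DIM('a) + 2) x)"
        by (simp add: power_mult_wt)
    qed
  qed measurable
qed measurable

text \<open>The kernel decays as \<open>wt N\<close>, with the \<open>N\<close> that belongs to
  \<open>f\<close>; \<open>wt_diff_scale\<close> transfers this weight to the argument of
  \<open>f\<close>. The bound holds at every \<open>x\<close> and is polynomial in \<open>x\<close>,
  so the action of a kernel leads back to tempered functions and can be iterated.\<close>

lemma rapid_tempered_bound:
  fixes f K :: "'a::euclidean_space \<Rightarrow> real"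
  assumes K: "rapid K" and f: "tempered f" and e: "0 < e"
  obtains C N where "0 \<le> C" "\<And>x. (\<integral>\<^sup>+z. ennreal \<bar>K z * f (x - e *\<^sub>R z)\<bar> \<partial>lborel) \<le> ennreal (C * (1 + norm x) ^ N)"
proof -
  note [measurable] = rapid_measurable[OF K] tempered_measurable[OF f]
  obtain N where N: "integrable lborel (\<lambda>x. f x * wt N x)" using f unfolding tempered_def by blast
  obtain C where C: "0 \<le> C" "\<And>x. \<bar>K x\<bar> \<le> C * wt N x" using rapidD[OF K] by blast
  define D where "D = (\<integral>x. \<bar>f x * wt N x\<bar> \<partial>lborel)"
  have D: "0 \<le> D" "(\<integral>\<^sup>+x. ennreal \<bar>f x * wt N x\<bar> \<partial>lborel) = ennreal D"
    unfolding D_def using N by (auto intro!: nn_integral_eq_integral)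
  have "(\<integral>\<^sup>+z. ennreal \<bar>K z * f (x - e *\<^sub>R z)\<bar> \<partial>lborel) \<le> ennreal ((C * (1 + e) ^ N * (1 / e ^ DIM('a)) * D) * (1 + norm x) ^ N)" for x
  proof -
    have "(\<integral>\<^sup>+z. ennreal \<bar>K z * f (x - e *\<^sub>R z)\<bar> \<partial>lborel)
       \<le> (\<integral>\<^sup>+z. ennreal (C * ((1 + norm x) * (1 + e)) ^ N) * ennreal \<bar>f (x - e *\<^sub>R z) * wt N (x - e *\<^sub>R z)\<bar> \<partial>lborel)"
    proof (intro nn_integral_mono)
      fix z
      have "\<bar>K z\<bar> \<le> C * (((1 + norm x) * (1 + e)) ^ N * wt N (x - e *\<^sub>R z))"
        using C(2)[of z] mult_left_mono[OF wt_diff_scale[of e N z x] C(1)] e by simp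
      then have "\<bar>K z * f (x - e *\<^sub>R z)\<bar> \<le> C * ((1 + norm x) * (1 + e)) ^ N * \<bar>f (x - e *\<^sub>R z) * wt N (x - e *\<^sub>R z)\<bar>"
        using mult_right_mono[of "\<bar>K z\<bar>" _ "\<bar>f (x - e *\<^sub>R z)\<bar>"] by (fastforce simp: abs_mult mult_ac)
      then show "ennreal \<bar>K z * f (x - e *\<^sub>R z)\<bar> \<le> ennreal (C * ((1 + norm x) * (1 + e)) ^ N) * ennreal \<bar>f (x - e *\<^sub>R z) * wt N (x - e *\<^sub>R z)\<bar>"
        using C e by (subst ennreal_mult[symmetric]) (auto intro!: ennreal_leI mult_nonneg_nonneg zero_le_power add_nonneg_nonneg)
    qed
    also have "\<dots> = ennreal (C * ((1 + norm x) * (1 + e)) ^ N) * (ennreal (1 / e ^ DIM('a)) * ennreal D)"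
      using e by (subst nn_integral_cmult)
        (auto simp: nn_integral_lborel_diff_scale[of "\<lambda>y. ennreal \<bar>f y * wt N y\<bar>"] D simp del: abs_mult)
    also have "\<dots> = ennreal ((C * (1 + e) ^ N * (1 / e ^ DIM('a)) * D) * (1 + norm x) ^ N)"
      using C e D by (simp add: ennreal_mult[symmetric] power_mult_distrib mult_ac add_nonneg_nonneg)
    finally show ?thesis .
  qed
  then show thesis using C e D by (intro that[of "C * (1 + e) ^ N * (1 / e ^ DIM('a)) * D" N]) auto
qed

lemma rapid_tempered_integrable:
  assumes "rapid K" "tempered f" "0 < e"
  shows "integrable lborel (\<lambda>z. K z * f (x - e *\<^sub>R z))"
proof -
  note [measurable] = rapid_measurable[OF assms(1)] tempered_measurable[OF assms(2)]
  obtain C N where "(\<integral>\<^sup>+z. ennreal \<bar>K z * f (x - e *\<^sub>R z)\<bar> \<partial>lborel) \<le> ennreal (C * (1 + norm x) ^ N)"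
    using rapid_tempered_bound[OF assms] by metis
  then show ?thesis by (intro integrableI_bounded) (auto simp: le_less_trans)
qed

text \<open>Convolution with the dilated kernel e^-d K(./e), after the substitution y = x - e z. The
  scale sits in the argument of \<open>f\<close>, so one fixed kernel serves all scales.\<close>

definition kop :: "('a::euclidean_space \<Rightarrow> real) \<Rightarrow> real \<Rightarrow> ('a \<Rightarrow> real) \<Rightarrow> 'a \<Rightarrow> real" where
  "kop K e f x = (\<integral>z. K z * f (x - e *\<^sub>R z) \<partial>lborel)"

lemma kop_measurable [measurable (raw)]:
  assumes [measurable]: "K \<in> borel_measurable borel" "f \<in> borel_measurable borel" "g \<in> borel_measurable M"
  shows "(\<lambda>x. kop K e f (g x)) \<in> borel_measurable M"
  unfolding kop_def by measurable

lemma abs_kop_le: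
  "ennreal \<bar>kop K e f x\<bar> \<le> (\<integral>\<^sup>+z. ennreal \<bar>K z * f (x - e *\<^sub>R z)\<bar> \<partial>lborel)"
proof (cases "integrable lborel (\<lambda>z. K z * f (x - e *\<^sub>R z))")
  case True
  then show ?thesis unfolding kop_def using integral_norm_bound_ennreal by fastforce
qed (simp add: kop_def not_integrable_integral_eq)

lemma tempered_kop:
  assumes "rapid K" "tempered f" "0 < e" shows "tempered (kop K e f)"
proof -
  note [measurable] = rapid_measurable[OF assms(1)] tempered_measurable[OF assms(2)]
  obtain C N where C: "0 \<le> C" "\<And>x. (\<integral>\<^sup>+z. ennreal \<bar>K z * f (x - e *\<^sub>R z)\<bar> \<partial>lborel) \<le> ennreal (C * (1 + norm x) ^ N)"
    using rapid_tempered_bound[OF assms] by blast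
  show ?thesis
  proof (rule tempered_poly)
    show "\<bar>kop K e f x\<bar> \<le> C * (1 + norm x) ^ N" for x
      using order_trans[OF abs_kop_le C(2)] C(1) by (subst (asm) ennreal_le_iff) (auto intro!: mult_nonneg_nonneg)
  qed measurable
qed

section \<open>Algebra of the operators \<open>kop\<close>\<close>

lemma kop_add:
  assumes "rapid K" "tempered f" "tempered g" "0 < e"
  shows "kop K e (\<lambda>x. f x + g x) x = kop K e f x + kop K e g x"
  unfolding kop_def distrib_left
  by (intro Bochner_Integration.integral_add rapid_tempered_integrable assms)

lemma kop_diff:
  assumes "rapid K" "tempered f" "tempered g" "0 < e"
  shows "kop K e (\<lambda>x. f x - g x) x = kop K e f x - kop K e g x"
  unfolding kop_def right_diff_distrib
  by (intro Bochner_Integration.integral_diff rapid_tempered_integrable assms)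

lemma kop_diff_kernel:
  assumes "rapid K" "rapid L" "tempered f" "0 < e"
  shows "kop (\<lambda>z. K z - L z) e f x = kop K e f x - kop L e f x"
  unfolding kop_def left_diff_distrib
  by (intro Bochner_Integration.integral_diff rapid_tempered_integrable assms)

text \<open>The inner integral of absolute values is bounded by a polynomial, which is itself
  tempered, so the outer kernel is integrable against it. This justifies every exchange of two
  kernels.\<close>

lemma kop_kop_integrable:
  fixes f :: "'a::euclidean_space \<Rightarrow> real"
  assumes K: "rapid K" and L: "rapid L" and f: "tempered f" and e: "0 < d" "0 < e"
  shows "integrable (lborel \<Otimes>\<^sub>M lborel) (\<lambda>(h, z). L h * (K z * f (x - d *\<^sub>R h - e *\<^sub>R z)))"
proof -
  note [measurable] = rapid_measurable[OF K] rapid_measurable[OF L] tempered_measurable[OF f]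
  obtain C N where C: "0 \<le> C" "\<And>x. (\<integral>\<^sup>+z. ennreal \<bar>K z * f (x - e *\<^sub>R z)\<bar> \<partial>lborel) \<le> ennreal (C * (1 + norm x) ^ N)"
    using rapid_tempered_bound[OF K f e(2)] by blast
  have "tempered (\<lambda>x::'a. C * (1 + norm x) ^ N)"
    by (rule tempered_poly[of _ C N]) (use C in auto)
  then have int: "integrable lborel (\<lambda>h. L h * (C * (1 + norm (x - d *\<^sub>R h)) ^ N))"
    using rapid_tempered_integrable[OF L _ e(1)] by blast
  have "(\<integral>\<^sup>+y. norm ((\<lambda>(h, z). L h * (K z * f (x - d *\<^sub>R h - e *\<^sub>R z))) y) \<partial>(lborel \<Otimes>\<^sub>M lborel))
     = (\<integral>\<^sup>+h. \<integral>\<^sup>+z. norm (L h * (K z * f (x - d *\<^sub>R h - e *\<^sub>R z))) \<partial>lborel \<partial>lborel)"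
    by (subst lborel.nn_integral_fst[symmetric]) (auto simp: case_prod_beta)
  also have "\<dots> = (\<integral>\<^sup>+h. ennreal \<bar>L h\<bar> * (\<integral>\<^sup>+z. ennreal \<bar>K z * f (x - d *\<^sub>R h - e *\<^sub>R z)\<bar> \<partial>lborel) \<partial>lborel)"
    by (subst nn_integral_cmult[symmetric]) (auto simp: abs_mult[of "L _"] ennreal_mult)
  also have "\<dots> \<le> (\<integral>\<^sup>+h. ennreal \<bar>L h\<bar> * ennreal (C * (1 + norm (x - d *\<^sub>R h)) ^ N) \<partial>lborel)"
    by (intro nn_integral_mono mult_left_mono C) auto
  also have "\<dots> = (\<integral>\<^sup>+h. ennreal (norm (L h * (C * (1 + norm (x - d *\<^sub>R h)) ^ N))) \<partial>lborel)"
    using C by (intro nn_integral_cong) (auto simp: abs_mult ennreal_mult)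
  also have "\<dots> < top" using int by (simp add: integrable_iff_bounded)
  finally show ?thesis
    by (intro integrableI_bounded) auto
qed

text \<open>The two scales may differ: mollification at scale \<open>d\<close> has to be exchanged
  with frequency projections at dyadic scales.\<close>

lemma kop_commute:
  fixes f :: "'a::euclidean_space \<Rightarrow> real"
  assumes K: "rapid K" and L: "rapid L" and f: "tempered f" and e: "0 < d" "0 < e"
  shows "kop L d (kop K e f) x = kop K e (kop L d f) x"
proof -
  have "kop L d (kop K e f) x = (\<integral>h. \<integral>z. L h * (K z * f (x - d *\<^sub>R h - e *\<^sub>R z)) \<partial>lborel \<partial>lborel)"
    unfolding kop_def by (intro Bochner_Integration.integral_cong integral_mult_right_zero[symmetric] refl)
  also have "\<dots> = (\<integral>z. \<integral>h. L h * (K z * f (x - d *\<^sub>R h - e *\<^sub>R z)) \<partial>lborel \<partial>lborel)"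
    using kop_kop_integrable[OF assms, of x] by (intro lborel_pair.Fubini_integral[symmetric]) (simp add: case_prod_beta)
  also have "\<dots> = (\<integral>z. \<integral>h. K z * (L h * f (x - e *\<^sub>R z - d *\<^sub>R h)) \<partial>lborel \<partial>lborel)"
    by (intro Bochner_Integration.integral_cong refl) (simp add: algebra_simps)
  also have "\<dots> = kop K e (kop L d f) x"
    unfolding kop_def by (intro Bochner_Integration.integral_cong integral_mult_right_zero refl)
  finally show ?thesis .
qed

text \<open>At a common scale the composition is again of the form \<open>kop\<close>, with the
  convolution of the two kernels. This turns the identity between \<open>a\<close>,
  \<open>b\<close>, \<open>a'\<close> and \<open>b'\<close> into an identity between
  operators.\<close>

lemma kop_kop_eq:
  fixes f :: "'a::euclidean_space \<Rightarrow> real"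
  assumes K: "rapid K" and L: "rapid L" and f: "tempered f" and e: "0 < e"
  shows "kop L e (kop K e f) x = kop (\<lambda>y. \<integral>h. L h * K (y - h) \<partial>lborel) e f x"
proof -
  note [measurable] = rapid_measurable[OF K] rapid_measurable[OF L] tempered_measurable[OF f]
  have "kop L e (kop K e f) x = (\<integral>h. \<integral>z. L h * (K z * f (x - e *\<^sub>R h - e *\<^sub>R z)) \<partial>lborel \<partial>lborel)"
    unfolding kop_def by (intro Bochner_Integration.integral_cong integral_mult_right_zero[symmetric] refl)
  also have "\<dots> = (\<integral>h. \<integral>y. L h * (K (y - h) * f (x - e *\<^sub>R h - e *\<^sub>R (y - h))) \<partial>lborel \<partial>lborel)"
    by (intro Bochner_Integration.integral_cong refl integral_lborel_shift[symmetric])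
  also have "\<dots> = (\<integral>h. \<integral>y. L h * (K (y - h) * f (x - e *\<^sub>R y)) \<partial>lborel \<partial>lborel)"
    by (simp add: algebra_simps)
  also have "\<dots> = (\<integral>y. \<integral>h. L h * (K (y - h) * f (x - e *\<^sub>R y)) \<partial>lborel \<partial>lborel)"
  proof (intro lborel_pair.Fubini_integral[symmetric])
    have "(\<integral>\<^sup>+y. norm ((\<lambda>(h, z). L h * (K (z - h) * f (x - e *\<^sub>R z))) y) \<partial>(lborel \<Otimes>\<^sub>M lborel))
       = (\<integral>\<^sup>+h. \<integral>\<^sup>+z. norm (L h * (K (z - h) * f (x - e *\<^sub>R h - e *\<^sub>R (z - h)))) \<partial>lborel \<partial>lborel)"
      by (subst lborel.nn_integral_fst[symmetric]) (auto simp: case_prod_beta algebra_simps)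
    also have "\<dots> = (\<integral>\<^sup>+h. \<integral>\<^sup>+z. norm (L h * (K z * f (x - e *\<^sub>R h - e *\<^sub>R z))) \<partial>lborel \<partial>lborel)"
      by (intro nn_integral_cong nn_integral_lborel_shift) measurable
    also have "\<dots> = (\<integral>\<^sup>+y. norm ((\<lambda>(h, z). L h * (K z * f (x - e *\<^sub>R h - e *\<^sub>R z))) y) \<partial>(lborel \<Otimes>\<^sub>M lborel))"
      by (subst lborel.nn_integral_fst[symmetric]) (auto simp: case_prod_beta)
    also have "\<dots> < \<infinity>" using kop_kop_integrable[OF K L f e e, of x] by (simp only: integrable_iff_bounded)
    finally show "integrable (lborel \<Otimes>\<^sub>M lborel) (\<lambda>(h, y). L h * (K (y - h) * f (x - e *\<^sub>R y)))"
      by (intro integrableI_bounded) auto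
  qed
  also have "\<dots> = (\<integral>y. (\<integral>h. L h * K (y - h) \<partial>lborel) * f (x - e *\<^sub>R y) \<partial>lborel)"
    by (simp add: mult.assoc[symmetric])
  finally show ?thesis by (simp add: kop_def)
qed

text \<open>An average of translates of \<open>F\<close>, over the kernel \<open>D\<close> at scale
  \<open>e\<close> and over the segment of length |h|. Translations preserve L^p norms, so its norm
  is at most the mass of \<open>D\<close> times that of \<open>F\<close>, uniformly in
  \<open>e\<close> and \<open>h\<close>.\<close>

definition avg :: "('a::euclidean_space \<Rightarrow> real) \<Rightarrow> real \<Rightarrow> 'a \<Rightarrow> ('a \<Rightarrow> ennreal) \<Rightarrow> 'a \<Rightarrow> ennreal" where
  "avg D e h F x = (\<integral>\<^sup>+z. ennreal (D z) * (\<integral>\<^sup>+s. indicator {0..1} s * F (x - e *\<^sub>R z - s *\<^sub>R h) \<partial>lborel) \<partial>lborel)"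

lemma avg_measurable [measurable (raw)]:
  assumes [measurable]: "D \<in> borel_measurable borel" "F \<in> borel_measurable borel"
    "g \<in> borel_measurable M" "h \<in> borel_measurable M"
  shows "(\<lambda>x. avg D e (h x) F (g x)) \<in> borel_measurable M"
  unfolding avg_def by measurable

lemma Lp_le_avg:
  fixes F :: "'a::euclidean_space \<Rightarrow> ennreal"
  assumes p: "1 \<le> p" and [measurable]: "D \<in> borel_measurable borel" "F \<in> borel_measurable borel"
    and F: "Lp_le lborel p F (ennreal A)" and D: "(\<integral>\<^sup>+z. ennreal (D z) \<partial>lborel) \<le> ennreal W" and pos: "0 \<le> A" "0 \<le> W"
  shows "Lp_le lborel p (avg D e h F) (ennreal (W * A))"
proof -
  have "Lp_le lborel p (\<lambda>x. \<integral>\<^sup>+s. indicator {0..1} s * F (x - e *\<^sub>R z - s *\<^sub>R h) \<partial>lborel) (ennreal (1 * A))" for z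
    using Lp_le_shift[OF _ F] pos
    by (intro Lp_le_Minkowski[OF lborel.sigma_finite_measure_axioms lborel.sigma_finite_measure_axioms p])
       (auto simp: diff_diff_eq)
  then have "Lp_le lborel p (\<lambda>x. \<integral>\<^sup>+z. ennreal (D z) * (\<integral>\<^sup>+s. indicator {0..1} s * F (x - e *\<^sub>R z - s *\<^sub>R h) \<partial>lborel) \<partial>lborel) (ennreal (W * A))"
    using D pos
    by (intro Lp_le_Minkowski[OF lborel.sigma_finite_measure_axioms lborel.sigma_finite_measure_axioms p]) auto
  then show ?thesis by (simp add: avg_def[abs_def])
qed

text \<open>\<open>D\<close> plays the part of a bound for the gradient of \<open>K\<close>. Only
  its averages along segments enter, and they are kept as integrals: a supremum over the segment
  would not be a mean of translates of \<open>D\<close>, as Minkowski's inequality requires.\<close>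

definition grad_bd :: "('a::euclidean_space \<Rightarrow> real) \<Rightarrow> ('a \<Rightarrow> real) \<Rightarrow> bool" where
  "grad_bd K D \<longleftrightarrow> D \<in> borel_measurable borel \<and>
     (\<forall>z k. ennreal \<bar>K (z - k) - K z\<bar> \<le> ennreal (norm k) * (\<integral>\<^sup>+s. indicator {0..1} s * ennreal (D (z - s *\<^sub>R k)) \<partial>lborel))"

text \<open>The fundamental theorem of calculus along the segment from z to z - k, followed by the
  Cauchy-Schwarz inequality.\<close>

lemma grad_bdI:
  fixes K :: "'a::euclidean_space \<Rightarrow> real"
  assumes der: "\<And>x. (K has_derivative (\<lambda>h. K' x \<bullet> h)) (at x)" and cont: "continuous_on UNIV K'"
    and D: "D \<in> borel_measurable borel" "\<And>x. norm (K' x) \<le> D x"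
  shows "grad_bd K D"
  unfolding grad_bd_def
proof (intro conjI allI D)
  fix z k :: 'a
  note [measurable] = D(1)
  have [measurable]: "K' \<in> borel_measurable borel" using cont by (rule borel_measurable_continuous_onI)
  have "((\<lambda>s. K (z - s *\<^sub>R k)) has_real_derivative - (K' (z - s *\<^sub>R k) \<bullet> k)) (at s within {0..1})" for s
  proof -
    have "((\<lambda>s. z - s *\<^sub>R k) has_derivative (\<lambda>t. - (t *\<^sub>R k))) (at s)"
      by (auto intro!: derivative_eq_intros)
    from diff_chain_at[OF this der] have "((\<lambda>s. K (z - s *\<^sub>R k)) has_derivative (\<lambda>t. K' (z - s *\<^sub>R k) \<bullet> - (t *\<^sub>R k))) (at s)"
      by (simp add: o_def)
    moreover have "(\<lambda>t. K' (z - s *\<^sub>R k) \<bullet> - (t *\<^sub>R k)) = (*) (- (K' (z - s *\<^sub>R k) \<bullet> k))"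
      by (auto simp: fun_eq_iff)
    ultimately show ?thesis
      by (auto simp: has_field_derivative_def intro: has_derivative_at_withinI)
  qed
  moreover have "continuous_on {0..1} (\<lambda>s. - (K' (z - s *\<^sub>R k) \<bullet> k))"
    by (intro continuous_intros continuous_on_compose2[OF cont]) auto
  ultimately have hb: "has_bochner_integral lborel (\<lambda>s. indicator {0..1} s *\<^sub>R (- (K' (z - s *\<^sub>R k) \<bullet> k))) (K (z - k) - K z)"
    using has_bochner_integral_FTC_Icc[of 0 1 "\<lambda>s. K (z - s *\<^sub>R k)" "\<lambda>s. - (K' (z - s *\<^sub>R k) \<bullet> k)"]
    by (auto simp: has_real_derivative_iff_has_vector_derivative)
  have "ennreal \<bar>K (z - k) - K z\<bar> \<le> (\<integral>\<^sup>+s. norm (indicator {0..1} s *\<^sub>R (- (K' (z - s *\<^sub>R k) \<bullet> k))) \<partial>lborel)"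
    using integral_norm_bound_ennreal[of lborel "\<lambda>s. indicator {0..1} s *\<^sub>R (- (K' (z - s *\<^sub>R k) \<bullet> k))"] hb
    unfolding has_bochner_integral_iff real_norm_def by metis
  also have "\<dots> \<le> (\<integral>\<^sup>+s. ennreal (norm k) * (indicator {0..1} s * ennreal (D (z - s *\<^sub>R k))) \<partial>lborel)"
  proof (intro nn_integral_mono)
    fix s :: real
    have "\<bar>K' (z - s *\<^sub>R k) \<bullet> k\<bar> \<le> D (z - s *\<^sub>R k) * norm k"
      using Cauchy_Schwarz_ineq2[of "K' (z - s *\<^sub>R k)" k] D(2)[of "z - s *\<^sub>R k"]
      by (meson mult_right_mono norm_ge_zero order_trans)
    then show "ennreal (norm (indicator {0..1} s *\<^sub>R (- (K' (z - s *\<^sub>R k) \<bullet> k)))) \<le> ennreal (norm k) * (indicator {0..1} s * ennreal (D (z - s *\<^sub>R k)))"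
      using order_trans[OF norm_ge_zero D(2)]
      by (auto simp: indicator_def ennreal_mult[symmetric] mult.commute intro!: ennreal_leI)
  qed
  also have "\<dots> = ennreal (norm k) * (\<integral>\<^sup>+s. indicator {0..1} s * ennreal (D (z - s *\<^sub>R k)) \<partial>lborel)"
    by (rule nn_integral_cmult) measurable
  finally show "ennreal \<bar>K (z - k) - K z\<bar> \<le> ennreal (norm k) * (\<integral>\<^sup>+s. indicator {0..1} s * ennreal (D (z - s *\<^sub>R k)) \<partial>lborel)" .
qed

text \<open>Translating \<open>x\<close> by \<open>h\<close> amounts to translating the kernel by k
  = h/e, to which \<open>grad_bd\<close> applies; shifting \<open>z\<close> back by s k puts the
  displacement s h into the argument of \<open>f\<close>. The factor |h|/e is Bernstein's
  inequality: a derivative costs the inverse of the scale.\<close>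

lemma kop_increment:
  fixes f :: "'a::euclidean_space \<Rightarrow> real"
  assumes K: "rapid K" and D: "grad_bd K D" and f: "tempered f" and e: "0 < e"
  shows "ennreal \<bar>kop K e f (x - h) - kop K e f x\<bar> \<le> ennreal (norm h / e) * avg D e h (\<lambda>y. ennreal \<bar>f y\<bar>) x"
proof -
  note [measurable] = rapid_measurable[OF K] tempered_measurable[OF f]
  have [measurable]: "D \<in> borel_measurable borel" using D by (simp add: grad_bd_def)
  define k where "k = (1 / e) *\<^sub>R h"
  have h: "h = e *\<^sub>R k" "norm k = norm h / e" using e by (auto simp: k_def)
  have int1: "integrable lborel (\<lambda>z. K (z - k) * f (x - e *\<^sub>R z))"
    using integrable_lborel_shift[OF rapid_tempered_integrable[OF K f e, of "x - h"], of k]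
    by (simp add: h algebra_simps)
  have "kop K e f (x - h) = (\<integral>z. K (z - k) * f (x - e *\<^sub>R z) \<partial>lborel)"
    unfolding kop_def by (subst integral_lborel_shift[symmetric, where c=k]) (simp add: h algebra_simps)
  then have eq: "kop K e f (x - h) - kop K e f x = (\<integral>z. (K (z - k) - K z) * f (x - e *\<^sub>R z) \<partial>lborel)"
    unfolding kop_def left_diff_distrib
    by (subst Bochner_Integration.integral_diff[OF int1 rapid_tempered_integrable[OF K f e, of x]]) simp
  have "integrable lborel (\<lambda>z. (K (z - k) - K z) * f (x - e *\<^sub>R z))"
    using int1 rapid_tempered_integrable[OF K f e, of x] by (simp add: left_diff_distrib)
  from integral_norm_bound_ennreal[OF this]
  have "ennreal \<bar>kop K e f (x - h) - kop K e f x\<bar> \<le> (\<integral>\<^sup>+z. ennreal \<bar>(K (z - k) - K z) * f (x - e *\<^sub>R z)\<bar> \<partial>lborel)"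
    by (simp add: eq)
  also have "\<dots> \<le> (\<integral>\<^sup>+z. (ennreal (norm k) * (\<integral>\<^sup>+s. indicator {0..1} s * ennreal (D (z - s *\<^sub>R k)) \<partial>lborel)) * ennreal \<bar>f (x - e *\<^sub>R z)\<bar> \<partial>lborel)"
    using D unfolding abs_mult grad_bd_def by (intro nn_integral_mono) (auto simp: ennreal_mult intro!: mult_right_mono)
  also have "\<dots> = ennreal (norm k) * (\<integral>\<^sup>+z. (\<integral>\<^sup>+s. indicator {0..1} s * ennreal (D (z - s *\<^sub>R k)) \<partial>lborel) * ennreal \<bar>f (x - e *\<^sub>R z)\<bar> \<partial>lborel)"
    unfolding mult.assoc by (rule nn_integral_cmult) measurable
  also have "(\<integral>\<^sup>+z. (\<integral>\<^sup>+s. indicator {0..1} s * ennreal (D (z - s *\<^sub>R k)) \<partial>lborel) * ennreal \<bar>f (x - e *\<^sub>R z)\<bar> \<partial>lborel)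
     = (\<integral>\<^sup>+z. \<integral>\<^sup>+s. indicator {0..1} s * ennreal (D (z - s *\<^sub>R k)) * ennreal \<bar>f (x - e *\<^sub>R z)\<bar> \<partial>lborel \<partial>lborel)"
    by (intro nn_integral_cong nn_integral_multc[symmetric]) measurable
  also have "\<dots> = (\<integral>\<^sup>+s. \<integral>\<^sup>+z. indicator {0..1} s * ennreal (D (z - s *\<^sub>R k)) * ennreal \<bar>f (x - e *\<^sub>R z)\<bar> \<partial>lborel \<partial>lborel)"
    by (rule lborel_pair.Fubini'[symmetric]) measurable
  also have "\<dots> = (\<integral>\<^sup>+s. \<integral>\<^sup>+z. indicator {0..1} s * ennreal (D z) * ennreal \<bar>f (x - e *\<^sub>R z - s *\<^sub>R h)\<bar> \<partial>lborel \<partial>lborel)"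
  proof (rule nn_integral_cong)
    fix s :: real
    have "(\<integral>\<^sup>+z. indicator {0..1} s * ennreal (D (z - s *\<^sub>R k)) * ennreal \<bar>f (x - e *\<^sub>R z)\<bar> \<partial>lborel)
      = (\<integral>\<^sup>+z. (\<lambda>y. indicator {0..1} s * ennreal (D y) * ennreal \<bar>f (x - e *\<^sub>R y - s *\<^sub>R h)\<bar>) (z - s *\<^sub>R k) \<partial>lborel)"
      by (simp add: h algebra_simps)
    also have "\<dots> = (\<integral>\<^sup>+y. indicator {0..1} s * ennreal (D y) * ennreal \<bar>f (x - e *\<^sub>R y - s *\<^sub>R h)\<bar> \<partial>lborel)"
      by (rule nn_integral_lborel_shift) measurable
    finally show "(\<integral>\<^sup>+z. indicator {0..1} s * ennreal (D (z - s *\<^sub>R k)) * ennreal \<bar>f (x - e *\<^sub>R z)\<bar> \<partial>lborel) = \<dots>" .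
  qed
  also have "\<dots> = (\<integral>\<^sup>+z. \<integral>\<^sup>+s. indicator {0..1} s * ennreal (D z) * ennreal \<bar>f (x - e *\<^sub>R z - s *\<^sub>R h)\<bar> \<partial>lborel \<partial>lborel)"
    by (rule lborel_pair.Fubini') measurable
  also have "\<dots> = avg D e h (\<lambda>y. ennreal \<bar>f y\<bar>) x"
    unfolding avg_def
  proof (rule nn_integral_cong)
    fix z
    show "(\<integral>\<^sup>+s. indicator {0..1} s * ennreal (D z) * ennreal \<bar>f (x - e *\<^sub>R z - s *\<^sub>R h)\<bar> \<partial>lborel)
      = ennreal (D z) * (\<integral>\<^sup>+s. indicator {0..1} s * ennreal \<bar>f (x - e *\<^sub>R z - s *\<^sub>R h)\<bar> \<partial>lborel)"
      unfolding mult.commute[of "indicator {0..1} _" "ennreal (D z)"] mult.assoc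
      by (rule nn_integral_cmult) measurable
  qed
  finally show ?thesis by (simp only: h(2))
qed

subsection \<open>Smooth functions\<close>

lemma borel_measurable_vec_nth [measurable (raw)]:
  fixes f :: "'a \<Rightarrow> real^'n"
  assumes "f \<in> borel_measurable M" shows "(\<lambda>x. f x $ i) \<in> borel_measurable M"
  using borel_measurable_inner[OF assms borel_measurable_const, of "axis i 1"] by (simp add: inner_axis)

text \<open>No formula for iterated derivatives is required: it suffices to exhibit a class of
  differentiable functions that is stable under one differentiation in each coordinate
  direction.\<close>

lemma smooth_fun_coinduct:
  assumes "P f" and step: "\<And>g. P g \<Longrightarrow> (\<forall>x. g differentiable (at x)) \<and> (\<forall>b\<in>Basis. P (\<lambda>x. frechet_derivative g (at x) b))"
  shows "smooth_fun f"
proof -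
  have "P (dir_deriv f vs)" if "set vs \<subseteq> Basis" for vs
    using that by (induction vs) (use assms in auto)
  then show ?thesis unfolding smooth_fun_def using step by blast
qed

lemma smooth_fun_differentiable: "smooth_fun f \<Longrightarrow> f differentiable (at x)"
  unfolding smooth_fun_def by (metis dir_deriv.simps(1) empty_subsetI list.set(1))

lemma dir_deriv_append: "dir_deriv f (vs @ ws) = dir_deriv (dir_deriv f ws) vs"
  by (induction vs) auto

lemma smooth_fun_deriv: "smooth_fun f \<Longrightarrow> b \<in> Basis \<Longrightarrow> smooth_fun (\<lambda>x. frechet_derivative f (at x) b)"
  unfolding smooth_fun_def
proof (intro allI impI)
  fix vs :: "(real^'a) list" and x assume *: "\<forall>vs. set vs \<subseteq> Basis \<longrightarrow> (\<forall>x. dir_deriv f vs differentiable at x)" "b \<in> Basis" "set vs \<subseteq> Basis"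
  have "dir_deriv (\<lambda>x. frechet_derivative f (at x) b) vs = dir_deriv f (vs @ [b])"
    by (simp add: dir_deriv_append)
  then show "dir_deriv (\<lambda>x. frechet_derivative f (at x) b) vs differentiable at x" using * by simp
qed

lemma smooth_fun_partial: "smooth_fun f \<Longrightarrow> smooth_fun (partial f i)"
  unfolding partial_def by (rule smooth_fun_deriv) (auto simp: axis_in_Basis_iff)

lemma smooth_fun_continuous: "smooth_fun f \<Longrightarrow> continuous_on S f"
  by (simp add: continuous_at_imp_continuous_on differentiable_imp_continuous_within smooth_fun_differentiable)

lemma smooth_fun_borel: "smooth_fun f \<Longrightarrow> f \<in> borel_measurable borel"
  by (intro borel_measurable_continuous_onI smooth_fun_continuous)

definition grad :: "(real^'n \<Rightarrow> real) \<Rightarrow> real^'n \<Rightarrow> real^'n" where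
  "grad f x = (\<chi> i. partial f i x)"

lemma grad_nth [simp]: "grad f x $ i = partial f i x"
  by (simp add: grad_def)

lemma frechet_derivative_eq_grad:
  assumes "f differentiable (at x)"
  shows "frechet_derivative f (at x) h = grad f x \<bullet> h"
proof -
  have lin: "linear (frechet_derivative f (at x))" by (rule linear_frechet_derivative[OF assms])
  have "h = (\<Sum>i\<in>UNIV. h $ i *\<^sub>R axis i 1)" using basis_expansion[of h] by (simp add: scalar_mult_eq_scaleR)
  then have "frechet_derivative f (at x) h = frechet_derivative f (at x) (\<Sum>i\<in>UNIV. h $ i *\<^sub>R axis i 1)"
    by simp
  also have "\<dots> = (\<Sum>i\<in>UNIV. h $ i * frechet_derivative f (at x) (axis i 1))"
    by (simp add: linear_sum[OF lin] linear_scale[OF lin])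
  also have "\<dots> = grad f x \<bullet> h" by (simp add: inner_vec_def partial_def mult.commute)
  finally show ?thesis .
qed

lemma smooth_fun_has_derivative: "smooth_fun f \<Longrightarrow> (f has_derivative (\<lambda>h. grad f x \<bullet> h)) (at x)"
  using smooth_fun_differentiable[of f x] frechet_derivative_works[of f "at x"] frechet_derivative_eq_grad[of f x]
  by (metis (no_types, lifting) ext)

lemma partial_eqI:
  assumes "(f has_derivative (\<lambda>h. g \<bullet> h)) (at x)" shows "partial f i x = g $ i"
  using frechet_derivative_at[OF assms] by (metis cart_eq_inner_axis partial_def)

lemma smooth_fun_grad_continuous: "smooth_fun f \<Longrightarrow> continuous_on S (grad f)"
  unfolding grad_def by (intro continuous_intros smooth_fun_continuous smooth_fun_partial)

lemma smooth_fun_affine: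
  assumes "smooth_fun f" shows "smooth_fun (\<lambda>x. c * f (s *\<^sub>R x + a))"
proof (rule smooth_fun_coinduct[where P="\<lambda>g. \<exists>c f. smooth_fun f \<and> g = (\<lambda>x. c * f (s *\<^sub>R x + a))"])
  show "\<exists>c' f'. smooth_fun f' \<and> (\<lambda>x. c * f (s *\<^sub>R x + a)) = (\<lambda>x. c' * f' (s *\<^sub>R x + a))" using assms by blast
next
  fix g assume "\<exists>c f. smooth_fun f \<and> g = (\<lambda>x. c * f (s *\<^sub>R x + a))"
  then obtain c f where f: "smooth_fun f" and g: "g = (\<lambda>x. c * f (s *\<^sub>R x + a))" by blast
  have der: "(g has_derivative (\<lambda>h. c * (s * (grad f (s *\<^sub>R x + a) \<bullet> h)))) (at x)" for x
  proof -
    have "((\<lambda>x. s *\<^sub>R x + a) has_derivative (\<lambda>h. s *\<^sub>R h)) (at x)" by (auto intro!: derivative_eq_intros)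
    from diff_chain_at[OF this smooth_fun_has_derivative[OF f]]
    have "((\<lambda>x. f (s *\<^sub>R x + a)) has_derivative (\<lambda>h. s * (grad f (s *\<^sub>R x + a) \<bullet> h))) (at x)"
      by (simp add: o_def)
    then show ?thesis unfolding g by (rule has_derivative_mult_right)
  qed
  have "(\<lambda>x. frechet_derivative g (at x) b) = (\<lambda>x. (c * s) * (\<lambda>y. frechet_derivative f (at y) b) (s *\<^sub>R x + a))" for b
    using frechet_derivative_at[OF der, symmetric] frechet_derivative_eq_grad[OF smooth_fun_differentiable[OF f]]
    by (auto simp: fun_eq_iff)
  then show "(\<forall>x. g differentiable at x) \<and> (\<forall>b\<in>Basis. \<exists>c f. smooth_fun f \<and> (\<lambda>x. frechet_derivative g (at x) b) = (\<lambda>x. c * f (s *\<^sub>R x + a)))"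
    using der smooth_fun_deriv[OF f] unfolding differentiable_def by blast
qed

text \<open>The class for the coinduction. The derivative of a product is a sum of two products, so
  products alone would not be stable; the closure under both operations is.\<close>

inductive smooth_alg :: "(real^'n \<Rightarrow> real) \<Rightarrow> bool" where
  base: "smooth_fun f \<Longrightarrow> smooth_alg f"
| add: "smooth_alg f \<Longrightarrow> smooth_alg g \<Longrightarrow> smooth_alg (\<lambda>x. f x + g x)"
| mult: "smooth_alg f \<Longrightarrow> smooth_alg g \<Longrightarrow> smooth_alg (\<lambda>x. f x * g x)"

lemma smooth_alg_smooth: assumes "smooth_alg f" shows "smooth_fun f"
proof (rule smooth_fun_coinduct[of smooth_alg, OF assms])
  fix g :: "real^'a \<Rightarrow> real" assume "smooth_alg g"
  then show "(\<forall>x. g differentiable at x) \<and> (\<forall>b\<in>Basis. smooth_alg (\<lambda>x. frechet_derivative g (at x) b))"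
  proof induction
    case (base f)
    then show ?case by (auto intro: smooth_alg.base smooth_fun_deriv smooth_fun_differentiable)
  next
    case (add f g)
    then have d: "(f has_derivative frechet_derivative f (at x)) (at x)" "(g has_derivative frechet_derivative g (at x)) (at x)" for x
      by (auto simp: frechet_derivative_works)
    note der = has_derivative_add[OF d]
    have "(\<lambda>x. frechet_derivative (\<lambda>x. f x + g x) (at x) b) = (\<lambda>x. frechet_derivative f (at x) b + frechet_derivative g (at x) b)" for b
      using frechet_derivative_at[OF der, symmetric] by (auto simp: fun_eq_iff)
    then show ?case using der add by (auto simp: differentiable_def intro!: smooth_alg.add)
  next
    case (mult f g)
    then have d: "(f has_derivative frechet_derivative f (at x)) (at x)" "(g has_derivative frechet_derivative g (at x)) (at x)" for x
      by (auto simp: frechet_derivative_works)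
    note der = has_derivative_mult[OF d]
    have "(\<lambda>x. frechet_derivative (\<lambda>x. f x * g x) (at x) b) = (\<lambda>x. f x * frechet_derivative g (at x) b + frechet_derivative f (at x) b * g x)" for b
      using frechet_derivative_at[OF der, symmetric] by (auto simp: fun_eq_iff)
    then show ?case using der mult by (auto simp: differentiable_def intro!: smooth_alg.add smooth_alg.mult)
  qed
qed

lemma smooth_fun_add: "smooth_fun f \<Longrightarrow> smooth_fun g \<Longrightarrow> smooth_fun (\<lambda>x. f x + g x)"
  by (rule smooth_alg_smooth[OF smooth_alg.add[OF smooth_alg.base smooth_alg.base]])

lemma smooth_fun_mult: "smooth_fun f \<Longrightarrow> smooth_fun g \<Longrightarrow> smooth_fun (\<lambda>x. f x * g x)"
  by (rule smooth_alg_smooth[OF smooth_alg.mult[OF smooth_alg.base smooth_alg.base]])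

lemma smooth_fun_const: "smooth_fun (\<lambda>x. c)"
  by (rule smooth_fun_coinduct[where P="\<lambda>g. \<exists>c. g = (\<lambda>x. c)"]) auto

lemma smooth_fun_nth: "smooth_fun (\<lambda>x. x $ j)"
proof (rule smooth_fun_coinduct[where P="\<lambda>g. g = (\<lambda>x. x $ j) \<or> (\<exists>c. g = (\<lambda>x. c))"])
  fix g :: "real^'a \<Rightarrow> real" assume "g = (\<lambda>x. x $ j) \<or> (\<exists>c. g = (\<lambda>x. c))"
  moreover have "((\<lambda>x. x $ j) has_derivative (\<lambda>h. h $ j)) (at x)" for x :: "real^'a"
    by (rule bounded_linear.has_derivative[OF bounded_linear_vec_nth has_derivative_ident])
  note d = this frechet_derivative_at[OF this, symmetric]
  ultimately show "(\<forall>x. g differentiable at x) \<and> (\<forall>b\<in>Basis. (\<lambda>x. frechet_derivative g (at x) b) = (\<lambda>x. x $ j) \<or> (\<exists>c. (\<lambda>x. frechet_derivative g (at x) b) = (\<lambda>x. c)))"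
    using d by (auto simp: differentiable_def intro: has_derivative_const)
qed simp

text \<open>Smoothness is local. The two formulas agree on the overlap because both equal
  \<open>g\<close> there, and each derivative of \<open>g\<close> is patched in the same way. Meant
  for \<open>LP_low\<close>, which is defined by cases.\<close>

lemma smooth_fun_patch:
  assumes U: "open U" "open V" "U \<union> V = UNIV" and f: "smooth_fun f1" "smooth_fun f2"
    and g: "\<And>x. x \<in> U \<Longrightarrow> g x = f1 x" "\<And>x. x \<in> V \<Longrightarrow> g x = f2 x"
  shows "smooth_fun g"
proof (rule smooth_fun_coinduct[where P="\<lambda>g. \<exists>f1 f2. smooth_fun f1 \<and> smooth_fun f2 \<and> (\<forall>x\<in>U. g x = f1 x) \<and> (\<forall>x\<in>V. g x = f2 x)"])
  show "\<exists>f1 f2. smooth_fun f1 \<and> smooth_fun f2 \<and> (\<forall>x\<in>U. g x = f1 x) \<and> (\<forall>x\<in>V. g x = f2 x)" using f g by blast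
next
  fix g assume "\<exists>f1 f2. smooth_fun f1 \<and> smooth_fun f2 \<and> (\<forall>x\<in>U. g x = f1 x) \<and> (\<forall>x\<in>V. g x = f2 x)"
  then obtain f1 f2 where f: "smooth_fun f1" "smooth_fun f2" "\<And>x. x \<in> U \<Longrightarrow> f1 x = g x" "\<And>x. x \<in> V \<Longrightarrow> f2 x = g x"
    by (metis)
  have 1: "g differentiable at x \<and> frechet_derivative g (at x) = frechet_derivative f1 (at x)" if "x \<in> U" for x
  proof -
    have "(f1 has_derivative frechet_derivative f1 (at x)) (at x)"
      using smooth_fun_differentiable[OF f(1)] by (simp add: frechet_derivative_works)
    from has_derivative_transform_within_open[OF this U(1) that f(3)] show ?thesis
      using frechet_derivative_at by (metis differentiable_def)
  qed
  have 2: "g differentiable at x \<and> frechet_derivative g (at x) = frechet_derivative f2 (at x)" if "x \<in> V" for x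
  proof -
    have "(f2 has_derivative frechet_derivative f2 (at x)) (at x)"
      using smooth_fun_differentiable[OF f(2)] by (simp add: frechet_derivative_works)
    from has_derivative_transform_within_open[OF this U(2) that f(4)] show ?thesis
      using frechet_derivative_at by (metis differentiable_def)
  qed
  show "(\<forall>x. g differentiable at x) \<and> (\<forall>b\<in>Basis. \<exists>f1 f2. smooth_fun f1 \<and> smooth_fun f2 \<and>
      (\<forall>x\<in>U. frechet_derivative g (at x) b = f1 x) \<and> (\<forall>x\<in>V. frechet_derivative g (at x) b = f2 x))"
  proof (intro conjI allI ballI)
    show "g differentiable at x" for x using 1 2 U(3) by blast
    fix b :: "real^'a" assume "b \<in> Basis"
    then show "\<exists>f1 f2. smooth_fun f1 \<and> smooth_fun f2 \<and>
      (\<forall>x\<in>U. frechet_derivative g (at x) b = f1 x) \<and> (\<forall>x\<in>V. frechet_derivative g (at x) b = f2 x)"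
      using 1 2 smooth_fun_deriv[OF f(1)] smooth_fun_deriv[OF f(2)]
      by (intro exI[of _ "\<lambda>x. frechet_derivative f1 (at x) b"] exI[of _ "\<lambda>x. frechet_derivative f2 (at x) b"]) auto
  qed
qed

section \<open>Test functions\<close>

lemma test_fun_iff: "test_fun f \<longleftrightarrow> smooth_fun f \<and> (\<exists>R. \<forall>x. R < norm x \<longrightarrow> f x = 0)"
proof -
  have "compact (fsupport f) \<longleftrightarrow> (\<exists>R. \<forall>x. R < norm x \<longrightarrow> f x = 0)"
    unfolding fsupport_def compact_closure bounded_iff by (auto simp: not_less) (meson not_le)+
  then show ?thesis by (simp add: test_fun_def)
qed

lemma test_fun_smooth: "test_fun f \<Longrightarrow> smooth_fun f" by (simp add: test_fun_def)

lemma test_funE: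
  assumes "test_fun f" obtains R where "0 < R" "\<And>x. R < norm x \<Longrightarrow> f x = 0"
proof -
  obtain R where "\<forall>x. R < norm x \<longrightarrow> f x = 0" using assms by (auto simp: test_fun_iff)
  then show thesis by (intro that[of "max R 1"]) auto
qed

lemma test_fun_affine:
  fixes f :: "real^'n \<Rightarrow> real"
  assumes "test_fun f" "s \<noteq> 0" shows "test_fun (\<lambda>x. c * f (s *\<^sub>R x + a))"
proof -
  obtain R where R: "0 < R" "\<And>x. R < norm x \<Longrightarrow> f x = 0" using test_funE[OF assms(1)] by blast
  have "f (s *\<^sub>R x + a) = 0" if "(R + norm a) / \<bar>s\<bar> < norm x" for x
  proof (rule R)
    have "R + norm a < \<bar>s\<bar> * norm x" using that assms(2) by (simp add: field_simps)
    then show "R < norm (s *\<^sub>R x + a)" using norm_diff_ineq[of "s *\<^sub>R x" a] by simp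
  qed
  then show ?thesis using assms smooth_fun_affine[of f c s a] unfolding test_fun_iff
    by (intro conjI exI[of _ "(R + norm a) / \<bar>s\<bar>"]) auto
qed

lemma test_fun_add: assumes "test_fun f" "test_fun g" shows "test_fun (\<lambda>x. f x + g x)"
proof -
  obtain R S where "\<And>x. R < norm x \<Longrightarrow> f x = 0" "\<And>x. S < norm x \<Longrightarrow> g x = 0"
    using test_funE[OF assms(1)] test_funE[OF assms(2)] by metis
  then show ?thesis using assms unfolding test_fun_iff
    by (intro conjI smooth_fun_add exI[of _ "max R S"]) auto
qed

lemma test_fun_smooth_mult: assumes "smooth_fun f" "test_fun g" shows "test_fun (\<lambda>x. f x * g x)"
  using assms smooth_fun_mult unfolding test_fun_iff by auto

lemma test_fun_partial: assumes "test_fun f" shows "test_fun (partial f i)"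
proof -
  obtain R where R: "0 < R" "\<And>x. R < norm x \<Longrightarrow> f x = 0" using test_funE[OF assms(1)] by blast
  have "partial f i x = 0" if "R < norm x" for x
  proof -
    have "((\<lambda>x. 0) has_derivative (\<lambda>h. 0 \<bullet> h)) (at x)" by simp
    moreover have "open {x::real^'a. R < norm x}"
      by (intro open_Collect_less continuous_intros)
    ultimately have "(f has_derivative (\<lambda>h. 0 \<bullet> h)) (at x)"
      by (rule has_derivative_transform_within_open) (use R(2) that in auto)
    from partial_eqI[OF this] show ?thesis by simp
  qed
  then show ?thesis using assms smooth_fun_partial unfolding test_fun_iff by blast
qed

lemma test_fun_rapid: assumes "test_fun f" shows "rapid f"
proof -
  obtain R where R: "0 < R" "\<And>x. R < norm x \<Longrightarrow> f x = 0" using test_funE[OF assms(1)] by blast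
  have "compact (f ` cball 0 R)"
    by (intro compact_continuous_image smooth_fun_continuous test_fun_smooth assms compact_cball)
  then obtain B where B: "\<And>x. norm x \<le> R \<Longrightarrow> \<bar>f x\<bar> \<le> B"
    using compact_imp_bounded[of "f ` cball 0 R"] by (force simp: bounded_iff)
  have B0: "0 \<le> B" using B[of 0] R(1) by auto
  show ?thesis unfolding rapid_def
  proof (intro conjI allI)
    show "f \<in> borel_measurable borel" by (intro smooth_fun_borel test_fun_smooth assms)
    fix N
    have "\<bar>f x\<bar> \<le> (B * (1 + R) ^ N) * wt N x" for x
    proof (cases "R < norm x")
      case True then show ?thesis using R B0 by simp
    next
      case False
      have "\<bar>f x\<bar> \<le> B * ((1 + norm x) ^ N * wt N x)" using B[of x] False by (simp add: power_mult_wt)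
      also have "\<dots> \<le> B * ((1 + R) ^ N * wt N x)"
        using False B0 by (intro mult_left_mono mult_right_mono power_mono) auto
      finally show ?thesis by (simp add: mult.assoc)
    qed
    then show "\<exists>C. \<forall>x. \<bar>f x\<bar> \<le> C * wt N x" by blast
  qed
qed

lemma test_fun_integrable: "test_fun f \<Longrightarrow> integrable lborel f"
  by (intro rapid_integrable test_fun_rapid)

text \<open>On the unit ball about \<open>x0\<close> the mean value inequality bounds the increment
  of the integrand by \<open>B y * norm h\<close>, and the linear term has the same bound. So the
  difference quotients minus the derivative are dominated by \<open>2 * B\<close>, and dominated
  convergence applies along every sequence tending to 0.\<close>

lemma has_derivative_integral:
  fixes k :: "'a::euclidean_space \<Rightarrow> 'b \<Rightarrow> real" and k' :: "'a \<Rightarrow> 'b \<Rightarrow> 'a"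
  assumes int: "\<And>x. integrable M (k x)"
    and der: "\<And>x y. ((\<lambda>x. k x y) has_derivative (\<lambda>h. k' x y \<bullet> h)) (at x)"
    and meas [measurable]: "k' x0 \<in> borel_measurable M"
    and bound: "\<And>x y. dist x0 x < 1 \<Longrightarrow> norm (k' x y) \<le> B y" and B: "integrable M B"
  shows "((\<lambda>x. \<integral>y. k x y \<partial>M) has_derivative (\<lambda>h. (\<integral>y. k' x0 y \<partial>M) \<bullet> h)) (at x0)"
    and "integrable M (k' x0)"
proof -
  have B0: "0 \<le> B y" for y using bound[of x0 y] norm_ge_zero order_trans by (metis dist_self zero_less_one)
  show int': "integrable M (k' x0)"
    by (rule Bochner_Integration.integrable_bound[OF B]) (use bound[of x0] B0 in auto)
  have lip: "\<bar>k (x0 + h) y - k x0 y\<bar> \<le> B y * norm h" if "norm h < 1" for h y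
  proof -
    have "norm (k (x0 + h) y - k x0 y) \<le> B y * norm (x0 + h - x0)"
    proof (rule differentiable_bound[of "ball x0 1" "\<lambda>x. k x y" "\<lambda>x h. k' x y \<bullet> h"])
      show "((\<lambda>x. k x y) has_derivative (\<lambda>h. k' x y \<bullet> h)) (at x within ball x0 1)" for x
        by (rule has_derivative_at_withinI[OF der])
      show "onorm (\<lambda>h. k' x y \<bullet> h) \<le> B y" if "x \<in> ball x0 1" for x
        using bound[of x y] that B0
        by (intro onorm_bound) (auto intro!: order_trans[OF Cauchy_Schwarz_ineq2] mult_right_mono)
    qed (use that in \<open>auto simp: dist_norm\<close>)
    then show ?thesis by simp
  qed
  show "((\<lambda>x. \<integral>y. k x y \<partial>M) has_derivative (\<lambda>h. (\<integral>y. k' x0 y \<partial>M) \<bullet> h)) (at x0)"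
    unfolding has_derivative_at
  proof (intro conjI)
    show "bounded_linear (\<lambda>h. (\<integral>y. k' x0 y \<partial>M) \<bullet> h)" by (rule bounded_linear_inner_right)
    have "((\<lambda>h. norm ((\<integral>y. k (x0 + h) y \<partial>M) - (\<integral>y. k x0 y \<partial>M) - (\<integral>y. k' x0 y \<partial>M) \<bullet> h) / norm h) \<longlongrightarrow> 0) (at 0 within ball 0 1)"
      unfolding tendsto_at_iff_sequentially
    proof (intro allI impI)
      fix X :: "nat \<Rightarrow> 'a" assume X: "\<forall>i. X i \<in> ball 0 1 - {0}" "X \<longlonglongrightarrow> 0"
      have Xi: "norm (X i) < 1" "X i \<noteq> 0" for i using X(1) by (auto simp: dist_norm)
      have ptw: "(\<lambda>i. (k (x0 + X i) y - k x0 y - k' x0 y \<bullet> X i) / norm (X i)) \<longlonglongrightarrow> 0" for y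
      proof -
        have "((\<lambda>h. norm (k (x0 + h) y - k x0 y - k' x0 y \<bullet> h) / norm h) \<longlongrightarrow> 0) (at 0)"
          using der[of y x0] by (simp add: has_derivative_at)
        moreover have "filterlim X (at 0) sequentially"
          using X(2) Xi(2) by (intro filterlim_atI) auto
        ultimately have "(\<lambda>i. norm (k (x0 + X i) y - k x0 y - k' x0 y \<bullet> X i) / norm (X i)) \<longlonglongrightarrow> 0"
          by (rule filterlim_compose)
        then show ?thesis
          by (intro tendsto_norm_zero_cancel[of "\<lambda>i. (k (x0 + X i) y - k x0 y - k' x0 y \<bullet> X i) / norm (X i)"])
             (simp add: abs_divide)
      qed
      have "(\<lambda>i. \<integral>y. (k (x0 + X i) y - k x0 y - k' x0 y \<bullet> X i) / norm (X i) \<partial>M) \<longlonglongrightarrow> (\<integral>y. 0 \<partial>M)"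
      proof (rule integral_dominated_convergence)
        show "integrable M (\<lambda>y. 2 * B y)" using B by simp
        show "(\<lambda>y. (k (x0 + X i) y - k x0 y - k' x0 y \<bullet> X i) / norm (X i)) \<in> borel_measurable M" for i
          using borel_measurable_integrable[OF int] by measurable
        show "AE y in M. norm ((k (x0 + X i) y - k x0 y - k' x0 y \<bullet> X i) / norm (X i)) \<le> 2 * B y" for i
        proof (rule AE_I2)
          fix y
          have "\<bar>k' x0 y \<bullet> X i\<bar> \<le> B y * norm (X i)"
            using order_trans[OF Cauchy_Schwarz_ineq2 mult_right_mono[OF bound[of x0 y]]] by simp
          then have "\<bar>k (x0 + X i) y - k x0 y - k' x0 y \<bullet> X i\<bar> \<le> 2 * B y * norm (X i)"
            using lip[OF Xi(1), of i y] by linarith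
          then show "norm ((k (x0 + X i) y - k x0 y - k' x0 y \<bullet> X i) / norm (X i)) \<le> 2 * B y"
            using Xi(2)[of i] by (simp add: abs_divide pos_divide_le_eq)
        qed
      qed (use ptw in auto)
      moreover have "(\<integral>y. (k (x0 + X i) y - k x0 y - k' x0 y \<bullet> X i) / norm (X i) \<partial>M)
          = ((\<integral>y. k (x0 + X i) y \<partial>M) - (\<integral>y. k x0 y \<partial>M) - (\<integral>y. k' x0 y \<partial>M) \<bullet> X i) / norm (X i)" for i
        using int int' by (simp add: Bochner_Integration.integral_diff)
      ultimately have "(\<lambda>i. ((\<integral>y. k (x0 + X i) y \<partial>M) - (\<integral>y. k x0 y \<partial>M) - (\<integral>y. k' x0 y \<partial>M) \<bullet> X i) / norm (X i)) \<longlonglongrightarrow> 0"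
        by (simp only: Bochner_Integration.integral_zero)
      from tendsto_norm_zero[OF this]
      show "((\<lambda>h. norm ((\<integral>y. k (x0 + h) y \<partial>M) - (\<integral>y. k x0 y \<partial>M) - (\<integral>y. k' x0 y \<partial>M) \<bullet> h) / norm h) \<circ> X) \<longlonglongrightarrow> 0"
        by (simp add: o_def abs_divide)
    qed
    then show "((\<lambda>h. norm ((\<integral>y. k (x0 + h) y \<partial>M) - (\<integral>y. k x0 y \<partial>M) - (\<integral>y. k' x0 y \<partial>M) \<bullet> h) / norm h) \<longlongrightarrow> 0) (at 0)"
      by (simp add: at_within_open[of 0 "ball 0 1"])
  qed
qed

text \<open>Averaging the difference of two translates over the unit interval yields the derivative, whose
  integral is therefore the difference of two equal integrals.\<close>
lemma integral_partial_eq_0: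
  fixes f :: "real^'n \<Rightarrow> real"
  assumes f: "integrable lborel f" and der: "\<And>x. (f has_derivative (\<lambda>h. g x \<bullet> h)) (at x)"
    and cont: "continuous_on UNIV g" and gi: "integrable lborel (\<lambda>x. g x $ i)"
  shows "(\<integral>x. g x $ i \<partial>lborel) = 0"
proof -
  let ?e = "axis i 1 :: real^'n"
  have [measurable]: "g \<in> borel_measurable borel" using cont by (rule borel_measurable_continuous_onI)
  have gie: "g x $ i = g x \<bullet> ?e" for x by (simp add: inner_axis)
  have FTC: "(\<integral>t. indicator {0..1} t *\<^sub>R (g (x + t *\<^sub>R ?e) $ i) \<partial>lborel) = f (x + ?e) - f x" for x
  proof -
    have "((\<lambda>t. f (x + t *\<^sub>R ?e)) has_real_derivative g (x + t *\<^sub>R ?e) $ i) (at t within {0..1})" for t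
    proof -
      have "((\<lambda>t. x + t *\<^sub>R ?e) has_derivative (\<lambda>s. s *\<^sub>R ?e)) (at t)" by (auto intro!: derivative_eq_intros)
      from diff_chain_at[OF this der] have "((\<lambda>t. f (x + t *\<^sub>R ?e)) has_derivative (\<lambda>s. s * (g (x + t *\<^sub>R ?e) $ i))) (at t)"
        by (simp add: o_def gie)
      then have "((\<lambda>t. f (x + t *\<^sub>R ?e)) has_derivative (*) (g (x + t *\<^sub>R ?e) $ i)) (at t)"
        by (rule has_derivative_eq_rhs) (simp add: fun_eq_iff)
      then show ?thesis
        unfolding has_field_derivative_def by (rule has_derivative_at_withinI)
    qed
    moreover have "continuous_on {0..1} (\<lambda>t. g (x + t *\<^sub>R ?e) $ i)"
      by (intro continuous_intros continuous_on_compose2[OF cont]) auto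
    ultimately show ?thesis
      using has_bochner_integral_FTC_Icc[of 0 1 "\<lambda>t. f (x + t *\<^sub>R ?e)" "\<lambda>t. g (x + t *\<^sub>R ?e) $ i"]
      by (auto simp: has_real_derivative_iff_has_vector_derivative has_bochner_integral_iff)
  qed
  have shift: "(\<integral>x. f' (x + c) \<partial>lborel) = (\<integral>x. f' x \<partial>lborel)" for f' :: "real^'n \<Rightarrow> real" and c
    using integral_lborel_shift[of f' "-c"] by simp
  have "integrable (lborel \<Otimes>\<^sub>M lborel) (\<lambda>(t::real, x). indicator {0..1} t *\<^sub>R (g (x + t *\<^sub>R ?e) $ i))"
  proof (rule integrableI_bounded)
    have "(\<integral>\<^sup>+y. norm (case y of (t::real, x) \<Rightarrow> indicator {0..1} t *\<^sub>R (g (x + t *\<^sub>R ?e) $ i)) \<partial>(lborel \<Otimes>\<^sub>M lborel))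
      = (\<integral>\<^sup>+(t::real). \<integral>\<^sup>+x. indicator {0..1} t * ennreal \<bar>g (x + t *\<^sub>R ?e) $ i\<bar> \<partial>lborel \<partial>lborel)"
    proof -
      have "(\<lambda>y. ennreal (norm (case y of (t::real, x) \<Rightarrow> indicator {0..1} t *\<^sub>R (g (x + t *\<^sub>R ?e) $ i)))) \<in> borel_measurable (lborel \<Otimes>\<^sub>M lborel)"
        by measurable
      from lborel.nn_integral_fst[OF this, symmetric] show ?thesis
        by (auto intro!: nn_integral_cong split: split_indicator)
    qed
    also have "\<dots> = (\<integral>\<^sup>+(t::real). indicator {0..1} t * (\<integral>\<^sup>+x. ennreal \<bar>g x $ i\<bar> \<partial>lborel) \<partial>lborel)"
      using nn_integral_lborel_shift[of "\<lambda>x. ennreal \<bar>g x $ i\<bar>" "- (_ *\<^sub>R ?e)"]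
      by (intro nn_integral_cong) (simp add: nn_integral_cmult)
    also have "\<dots> = (\<integral>\<^sup>+x. ennreal \<bar>g x $ i\<bar> \<partial>lborel)" by (simp add: nn_integral_multc)
    also have "\<dots> < \<infinity>" using gi by (simp add: integrable_iff_bounded)
    finally show "(\<integral>\<^sup>+y. norm (case y of (t::real, x) \<Rightarrow> indicator {0..1} t *\<^sub>R (g (x + t *\<^sub>R ?e) $ i)) \<partial>(lborel \<Otimes>\<^sub>M lborel)) < \<infinity>" .
  qed measurable
  from lborel_pair.Fubini_integral[OF this]
  have "(\<integral>x. \<integral>t. indicator {0..1} t *\<^sub>R (g (x + t *\<^sub>R ?e) $ i) \<partial>lborel \<partial>lborel)
      = (\<integral>(t::real). \<integral>x. indicator {0..1} t *\<^sub>R (g (x + t *\<^sub>R ?e) $ i) \<partial>lborel \<partial>lborel)" by simp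
  also have "\<dots> = (\<integral>(t::real). indicator {0..1} t *\<^sub>R (\<integral>x. g x $ i \<partial>lborel) \<partial>lborel)"
    using shift[of "\<lambda>x. g x $ i"] by simp
  also have "\<dots> = (\<integral>x. g x $ i \<partial>lborel)" by simp
  finally have "(\<integral>x. g x $ i \<partial>lborel) = (\<integral>x. f (x + ?e) - f x \<partial>lborel)" by (simp only: FTC)
  also have "\<dots> = 0"
    using f integrable_lborel_shift[OF f, of "- ?e"] shift[of f ?e] by simp
  finally show ?thesis .
qed

subsection \<open>Real Fourier integrals of test functions\<close>

text \<open>Together with \<open>sinT\<close> below: the real and imaginary parts of the inverse
  Fourier transform in the convention of \<open>LP_psi\<close>. They are kept apart so that real
  kernels act on real functions.\<close>

definition cosT :: "(real^'n \<Rightarrow> real) \<Rightarrow> real^'n \<Rightarrow> real" where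
  "cosT a x = (\<integral>\<xi>. a \<xi> * cos (2 * pi * (x \<bullet> \<xi>)) \<partial>lborel)"

definition sinT :: "(real^'n \<Rightarrow> real) \<Rightarrow> real^'n \<Rightarrow> real" where
  "sinT a x = (\<integral>\<xi>. a \<xi> * sin (2 * pi * (x \<bullet> \<xi>)) \<partial>lborel)"

lemma trig_bounded_integrable:
  fixes a :: "real^'n \<Rightarrow> real"
  assumes "integrable lborel a" "c \<in> borel_measurable borel" "\<And>\<xi>. \<bar>c \<xi>\<bar> \<le> 1"
  shows "integrable lborel (\<lambda>\<xi>. a \<xi> * c \<xi>)"
proof (rule Bochner_Integration.integrable_bound[OF assms(1)])
  have [measurable]: "a \<in> borel_measurable borel" using assms(1) by (auto dest: borel_measurable_integrable)
  show "(\<lambda>\<xi>. a \<xi> * c \<xi>) \<in> borel_measurable lborel" using assms(2) by measurable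
  show "AE \<xi> in lborel. norm (a \<xi> * c \<xi>) \<le> norm (a \<xi>)"
    using assms(3) by (auto simp: abs_mult intro!: mult_left_le)
qed

lemma cosT_integrable: "integrable lborel a \<Longrightarrow> integrable lborel (\<lambda>\<xi>. a \<xi> * cos (2 * pi * (x \<bullet> \<xi>)))"
  for a :: "real^'n \<Rightarrow> real"
  by (rule trig_bounded_integrable) auto

lemma sinT_integrable: "integrable lborel a \<Longrightarrow> integrable lborel (\<lambda>\<xi>. a \<xi> * sin (2 * pi * (x \<bullet> \<xi>)))"
  for a :: "real^'n \<Rightarrow> real"
  by (rule trig_bounded_integrable) auto

lemma test_fun_nth_mult: "test_fun a \<Longrightarrow> test_fun (\<lambda>\<xi>. 2 * pi * \<xi> $ j * a \<xi>)"
  using test_fun_smooth_mult[OF smooth_fun_mult[OF smooth_fun_const[of "2 * pi"] smooth_fun_nth[of j]]] by simp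

text \<open>Differentiation in space multiplies the symbol by 2 pi times a coordinate of \<xi>,
  which is again a test function; the products |\<xi>| |a| provide the dominating function.\<close>

lemma cosT_has_derivative:
  fixes a :: "real^'n \<Rightarrow> real"
  assumes a: "test_fun a"
  shows "(cosT a has_derivative (\<lambda>h. (\<chi> j. - sinT (\<lambda>\<xi>. 2 * pi * \<xi> $ j * a \<xi>) x) \<bullet> h)) (at x)"
    and "(sinT a has_derivative (\<lambda>h. (\<chi> j. cosT (\<lambda>\<xi>. 2 * pi * \<xi> $ j * a \<xi>) x) \<bullet> h)) (at x)"
proof -
  have ra: "rapid a" by (rule test_fun_rapid[OF a])
  note [measurable] = rapid_measurable[OF ra]
  have B: "integrable lborel (\<lambda>\<xi>. 2 * pi * (norm \<xi> * \<bar>a \<xi>\<bar>))"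
    by (intro integrable_mult_right rapid_integrable rapid_norm_mult rapid_abs ra)
  have int_nth: "(\<integral>\<xi>. f \<xi> \<partial>lborel) $ j = (\<integral>\<xi>. f \<xi> $ j \<partial>lborel)" if "integrable lborel f" for f :: "real^'n \<Rightarrow> real^'n" and j
    using integral_bounded_linear[OF bounded_linear_vec_nth that, of j] by simp
  have nb: "norm ((a \<xi> * (c * (2 * pi))) *\<^sub>R \<xi>) \<le> 2 * pi * (norm \<xi> * \<bar>a \<xi>\<bar>)" if "\<bar>c\<bar> \<le> 1" for c and \<xi> :: "real^'n"
    using mult_left_mono[OF that, of "2 * pi * (norm \<xi> * \<bar>a \<xi>\<bar>)"] by (simp add: abs_mult mult_ac)
  have 1: "((\<lambda>x. a \<xi> * cos (2 * pi * (x \<bullet> \<xi>))) has_derivative (\<lambda>h. ((a \<xi> * (- sin (2 * pi * (x \<bullet> \<xi>)) * (2 * pi))) *\<^sub>R \<xi>) \<bullet> h)) (at x)" for x \<xi>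
    by (auto intro!: derivative_eq_intros simp: inner_commute)
  have 2: "((\<lambda>x. a \<xi> * sin (2 * pi * (x \<bullet> \<xi>))) has_derivative (\<lambda>h. ((a \<xi> * (cos (2 * pi * (x \<bullet> \<xi>)) * (2 * pi))) *\<^sub>R \<xi>) \<bullet> h)) (at x)" for x \<xi>
    by (auto intro!: derivative_eq_intros simp: inner_commute)
  have C: "((\<lambda>x. \<integral>\<xi>. a \<xi> * cos (2 * pi * (x \<bullet> \<xi>)) \<partial>lborel) has_derivative
      (\<lambda>h. (\<integral>\<xi>. (a \<xi> * (- sin (2 * pi * (x \<bullet> \<xi>)) * (2 * pi))) *\<^sub>R \<xi> \<partial>lborel) \<bullet> h)) (at x)"
     "integrable lborel (\<lambda>\<xi>. (a \<xi> * (- sin (2 * pi * (x \<bullet> \<xi>)) * (2 * pi))) *\<^sub>R \<xi>)"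
  proof -
    have m: "(\<lambda>\<xi>. (a \<xi> * (- sin (2 * pi * (x \<bullet> \<xi>)) * (2 * pi))) *\<^sub>R \<xi>) \<in> borel_measurable lborel" by measurable
    have b: "norm ((a \<xi> * (- sin (2 * pi * (y \<bullet> \<xi>)) * (2 * pi))) *\<^sub>R \<xi>) \<le> 2 * pi * (norm \<xi> * \<bar>a \<xi>\<bar>)" for y \<xi>
      by (rule nb) simp
    note * = has_derivative_integral[where k="\<lambda>x \<xi>. a \<xi> * cos (2 * pi * (x \<bullet> \<xi>))", OF cosT_integrable[OF test_fun_integrable[OF a]] 1 m b B]
    show "((\<lambda>x. \<integral>\<xi>. a \<xi> * cos (2 * pi * (x \<bullet> \<xi>)) \<partial>lborel) has_derivative
      (\<lambda>h. (\<integral>\<xi>. (a \<xi> * (- sin (2 * pi * (x \<bullet> \<xi>)) * (2 * pi))) *\<^sub>R \<xi> \<partial>lborel) \<bullet> h)) (at x)" by (rule *)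
    show "integrable lborel (\<lambda>\<xi>. (a \<xi> * (- sin (2 * pi * (x \<bullet> \<xi>)) * (2 * pi))) *\<^sub>R \<xi>)" by (rule *)
  qed
  have S: "((\<lambda>x. \<integral>\<xi>. a \<xi> * sin (2 * pi * (x \<bullet> \<xi>)) \<partial>lborel) has_derivative
      (\<lambda>h. (\<integral>\<xi>. (a \<xi> * (cos (2 * pi * (x \<bullet> \<xi>)) * (2 * pi))) *\<^sub>R \<xi> \<partial>lborel) \<bullet> h)) (at x)"
     "integrable lborel (\<lambda>\<xi>. (a \<xi> * (cos (2 * pi * (x \<bullet> \<xi>)) * (2 * pi))) *\<^sub>R \<xi>)"
  proof -
    have m: "(\<lambda>\<xi>. (a \<xi> * (cos (2 * pi * (x \<bullet> \<xi>)) * (2 * pi))) *\<^sub>R \<xi>) \<in> borel_measurable lborel" by measurable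
    have b: "norm ((a \<xi> * (cos (2 * pi * (y \<bullet> \<xi>)) * (2 * pi))) *\<^sub>R \<xi>) \<le> 2 * pi * (norm \<xi> * \<bar>a \<xi>\<bar>)" for y \<xi>
      by (rule nb) simp
    note * = has_derivative_integral[where k="\<lambda>x \<xi>. a \<xi> * sin (2 * pi * (x \<bullet> \<xi>))", OF sinT_integrable[OF test_fun_integrable[OF a]] 2 m b B]
    show "((\<lambda>x. \<integral>\<xi>. a \<xi> * sin (2 * pi * (x \<bullet> \<xi>)) \<partial>lborel) has_derivative
      (\<lambda>h. (\<integral>\<xi>. (a \<xi> * (cos (2 * pi * (x \<bullet> \<xi>)) * (2 * pi))) *\<^sub>R \<xi> \<partial>lborel) \<bullet> h)) (at x)" by (rule *)
    show "integrable lborel (\<lambda>\<xi>. (a \<xi> * (cos (2 * pi * (x \<bullet> \<xi>)) * (2 * pi))) *\<^sub>R \<xi>)" by (rule *)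
  qed
  have "(\<integral>\<xi>. (a \<xi> * (- sin (2 * pi * (x \<bullet> \<xi>)) * (2 * pi))) *\<^sub>R \<xi> \<partial>lborel) = (\<chi> j. - sinT (\<lambda>\<xi>. 2 * pi * \<xi> $ j * a \<xi>) x)"
  proof (unfold vec_eq_iff, intro allI)
    fix j
    have "(\<integral>\<xi>. (a \<xi> * (- sin (2 * pi * (x \<bullet> \<xi>)) * (2 * pi))) *\<^sub>R \<xi> \<partial>lborel) $ j
        = (\<integral>\<xi>. ((a \<xi> * (- sin (2 * pi * (x \<bullet> \<xi>)) * (2 * pi))) *\<^sub>R \<xi>) $ j \<partial>lborel)" by (rule int_nth[OF C(2)])
    also have "\<dots> = (\<integral>\<xi>. - (2 * pi * \<xi> $ j * a \<xi> * sin (2 * pi * (x \<bullet> \<xi>))) \<partial>lborel)"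
      by (intro Bochner_Integration.integral_cong) auto
    finally show "(\<integral>\<xi>. (a \<xi> * (- sin (2 * pi * (x \<bullet> \<xi>)) * (2 * pi))) *\<^sub>R \<xi> \<partial>lborel) $ j = (\<chi> j. - sinT (\<lambda>\<xi>. 2 * pi * \<xi> $ j * a \<xi>) x) $ j"
      by (simp add: sinT_def)
  qed
  with C(1) show "(cosT a has_derivative (\<lambda>h. (\<chi> j. - sinT (\<lambda>\<xi>. 2 * pi * \<xi> $ j * a \<xi>) x) \<bullet> h)) (at x)"
    by (simp only: cosT_def[abs_def])
  have "(\<integral>\<xi>. (a \<xi> * (cos (2 * pi * (x \<bullet> \<xi>)) * (2 * pi))) *\<^sub>R \<xi> \<partial>lborel) = (\<chi> j. cosT (\<lambda>\<xi>. 2 * pi * \<xi> $ j * a \<xi>) x)"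
  proof (unfold vec_eq_iff, intro allI)
    fix j
    have "(\<integral>\<xi>. (a \<xi> * (cos (2 * pi * (x \<bullet> \<xi>)) * (2 * pi))) *\<^sub>R \<xi> \<partial>lborel) $ j
        = (\<integral>\<xi>. ((a \<xi> * (cos (2 * pi * (x \<bullet> \<xi>)) * (2 * pi))) *\<^sub>R \<xi>) $ j \<partial>lborel)" by (rule int_nth[OF S(2)])
    also have "\<dots> = (\<integral>\<xi>. 2 * pi * \<xi> $ j * a \<xi> * cos (2 * pi * (x \<bullet> \<xi>)) \<partial>lborel)"
      by (intro Bochner_Integration.integral_cong) auto
    finally show "(\<integral>\<xi>. (a \<xi> * (cos (2 * pi * (x \<bullet> \<xi>)) * (2 * pi))) *\<^sub>R \<xi> \<partial>lborel) $ j = (\<chi> j. cosT (\<lambda>\<xi>. 2 * pi * \<xi> $ j * a \<xi>) x) $ j"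
      by (simp add: cosT_def)
  qed
  with S(1) show "(sinT a has_derivative (\<lambda>h. (\<chi> j. cosT (\<lambda>\<xi>. 2 * pi * \<xi> $ j * a \<xi>) x) \<bullet> h)) (at x)"
    by (simp only: sinT_def[abs_def])
qed

lemma cosT_continuous: "test_fun a \<Longrightarrow> continuous_on S (cosT a)" "test_fun a \<Longrightarrow> continuous_on S (sinT a)"
  using has_derivative_continuous[OF cosT_has_derivative(1)] has_derivative_continuous[OF cosT_has_derivative(2)]
  by (auto intro!: continuous_at_imp_continuous_on)

text \<open>Integration by parts against a bounded function with bounded derivative: the product
  with the test function has an integrable gradient, whose integral vanishes.\<close>

lemma integral_partial_test_mult_eq_0:
  fixes a c :: "real^'n \<Rightarrow> real"
  assumes a: "test_fun a" and c: "\<And>\<xi>. (c has_derivative (\<lambda>h. c' \<xi> \<bullet> h)) (at \<xi>)" "continuous_on UNIV c'"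
    and b: "\<And>\<xi>. \<bar>c \<xi>\<bar> \<le> B" "\<And>\<xi>. \<bar>c' \<xi> $ j\<bar> \<le> B"
  shows "(\<integral>\<xi>. partial a j \<xi> * c \<xi> \<partial>lborel) = - (\<integral>\<xi>. a \<xi> * c' \<xi> $ j \<partial>lborel)"
proof -
  have cc: "continuous_on UNIV c" using has_derivative_continuous[OF c(1)] by (auto intro!: continuous_at_imp_continuous_on)
  have [measurable]: "c \<in> borel_measurable borel" "c' \<in> borel_measurable borel"
    using cc c(2) by (auto intro: borel_measurable_continuous_onI)
  have der: "((\<lambda>\<xi>. c \<xi> * a \<xi>) has_derivative (\<lambda>h. (c \<xi> *\<^sub>R grad a \<xi> + a \<xi> *\<^sub>R c' \<xi>) \<bullet> h)) (at \<xi>)" for \<xi>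
    using has_derivative_mult[OF c(1) smooth_fun_has_derivative[OF test_fun_smooth[OF a]]]
    by (rule has_derivative_eq_rhs) (auto simp: inner_add_left)
  have i: "integrable lborel (\<lambda>\<xi>. g \<xi> * f \<xi>)" if "rapid f" "g \<in> borel_measurable borel" "\<And>\<xi>. \<bar>g \<xi>\<bar> \<le> B" for f g :: "real^'n \<Rightarrow> real"
    using that by (intro rapid_integrable rapid_poly_mult[where C=B and m=0]) auto
  have i1: "integrable lborel (\<lambda>\<xi>. c \<xi> * partial a j \<xi>)" "integrable lborel (\<lambda>\<xi>. c' \<xi> $ j * a \<xi>)" "integrable lborel (\<lambda>\<xi>. c \<xi> * a \<xi>)"
    using b by (auto intro!: i test_fun_rapid test_fun_partial a)
  have "(\<integral>\<xi>. (c \<xi> *\<^sub>R grad a \<xi> + a \<xi> *\<^sub>R c' \<xi>) $ j \<partial>lborel) = 0"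
  proof (rule integral_partial_eq_0[OF _ der])
    show "continuous_on UNIV (\<lambda>x. c x *\<^sub>R grad a x + a x *\<^sub>R c' x)"
      by (intro continuous_intros cc c smooth_fun_grad_continuous smooth_fun_continuous test_fun_smooth a)
    show "integrable lborel (\<lambda>x. (c x *\<^sub>R grad a x + a x *\<^sub>R c' x) $ j)"
      using i1 by (simp add: mult.commute[of "a _"])
  qed (use i1 in simp)
  then have "(\<integral>\<xi>. c \<xi> * partial a j \<xi> + c' \<xi> $ j * a \<xi> \<partial>lborel) = 0" by (simp add: mult.commute[of "a _"])
  then show ?thesis using i1 by (simp add: mult.commute)
qed

text \<open>Differentiation in frequency multiplies by 2 pi x_j in space and exchanges sine and
  cosine. This is the source of the decay of the kernels.\<close>

lemma sinT_partial:
  fixes a :: "real^'n \<Rightarrow> real"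
  assumes a: "test_fun a"
  shows "sinT (partial a j) x = - (2 * pi * x $ j * cosT a x)" "cosT (partial a j) x = 2 * pi * x $ j * sinT a x"
proof -
  have x: "\<bar>x $ j\<bar> \<le> norm x" by (rule component_le_norm_cart)
  \<comment> \<open>The integration by parts asks for one bound for a function and its derivative; 1
    + 2 pi |x| majorises the sine or cosine as well as its derivative in direction
    \<open>j\<close>.\<close>
  have ab: "\<bar>2 * pi * c * x $ j\<bar> \<le> 1 + 2 * pi * norm x" if "\<bar>c\<bar> \<le> 1" for c :: real
    using mult_mono[OF that x] by (auto simp: abs_mult intro!: add_increasing)
  have "(\<integral>\<xi>. partial a j \<xi> * sin (2 * pi * (x \<bullet> \<xi>)) \<partial>lborel) = - (\<integral>\<xi>. a \<xi> * ((2 * pi * cos (2 * pi * (x \<bullet> \<xi>))) *\<^sub>R x) $ j \<partial>lborel)"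
    by (rule integral_partial_test_mult_eq_0[OF a, where B="1 + 2 * pi * norm x"])
       (auto intro!: derivative_eq_intros continuous_intros ab order_trans[OF abs_sin_le_one] simp: inner_commute)
  then show "sinT (partial a j) x = - (2 * pi * x $ j * cosT a x)"
    by (simp add: sinT_def cosT_def mult_ac flip: integral_mult_right_zero)
  have "(\<integral>\<xi>. partial a j \<xi> * cos (2 * pi * (x \<bullet> \<xi>)) \<partial>lborel) = - (\<integral>\<xi>. a \<xi> * ((2 * pi * - sin (2 * pi * (x \<bullet> \<xi>))) *\<^sub>R x) $ j \<partial>lborel)"
    by (rule integral_partial_test_mult_eq_0[OF a, where B="1 + 2 * pi * norm x"])
       (auto intro!: derivative_eq_intros continuous_intros ab order_trans[OF abs_cos_le_one] simp: inner_commute)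
  then show "cosT (partial a j) x = 2 * pi * x $ j * sinT a x"
    by (simp add: sinT_def cosT_def mult_ac flip: integral_mult_right_zero integral_minus)
qed

lemma cosT_sinT_bound:
  assumes "integrable lborel a"
  shows "\<bar>cosT a x\<bar> \<le> (\<integral>\<xi>. \<bar>a \<xi>\<bar> \<partial>lborel)" "\<bar>sinT a x\<bar> \<le> (\<integral>\<xi>. \<bar>a \<xi>\<bar> \<partial>lborel)"
proof -
  have "\<bar>cosT a x\<bar> \<le> (\<integral>\<xi>. \<bar>a \<xi> * cos (2 * pi * (x \<bullet> \<xi>))\<bar> \<partial>lborel)" unfolding cosT_def by (rule integral_abs_bound)
  also have "\<dots> \<le> (\<integral>\<xi>. \<bar>a \<xi>\<bar> \<partial>lborel)"
    using integrable_abs[OF cosT_integrable[OF assms, of x]] assms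
    by (intro integral_mono) (auto simp: abs_mult intro!: mult_left_le)
  finally show "\<bar>cosT a x\<bar> \<le> (\<integral>\<xi>. \<bar>a \<xi>\<bar> \<partial>lborel)" .
  have "\<bar>sinT a x\<bar> \<le> (\<integral>\<xi>. \<bar>a \<xi> * sin (2 * pi * (x \<bullet> \<xi>))\<bar> \<partial>lborel)" unfolding sinT_def by (rule integral_abs_bound)
  also have "\<dots> \<le> (\<integral>\<xi>. \<bar>a \<xi>\<bar> \<partial>lborel)"
    using integrable_abs[OF sinT_integrable[OF assms, of x]] assms
    by (intro integral_mono) (auto simp: abs_mult intro!: mult_left_le)
  finally show "\<bar>sinT a x\<bar> \<le> (\<integral>\<xi>. \<bar>a \<xi>\<bar> \<partial>lborel)" .
qed

text \<open>Each power of |x_j| is traded for a derivative of the symbol. Both transforms are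
  carried through the induction because \<open>sinT_partial\<close> exchanges them.\<close>

lemma cosT_decay:
  fixes a :: "real^'n \<Rightarrow> real"
  assumes "test_fun a"
  shows "\<exists>C. \<forall>x. \<bar>x $ j\<bar> ^ k * \<bar>cosT a x\<bar> \<le> C \<and> \<bar>x $ j\<bar> ^ k * \<bar>sinT a x\<bar> \<le> C"
  using assms
proof (induction k arbitrary: a)
  case 0
  then show ?case using cosT_sinT_bound[OF test_fun_integrable[OF 0]] by auto
next
  case (Suc k)
  obtain C where C: "\<And>x. \<bar>x $ j\<bar> ^ k * \<bar>cosT (partial a j) x\<bar> \<le> C" "\<And>x. \<bar>x $ j\<bar> ^ k * \<bar>sinT (partial a j) x\<bar> \<le> C"
    using Suc.IH[OF test_fun_partial[OF Suc.prems, of j]] by blast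
  have "\<bar>x $ j\<bar> ^ Suc k * \<bar>cosT a x\<bar> \<le> C / (2 * pi)" "\<bar>x $ j\<bar> ^ Suc k * \<bar>sinT a x\<bar> \<le> C / (2 * pi)" for x
    using C[of x] unfolding sinT_partial[OF Suc.prems] by (auto simp: abs_mult field_simps)
  then show ?case by blast
qed

text \<open>Passes from decay in the single coordinates to decay in the norm. With m the largest
  |x_j|, 1 + |x| is at most n(1 + m), hence at most 2n max(1, m), for n the dimension.\<close>

lemma one_plus_norm_power_le:
  fixes x :: "real^'n"
  shows "(1 + norm x) ^ k \<le> (2 * real CARD('n)) ^ k * (1 + (\<Sum>j\<in>UNIV. \<bar>x $ j\<bar> ^ k))"
proof -
  define m where "m = Max (range (\<lambda>j. \<bar>x $ j\<bar>))"
  have m: "\<bar>x $ j\<bar> \<le> m" for j unfolding m_def by (intro Max_ge) auto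
  have "m \<in> range (\<lambda>j. \<bar>x $ j\<bar>)" unfolding m_def by (intro Max_in) auto
  then obtain j0 where j0: "m = \<bar>x $ j0\<bar>" by auto
  have c1: "1 \<le> real CARD('n)" by (simp add: Suc_leI)
  have "norm x \<le> (\<Sum>j\<in>UNIV. \<bar>x $ j\<bar>)" by (rule norm_le_l1_cart)
  also have "\<dots> \<le> real CARD('n) * m" using sum_bounded_above[of UNIV "\<lambda>j. \<bar>x $ j\<bar>" m] m by simp
  finally have "1 + norm x \<le> real CARD('n) * (1 + m)" unfolding distrib_left using c1 by linarith
  also have "\<dots> \<le> real CARD('n) * (2 * max 1 m)" by (intro mult_left_mono) auto
  finally have "(1 + norm x) ^ k \<le> (real CARD('n) * (2 * max 1 m)) ^ k"
    by (intro power_mono) (auto simp: add_nonneg_nonneg)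
  also have "\<dots> = (2 * real CARD('n)) ^ k * (max 1 m) ^ k" by (simp add: power_mult_distrib)
  also have "(max 1 m) ^ k \<le> 1 + (\<Sum>j\<in>UNIV. \<bar>x $ j\<bar> ^ k)"
  proof (cases "m \<le> 1")
    case True then show ?thesis by (simp add: max_def sum_nonneg)
  next
    case False
    have "m ^ k \<le> (\<Sum>j\<in>UNIV. \<bar>x $ j\<bar> ^ k)" unfolding j0 by (rule member_le_sum) auto
    then show ?thesis using False by (simp add: max_def)
  qed
  finally show ?thesis by (simp add: mult_left_mono)
qed

lemma rapid_cosT:
  fixes a :: "real^'n \<Rightarrow> real"
  assumes a: "test_fun a" shows "rapid (cosT a)" "rapid (sinT a)"
proof -
  have *: "rapid f" if f: "continuous_on UNIV f" and b: "\<And>j k. \<exists>C. \<forall>x. \<bar>x $ j\<bar> ^ k * \<bar>f x\<bar> \<le> C" for f :: "real^'n \<Rightarrow> real"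
    unfolding rapid_def
  proof (intro conjI allI)
    show "f \<in> borel_measurable borel" using f by (rule borel_measurable_continuous_onI)
    fix N
    obtain C where C: "\<And>j x. \<bar>x $ j\<bar> ^ N * \<bar>f x\<bar> \<le> C j" using b[of _ N] by metis
    obtain C0 where C0: "\<And>x. \<bar>f x\<bar> \<le> C0" using b[of undefined 0] by auto
    have "\<bar>f x\<bar> \<le> ((2 * real CARD('n)) ^ N * (C0 + (\<Sum>j\<in>UNIV. C j))) * wt N x" for x
    proof -
      have "(1 + norm x) ^ N * \<bar>f x\<bar> \<le> (2 * real CARD('n)) ^ N * (1 + (\<Sum>j\<in>UNIV. \<bar>x $ j\<bar> ^ N)) * \<bar>f x\<bar>"
        by (intro mult_right_mono one_plus_norm_power_le) auto
      also have "\<dots> = (2 * real CARD('n)) ^ N * (\<bar>f x\<bar> + (\<Sum>j\<in>UNIV. \<bar>x $ j\<bar> ^ N * \<bar>f x\<bar>))"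
        by (simp add: algebra_simps sum_distrib_left sum_distrib_right)
      also have "\<dots> \<le> (2 * real CARD('n)) ^ N * (C0 + (\<Sum>j\<in>UNIV. C j))"
        by (intro mult_left_mono add_mono sum_mono C C0) auto
      finally have "(1 + norm x) ^ N * \<bar>f x\<bar> * wt N x \<le> (2 * real CARD('n)) ^ N * (C0 + (\<Sum>j\<in>UNIV. C j)) * wt N x"
        by (intro mult_right_mono) auto
      moreover have "(1 + norm x) ^ N * \<bar>f x\<bar> * wt N x = \<bar>f x\<bar>"
        using power_mult_wt[of x N] by (simp add: mult.commute mult.left_commute)
      ultimately show ?thesis by simp
    qed
    then show "\<exists>C. \<forall>x. \<bar>f x\<bar> \<le> C * wt N x" by blast
  qed
  show "rapid (cosT a)" "rapid (sinT a)" using cosT_decay[OF a]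
    by (auto intro!: * cosT_continuous[OF a]) metis+
qed

text \<open>A Gaussian factor makes the inversion integral absolutely convergent.\<close>
definition gauss :: "real^'n \<Rightarrow> real" where
  "gauss x = exp (- (norm x)\<^sup>2 / 2) / sqrt (2 * pi) ^ CARD('n)"

lemma gauss_prod: "gauss x = (\<Prod>b\<in>Basis. std_normal_density (x \<bullet> b))"
  for x :: "real^'n"
proof -
  have "(\<Prod>b\<in>Basis. std_normal_density (x \<bullet> b)) = (\<Prod>b\<in>(Basis :: (real^'n) set). (1 / sqrt (2 * pi))) * (\<Prod>b\<in>Basis. exp (- (x \<bullet> b)\<^sup>2 / 2))"
    unfolding std_normal_density_def prod.distrib ..
  also have "(\<Prod>b\<in>Basis. exp (- (x \<bullet> b)\<^sup>2 / 2)) = exp (\<Sum>b\<in>Basis. - (x \<bullet> b)\<^sup>2 / 2)" by (simp add: exp_sum)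
  also have "(\<Sum>b\<in>Basis. - (x \<bullet> b)\<^sup>2 / 2) = - (norm x)\<^sup>2 / 2"
    unfolding power2_norm_eq_inner euclidean_inner[of x x]
    by (simp add: sum_negf sum_divide_distrib[symmetric] power2_eq_square)
  finally show ?thesis by (simp add: gauss_def power_one_over)
qed

text \<open>Density and exponential factorise over the basis vectors, so the integral over the
  product measure reduces to one dimension, where it is the characteristic function of the standard
  normal distribution. The real part is the claim.\<close>

lemma gauss_cos_integral:
  fixes \<eta> :: "real^'n"
  shows "has_bochner_integral lborel (\<lambda>x. gauss x * cos (x \<bullet> \<eta>)) (exp (- (norm \<eta>)\<^sup>2 / 2))"
proof -
  interpret product_sigma_finite "\<lambda>_::real^'n. lborel :: real measure" ..
  let ?f = "\<lambda>b t. complex_of_real (std_normal_density t) * iexp ((\<eta> \<bullet> b) * t)"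
  have f: "integrable lborel (?f b)" "(\<integral>t. ?f b t \<partial>lborel) = complex_of_real (exp (- (\<eta> \<bullet> b)\<^sup>2 / 2))" for b
  proof -
    have "integrable lborel (\<lambda>t. norm (std_normal_density t))" by (auto intro!: integrable_normal_density)
    then show "integrable lborel (?f b)"
      by (rule Bochner_Integration.integrable_bound) (auto simp: norm_mult)
    have "(\<integral>t. ?f b t \<partial>lborel) = (\<integral>t. std_normal_density t *\<^sub>R iexp ((\<eta> \<bullet> b) * t) \<partial>lborel)"
      by (simp add: scaleR_conv_of_real)
    also have "\<dots> = char std_normal_distribution (\<eta> \<bullet> b)"
      unfolding char_def by (subst integral_density) auto
    finally show "(\<integral>t. ?f b t \<partial>lborel) = complex_of_real (exp (- (\<eta> \<bullet> b)\<^sup>2 / 2))"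
      by (simp add: char_std_normal_distribution)
  qed
  have prod: "(\<Prod>b\<in>Basis. ?f b (x \<bullet> b)) = complex_of_real (gauss x) * iexp (x \<bullet> \<eta>)" for x
  proof -
    have "(\<Prod>b\<in>Basis. iexp ((\<eta> \<bullet> b) * (x \<bullet> b))) = iexp (\<Sum>b\<in>Basis. (\<eta> \<bullet> b) * (x \<bullet> b))"
      by (simp add: exp_sum sum_distrib_left)
    also have "(\<Sum>b\<in>Basis. (\<eta> \<bullet> b) * (x \<bullet> b)) = x \<bullet> \<eta>" by (simp add: euclidean_inner[of x \<eta>] mult.commute)
    finally show ?thesis by (simp add: prod.distrib gauss_prod)
  qed
  have m[measurable]: "(\<lambda>x. \<Prod>b\<in>Basis. ?f b (x \<bullet> b)) \<in> borel_measurable (borel :: (real^'n) measure)" by measurable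
  have T: "(\<lambda>f. \<Sum>b\<in>Basis. f b *\<^sub>R b) \<in> (\<Pi>\<^sub>M b\<in>(Basis :: (real^'n) set). lborel) \<rightarrow>\<^sub>M borel" by measurable
  have comp: "(\<Prod>b\<in>Basis. ?f b ((\<Sum>b\<in>Basis. f b *\<^sub>R b) \<bullet> b)) = (\<Prod>b\<in>Basis. ?f b (f b))" for f :: "real^'n \<Rightarrow> real"
    by (intro prod.cong refl) (simp add: inner_sum_left inner_Basis if_distrib cong: if_cong)
  have "integrable (lborel :: (real^'n) measure) (\<lambda>x. \<Prod>b\<in>Basis. ?f b (x \<bullet> b))"
    by (subst lborel_eq, subst integrable_distr_eq[OF T m]) (simp only: comp, intro product_integrable_prod f, simp)
  moreover have "(\<integral>x. (\<Prod>b\<in>Basis. ?f b (x \<bullet> b)) \<partial>(lborel :: (real^'n) measure)) = (\<Prod>b\<in>Basis. complex_of_real (exp (- (\<eta> \<bullet> b)\<^sup>2 / 2)))"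
    by (subst lborel_eq, subst integral_distr[OF T m]) (simp only: comp, subst product_integral_prod[OF _ f(1)], simp, simp only: f)
  moreover have "(\<Prod>b\<in>Basis. complex_of_real (exp (- (\<eta> \<bullet> b)\<^sup>2 / 2))) = complex_of_real (exp (- (norm \<eta>)\<^sup>2 / 2))"
  proof -
    have "(\<Prod>b\<in>Basis. exp (- (\<eta> \<bullet> b)\<^sup>2 / 2)) = exp (\<Sum>b\<in>Basis. - (\<eta> \<bullet> b)\<^sup>2 / 2)" by (simp add: exp_sum)
    also have "(\<Sum>b\<in>Basis. - (\<eta> \<bullet> b)\<^sup>2 / 2) = - (norm \<eta>)\<^sup>2 / 2"
      unfolding power2_norm_eq_inner euclidean_inner[of \<eta> \<eta>]
      by (simp add: sum_negf sum_divide_distrib[symmetric] power2_eq_square)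
    finally show ?thesis by (simp only: of_real_prod[symmetric])
  qed
  ultimately have "has_bochner_integral lborel (\<lambda>x. complex_of_real (gauss x) * iexp (x \<bullet> \<eta>)) (complex_of_real (exp (- (norm \<eta>)\<^sup>2 / 2)))"
    unfolding prod has_bochner_integral_iff by (simp only: simp_thms)
  from has_bochner_integral_Re[OF this] show ?thesis by (simp add: Re_exp)
qed

lemma gauss_integrable: "integrable lborel gauss" and gauss_integral: "(\<integral>x. gauss x \<partial>lborel) = 1"
  using gauss_cos_integral[of 0] by (auto simp: has_bochner_integral_iff)

lemma gauss_measurable [measurable]: "gauss \<in> borel_measurable borel"
  unfolding gauss_def by measurable

lemma integrable_pair_mult:
  fixes f g :: "real^'n \<Rightarrow> real"
  assumes f: "integrable lborel f" and g: "integrable lborel g"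
    and [measurable]: "(\<lambda>(x, y). c x y) \<in> borel_measurable (borel \<Otimes>\<^sub>M borel)" and c: "\<And>x y. \<bar>c x y\<bar> \<le> 1"
  shows "integrable (lborel \<Otimes>\<^sub>M lborel) (\<lambda>(x, y). f x * (g y * c x y))"
proof (rule integrableI_bounded)
  have [measurable]: "f \<in> borel_measurable borel" "g \<in> borel_measurable borel"
    using f g by (auto dest: borel_measurable_integrable)
  show "(\<lambda>(x, y). f x * (g y * c x y)) \<in> borel_measurable (lborel \<Otimes>\<^sub>M lborel)" by measurable
  have "(\<integral>\<^sup>+z. ennreal (norm (case z of (x, y) \<Rightarrow> f x * (g y * c x y))) \<partial>(lborel \<Otimes>\<^sub>M lborel))
     \<le> (\<integral>\<^sup>+z. (case z of (x, y) \<Rightarrow> ennreal \<bar>f x\<bar> * ennreal \<bar>g y\<bar>) \<partial>(lborel \<Otimes>\<^sub>M lborel))"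
    using c by (intro nn_integral_mono)
      (auto simp: abs_mult ennreal_mult[symmetric] intro!: ennreal_leI mult_left_mono mult_left_le)
  also have "\<dots> = (\<integral>\<^sup>+x. \<integral>\<^sup>+y. ennreal \<bar>f x\<bar> * ennreal \<bar>g y\<bar> \<partial>lborel \<partial>lborel)"
  proof -
    have "(\<lambda>z. case z of (x, y) \<Rightarrow> ennreal \<bar>f x\<bar> * ennreal \<bar>g y\<bar>) \<in> borel_measurable (lborel \<Otimes>\<^sub>M lborel)" by measurable
    from lborel.nn_integral_fst[OF this] show ?thesis by simp
  qed
  also have "\<dots> = (\<integral>\<^sup>+x. ennreal \<bar>f x\<bar> \<partial>lborel) * (\<integral>\<^sup>+y. ennreal \<bar>g y\<bar> \<partial>lborel)"
    by (simp add: nn_integral_cmult nn_integral_multc)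
  also have "\<dots> < \<infinity>" using f g by (auto simp: integrable_iff_bounded ennreal_mult_less_top)
  finally show "(\<integral>\<^sup>+z. ennreal (norm (case z of (x, y) \<Rightarrow> f x * (g y * c x y))) \<partial>(lborel \<Otimes>\<^sub>M lborel)) < \<infinity>" .
qed

text \<open>Fubini's theorem moves the transform from \<open>a\<close> to the Gaussian factor, for
  which it is known; rescaling by 2 pi / e brings the Gaussian back to \<open>gauss\<close>. The two
  normalising factors sqrt(2 pi)^n cancel the Jacobian (2 pi)^n.\<close>

lemma cosT_gauss:
  fixes a :: "real^'n \<Rightarrow> real"
  assumes a: "test_fun a" and e: "0 < e"
  shows "(\<integral>x. cosT a x * exp (- (norm (e *\<^sub>R x))\<^sup>2 / 2) \<partial>lborel) = (\<integral>y. a ((e / (2 * pi)) *\<^sub>R y) * gauss y \<partial>lborel)"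
proof -
  let ?c = "sqrt (2 * pi) ^ CARD('n)"
  note [measurable] = rapid_measurable[OF test_fun_rapid[OF a]]
  have cc: "?c * ?c = (2 * pi) ^ CARD('n)"
    by (subst power_mult_distrib[symmetric]) simp
  have G: "exp (- (norm x)\<^sup>2 / 2) = ?c * gauss x" for x :: "real^'n" by (simp add: gauss_def)
  have ig: "integrable lborel (\<lambda>x::real^'n. gauss (e *\<^sub>R x))"
    using integrable_lborel_affine[OF gauss_integrable, of e 0] e by simp
  have inner: "(\<integral>x. gauss (e *\<^sub>R x) * cos (2 * pi * (x \<bullet> \<xi>)) \<partial>lborel) = 1 / e ^ CARD('n) * (?c * gauss ((2 * pi / e) *\<^sub>R \<xi>))" for \<xi> :: "real^'n"
  proof -
    have "(\<integral>x. gauss (e *\<^sub>R x) * cos (2 * pi * (x \<bullet> \<xi>)) \<partial>lborel) = (\<integral>x. (\<lambda>y. gauss y * cos (y \<bullet> ((2 * pi / e) *\<^sub>R \<xi>))) (0 + e *\<^sub>R x) \<partial>lborel)"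
      using e by (simp add: mult.assoc)
    also have "\<dots> = 1 / e ^ CARD('n) * exp (- (norm ((2 * pi / e) *\<^sub>R \<xi>))\<^sup>2 / 2)"
      using e has_bochner_integral_integral_eq[OF gauss_cos_integral[of "(2 * pi / e) *\<^sub>R \<xi>"]]
      by (subst integral_lborel_affine) simp_all
    finally show ?thesis by (simp only: G)
  qed
  have "(\<integral>x. cosT a x * exp (- (norm (e *\<^sub>R x))\<^sup>2 / 2) \<partial>lborel)
      = ?c * (\<integral>x. \<integral>\<xi>. gauss (e *\<^sub>R x) * (a \<xi> * cos (2 * pi * (x \<bullet> \<xi>))) \<partial>lborel \<partial>lborel)"
  proof -
    have "cosT a x * (?c * gauss (e *\<^sub>R x)) = ?c * (\<integral>\<xi>. gauss (e *\<^sub>R x) * (a \<xi> * cos (2 * pi * (x \<bullet> \<xi>))) \<partial>lborel)" for x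
      unfolding cosT_def integral_mult_right_zero by (simp only: mult_ac)
    then show ?thesis unfolding G by (simp only: integral_mult_right_zero)
  qed
  also have "(\<integral>x. \<integral>\<xi>. gauss (e *\<^sub>R x) * (a \<xi> * cos (2 * pi * (x \<bullet> \<xi>))) \<partial>lborel \<partial>lborel)
      = (\<integral>\<xi>. \<integral>x. gauss (e *\<^sub>R x) * (a \<xi> * cos (2 * pi * (x \<bullet> \<xi>))) \<partial>lborel \<partial>lborel)"
    by (intro lborel_pair.Fubini_integral[symmetric] integrable_pair_mult ig test_fun_integrable a) auto
  also have "\<dots> = (\<integral>\<xi>. a \<xi> * (\<integral>x. gauss (e *\<^sub>R x) * cos (2 * pi * (x \<bullet> \<xi>)) \<partial>lborel) \<partial>lborel)"
    by (intro Bochner_Integration.integral_cong refl, subst integral_mult_right_zero[symmetric]) (simp add: mult_ac)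
  also have "\<dots> = (\<integral>\<xi>. (?c / e ^ CARD('n)) * (a \<xi> * gauss ((2 * pi / e) *\<^sub>R \<xi>)) \<partial>lborel)"
    unfolding inner by (simp add: mult_ac)
  also have "\<dots> = ?c / e ^ CARD('n) * (\<integral>\<xi>. a \<xi> * gauss ((2 * pi / e) *\<^sub>R \<xi>) \<partial>lborel)"
    by (rule integral_mult_right_zero)
  also have "(\<integral>\<xi>. a \<xi> * gauss ((2 * pi / e) *\<^sub>R \<xi>) \<partial>lborel)
      = (\<integral>\<xi>. (\<lambda>y. a ((e / (2 * pi)) *\<^sub>R y) * gauss y) (0 + (2 * pi / e) *\<^sub>R \<xi>) \<partial>lborel)"
    using e by simp
  also have "\<dots> = 1 / (2 * pi / e) ^ CARD('n) * (\<integral>y. a ((e / (2 * pi)) *\<^sub>R y) * gauss y \<partial>lborel)"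
    using e by (subst integral_lborel_affine) simp_all
  also have "?c * (?c / e ^ CARD('n) * (1 / (2 * pi / e) ^ CARD('n) * (\<integral>y. a ((e / (2 * pi)) *\<^sub>R y) * gauss y \<partial>lborel)))
     = (?c * ?c) / (2 * pi) ^ CARD('n) * (\<integral>y. a ((e / (2 * pi)) *\<^sub>R y) * gauss y \<partial>lborel)"
    using e by (simp add: power_divide)
  finally show ?thesis unfolding cc by simp
qed

text \<open>Fourier inversion at the origin: let e tend to 0 in \<open>cosT_gauss\<close>. On the
  left the Gaussian factor tends to 1, on the right the argument of \<open>a\<close> tends to 0,
  both under a dominating function. Other frequencies are reached by translating
  \<open>a\<close>.\<close>

lemma integral_cosT:
  fixes a :: "real^'n \<Rightarrow> real"
  assumes a: "test_fun a" shows "(\<integral>x. cosT a x \<partial>lborel) = a 0"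
proof -
  note [measurable] = rapid_measurable[OF test_fun_rapid[OF a]] rapid_measurable[OF rapid_cosT(1)[OF a]]
  let ?e = "\<lambda>i. 1 / real (Suc i)"
  have e0: "?e \<longlonglongrightarrow> 0" by (rule LIMSEQ_Suc[OF lim_1_over_n])
  have "(\<lambda>i. \<integral>x. cosT a x * exp (- (norm (?e i *\<^sub>R x))\<^sup>2 / 2) \<partial>lborel) \<longlonglongrightarrow> (\<integral>x. cosT a x \<partial>lborel)"
  proof (rule integral_dominated_convergence[where w="\<lambda>x. \<bar>cosT a x\<bar>"])
    show "integrable lborel (\<lambda>x. \<bar>cosT a x\<bar>)" by (intro integrable_abs rapid_integrable rapid_cosT a)
    show "AE x in lborel. (\<lambda>i. cosT a x * exp (- (norm (?e i *\<^sub>R x))\<^sup>2 / 2)) \<longlonglongrightarrow> cosT a x"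
    proof (rule AE_I2)
      fix x
      have "(\<lambda>i. cosT a x * exp (- (norm (?e i *\<^sub>R x))\<^sup>2 / 2)) \<longlonglongrightarrow> cosT a x * exp (- (norm (0 *\<^sub>R x))\<^sup>2 / 2)"
        by (intro tendsto_intros e0) auto
      then show "(\<lambda>i. cosT a x * exp (- (norm (?e i *\<^sub>R x))\<^sup>2 / 2)) \<longlonglongrightarrow> cosT a x" by simp
    qed
    show "AE x in lborel. norm (cosT a x * exp (- (norm (?e i *\<^sub>R x))\<^sup>2 / 2)) \<le> \<bar>cosT a x\<bar>" for i
      by (auto simp: abs_mult intro!: mult_left_le)
  qed measurable
  moreover have "(\<lambda>i. \<integral>y. a ((?e i / (2 * pi)) *\<^sub>R y) * gauss y \<partial>lborel) \<longlonglongrightarrow> (\<integral>y. a 0 * gauss (y :: real^'n) \<partial>lborel)"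
  proof -
    obtain B where B: "\<And>x. \<bar>a x\<bar> \<le> B * wt 0 x" using rapidD[OF test_fun_rapid[OF a]] by metis
    show ?thesis
    proof (rule integral_dominated_convergence[where w="\<lambda>y. B * gauss y"])
      show "integrable lborel (\<lambda>y::real^'n. B * gauss y)" by (intro integrable_mult_right gauss_integrable)
      show "AE y in lborel. (\<lambda>i. a ((?e i / (2 * pi)) *\<^sub>R y) * gauss y) \<longlonglongrightarrow> a 0 * gauss y"
      proof (rule AE_I2)
        fix y :: "real^'n"
        have c: "isCont a 0" using smooth_fun_continuous[OF test_fun_smooth[OF a], of UNIV] by (simp add: continuous_on_eq_continuous_at)
        have "(\<lambda>i. (?e i / (2 * pi)) *\<^sub>R y) \<longlonglongrightarrow> (0 / (2 * pi)) *\<^sub>R y"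
          by (intro tendsto_intros e0) auto
        then have "(\<lambda>i. a ((?e i / (2 * pi)) *\<^sub>R y)) \<longlonglongrightarrow> a 0"
          using c by (intro isCont_tendsto_compose[where g=a]) auto
        then show "(\<lambda>i. a ((?e i / (2 * pi)) *\<^sub>R y) * gauss y) \<longlonglongrightarrow> a 0 * gauss y" by (intro tendsto_intros)
      qed
      show "AE y in lborel. norm (a ((?e i / (2 * pi)) *\<^sub>R y) * gauss y) \<le> B * gauss y" for i
      proof (rule AE_I2)
        fix y :: "real^'n"
        have "0 \<le> gauss y" by (simp add: gauss_def)
        then show "norm (a ((?e i / (2 * pi)) *\<^sub>R y) * gauss y) \<le> B * gauss y"
          using B[of "(?e i / (2 * pi)) *\<^sub>R y"] by (simp add: abs_mult wt_def mult_right_mono)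
      qed
    qed measurable
  qed
  moreover have "(\<integral>y. a 0 * gauss (y :: real^'n) \<partial>lborel) = a 0" by (simp add: gauss_integral)
  moreover have "(\<integral>x. cosT a x * exp (- (norm (?e i *\<^sub>R x))\<^sup>2 / 2) \<partial>lborel) = (\<integral>y. a ((?e i / (2 * pi)) *\<^sub>R y) * gauss y \<partial>lborel)" for i
    by (rule cosT_gauss[OF a]) simp
  ultimately show ?thesis by (simp only: LIMSEQ_unique)
qed

lemma integral_sinT:
  fixes a :: "real^'n \<Rightarrow> real"
  shows "(\<integral>x. sinT a x \<partial>lborel) = 0"
proof -
  have "(\<integral>x. sinT a x \<partial>lborel) = (\<integral>x. sinT a (0 + (-1) *\<^sub>R x) \<partial>lborel)"
    by (subst integral_lborel_affine) simp_all
  also have "\<dots> = - (\<integral>x. sinT a x \<partial>lborel)" by (simp add: sinT_def)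
  finally show ?thesis by simp
qed

lemma cosT_translate:
  fixes a :: "real^'n \<Rightarrow> real"
  assumes a: "integrable lborel a"
  shows "cosT (\<lambda>\<eta>. a (\<eta> + \<xi>)) h = cosT a h * cos (2 * pi * (h \<bullet> \<xi>)) + sinT a h * sin (2 * pi * (h \<bullet> \<xi>))"
    and "sinT (\<lambda>\<eta>. a (\<eta> + \<xi>)) h = sinT a h * cos (2 * pi * (h \<bullet> \<xi>)) - cosT a h * sin (2 * pi * (h \<bullet> \<xi>))"
proof -
  have sh: "(\<integral>\<eta>. f (\<eta> + \<xi>) \<partial>lborel) = (\<integral>\<eta>. f \<eta> \<partial>lborel)" for f :: "real^'n \<Rightarrow> real"
    using integral_lborel_shift[of f "-\<xi>"] by simp
  have "cosT (\<lambda>\<eta>. a (\<eta> + \<xi>)) h = (\<integral>\<eta>. (\<lambda>\<eta>. a \<eta> * cos (2 * pi * (h \<bullet> (\<eta> - \<xi>)))) (\<eta> + \<xi>) \<partial>lborel)"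
    by (simp add: cosT_def)
  also have "\<dots> = (\<integral>\<eta>. a \<eta> * cos (2 * pi * (h \<bullet> (\<eta> - \<xi>))) \<partial>lborel)" by (rule sh)
  also have "\<dots> = (\<integral>\<eta>. a \<eta> * cos (2 * pi * (h \<bullet> \<eta>)) * cos (2 * pi * (h \<bullet> \<xi>)) + a \<eta> * sin (2 * pi * (h \<bullet> \<eta>)) * sin (2 * pi * (h \<bullet> \<xi>)) \<partial>lborel)"
    by (simp add: inner_diff_right right_diff_distrib cos_diff distrib_left mult.assoc)
  also have "\<dots> = cosT a h * cos (2 * pi * (h \<bullet> \<xi>)) + sinT a h * sin (2 * pi * (h \<bullet> \<xi>))"
    unfolding cosT_def sinT_def
    by (subst Bochner_Integration.integral_add) (auto intro!: integrable_mult_left cosT_integrable sinT_integrable a)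
  finally show "cosT (\<lambda>\<eta>. a (\<eta> + \<xi>)) h = cosT a h * cos (2 * pi * (h \<bullet> \<xi>)) + sinT a h * sin (2 * pi * (h \<bullet> \<xi>))" .
  have "sinT (\<lambda>\<eta>. a (\<eta> + \<xi>)) h = (\<integral>\<eta>. (\<lambda>\<eta>. a \<eta> * sin (2 * pi * (h \<bullet> (\<eta> - \<xi>)))) (\<eta> + \<xi>) \<partial>lborel)"
    by (simp add: sinT_def)
  also have "\<dots> = (\<integral>\<eta>. a \<eta> * sin (2 * pi * (h \<bullet> (\<eta> - \<xi>))) \<partial>lborel)" by (rule sh)
  also have "\<dots> = (\<integral>\<eta>. a \<eta> * sin (2 * pi * (h \<bullet> \<eta>)) * cos (2 * pi * (h \<bullet> \<xi>)) - a \<eta> * cos (2 * pi * (h \<bullet> \<eta>)) * sin (2 * pi * (h \<bullet> \<xi>)) \<partial>lborel)"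
    by (simp add: inner_diff_right right_diff_distrib sin_diff mult.assoc)
  also have "\<dots> = sinT a h * cos (2 * pi * (h \<bullet> \<xi>)) - cosT a h * sin (2 * pi * (h \<bullet> \<xi>))"
    unfolding cosT_def sinT_def
    by (subst Bochner_Integration.integral_diff) (auto intro!: integrable_mult_left cosT_integrable sinT_integrable a)
  finally show "sinT (\<lambda>\<eta>. a (\<eta> + \<xi>)) h = sinT a h * cos (2 * pi * (h \<bullet> \<xi>)) - cosT a h * sin (2 * pi * (h \<bullet> \<xi>))" .
qed

text \<open>The real part of the convolution theorem. After expanding the transform of
  \<open>b\<close> and exchanging integrals, the addition theorems turn the integrand at fixed \<xi>
  into the transforms of the translate a(. + \<xi>); inversion at the origin evaluates their
  integrals to a(\<xi>) and 0.\<close>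

lemma cosT_mult:
  fixes a b :: "real^'n \<Rightarrow> real"
  assumes a: "test_fun a" and b: "test_fun b"
  shows "cosT (\<lambda>\<xi>. a \<xi> * b \<xi>) y = (\<integral>h. cosT a h * cosT b (y - h) \<partial>lborel) - (\<integral>h. sinT a h * sinT b (y - h) \<partial>lborel)"
proof -
  note ia = test_fun_integrable[OF a] and ib = test_fun_integrable[OF b]
  note rc = rapid_integrable[OF rapid_cosT(1)[OF a]] and rs = rapid_integrable[OF rapid_cosT(2)[OF a]]
  have i1: "integrable (lborel \<Otimes>\<^sub>M lborel) (\<lambda>(h, \<xi>). cosT a h * (b \<xi> * cos (2 * pi * ((y - h) \<bullet> \<xi>))))"
    by (intro integrable_pair_mult rc ib) auto
  have i2: "integrable (lborel \<Otimes>\<^sub>M lborel) (\<lambda>(h, \<xi>). sinT a h * (b \<xi> * sin (2 * pi * ((y - h) \<bullet> \<xi>))))"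
    by (intro integrable_pair_mult rs ib) auto
  have trig: "cosT a h * (b \<xi> * cos (2 * pi * ((y - h) \<bullet> \<xi>))) - sinT a h * (b \<xi> * sin (2 * pi * ((y - h) \<bullet> \<xi>)))
     = b \<xi> * cos (2 * pi * (y \<bullet> \<xi>)) * cosT (\<lambda>\<eta>. a (\<eta> + \<xi>)) h - b \<xi> * sin (2 * pi * (y \<bullet> \<xi>)) * sinT (\<lambda>\<eta>. a (\<eta> + \<xi>)) h" for h \<xi>
    by (simp add: cosT_translate[OF ia] inner_diff_left right_diff_distrib cos_diff sin_diff) (simp add: algebra_simps)
  have ta: "test_fun (\<lambda>\<eta>. a (\<eta> + \<xi>))" for \<xi>
    using test_fun_affine[OF a, of 1 1 \<xi>] by simp
  have "(\<integral>h. cosT a h * cosT b (y - h) \<partial>lborel) - (\<integral>h. sinT a h * sinT b (y - h) \<partial>lborel)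
      = (\<integral>h. \<integral>\<xi>. cosT a h * (b \<xi> * cos (2 * pi * ((y - h) \<bullet> \<xi>))) \<partial>lborel \<partial>lborel)
        - (\<integral>h. \<integral>\<xi>. sinT a h * (b \<xi> * sin (2 * pi * ((y - h) \<bullet> \<xi>))) \<partial>lborel \<partial>lborel)"
    by (simp add: cosT_def[of b] sinT_def[of b])
  also have "\<dots> = (\<integral>\<xi>. \<integral>h. cosT a h * (b \<xi> * cos (2 * pi * ((y - h) \<bullet> \<xi>))) \<partial>lborel \<partial>lborel)
        - (\<integral>\<xi>. \<integral>h. sinT a h * (b \<xi> * sin (2 * pi * ((y - h) \<bullet> \<xi>))) \<partial>lborel \<partial>lborel)"
    using lborel_pair.Fubini_integral[OF i1] lborel_pair.Fubini_integral[OF i2] by simp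
  also have "\<dots> = (\<integral>\<xi>. (\<integral>h. cosT a h * (b \<xi> * cos (2 * pi * ((y - h) \<bullet> \<xi>))) \<partial>lborel)
        - (\<integral>h. sinT a h * (b \<xi> * sin (2 * pi * ((y - h) \<bullet> \<xi>))) \<partial>lborel) \<partial>lborel)"
    using lborel_pair.integrable_snd[OF i1] lborel_pair.integrable_snd[OF i2]
    by (intro Bochner_Integration.integral_diff[symmetric])
  also have "\<dots> = (\<integral>\<xi>. a \<xi> * b \<xi> * cos (2 * pi * (y \<bullet> \<xi>)) \<partial>lborel)"
  proof (intro Bochner_Integration.integral_cong refl)
    fix \<xi>
    have m[measurable]: "cosT a \<in> borel_measurable borel" "sinT a \<in> borel_measurable borel"
      using rapid_cosT[OF a] by (auto dest: rapid_measurable)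
    have j1: "integrable lborel (\<lambda>h. cosT a h * (b \<xi> * cos (2 * pi * ((y - h) \<bullet> \<xi>))))"
    proof -
      have "integrable lborel (\<lambda>h. b \<xi> * (cosT a h * cos (2 * pi * ((y - h) \<bullet> \<xi>))))"
        by (intro integrable_mult_right trig_bounded_integrable rc) auto
      then show ?thesis by (simp only: mult.left_commute)
    qed
    have j2: "integrable lborel (\<lambda>h. sinT a h * (b \<xi> * sin (2 * pi * ((y - h) \<bullet> \<xi>))))"
    proof -
      have "integrable lborel (\<lambda>h. b \<xi> * (sinT a h * sin (2 * pi * ((y - h) \<bullet> \<xi>))))"
        by (intro integrable_mult_right trig_bounded_integrable rs) auto
      then show ?thesis by (simp only: mult.left_commute)
    qed
    have "(\<integral>h. cosT a h * (b \<xi> * cos (2 * pi * ((y - h) \<bullet> \<xi>))) \<partial>lborel) - (\<integral>h. sinT a h * (b \<xi> * sin (2 * pi * ((y - h) \<bullet> \<xi>))) \<partial>lborel)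
      = (\<integral>h. b \<xi> * cos (2 * pi * (y \<bullet> \<xi>)) * cosT (\<lambda>\<eta>. a (\<eta> + \<xi>)) h - b \<xi> * sin (2 * pi * (y \<bullet> \<xi>)) * sinT (\<lambda>\<eta>. a (\<eta> + \<xi>)) h \<partial>lborel)"
      by (simp only: trig Bochner_Integration.integral_diff[OF j1 j2, symmetric])
    also have "\<dots> = b \<xi> * cos (2 * pi * (y \<bullet> \<xi>)) * (\<integral>h. cosT (\<lambda>\<eta>. a (\<eta> + \<xi>)) h \<partial>lborel) - b \<xi> * sin (2 * pi * (y \<bullet> \<xi>)) * (\<integral>h. sinT (\<lambda>\<eta>. a (\<eta> + \<xi>)) h \<partial>lborel)"
      by (subst Bochner_Integration.integral_diff) (auto intro!: integrable_mult_right rapid_integrable rapid_cosT ta)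
    also have "\<dots> = a \<xi> * b \<xi> * cos (2 * pi * (y \<bullet> \<xi>))"
      by (simp add: integral_cosT[OF ta] integral_sinT)
    finally show "(\<integral>h. cosT a h * (b \<xi> * cos (2 * pi * ((y - h) \<bullet> \<xi>))) \<partial>lborel) - (\<integral>h. sinT a h * (b \<xi> * sin (2 * pi * ((y - h) \<bullet> \<xi>))) \<partial>lborel)
      = a \<xi> * b \<xi> * cos (2 * pi * (y \<bullet> \<xi>))" .
  qed
  finally show ?thesis by (simp add: cosT_def)
qed

text \<open>The sum of the absolute partial derivatives dominates the Euclidean norm of the gradient
  and is a finite sum of absolute values of \<open>rapid\<close> functions.\<close>

lemma cosT_grad_bd:
  fixes a :: "real^'n \<Rightarrow> real"
  assumes a: "test_fun a"
  obtains D where "grad_bd (cosT a) D" "rapid D" "\<And>x. 0 \<le> D x"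
proof -
  let ?g = "\<lambda>x. \<chi> j. - sinT (\<lambda>\<xi>. 2 * pi * \<xi> $ j * a \<xi>) x"
  let ?D = "\<lambda>x. \<Sum>j\<in>UNIV. \<bar>sinT (\<lambda>\<xi>. 2 * pi * \<xi> $ j * a \<xi>) x\<bar>"
  have r: "rapid ?D" by (intro rapid_sum rapid_abs rapid_cosT test_fun_nth_mult a) auto
  have "grad_bd (cosT a) ?D"
  proof (rule grad_bdI[OF cosT_has_derivative(1)[OF a]])
    show "continuous_on UNIV ?g" by (intro continuous_intros cosT_continuous test_fun_nth_mult a)
    show "norm (?g x) \<le> ?D x" for x using norm_le_l1_cart[of "?g x"] by simp
  qed (rule rapid_measurable[OF r])
  then show thesis using r that by (simp add: sum_nonneg)
qed

lemma sinT_grad_bd: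
  fixes a :: "real^'n \<Rightarrow> real"
  assumes a: "test_fun a"
  obtains D where "grad_bd (sinT a) D" "rapid D" "\<And>x. 0 \<le> D x"
proof -
  let ?g = "\<lambda>x. \<chi> j. cosT (\<lambda>\<xi>. 2 * pi * \<xi> $ j * a \<xi>) x"
  let ?D = "\<lambda>x. \<Sum>j\<in>UNIV. \<bar>cosT (\<lambda>\<xi>. 2 * pi * \<xi> $ j * a \<xi>) x\<bar>"
  have r: "rapid ?D" by (intro rapid_sum rapid_abs rapid_cosT test_fun_nth_mult a) auto
  have "grad_bd (sinT a) ?D"
  proof (rule grad_bdI[OF cosT_has_derivative(2)[OF a]])
    show "continuous_on UNIV ?g" by (intro continuous_intros cosT_continuous test_fun_nth_mult a)
    show "norm (?g x) \<le> ?D x" for x using norm_le_l1_cart[of "?g x"] by simp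
  qed (rule rapid_measurable[OF r])
  then show thesis using r that by (simp add: sum_nonneg)
qed

subsection \<open>Littlewood-Paley kernels\<close>

lemma pred_cball [measurable (raw)]:
  fixes f :: "'a \<Rightarrow> 'b::euclidean_space"
  assumes [measurable]: "f \<in> borel_measurable M"
  shows "Measurable.pred M (\<lambda>x. f x \<in> cball c r)"
  unfolding mem_cball by measurable

text \<open>Outside the closed annulus this is the support condition. The bounding spheres belong to
  the support, and there continuity forces the value 0. They matter, because dyadic dilations of the
  annulus touch each other exactly along such spheres.\<close>

lemma LP_symbol_zero:
  fixes chi :: "real^'n \<Rightarrow> real"
  assumes chi: "LP_symbol chi" and x: "norm x \<le> 1/2 \<or> 2 \<le> norm x"
  shows "chi x = 0"
proof -
  have supp: "chi y = 0" if "norm y < 1/2 \<or> 2 < norm y" for y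
  proof (rule ccontr)
    assume "chi y \<noteq> 0"
    then have "y \<in> fsupport chi" unfolding fsupport_def by (intro subsetD[OF closure_subset]) simp
    moreover have "fsupport chi = {\<xi>. 1/2 \<le> norm \<xi> \<and> norm \<xi> \<le> 2}" using chi unfolding LP_symbol_def by blast
    ultimately show False using that by auto
  qed
  \<comment> \<open>The sign of a radial approach that stays outside the annulus: inwards from the
    inner sphere, outwards from the outer one.\<close>
  define s :: real where "s = (if norm x \<le> 1/2 then -1 else 1)"
  have "(\<lambda>k. (1 + s * (1 / real (Suc k))) *\<^sub>R x) \<longlonglongrightarrow> (1 + s * 0) *\<^sub>R x"
    by (intro tendsto_intros LIMSEQ_Suc[OF lim_1_over_n])
  moreover have "isCont chi x" using chi smooth_fun_continuous[OF test_fun_smooth, of chi UNIV]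
    by (simp add: LP_symbol_def continuous_on_eq_continuous_at)
  ultimately have lim: "(\<lambda>k. chi ((1 + s * (1 / real (Suc k))) *\<^sub>R x)) \<longlonglongrightarrow> chi x"
    by (intro isCont_tendsto_compose[where g=chi]) auto
  have "chi ((1 + s * (1 / real (Suc k))) *\<^sub>R x) = 0" for k
  proof (cases "x = 0")
    case True then show ?thesis using supp[of 0] by simp
  next
    case False
    show ?thesis
    proof (rule supp)
      have k: "0 < 1 / real (Suc k)" "1 / real (Suc k) \<le> 1" by auto
      show "norm ((1 + s * (1 / real (Suc k))) *\<^sub>R x) < 1/2 \<or> 2 < norm ((1 + s * (1 / real (Suc k))) *\<^sub>R x)"
      proof (cases "norm x \<le> 1/2")
        case True
        have "(1 - 1 / real (Suc k)) * norm x < norm x"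
          using k False by (simp add: left_diff_distrib)
        also have "norm x \<le> 1/2" by (rule True)
        finally show ?thesis using True k by (simp add: s_def abs_mult abs_of_nonneg del: of_nat_Suc)
      next
        case F: False
        then have "2 \<le> norm x" using x by simp
        moreover have "norm x < (1 + 1 / real (Suc k)) * norm x"
          using k False by (simp add: distrib_right)
        ultimately show ?thesis using F k by (simp add: s_def abs_of_pos del: of_nat_Suc)
      qed
    qed
  qed
  then have "(\<lambda>k. chi ((1 + s * (1 / real (Suc k))) *\<^sub>R x)) = (\<lambda>k. 0)" by (rule ext)
  with lim show ?thesis using LIMSEQ_unique[of "\<lambda>k. 0::real" "chi x" 0] by simp
qed

text \<open>On the annulus only the indices -1, 0 and 1 contribute to the partition of unity. The
  extreme cases, such as n = 2 and |x| = 2, land on a bounding sphere, where \<open>chi\<close>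
  vanishes.\<close>

lemma LP_symbol_sum3:
  fixes chi :: "real^'n \<Rightarrow> real"
  assumes chi: "LP_symbol chi" and x: "1/2 \<le> norm x" "norm x \<le> 2"
  shows "chi (2 *\<^sub>R x) + chi x + chi ((1/2) *\<^sub>R x) = 1"
proof -
  have "x \<noteq> 0" using x by auto
  then have hs: "((\<lambda>n::int. chi ((2 powr (- real_of_int n)) *\<^sub>R x)) has_sum 1) UNIV"
    using chi unfolding LP_symbol_def by blast
  have z: "chi ((2 powr (- real_of_int n)) *\<^sub>R x) = 0" if "n \<notin> {-1, 0, 1}" for n :: int
  proof (rule LP_symbol_zero[OF chi])
    have "n \<noteq> -1" "n \<noteq> 0" "n \<noteq> 1" using that by auto
    then consider "n \<ge> 2" | "n \<le> -2" by linarith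
    then show "norm ((2 powr (- real_of_int n)) *\<^sub>R x) \<le> 1/2 \<or> 2 \<le> norm ((2 powr (- real_of_int n)) *\<^sub>R x)"
    proof cases
      case 1
      then have "(2::real) powr (- real_of_int n) \<le> 2 powr (-2)" by (intro powr_mono) auto
      then have "2 powr (- real_of_int n) * norm x \<le> 2 powr (-2) * 2" using x by (intro mult_mono) auto
      also have "(2::real) powr (-2) * 2 = 1/2" by (simp add: powr_minus_divide)
      finally show ?thesis by simp
    next
      case 2
      then have "(2::real) powr 2 \<le> 2 powr (- real_of_int n)" by (intro powr_mono) auto
      then have "2 powr 2 * (1/2) \<le> 2 powr (- real_of_int n) * norm x" using x by (intro mult_mono) auto
      then show ?thesis by simp
    qed
  qed
  have "((\<lambda>n::int. chi ((2 powr (- real_of_int n)) *\<^sub>R x)) has_sum (\<Sum>n\<in>{-1,0,1::int}. chi ((2 powr (- real_of_int n)) *\<^sub>R x))) UNIV"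
    by (rule has_sum_finite_neutralI[where B="{-1, 0, 1}"]) (use z in auto)
  from has_sum_unique[OF this hs] show ?thesis by (simp add: powr_minus_divide)
qed

text \<open>The sum of chi(2^-n .) over all n <= 0, extended by 1 at the origin: inside the unit
  ball this part of the partition of unity is complete, outside only n = 0 is left.\<close>

definition LP_low :: "(real^'n \<Rightarrow> real) \<Rightarrow> real^'n \<Rightarrow> real" where
  "LP_low chi x = (if norm x < 1 then 1 else chi x)"

text \<open>Equal to 1 on the support of \<open>chi\<close>, hence reproducing it under
  multiplication, and still zero at the origin, so that its inverse transform has mean zero.\<close>

definition LP_fat :: "(real^'n \<Rightarrow> real) \<Rightarrow> real^'n \<Rightarrow> real" where
  "LP_fat chi x = chi (2 *\<^sub>R x) + chi x + chi ((1/2) *\<^sub>R x)"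

lemma LP_symbol_test: "LP_symbol chi \<Longrightarrow> test_fun chi"
  by (simp add: LP_symbol_def)

lemma LP_fat_test: "LP_symbol chi \<Longrightarrow> test_fun (LP_fat chi)"
  unfolding LP_fat_def
  using test_fun_affine[OF LP_symbol_test, of chi 2 1 0] test_fun_affine[OF LP_symbol_test, of chi "1/2" 1 0]
  by (intro test_fun_add) (simp_all add: LP_symbol_test)

lemma LP_fat_mult: "LP_symbol chi \<Longrightarrow> LP_fat chi x * chi x = chi x"
  using LP_symbol_sum3[of chi x] LP_symbol_zero[of chi x] unfolding LP_fat_def
  by (cases "1/2 \<le> norm x \<and> norm x \<le> 2") auto

lemma LP_low_eq:
  assumes chi: "LP_symbol chi" and x: "1/2 \<le> norm x" shows "LP_low chi x = chi x + chi (2 *\<^sub>R x)"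
proof (cases "norm x < 1")
  case True
  then show ?thesis using LP_symbol_sum3[OF chi x] LP_symbol_zero[OF chi, of "(1/2) *\<^sub>R x"] by (auto simp: LP_low_def)
next
  case False
  then show ?thesis using LP_symbol_zero[OF chi, of "2 *\<^sub>R x"] by (auto simp: LP_low_def)
qed

text \<open>One block is the difference of two consecutive low-frequency cut-offs. Transformed, this
  is the identity \<open>a_eq\<close> of the kernels and the origin of all telescoping sums.\<close>

lemma LP_low_diff:
  assumes chi: "LP_symbol chi" shows "LP_low chi x - LP_low chi (2 *\<^sub>R x) = chi x"
proof (cases "norm x < 1/2")
  case True
  then show ?thesis using LP_symbol_zero[OF chi, of x] by (simp add: LP_low_def)
next
  case False
  then show ?thesis using LP_low_eq[OF chi, of x] by (simp add: LP_low_def)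
qed

text \<open>Patched from the constant 1 on the unit ball and chi(x) + chi(2x) on |x| > 1/2, which
  agree on the overlap by the partition of unity.\<close>

lemma LP_low_test: assumes chi: "LP_symbol chi" shows "test_fun (LP_low chi)"
proof -
  have "smooth_fun (LP_low chi)"
  proof (rule smooth_fun_patch[where U="ball 0 1" and V="{x. 1/2 < norm x}" and ?f1.0="\<lambda>x. 1" and ?f2.0="\<lambda>x. chi x + chi (2 *\<^sub>R x)"])
    show "open {x::real^'a. 1/2 < norm x}" by (intro open_Collect_less continuous_intros)
    show "smooth_fun (\<lambda>x. chi x + chi (2 *\<^sub>R x))"
      using smooth_fun_affine[OF test_fun_smooth[OF LP_symbol_test[OF chi]], of 1 2 0]
        test_fun_smooth[OF LP_symbol_test[OF chi]]
      by (intro smooth_fun_add) simp_all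
  qed (use LP_low_eq[OF chi] in \<open>auto simp: LP_low_def smooth_fun_const\<close>)
  moreover have "LP_low chi x = 0" if "2 < norm x" for x
    using that LP_symbol_zero[OF chi, of x] by (simp add: LP_low_def)
  ultimately show ?thesis unfolding test_fun_iff by blast
qed

text \<open>\<open>LP_low chi\<close> has a second use, as the bump function \<theta> in the
  fundamental lemma of the calculus of variations; there its sign matters.\<close>

lemma LP_low_nonneg: assumes chi: "LP_symbol chi" shows "0 \<le> LP_low chi x"
proof -
  have "\<forall>\<xi>. 1/2 < norm \<xi> \<and> norm \<xi> < 2 \<longrightarrow> chi \<xi> > 0" using chi unfolding LP_symbol_def by blast
  then have "0 \<le> chi x" using LP_symbol_zero[OF chi, of x]
    by (cases "1/2 < norm x \<and> norm x < 2") (auto simp: not_less intro: less_imp_le)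
  then show ?thesis by (simp add: LP_low_def)
qed

lemma cosT_scale:
  fixes a :: "real^'n \<Rightarrow> real"
  assumes s: "0 < s"
  shows "cosT (\<lambda>\<xi>. a (s *\<^sub>R \<xi>)) x = cosT a ((1/s) *\<^sub>R x) / s ^ CARD('n)"
    and "sinT (\<lambda>\<xi>. a (s *\<^sub>R \<xi>)) x = sinT a ((1/s) *\<^sub>R x) / s ^ CARD('n)"
proof -
  have "cosT (\<lambda>\<xi>. a (s *\<^sub>R \<xi>)) x = (\<integral>\<xi>. (\<lambda>\<eta>. a \<eta> * cos (2 * pi * (((1/s) *\<^sub>R x) \<bullet> \<eta>))) (0 + s *\<^sub>R \<xi>) \<partial>lborel)"
    using s by (simp add: cosT_def)
  also have "\<dots> = cosT a ((1/s) *\<^sub>R x) / s ^ CARD('n)"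
    using s by (subst integral_lborel_affine) (simp_all add: cosT_def)
  finally show "cosT (\<lambda>\<xi>. a (s *\<^sub>R \<xi>)) x = cosT a ((1/s) *\<^sub>R x) / s ^ CARD('n)" .
  have "sinT (\<lambda>\<xi>. a (s *\<^sub>R \<xi>)) x = (\<integral>\<xi>. (\<lambda>\<eta>. a \<eta> * sin (2 * pi * (((1/s) *\<^sub>R x) \<bullet> \<eta>))) (0 + s *\<^sub>R \<xi>) \<partial>lborel)"
    using s by (simp add: sinT_def)
  also have "\<dots> = sinT a ((1/s) *\<^sub>R x) / s ^ CARD('n)"
    using s by (subst integral_lborel_affine) (simp_all add: sinT_def)
  finally show "sinT (\<lambda>\<xi>. a (s *\<^sub>R \<xi>)) x = sinT a ((1/s) *\<^sub>R x) / s ^ CARD('n)" .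
qed

text \<open>All blocks are dilations of one complex kernel, so that each of them is
  \<open>kop\<close> with the same two real kernels at scale 2^-n. The integral of the definition is
  taken with respect to \<open>lebesgue\<close>; the integrand is Borel.\<close>

lemma LP_psi_eq:
  fixes chi :: "real^'n \<Rightarrow> real"
  assumes chi: "LP_symbol chi"
  defines "e \<equiv> \<lambda>n::int. 2 powr (- real_of_int n)"
  shows "LP_psi chi n x = Complex (cosT chi ((1 / e n) *\<^sub>R x) / e n ^ CARD('n)) (sinT chi ((1 / e n) *\<^sub>R x) / e n ^ CARD('n))"
proof -
  note [measurable] = rapid_measurable[OF test_fun_rapid[OF LP_symbol_test[OF chi]]]
  let ?c = "\<lambda>\<xi>. chi (e n *\<^sub>R \<xi>)"
  have e: "0 < e n" by (simp add: e_def)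
  have "test_fun ?c" using test_fun_affine[OF LP_symbol_test[OF chi], of "e n" 1 0] e by simp
  note ic = test_fun_integrable[OF this]
  have "LP_psi chi n x = (\<integral>\<xi>. complex_of_real (?c \<xi>) * cis (2 * pi * (x \<bullet> \<xi>)) \<partial>lborel)"
    unfolding LP_psi_def e_def cis_conv_exp by (rule integral_completion) measurable
  also have "\<dots> = (\<integral>\<xi>. complex_of_real (?c \<xi> * cos (2 * pi * (x \<bullet> \<xi>))) + \<i> * complex_of_real (?c \<xi> * sin (2 * pi * (x \<bullet> \<xi>))) \<partial>lborel)"
    by (intro Bochner_Integration.integral_cong) (auto simp: complex_eq_iff)
  also have "\<dots> = complex_of_real (cosT ?c x) + \<i> * complex_of_real (sinT ?c x)"
    unfolding cosT_def sinT_def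
    by (subst Bochner_Integration.integral_add) (auto intro!: integrable_mult_right integrable_of_real cosT_integrable sinT_integrable ic simp del: of_real_mult)
  finally show ?thesis by (simp add: cosT_scale[OF e] complex_eq_iff)
qed

text \<open>Since \<open>chi\<close> need not be even, its inverse Fourier transform \<open>a + i b\<close> is complex. That of \<open>LP_fat chi\<close> is
  \<open>a' + i b'\<close>, and \<open>P\<close> is the real part of that of \<open>LP_low chi\<close>.\<close>
locale lp_kernels =
  fixes chi P a b a' b' DP Da Db :: "real^'n \<Rightarrow> real"
  assumes rapid: "rapid P" "rapid a" "rapid b" "rapid a'" "rapid b'" "rapid DP" "rapid Da" "rapid Db"
    and D_nonneg: "\<And>x. 0 \<le> DP x" "\<And>x. 0 \<le> Da x" "\<And>x. 0 \<le> Db x"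
    and integral_P: "(\<integral>x. P x \<partial>lborel) = 1"
    and mean_zero: "(\<integral>x. a' x \<partial>lborel) = 0" "(\<integral>x. b' x \<partial>lborel) = 0"
    and grad_bd: "grad_bd P DP" "grad_bd a' Da" "grad_bd b' Db"
    and a_eq: "\<And>z. a z = P z - P ((1/2) *\<^sub>R z) / 2 ^ CARD('n)"
    and a_repr: "\<And>y. a y = (\<integral>h. a' h * a (y - h) \<partial>lborel) - (\<integral>h. b' h * b (y - h) \<partial>lborel)"
    and psi_eq: "\<And>n x. LP_psi chi n x = Complex (a ((1 / 2 powr (- real_of_int n)) *\<^sub>R x) / (2 powr (- real_of_int n)) ^ CARD('n))
       (b ((1 / 2 powr (- real_of_int n)) *\<^sub>R x) / (2 powr (- real_of_int n)) ^ CARD('n))"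

text \<open>Collects in one locale what the estimates require of the Fourier transform: moments, a
  bound for the gradients, the telescoping identity and the reproducing identity.\<close>

lemma ex_lp_kernels:
  fixes chi :: "real^'n \<Rightarrow> real"
  assumes chi: "LP_symbol chi"
  shows "\<exists>P a b a' b' DP Da Db. lp_kernels chi P a b a' b' DP Da Db"
proof -
  note t = LP_low_test[OF chi] LP_symbol_test[OF chi] LP_fat_test[OF chi]
  obtain DP where DP: "grad_bd (cosT (LP_low chi)) DP" "rapid DP" "\<And>x. 0 \<le> DP x" using cosT_grad_bd[OF t(1)] by blast
  obtain Da where Da: "grad_bd (cosT (LP_fat chi)) Da" "rapid Da" "\<And>x. 0 \<le> Da x" using cosT_grad_bd[OF t(3)] by blast
  obtain Db where Db: "grad_bd (sinT (LP_fat chi)) Db" "rapid Db" "\<And>x. 0 \<le> Db x" using sinT_grad_bd[OF t(3)] by blast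
  have "lp_kernels chi (cosT (LP_low chi)) (cosT chi) (sinT chi) (cosT (LP_fat chi)) (sinT (LP_fat chi)) DP Da Db"
  proof
    show "(\<integral>x. cosT (LP_low chi) x \<partial>lborel) = 1" by (simp add: integral_cosT[OF t(1)] LP_low_def)
    show "(\<integral>x. cosT (LP_fat chi) x \<partial>lborel) = 0"
      using LP_symbol_zero[OF chi, of 0] by (simp add: integral_cosT[OF t(3)] LP_fat_def)
    show "(\<integral>x. sinT (LP_fat chi) x \<partial>lborel) = 0" by (rule integral_sinT)
    fix z
    have "cosT chi z = cosT (\<lambda>x. LP_low chi x - LP_low chi (2 *\<^sub>R x)) z" by (simp add: LP_low_diff[OF chi])
    also have "\<dots> = cosT (LP_low chi) z - cosT (\<lambda>x. LP_low chi (2 *\<^sub>R x)) z"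
    proof -
      have "test_fun (\<lambda>x. LP_low chi (2 *\<^sub>R x))" using test_fun_affine[OF t(1), of 2 1 0] by simp
      then show ?thesis unfolding cosT_def left_diff_distrib
        by (intro Bochner_Integration.integral_diff cosT_integrable test_fun_integrable t)
    qed
    finally show "cosT chi z = cosT (LP_low chi) z - cosT (LP_low chi) ((1/2) *\<^sub>R z) / 2 ^ CARD('n)"
      using cosT_scale(1)[of 2 "LP_low chi" z] by simp
    show "cosT chi z = (\<integral>h. cosT (LP_fat chi) h * cosT chi (z - h) \<partial>lborel) - (\<integral>h. sinT (LP_fat chi) h * sinT chi (z - h) \<partial>lborel)"
      using cosT_mult[OF t(3,2), of z] by (simp add: LP_fat_mult[OF chi])
  qed (use DP Da Db rapid_cosT t LP_psi_eq[OF chi] in auto)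
  then show ?thesis by blast
qed

subsection \<open>The fundamental lemma of the calculus of variations\<close>

text \<open>The Borel counterpart of \<open>loc_integrable\<close>, with balls about the origin as
  the compact sets.\<close>

definition loc_int :: "(real^'n \<Rightarrow> real) \<Rightarrow> bool" where
  "loc_int f \<longleftrightarrow> f \<in> borel_measurable borel \<and> (\<forall>R. integrable lborel (\<lambda>x. indicator (cball 0 R) x * f x))"

lemma loc_int_measurable [measurable_dest]: "loc_int f \<Longrightarrow> f \<in> borel_measurable borel"
  by (simp add: loc_int_def)

lemma loc_int_mult:
  assumes f: "loc_int f" and [measurable]: "g \<in> borel_measurable borel"
    and g: "\<And>x. R < norm x \<Longrightarrow> g x = 0" "\<And>x. \<bar>g x\<bar> \<le> B"
  shows "integrable lborel (\<lambda>x. f x * g x)"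
proof (rule Bochner_Integration.integrable_bound)
  note [measurable] = loc_int_measurable[OF f]
  show "integrable lborel (\<lambda>x. B * (indicator (cball 0 R) x * f x))" using f by (auto simp: loc_int_def)
  show "AE x in lborel. norm (f x * g x) \<le> norm (B * (indicator (cball 0 R) x * f x))"
  proof (rule AE_I2)
    fix x
    have "\<bar>f x\<bar> * \<bar>g x\<bar> \<le> \<bar>f x\<bar> * \<bar>B\<bar>" using g(2)[of x] by (intro mult_left_mono) auto
    then show "norm (f x * g x) \<le> norm (B * (indicator (cball 0 R) x * f x))"
      using g(1)[of x] by (cases "norm x \<le> R") (auto simp: abs_mult mult.commute)
  qed
  show "(\<lambda>x. f x * g x) \<in> borel_measurable lborel" by measurable
qed

lemma loc_int_test_mult:
  assumes f: "loc_int f" and g: "test_fun g" shows "integrable lborel (\<lambda>x. f x * g x)"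
proof -
  obtain R where R: "\<And>x. R < norm x \<Longrightarrow> g x = 0" using test_funE[OF g] by metis
  obtain B where B: "\<And>x. \<bar>g x\<bar> \<le> B * wt 0 x" using rapidD[OF test_fun_rapid[OF g]] by metis
  show ?thesis
    by (rule loc_int_mult[OF f rapid_measurable[OF test_fun_rapid[OF g]] R]) (use B in \<open>auto simp: wt_def\<close>)
qed

text \<open>The densities of the positive and the negative part are finite measures that agree on
  the open sets, an intersection-stable generator, and hence everywhere. Comparing them on {f > 0}
  and on {f < 0} shows that both sets are null.\<close>

lemma AE_zero_if_open_integrals_zero:
  fixes f :: "'a::euclidean_space \<Rightarrow> real"
  assumes f: "integrable lborel f" and U: "\<And>U. open U \<Longrightarrow> (\<integral>x. indicator U x * f x \<partial>lborel) = 0"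
  shows "AE x in lborel. f x = 0"
proof -
  have [measurable]: "f \<in> borel_measurable borel" using f by (auto dest: borel_measurable_integrable)
  let ?p = "density lborel (\<lambda>x. ennreal (f x))" and ?m = "density lborel (\<lambda>x. ennreal (- f x))"
  have em: "emeasure ?p V = emeasure ?m V" if V: "open V" for V
  proof -
    have [measurable]: "V \<in> sets borel" using V by simp
    have i: "integrable lborel (\<lambda>x. indicator V x * f x)"
      using integrable_mult_indicator[of V lborel f] f by simp
    have "emeasure ?p V = (\<integral>\<^sup>+x. ennreal (indicator V x * f x) \<partial>lborel)"
      "emeasure ?m V = (\<integral>\<^sup>+x. ennreal (- (indicator V x * f x)) \<partial>lborel)"
      by (auto simp: emeasure_density intro!: nn_integral_cong split: split_indicator)
    moreover have "(\<integral>x. indicator V x * f x \<partial>lborel) = enn2real (\<integral>\<^sup>+x. ennreal (indicator V x * f x) \<partial>lborel) - enn2real (\<integral>\<^sup>+x. ennreal (- (indicator V x * f x)) \<partial>lborel)"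
      by (rule real_lebesgue_integral_def[OF i])
    moreover have "(\<integral>\<^sup>+x. ennreal (indicator V x * f x) \<partial>lborel) < top" "(\<integral>\<^sup>+x. ennreal (- (indicator V x * f x)) \<partial>lborel) < top"
      using i by (auto simp: real_integrable_def less_top)
    ultimately show ?thesis using U[OF V] by (metis eq_iff_diff_eq_0 ennreal_enn2real)
  qed
  have fin: "emeasure ?p UNIV \<noteq> \<infinity>"
    using f by (simp add: emeasure_density real_integrable_def)
  have eq: "?p = ?m"
  proof (rule measure_eqI_generator_eq[where E="{S. open S}" and \<Omega>=UNIV and A="\<lambda>_. UNIV"])
    show "Int_stable {S::'a set. open S}" by (auto simp: Int_stable_def)
    show "sets ?p = sigma_sets UNIV {S::'a set. open S}" "sets ?m = sigma_sets UNIV {S::'a set. open S}"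
      by (simp_all add: borel_def)
  qed (use em fin in auto)
  define A where "A = {x. 0 < f x}"
  have [measurable]: "A \<in> sets borel" unfolding A_def by measurable
  have "(\<integral>\<^sup>+x. ennreal (f x) * indicator A x \<partial>lborel) = (\<integral>\<^sup>+x. ennreal (- f x) * indicator A x \<partial>lborel)"
    using arg_cong[OF eq, of "\<lambda>M. emeasure M A"] by (simp add: emeasure_density)
  also have "\<dots> = 0" by (auto simp: A_def indicator_def nn_integral_0_iff_AE ennreal_neg)
  finally have "AE x in lborel. ennreal (f x) * indicator A x = 0" by (simp add: nn_integral_0_iff_AE)
  then have 1: "AE x in lborel. f x \<le> 0" by eventually_elim (auto simp: A_def indicator_def ennreal_eq_0_iff split: if_splits)
  define A' where "A' = {x. f x < 0}"
  have [measurable]: "A' \<in> sets borel" unfolding A'_def by measurable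
  have "(\<integral>\<^sup>+x. ennreal (- f x) * indicator A' x \<partial>lborel) = (\<integral>\<^sup>+x. ennreal (f x) * indicator A' x \<partial>lborel)"
    using arg_cong[OF eq, of "\<lambda>M. emeasure M A'"] by (simp add: emeasure_density)
  also have "\<dots> = 0" by (auto simp: A'_def indicator_def nn_integral_0_iff_AE ennreal_neg)
  finally have "AE x in lborel. ennreal (- f x) * indicator A' x = 0" by (simp add: nn_integral_0_iff_AE)
  then have "AE x in lborel. 0 \<le> f x" by eventually_elim (auto simp: A'_def indicator_def ennreal_eq_0_iff split: if_splits)
  with 1 show ?thesis by eventually_elim simp
qed

text \<open>The indicator of a bounded open set is the limit of the continuous functions min(1, k
  dist(x, complement)), which are supported in the closure of the set.\<close>

lemma AE_zero_if_continuous_integrals_zero: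
  fixes f :: "real^'n \<Rightarrow> real"
  assumes f: "loc_int f"
    and g: "\<And>g R. continuous_on UNIV g \<Longrightarrow> (\<And>x. R < norm x \<Longrightarrow> g x = 0) \<Longrightarrow> (\<integral>x. f x * g x \<partial>lborel) = 0"
  shows "AE x in lborel. f x = 0"
proof -
  note [measurable] = loc_int_measurable[OF f]
  have open0: "(\<integral>x. indicator V x * f x \<partial>lborel) = 0" if V: "open V" and VR: "V \<subseteq> cball 0 R" for V R
  proof -
    have [measurable]: "V \<in> sets borel" using V by simp
    define g where "g k x = min 1 (real k * infdist x (- V))" for k x
    have ne: "- V \<noteq> {}" using VR bounded_cball bounded_subset not_bounded_UNIV by (metis Compl_empty_eq double_compl)
    have gc: "continuous_on UNIV (g k)" for k unfolding g_def by (intro continuous_intros)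
    have gz: "g k x = 0" if "x \<notin> V" for k x using that ne by (simp add: g_def)
    have g01: "\<bar>g k x\<bar> \<le> 1" for k x using infdist_nonneg[of x "-V"] by (auto simp: g_def)
    have [measurable]: "g k \<in> borel_measurable borel" for k using gc by (rule borel_measurable_continuous_onI)
    have "(\<integral>x. f x * g k x \<partial>lborel) = 0" for k
      by (rule g[OF gc, of R]) (use gz VR in force)
    moreover have "(\<lambda>k. \<integral>x. f x * g k x \<partial>lborel) \<longlonglongrightarrow> (\<integral>x. indicator V x * f x \<partial>lborel)"
    proof (rule integral_dominated_convergence[where w="\<lambda>x. \<bar>indicator (cball 0 R) x * f x\<bar>"])
      show "integrable lborel (\<lambda>x. \<bar>indicator (cball 0 R) x * f x\<bar>)" using f unfolding loc_int_def by (intro integrable_abs) blast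
      show "AE x in lborel. (\<lambda>k. f x * g k x) \<longlonglongrightarrow> indicator V x * f x"
      proof (rule AE_I2)
        fix x
        show "(\<lambda>k. f x * g k x) \<longlonglongrightarrow> indicator V x * f x"
        proof (cases "x \<in> V")
          case True
          have "closed (- V)" using V by (simp add: closed_Compl)
          then have pos: "0 < infdist x (- V)"
            using True ne in_closed_iff_infdist_zero[of "-V" x] infdist_nonneg[of x "-V"] by force
          obtain K :: nat where K: "1 / infdist x (- V) \<le> real K" using real_arch_simple by blast
          have "g k x = 1" if "K \<le> k" for k
          proof -
            have "1 / infdist x (- V) \<le> real k" using K that by simp
            then show ?thesis using pos by (simp add: g_def pos_divide_le_eq)
          qed
          then have "\<forall>\<^sub>F k in sequentially. f x * g k x = indicator V x * f x"
            using True by (intro eventually_sequentiallyI[of K]) simp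
          then show ?thesis by (rule tendsto_eventually)
        qed (simp add: gz)
      qed
      show "AE x in lborel. norm (f x * g k x) \<le> \<bar>indicator (cball 0 R) x * f x\<bar>" for k
      proof (rule AE_I2)
        fix x
        show "norm (f x * g k x) \<le> \<bar>indicator (cball 0 R) x * f x\<bar>"
          using gz[of x k] g01[of k x] subsetD[OF VR, of x] by (cases "x \<in> V") (auto simp: abs_mult intro!: mult_left_le)
      qed
    qed measurable
    ultimately show ?thesis by (simp add: LIMSEQ_const_iff)
  qed
  have "AE x in lborel. indicator (ball 0 (real k)) x * f x = 0" for k
  proof (rule AE_zero_if_open_integrals_zero)
    have [measurable]: "ball (0::real^'n) (real k) \<in> sets borel" by simp
    show "integrable lborel (\<lambda>x. indicator (ball 0 (real k)) x * f x)"
      using loc_int_mult[OF f, of "indicator (ball 0 (real k))" "real k" 1]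
      by (simp add: mult.commute indicator_def)
    fix U :: "(real^'n) set" assume "open U"
    then have "(\<integral>x. indicator (U \<inter> ball 0 (real k)) x * f x \<partial>lborel) = 0"
      by (intro open0[of _ "real k"]) auto
    then show "(\<integral>x. indicator U x * (indicator (ball 0 (real k)) x * f x) \<partial>lborel) = 0"
      by (simp add: indicator_inter_arith mult.assoc)
  qed
  then have "AE x in lborel. \<forall>k. indicator (ball 0 (real k)) x * f x = 0" by (subst AE_all_countable) blast
  then show ?thesis
  proof eventually_elim
    fix x assume *: "\<forall>k. indicator (ball 0 (real k)) x * f x = 0"
    obtain k where "norm x < real k" using reals_Archimedean2 by blast
    then show "f x = 0" using *[rule_format, of k] by simp
  qed
qed

text \<open>The test functions are the translates and dilates of a single bump \<theta>. Integrating
  the hypothesis over \<open>y\<close> against a continuous \<open>g\<close> of bounded support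
  gives zero for the pairing of \<open>f\<close> with the mollification of \<open>g\<close>; as e
  tends to 0 this mollification tends to \<open>g\<close> times the integral of \<theta>, which is
  positive because \<theta> is 1 on the unit ball.\<close>

lemma fundamental_lemma_calculus_of_variations:
  fixes f \<theta> :: "real^'n \<Rightarrow> real"
  assumes f: "loc_int f" and \<theta>: "test_fun \<theta>" "\<And>x. 0 \<le> \<theta> x" "\<And>x. norm x < 1 \<Longrightarrow> \<theta> x = 1"
    and zero: "\<And>e y. 0 < e \<Longrightarrow> (\<integral>x. f x * \<theta> ((1/e) *\<^sub>R (x - y)) \<partial>lborel) = 0"
  shows "AE x in lborel. f x = 0"
proof (rule AE_zero_if_continuous_integrals_zero[OF f])
  fix g :: "real^'n \<Rightarrow> real" and R assume g: "continuous_on UNIV g" "\<And>x. R < norm x \<Longrightarrow> g x = 0"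
  note [measurable] = loc_int_measurable[OF f] rapid_measurable[OF test_fun_rapid[OF \<theta>(1)]]
  have [measurable]: "g \<in> borel_measurable borel" using g(1) by (rule borel_measurable_continuous_onI)
  obtain S where S: "0 < S" "\<And>x. S < norm x \<Longrightarrow> \<theta> x = 0" using test_funE[OF \<theta>(1)] by blast
  have i\<theta>: "integrable lborel \<theta>" by (rule test_fun_integrable[OF \<theta>(1)])
  have "bounded (g ` cball 0 R)"
    by (intro compact_imp_bounded compact_continuous_image continuous_on_subset[OF g(1)]) auto
  then obtain B where B: "\<And>x. norm x \<le> R \<Longrightarrow> \<bar>g x\<bar> \<le> B" by (force simp: bounded_iff)
  define B' where "B' = max B 0"
  have B': "\<bar>g x\<bar> \<le> B'" "0 \<le> B'" for x using B[of x] g(2)[of x] by (cases "norm x \<le> R"; force simp: B'_def)+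
  \<comment> \<open>The mollification of \<open>g\<close> at scale \<open>e\<close>, up to the
    factor given by the integral of \<theta>. For e <= 1 its support stays in the ball of radius R +
    S, so one multiple of |f| on that ball dominates throughout the limit.\<close>
  let ?h = "\<lambda>e x. \<integral>z. g (x - e *\<^sub>R z) * \<theta> z \<partial>lborel"
  have hb: "\<bar>?h e x\<bar> \<le> B' * (\<integral>z. \<theta> z \<partial>lborel)" for e x
  proof -
    have "\<bar>?h e x\<bar> \<le> (\<integral>z. B' * \<theta> z \<partial>lborel)"
    proof -
      have "\<bar>?h e x\<bar> \<le> (\<integral>z. \<bar>g (x - e *\<^sub>R z) * \<theta> z\<bar> \<partial>lborel)" by (rule integral_abs_bound)
      also have "\<dots> \<le> (\<integral>z. B' * \<theta> z \<partial>lborel)"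
        using B' \<theta>(2) i\<theta> by (intro integral_mono' ) (auto simp: abs_mult intro!: mult_right_mono)
      finally show ?thesis .
    qed
    then show ?thesis by simp
  qed
  have hz: "?h e x = 0" if "0 < e" "e \<le> 1" "R + S < norm x" for e x
  proof -
    have "g (x - e *\<^sub>R z) * \<theta> z = 0" for z
    proof (cases "S < norm z")
      case False
      have "norm (e *\<^sub>R z) \<le> 1 * S" unfolding norm_scaleR using that False S by (intro mult_mono) auto
      then have "R < norm (x - e *\<^sub>R z)" using that norm_triangle_ineq2[of x "e *\<^sub>R z"] by linarith
      then show ?thesis using g(2) by simp
    qed (use S in simp)
    then show ?thesis by (simp only: Bochner_Integration.integral_zero)
  qed
  have zero': "(\<integral>x. f x * ?h e x \<partial>lborel) = 0" if e: "0 < e" "e \<le> 1" for e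
  proof -
    have "integrable (lborel \<Otimes>\<^sub>M lborel) (\<lambda>(y, x). g y * (f x * \<theta> ((1/e) *\<^sub>R (x - y))))"
    proof (rule integrableI_bounded)
      have th: "\<exists>C. \<forall>x. \<bar>\<theta> x\<bar> \<le> C" using rapidD[OF test_fun_rapid[OF \<theta>(1)], of 0] by (metis wt_def power_0 div_by_1 mult.right_neutral)
      then obtain C where C: "\<And>x. \<bar>\<theta> x\<bar> \<le> C" by blast
      have "(\<integral>\<^sup>+z. ennreal (norm (case z of (y, x) \<Rightarrow> g y * (f x * \<theta> ((1/e) *\<^sub>R (x - y))))) \<partial>(lborel \<Otimes>\<^sub>M lborel))
        \<le> (\<integral>\<^sup>+z. (case z of (y, x) \<Rightarrow> ennreal \<bar>g y\<bar> * (ennreal C * ennreal \<bar>indicator (cball 0 (R + S)) x * f x\<bar>)) \<partial>(lborel \<Otimes>\<^sub>M lborel))"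
      proof (intro nn_integral_mono)
        fix w :: "(real^'n) \<times> (real^'n)"
        obtain y x where w: "w = (y, x)" by force
        have "\<bar>g y * (f x * \<theta> ((1/e) *\<^sub>R (x - y)))\<bar> \<le> \<bar>g y\<bar> * (C * \<bar>indicator (cball 0 (R + S)) x * f x\<bar>)"
        proof (cases "norm x \<le> R + S")
          case True
          then show ?thesis using C[of "(1/e) *\<^sub>R (x - y)"] by (auto simp: abs_mult mult.commute[of "\<bar>f x\<bar>"] intro!: mult_left_mono mult_right_mono)
        next
          case False
          have "g y * \<theta> ((1/e) *\<^sub>R (x - y)) = 0"
          proof (cases "R < norm y")
            case F: False
            have "S < norm (x - y)" using False F norm_triangle_ineq2[of x y] by linarith
            also have "\<dots> \<le> (1/e) * norm (x - y)" using e mult_right_mono[of 1 "1/e" "norm (x - y)"] by simp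
            finally show ?thesis using S(2)[of "(1/e) *\<^sub>R (x - y)"] e by simp
          qed (use g in simp)
          then show ?thesis using False by auto
        qed
        then show "ennreal (norm (case w of (y, x) \<Rightarrow> g y * (f x * \<theta> ((1/e) *\<^sub>R (x - y)))))
            \<le> (case w of (y, x) \<Rightarrow> ennreal \<bar>g y\<bar> * (ennreal C * ennreal \<bar>indicator (cball 0 (R + S)) x * f x\<bar>))"
          using order_trans[OF abs_ge_zero C[of 0]]
          by (simp add: w ennreal_mult[symmetric] ennreal_leI del: abs_mult)
      qed
      also have "\<dots> = (\<integral>\<^sup>+y. \<integral>\<^sup>+x. ennreal \<bar>g y\<bar> * (ennreal C * ennreal \<bar>indicator (cball 0 (R + S)) x * f x\<bar>) \<partial>lborel \<partial>lborel)"
      proof -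
        have "(\<lambda>z. case z of (y, x) \<Rightarrow> ennreal \<bar>g y\<bar> * (ennreal C * ennreal \<bar>indicator (cball 0 (R + S)) x * f x\<bar>)) \<in> borel_measurable (lborel \<Otimes>\<^sub>M lborel)"
          by measurable
        from lborel.nn_integral_fst[OF this] show ?thesis by simp
      qed
      also have "\<dots> = (\<integral>\<^sup>+y. ennreal \<bar>g y\<bar> \<partial>lborel) * (ennreal C * (\<integral>\<^sup>+x. ennreal \<bar>indicator (cball 0 (R + S)) x * f x\<bar> \<partial>lborel))"
        by (simp add: nn_integral_cmult nn_integral_multc del: abs_mult)
      also have "\<dots> < \<infinity>"
      proof -
        have "integrable lborel g"
        proof -
          have l1: "loc_int (\<lambda>x::real^'n. 1)"
            unfolding loc_int_def by (auto intro!: integrable_real_indicator emeasure_bounded_finite)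
          have "integrable lborel (\<lambda>x. 1 * g x)"
            by (rule loc_int_mult[OF l1 _ g(2) B'(1)]) measurable
          then show ?thesis by simp
        qed
        then have "(\<integral>\<^sup>+y. ennreal \<bar>g y\<bar> \<partial>lborel) < \<infinity>" by (simp add: integrable_iff_bounded)
        moreover have "(\<integral>\<^sup>+x. ennreal \<bar>indicator (cball 0 (R + S)) x * f x\<bar> \<partial>lborel) < \<infinity>"
          using f unfolding loc_int_def integrable_iff_bounded by simp
        ultimately show ?thesis by (simp add: ennreal_mult_less_top)
      qed
      finally show "(\<integral>\<^sup>+z. ennreal (norm (case z of (y, x) \<Rightarrow> g y * (f x * \<theta> ((1/e) *\<^sub>R (x - y))))) \<partial>(lborel \<Otimes>\<^sub>M lborel)) < \<infinity>" .
    qed measurable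
    from lborel_pair.Fubini_integral[OF this]
    have "(\<integral>x. \<integral>y. g y * (f x * \<theta> ((1/e) *\<^sub>R (x - y))) \<partial>lborel \<partial>lborel) = (\<integral>y. \<integral>x. g y * (f x * \<theta> ((1/e) *\<^sub>R (x - y))) \<partial>lborel \<partial>lborel)" .
    also have "\<dots> = 0" using zero[OF e(1)] by simp
    finally have "(\<integral>x. \<integral>y. g y * (f x * \<theta> ((1/e) *\<^sub>R (x - y))) \<partial>lborel \<partial>lborel) = 0" .
    moreover have "(\<integral>y. g y * (f x * \<theta> ((1/e) *\<^sub>R (x - y))) \<partial>lborel) = e ^ CARD('n) * (f x * ?h e x)" for x
    proof -
      have "f x * ?h e x = (\<integral>z. f x * (g (x - e *\<^sub>R z) * \<theta> z) \<partial>lborel)" by simp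
      also have "\<dots> = (\<integral>z. (\<lambda>y. g y * (f x * \<theta> ((1/e) *\<^sub>R (x - y)))) (x + (-e) *\<^sub>R z) \<partial>lborel)"
        using e by (simp add: mult_ac)
      also have "\<dots> = (1 / e ^ CARD('n)) * (\<integral>y. g y * (f x * \<theta> ((1/e) *\<^sub>R (x - y))) \<partial>lborel)"
        using e by (subst integral_lborel_affine) simp_all
      finally show ?thesis using e by simp
    qed
    ultimately show ?thesis using e by simp
  qed
  have "(\<lambda>k. \<integral>x. f x * ?h (1 / real (Suc k)) x \<partial>lborel) \<longlonglongrightarrow> (\<integral>x. f x * (g x * (\<integral>z. \<theta> z \<partial>lborel)) \<partial>lborel)"
  proof (rule integral_dominated_convergence[where w="\<lambda>x. (B' * (\<integral>z. \<theta> z \<partial>lborel)) * \<bar>indicator (cball 0 (R + S)) x * f x\<bar>"])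
    show "integrable lborel (\<lambda>x. (B' * (\<integral>z. \<theta> z \<partial>lborel)) * \<bar>indicator (cball 0 (R + S)) x * f x\<bar>)"
      using f unfolding loc_int_def by (intro integrable_mult_right integrable_abs) blast
    show "AE x in lborel. norm (f x * ?h (1 / real (Suc k)) x) \<le> (B' * (\<integral>z. \<theta> z \<partial>lborel)) * \<bar>indicator (cball 0 (R + S)) x * f x\<bar>" for k
    proof (rule AE_I2)
      fix x
      show "norm (f x * ?h (1 / real (Suc k)) x) \<le> (B' * (\<integral>z. \<theta> z \<partial>lborel)) * \<bar>indicator (cball 0 (R + S)) x * f x\<bar>"
      proof (cases "norm x \<le> R + S")
        case True
        then show ?thesis using mult_left_mono[OF hb[of x "1 / real (Suc k)"], of "\<bar>f x\<bar>"] by (simp add: abs_mult mult.commute)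
      next
        case False
        then show ?thesis using hz[of "1 / real (Suc k)" x] by simp
      qed
    qed
    show "AE x in lborel. (\<lambda>k. f x * ?h (1 / real (Suc k)) x) \<longlonglongrightarrow> f x * (g x * (\<integral>z. \<theta> z \<partial>lborel))"
    proof (rule AE_I2)
      fix x
      have "(\<lambda>k. ?h (1 / real (Suc k)) x) \<longlonglongrightarrow> (\<integral>z. g x * \<theta> z \<partial>lborel)"
      proof (rule integral_dominated_convergence[where w="\<lambda>z. B' * \<theta> z"])
        show "AE z in lborel. (\<lambda>k. g (x - (1 / real (Suc k)) *\<^sub>R z) * \<theta> z) \<longlonglongrightarrow> g x * \<theta> z"
        proof (rule AE_I2)
          fix z
          have "(\<lambda>k. x - (1 / real (Suc k)) *\<^sub>R z) \<longlonglongrightarrow> x - 0 *\<^sub>R z"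
            by (intro tendsto_intros LIMSEQ_Suc[OF lim_1_over_n])
          then have "(\<lambda>k. g (x - (1 / real (Suc k)) *\<^sub>R z)) \<longlonglongrightarrow> g x"
            using g(1) by (intro isCont_tendsto_compose[where g=g]) (auto simp: continuous_on_eq_continuous_at)
          then show "(\<lambda>k. g (x - (1 / real (Suc k)) *\<^sub>R z) * \<theta> z) \<longlonglongrightarrow> g x * \<theta> z" by (intro tendsto_intros)
        qed
        show "AE z in lborel. norm (g (x - (1 / real (Suc k)) *\<^sub>R z) * \<theta> z) \<le> B' * \<theta> z" for k
          using B' \<theta>(2) by (auto simp: abs_mult intro!: mult_right_mono)
      qed (use i\<theta> in auto)
      then show "(\<lambda>k. f x * ?h (1 / real (Suc k)) x) \<longlonglongrightarrow> f x * (g x * (\<integral>z. \<theta> z \<partial>lborel))"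
        by (intro tendsto_intros) simp
    qed
  qed measurable
  moreover have "(\<integral>x. f x * ?h (1 / real (Suc k)) x \<partial>lborel) = 0" for k by (rule zero') auto
  ultimately have "(\<integral>x. f x * (g x * (\<integral>z. \<theta> z \<partial>lborel)) \<partial>lborel) = 0" by (simp add: LIMSEQ_const_iff)
  then have "(\<integral>x. f x * g x \<partial>lborel) * (\<integral>z. \<theta> z \<partial>lborel) = 0" by (simp add: mult.assoc[symmetric])
  moreover have "(\<integral>z. \<theta> z \<partial>lborel) > 0"
  proof -
    have "0 < measure lborel (ball (0::real^'n) 1)" by (simp add: content_ball_pos)
    also have "\<dots> = (\<integral>z. indicator (ball (0::real^'n) 1) z \<partial>lborel)" by simp
    also have "\<dots> \<le> (\<integral>z. \<theta> z \<partial>lborel)"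
      using \<theta>(2,3) i\<theta> by (intro integral_mono') (auto simp: indicator_def)
    finally show ?thesis .
  qed
  ultimately show "(\<integral>x. f x * g x \<partial>lborel) = 0" by simp
qed

subsection \<open>Increments of weakly differentiable functions\<close>

text \<open>Joint integrability for the exchange of the line parameter with the space variable. For
  \<open>t\<close> in the unit interval the support of the translated \<open>k\<close> stays in the
  ball of radius R + |h|; the second function arises from the first by translating
  \<open>x\<close>.\<close>

lemma loc_int_translates:
  fixes v k :: "real^'n \<Rightarrow> real"
  assumes v: "loc_int v" and [measurable]: "k \<in> borel_measurable borel"
    and k: "\<And>x. R < norm x \<Longrightarrow> k x = 0" "\<And>x. \<bar>k x\<bar> \<le> B"
  shows "integrable (lborel \<Otimes>\<^sub>M lborel) (\<lambda>(t::real, x). indicator {0..1} t * (v x * k (x + t *\<^sub>R h)))" (is ?I1)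
    and "integrable (lborel \<Otimes>\<^sub>M lborel) (\<lambda>(t::real, x). indicator {0..1} t * (v (x - t *\<^sub>R h) * k x))" (is ?I2)
proof -
  note [measurable] = loc_int_measurable[OF v]
  have B: "0 \<le> B" using order_trans[OF abs_ge_zero k(2)] .
  let ?v = "\<lambda>x. indicator (cball 0 (R + norm h)) x * v x"
  have le: "indicator {0..1} t * ennreal \<bar>v x * k (x + t *\<^sub>R h)\<bar> \<le> indicator {0..1} t * (ennreal B * ennreal \<bar>?v x\<bar>)" for t :: real and x
  proof (cases "t \<in> {0..1}")
    case True
    have "norm (t *\<^sub>R h) \<le> norm h" using True by (auto simp: mult_left_le_one_le)
    then have "R < norm (x + t *\<^sub>R h)" if "R + norm h < norm x"
      using that norm_diff_ineq[of x "t *\<^sub>R h"] by linarith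
    then have "\<bar>v x * k (x + t *\<^sub>R h)\<bar> \<le> B * \<bar>?v x\<bar>"
      using k(1)[of "x + t *\<^sub>R h"] mult_left_mono[OF k(2)[of "x + t *\<^sub>R h"], of "\<bar>v x\<bar>"]
      by (cases "norm x \<le> R + norm h") (auto simp: abs_mult mult.commute)
    then show ?thesis using B by (auto simp: ennreal_mult[symmetric] intro!: mult_left_mono ennreal_leI)
  qed simp
  have "(\<integral>\<^sup>+x. ennreal \<bar>?v x\<bar> \<partial>lborel) < top"
    using v unfolding loc_int_def integrable_iff_bounded by (simp add: less_top)
  moreover have "(\<integral>\<^sup>+(t::real). \<integral>\<^sup>+x. indicator {0..1} t * ennreal \<bar>v x * k (x + t *\<^sub>R h)\<bar> \<partial>lborel \<partial>lborel)
     \<le> (\<integral>\<^sup>+(t::real). \<integral>\<^sup>+x. indicator {0..1} t * (ennreal B * ennreal \<bar>?v x\<bar>) \<partial>lborel \<partial>lborel)"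
    by (intro nn_integral_mono le)
  moreover have "\<dots> = ennreal B * (\<integral>\<^sup>+x. ennreal \<bar>?v x\<bar> \<partial>lborel)"
    by (simp add: nn_integral_cmult nn_integral_multc del: abs_mult)
  ultimately have fin: "(\<integral>\<^sup>+(t::real). \<integral>\<^sup>+x. indicator {0..1} t * ennreal \<bar>v x * k (x + t *\<^sub>R h)\<bar> \<partial>lborel \<partial>lborel) < \<infinity>"
    by (auto simp: ennreal_mult_less_top le_less_trans)
  show ?I1
  proof (rule integrableI_bounded)
    show "(\<lambda>(t::real, x). indicator {0..1} t * (v x * k (x + t *\<^sub>R h))) \<in> borel_measurable (lborel \<Otimes>\<^sub>M lborel)" by measurable
    have "(\<lambda>z. ennreal (norm (case z of (t::real, x) \<Rightarrow> indicator {0..1} t * (v x * k (x + t *\<^sub>R h))))) \<in> borel_measurable (lborel \<Otimes>\<^sub>M lborel)" by measurable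
    from lborel.nn_integral_fst[OF this, symmetric]
    have "(\<integral>\<^sup>+z. ennreal (norm (case z of (t::real, x) \<Rightarrow> indicator {0..1} t * (v x * k (x + t *\<^sub>R h)))) \<partial>(lborel \<Otimes>\<^sub>M lborel))
      = (\<integral>\<^sup>+(t::real). \<integral>\<^sup>+x. indicator {0..1} t * ennreal \<bar>v x * k (x + t *\<^sub>R h)\<bar> \<partial>lborel \<partial>lborel)"
      by (auto intro!: nn_integral_cong split: split_indicator)
    with fin show "(\<integral>\<^sup>+z. ennreal (norm (case z of (t::real, x) \<Rightarrow> indicator {0..1} t * (v x * k (x + t *\<^sub>R h)))) \<partial>(lborel \<Otimes>\<^sub>M lborel)) < \<infinity>" by simp
  qed
  show ?I2
  proof (rule integrableI_bounded)
    show "(\<lambda>(t::real, x). indicator {0..1} t * (v (x - t *\<^sub>R h) * k x)) \<in> borel_measurable (lborel \<Otimes>\<^sub>M lborel)" by measurable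
    have "(\<lambda>z. ennreal (norm (case z of (t::real, x) \<Rightarrow> indicator {0..1} t * (v (x - t *\<^sub>R h) * k x)))) \<in> borel_measurable (lborel \<Otimes>\<^sub>M lborel)" by measurable
    from lborel.nn_integral_fst[OF this, symmetric]
    have "(\<integral>\<^sup>+z. ennreal (norm (case z of (t::real, x) \<Rightarrow> indicator {0..1} t * (v (x - t *\<^sub>R h) * k x))) \<partial>(lborel \<Otimes>\<^sub>M lborel))
      = (\<integral>\<^sup>+(t::real). \<integral>\<^sup>+x. indicator {0..1} t * ennreal \<bar>v (x - t *\<^sub>R h) * k x\<bar> \<partial>lborel \<partial>lborel)"
      by (auto intro!: nn_integral_cong split: split_indicator)
    also have "\<dots> = (\<integral>\<^sup>+(t::real). \<integral>\<^sup>+x. (\<lambda>y. indicator {0..1} t * ennreal \<bar>v y * k (y + t *\<^sub>R h)\<bar>) (x - t *\<^sub>R h) \<partial>lborel \<partial>lborel)"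
      by simp
    also have "\<dots> = (\<integral>\<^sup>+(t::real). \<integral>\<^sup>+x. indicator {0..1} t * ennreal \<bar>v x * k (x + t *\<^sub>R h)\<bar> \<partial>lborel \<partial>lborel)"
      by (intro nn_integral_cong nn_integral_lborel_shift) measurable
    finally show "(\<integral>\<^sup>+z. ennreal (norm (case z of (t::real, x) \<Rightarrow> indicator {0..1} t * (v (x - t *\<^sub>R h) * k x))) \<partial>(lborel \<Otimes>\<^sub>M lborel)) < \<infinity>"
      using fin by simp
  qed
qed

section \<open>Stability of local integrability\<close>

lemma loc_int_cmult: "loc_int f \<Longrightarrow> loc_int (\<lambda>x. c * f x)"
  unfolding loc_int_def by (auto simp: mult.left_commute)

lemma loc_int_add: assumes f: "loc_int f" and g: "loc_int g" shows "loc_int (\<lambda>x. f x + g x)"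
proof -
  note [measurable] = loc_int_measurable[OF f] loc_int_measurable[OF g]
  show ?thesis using f g unfolding loc_int_def by (auto simp: distrib_left)
qed

lemma loc_int_diff: "loc_int f \<Longrightarrow> loc_int g \<Longrightarrow> loc_int (\<lambda>x. f x - g x)"
  using loc_int_add[OF _ loc_int_cmult[of g "-1"]] by simp

lemma loc_int_sum:
  "finite I \<Longrightarrow> (\<And>i. i \<in> I \<Longrightarrow> loc_int (f i)) \<Longrightarrow> loc_int (\<lambda>x. \<Sum>i\<in>I. f i x)"
proof (induction I rule: finite_induct)
  case empty show ?case by (simp add: loc_int_def)
next
  case (insert i I) then show ?case by (simp add: loc_int_add)
qed

lemma loc_int_shift: assumes f: "loc_int f" shows "loc_int (\<lambda>x. f (x - h))"
  unfolding loc_int_def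
proof (intro conjI allI)
  note [measurable] = loc_int_measurable[OF f]
  show "(\<lambda>x. f (x - h)) \<in> borel_measurable borel" by measurable
  fix R
  have m: "(\<lambda>y. indicator (cball 0 R) (y + h)) \<in> borel_measurable borel"
    using measurable_compose[of "\<lambda>y. y + h" borel borel "indicator (cball 0 R)"] by simp
  have z: "indicator (cball 0 R) (y + h) = (0::real)" if "R + norm h < norm y" for y
    using that norm_diff_ineq[of y h] by (auto simp: indicator_def)
  have "integrable lborel (\<lambda>y. f y * indicator (cball 0 R) (y + h))"
    by (rule loc_int_mult[OF f m z, where B=1]) (auto simp: indicator_def)
  from integrable_lborel_shift[OF this, of h]
  show "integrable lborel (\<lambda>x. indicator (cball 0 R) x * f (x - h))" by (simp add: mult.commute)
qed

lemma loc_int_line_average: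
  fixes f :: "real^'n \<Rightarrow> real"
  assumes f: "loc_int f" shows "loc_int (\<lambda>x. \<integral>(t::real). indicator {0..1} t * f (x - t *\<^sub>R h) \<partial>lborel)"
  unfolding loc_int_def
proof (intro conjI allI)
  note [measurable] = loc_int_measurable[OF f]
  show "(\<lambda>x. \<integral>(t::real). indicator {0..1} t * f (x - t *\<^sub>R h) \<partial>lborel) \<in> borel_measurable borel" by measurable
  fix R
  have m: "(indicator (cball 0 R) :: real^'n \<Rightarrow> real) \<in> borel_measurable borel" by simp
  have "integrable (lborel \<Otimes>\<^sub>M lborel) (\<lambda>(t::real, x). indicator {0..1} t * (f (x - t *\<^sub>R h) * indicator (cball 0 R) x))"
    by (rule loc_int_translates(2)[OF f m, of R 1]) (auto simp: indicator_def)
  from lborel_pair.integrable_snd[OF this]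
  show "integrable lborel (\<lambda>x. indicator (cball 0 R) x * (\<integral>(t::real). indicator {0..1} t * f (x - t *\<^sub>R h) \<partial>lborel))"
    by (simp only: mult.assoc[symmetric] integral_mult_left_zero mult.commute[of "indicator (cball 0 R) _"])
qed

lemma partial_translate:
  assumes "smooth_fun f" shows "partial (\<lambda>x. f (x + h)) j x = partial f j (x + h)"
proof -
  have "((\<lambda>x. f (x + h)) has_derivative (\<lambda>k. grad f (x + h) \<bullet> k)) (at x)"
  proof -
    have "((\<lambda>x. x + h) has_derivative (\<lambda>k. k)) (at x)" by (auto intro!: derivative_eq_intros)
    from diff_chain_at[OF this smooth_fun_has_derivative[OF assms]] show ?thesis by (simp add: o_def)
  qed
  from partial_eqI[OF this] show ?thesis by simp
qed

lemma smooth_fun_line_integral: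
  fixes f :: "real^'n \<Rightarrow> real"
  assumes f: "smooth_fun f"
  shows "has_bochner_integral lborel (\<lambda>t::real. indicator {0..1} t * (grad f (x + t *\<^sub>R h) \<bullet> h)) (f (x + h) - f x)"
proof -
  have "((\<lambda>t. f (x + t *\<^sub>R h)) has_real_derivative grad f (x + t *\<^sub>R h) \<bullet> h) (at t within {0..1})" for t
  proof -
    have "((\<lambda>t. x + t *\<^sub>R h) has_derivative (\<lambda>s. s *\<^sub>R h)) (at t)" by (auto intro!: derivative_eq_intros)
    from diff_chain_at[OF this smooth_fun_has_derivative[OF f]]
    have "((\<lambda>t. f (x + t *\<^sub>R h)) has_derivative (\<lambda>s. s * (grad f (x + t *\<^sub>R h) \<bullet> h))) (at t)" by (simp add: o_def)
    then have "((\<lambda>t. f (x + t *\<^sub>R h)) has_derivative (*) (grad f (x + t *\<^sub>R h) \<bullet> h)) (at t)"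
      by (rule has_derivative_eq_rhs) (simp add: fun_eq_iff)
    then show ?thesis unfolding has_field_derivative_def by (rule has_derivative_at_withinI)
  qed
  moreover have "continuous_on {0..1} (\<lambda>t. grad f (x + t *\<^sub>R h) \<bullet> h)"
    by (intro continuous_intros continuous_on_compose2[OF smooth_fun_grad_continuous[OF f, of UNIV]]) auto
  ultimately show ?thesis
    using has_bochner_integral_FTC_Icc[of 0 1 "\<lambda>t. f (x + t *\<^sub>R h)" "\<lambda>t. grad f (x + t *\<^sub>R h) \<bullet> h"]
    by (auto simp: has_real_derivative_iff_has_vector_derivative)
qed

lemma test_fun_bounds:
  assumes "test_fun f" obtains R B where "\<And>x. R < norm x \<Longrightarrow> f x = 0" "\<And>x. \<bar>f x\<bar> \<le> B" "f \<in> borel_measurable borel"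
proof -
  obtain R where "\<And>x. R < norm x \<Longrightarrow> f x = 0" using test_funE[OF assms] by metis
  moreover obtain B where "\<And>x. \<bar>f x\<bar> \<le> B * wt 0 x" using rapidD[OF test_fun_rapid[OF assms]] by metis
  ultimately show thesis using that[of R B] rapid_measurable[OF test_fun_rapid[OF assms]] by (simp add: wt_def)
qed

text \<open>Against a test function \<zeta> the translation is moved to \<zeta>, the increment of
  \<zeta> is written as a line integral of its gradient, the definition of the weak gradient is
  applied to each translate of \<zeta>, and the translation is moved back to \<open>g\<close>. The
  fundamental lemma removes \<zeta>.\<close>

lemma weak_gradient_increment:
  fixes v \<theta> :: "real^'n \<Rightarrow> real" and g :: "'n \<Rightarrow> real^'n \<Rightarrow> real"
  assumes v: "loc_int v" and g: "\<And>j. loc_int (g j)"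
    and weak: "\<And>\<zeta> j. test_fun \<zeta> \<Longrightarrow> (\<integral>x. v x * partial \<zeta> j x \<partial>lborel) = - (\<integral>x. g j x * \<zeta> x \<partial>lborel)"
    and \<theta>: "test_fun \<theta>" "\<And>x. 0 \<le> \<theta> x" "\<And>x. norm x < 1 \<Longrightarrow> \<theta> x = 1"
  shows "AE x in lborel. v x - v (x - h) = (\<Sum>j\<in>UNIV. h $ j * (\<integral>t. indicator {0..1} t * g j (x - t *\<^sub>R h) \<partial>lborel))"
proof -
  let ?A = "\<lambda>j x. \<integral>(t::real). indicator {0..1} t * g j (x - t *\<^sub>R h) \<partial>lborel"
  let ?f = "\<lambda>x. v x - v (x - h) - (\<Sum>j\<in>UNIV. h $ j * ?A j x)"
  have lA: "loc_int (\<lambda>x. h $ j * ?A j x)" for j by (intro loc_int_cmult loc_int_line_average g)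
  have lf: "loc_int ?f"
    by (intro loc_int_diff loc_int_sum loc_int_shift lA v) simp
  have main: "(\<integral>x. ?f x * \<zeta> x \<partial>lborel) = 0" if \<zeta>: "test_fun \<zeta>" for \<zeta>
  proof -
    have s\<zeta>: "smooth_fun \<zeta>" by (rule test_fun_smooth[OF \<zeta>])
    have t\<zeta>: "test_fun (\<lambda>x. \<zeta> (x + c))" for c using test_fun_affine[OF \<zeta>, of 1 1 c] by simp
    obtain R B where RB: "\<And>x. R < norm x \<Longrightarrow> \<zeta> x = 0" "\<And>x. \<bar>\<zeta> x\<bar> \<le> B" "\<zeta> \<in> borel_measurable borel"
      using test_fun_bounds[OF \<zeta>] by blast
    have i1: "integrable (lborel \<Otimes>\<^sub>M lborel) (\<lambda>(t::real, x). indicator {0..1} t * (v x * partial \<zeta> j (x + t *\<^sub>R h)))" for j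
    proof -
      obtain R B where "\<And>x. R < norm x \<Longrightarrow> partial \<zeta> j x = 0" "\<And>x. \<bar>partial \<zeta> j x\<bar> \<le> B" "partial \<zeta> j \<in> borel_measurable borel"
        using test_fun_bounds[OF test_fun_partial[OF \<zeta>, of j]] by blast
      then show ?thesis by (intro loc_int_translates(1)[OF v])
    qed
    have i2: "integrable (lborel \<Otimes>\<^sub>M lborel) (\<lambda>(t::real, x). indicator {0..1} t * (g j (x - t *\<^sub>R h) * \<zeta> x))" for j
      by (rule loc_int_translates(2)[OF g RB(3,1,2)])
    have "(\<integral>x. v (x - h) * \<zeta> x \<partial>lborel) = (\<integral>x. (\<lambda>y. v y * \<zeta> (y + h)) (x - h) \<partial>lborel)" by simp
    also have "\<dots> = (\<integral>x. v x * \<zeta> (x + h) \<partial>lborel)" by (rule integral_lborel_shift)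
    finally have "(\<integral>x. v (x - h) * \<zeta> x \<partial>lborel) - (\<integral>x. v x * \<zeta> x \<partial>lborel) = (\<integral>x. v x * (\<zeta> (x + h) - \<zeta> x) \<partial>lborel)"
      by (simp add: right_diff_distrib Bochner_Integration.integral_diff[OF loc_int_test_mult[OF v t\<zeta>] loc_int_test_mult[OF v \<zeta>]])
    also have "\<dots> = (\<integral>x. (\<Sum>j\<in>UNIV. h $ j * (\<integral>(t::real). indicator {0..1} t * (v x * partial \<zeta> j (x + t *\<^sub>R h)) \<partial>lborel)) \<partial>lborel)"
    proof (intro Bochner_Integration.integral_cong refl)
      fix x
      have c: "continuous_on {0..1} (\<lambda>t. v x * partial \<zeta> j (x + t *\<^sub>R h))" for j
        by (intro continuous_intros continuous_on_compose2[OF smooth_fun_continuous[OF smooth_fun_partial[OF s\<zeta>], of UNIV]]) auto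
      have i: "integrable lborel (\<lambda>t::real. indicator {0..1} t * (v x * partial \<zeta> j (x + t *\<^sub>R h)))" for j
        using borel_integrable_atLeastAtMost'[OF c] by (simp add: set_integrable_def)
      have "v x * (\<zeta> (x + h) - \<zeta> x) = v x * (\<integral>(t::real). indicator {0..1} t * (grad \<zeta> (x + t *\<^sub>R h) \<bullet> h) \<partial>lborel)"
        using has_bochner_integral_integral_eq[OF smooth_fun_line_integral[OF s\<zeta>, of x h]] by simp
      also have "\<dots> = (\<integral>(t::real). v x * (indicator {0..1} t * (grad \<zeta> (x + t *\<^sub>R h) \<bullet> h)) \<partial>lborel)" by simp
      also have "\<dots> = (\<integral>(t::real). (\<Sum>j\<in>UNIV. h $ j * (indicator {0..1} t * (v x * partial \<zeta> j (x + t *\<^sub>R h)))) \<partial>lborel)"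
        by (intro Bochner_Integration.integral_cong refl) (simp add: inner_vec_def sum_distrib_left mult_ac)
      also have "\<dots> = (\<Sum>j\<in>UNIV. h $ j * (\<integral>(t::real). indicator {0..1} t * (v x * partial \<zeta> j (x + t *\<^sub>R h)) \<partial>lborel))"
        using i by (subst Bochner_Integration.integral_sum) auto
      finally show "v x * (\<zeta> (x + h) - \<zeta> x) = (\<Sum>j\<in>UNIV. h $ j * (\<integral>(t::real). indicator {0..1} t * (v x * partial \<zeta> j (x + t *\<^sub>R h)) \<partial>lborel))" .
    qed
    also have "\<dots> = (\<Sum>j\<in>UNIV. h $ j * (\<integral>x. \<integral>(t::real). indicator {0..1} t * (v x * partial \<zeta> j (x + t *\<^sub>R h)) \<partial>lborel \<partial>lborel))"
      using lborel_pair.integrable_snd[OF i1] by (subst Bochner_Integration.integral_sum) auto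
    also have "\<dots> = (\<Sum>j\<in>UNIV. h $ j * - (\<integral>x. \<zeta> x * ?A j x \<partial>lborel))"
    proof -
      have "(\<integral>x. \<integral>(t::real). indicator {0..1} t * (v x * partial \<zeta> j (x + t *\<^sub>R h)) \<partial>lborel \<partial>lborel) = - (\<integral>x. \<zeta> x * ?A j x \<partial>lborel)" for j
      proof -
      have "(\<integral>x. \<integral>(t::real). indicator {0..1} t * (v x * partial \<zeta> j (x + t *\<^sub>R h)) \<partial>lborel \<partial>lborel)
        = (\<integral>(t::real). \<integral>x. indicator {0..1} t * (v x * partial \<zeta> j (x + t *\<^sub>R h)) \<partial>lborel \<partial>lborel)"
        by (rule lborel_pair.Fubini_integral[OF i1])
      also have "\<dots> = (\<integral>(t::real). \<integral>x. - (indicator {0..1} t * (g j (x - t *\<^sub>R h) * \<zeta> x)) \<partial>lborel \<partial>lborel)"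
      proof (rule Bochner_Integration.integral_cong[OF refl])
        fix t :: real
        have "(\<integral>x. v x * partial \<zeta> j (x + t *\<^sub>R h) \<partial>lborel) = - (\<integral>x. g j x * \<zeta> (x + t *\<^sub>R h) \<partial>lborel)"
          using weak[OF t\<zeta>[of "t *\<^sub>R h"], of j] by (simp add: partial_translate[OF s\<zeta>])
        also have "(\<integral>x. g j x * \<zeta> (x + t *\<^sub>R h) \<partial>lborel) = (\<integral>x. g j (x - t *\<^sub>R h) * \<zeta> x \<partial>lborel)"
          using integral_lborel_shift[of "\<lambda>x. g j x * \<zeta> (x + t *\<^sub>R h)" "t *\<^sub>R h"] by simp
        finally show "(\<integral>x. indicator {0..1} t * (v x * partial \<zeta> j (x + t *\<^sub>R h)) \<partial>lborel)
          = (\<integral>x. - (indicator {0..1} t * (g j (x - t *\<^sub>R h) * \<zeta> x)) \<partial>lborel)" by simp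
      qed
      also have "\<dots> = - (\<integral>(t::real). \<integral>x. indicator {0..1} t * (g j (x - t *\<^sub>R h) * \<zeta> x) \<partial>lborel \<partial>lborel)" by simp
      also have "\<dots> = - (\<integral>x. \<integral>(t::real). indicator {0..1} t * (g j (x - t *\<^sub>R h) * \<zeta> x) \<partial>lborel \<partial>lborel)"
        by (simp only: lborel_pair.Fubini_integral[OF i2])
      also have "\<dots> = - (\<integral>x. \<zeta> x * ?A j x \<partial>lborel)"
        by (simp only: mult.assoc[symmetric] integral_mult_left_zero mult.commute[of "\<zeta> _"])
      finally show ?thesis .
      qed
      then show ?thesis by (simp only:)
    qed
    finally have eq: "(\<integral>x. v x * \<zeta> x \<partial>lborel) - (\<integral>x. v (x - h) * \<zeta> x \<partial>lborel) = (\<Sum>j\<in>UNIV. h $ j * (\<integral>x. \<zeta> x * ?A j x \<partial>lborel))"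
      by (simp add: sum_negf)
    have iA: "integrable lborel (\<lambda>x. h $ j * ?A j x * \<zeta> x)" for j
      by (rule loc_int_test_mult[OF lA \<zeta>])
    have "(\<integral>x. ?f x * \<zeta> x \<partial>lborel) = (\<integral>x. v x * \<zeta> x - v (x - h) * \<zeta> x - (\<Sum>j\<in>UNIV. h $ j * ?A j x * \<zeta> x) \<partial>lborel)"
      by (simp add: left_diff_distrib sum_distrib_right)
    also have "\<dots> = (\<integral>x. v x * \<zeta> x \<partial>lborel) - (\<integral>x. v (x - h) * \<zeta> x \<partial>lborel) - (\<Sum>j\<in>UNIV. \<integral>x. h $ j * ?A j x * \<zeta> x \<partial>lborel)"
      using iA loc_int_test_mult[OF v \<zeta>] loc_int_test_mult[OF loc_int_shift[OF v] \<zeta>]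
      by (simp add: Bochner_Integration.integral_diff Bochner_Integration.integral_sum)
    also have "(\<Sum>j\<in>UNIV. \<integral>x. h $ j * ?A j x * \<zeta> x \<partial>lborel) = (\<Sum>j\<in>UNIV. h $ j * (\<integral>x. \<zeta> x * ?A j x \<partial>lborel))"
      by (simp only: mult.assoc integral_mult_right_zero mult.commute[of "\<zeta> _"])
    finally show ?thesis using eq by simp
  qed
  have "AE x in lborel. ?f x = 0"
  proof (rule fundamental_lemma_calculus_of_variations[OF lf \<theta>])
    fix e y assume e: "0 < (e::real)"
    have "test_fun (\<lambda>x. \<theta> ((1/e) *\<^sub>R (x - y)))"
      using test_fun_affine[OF \<theta>(1), of "1/e" 1 "- (1/e) *\<^sub>R y"] e by (simp add: scaleR_diff_right)
    from main[OF this] show "(\<integral>x. ?f x * \<theta> ((1/e) *\<^sub>R (x - y)) \<partial>lborel) = 0" .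
  qed
  then show ?thesis by eventually_elim simp
qed

lemma pred_ball [measurable (raw)]:
  fixes f :: "'a \<Rightarrow> 'b::euclidean_space"
  assumes [measurable]: "f \<in> borel_measurable M"
  shows "Measurable.pred M (\<lambda>x. f x \<in> ball c r)"
  unfolding mem_ball by measurable

section \<open>Temperedness of functions in Lebesgue spaces and of their primitives\<close>

lemma powr_le_one_plus: "0 \<le> x \<Longrightarrow> 1 \<le> t \<Longrightarrow> x \<le> 1 + x powr t" for x t :: real
proof (cases "x \<le> 1")
  case False
  assume "1 \<le> t"
  then have "x powr 1 \<le> x powr t" using False by (intro powr_mono) auto
  then show ?thesis using False by simp
qed (simp add: add_increasing2)

text \<open>A crude substitute for Hoelder's inequality without a conjugate exponent: since w <= 1
  and y <= 1 + y^r, the product w H is at most w + H^r. What matters is that \<open>K\<close> is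
  uniform over all \<open>H\<close> and \<open>w\<close> with the given bounds.\<close>

lemma Lp_le_weighted_L1:
  assumes r: "1 \<le> r"
  obtains K where "0 \<le> K" "\<And>H w. H \<in> borel_measurable lborel \<Longrightarrow> w \<in> borel_measurable lborel \<Longrightarrow>
     Lp_le (lborel :: 'a::euclidean_space measure) r H (ennreal A) \<Longrightarrow> (\<And>x. w x \<le> 1) \<Longrightarrow> (\<integral>\<^sup>+x. w x \<partial>lborel) \<le> ennreal W \<Longrightarrow>
     (\<integral>\<^sup>+x. w x * H x \<partial>lborel) \<le> ennreal K"
proof (cases "r = top")
  case True
  show thesis
  proof (rule that[of "max 0 W * max 0 A"])
    fix H w :: "'a \<Rightarrow> ennreal" assume [measurable]: "H \<in> borel_measurable lborel" "w \<in> borel_measurable lborel"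
      and H: "Lp_le lborel r H (ennreal A)" and w: "(\<integral>\<^sup>+x. w x \<partial>lborel) \<le> ennreal W"
    have "(\<integral>\<^sup>+x. w x * H x \<partial>lborel) \<le> (\<integral>\<^sup>+x. w x * ennreal A \<partial>lborel)"
      using H True by (intro nn_integral_mono_AE) (auto simp: Lp_le_def elim!: eventually_mono intro!: mult_left_mono)
    also have "\<dots> = (\<integral>\<^sup>+x. w x \<partial>lborel) * ennreal A" by (rule nn_integral_multc) measurable
    also have "\<dots> \<le> ennreal W * ennreal A" by (intro mult_right_mono w) auto
    also have "\<dots> \<le> ennreal (max 0 W) * ennreal (max 0 A)" by (intro mult_mono ennreal_leI) auto
    also have "\<dots> = ennreal (max 0 W * max 0 A)" by (rule ennreal_mult[symmetric]) auto
    finally show "(\<integral>\<^sup>+x. w x * H x \<partial>lborel) \<le> ennreal (max 0 W * max 0 A)" .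
  qed simp
next
  case False
  note t = enn2real_ge_1[OF r False]
  show thesis
  proof (rule that[of "max 0 W + max 0 A powr enn2real r"])
    fix H w :: "'a \<Rightarrow> ennreal" assume [measurable]: "H \<in> borel_measurable lborel" "w \<in> borel_measurable lborel"
      and H: "Lp_le lborel r H (ennreal A)" and w: "(\<integral>\<^sup>+x. w x \<partial>lborel) \<le> ennreal W" "\<And>x. w x \<le> 1"
    have "(\<integral>\<^sup>+x. w x * H x \<partial>lborel) \<le> (\<integral>\<^sup>+x. w x + enn_powr (H x) (enn2real r) \<partial>lborel)"
    proof (intro nn_integral_mono)
      fix x
      have "H x \<le> 1 + enn_powr (H x) (enn2real r)"
      proof (cases "H x")
        case (real y)
        then show ?thesis using powr_le_one_plus[OF real(1) t]
          by (simp add: ennreal_1[symmetric] ennreal_plus[symmetric] ennreal_leI del: ennreal_1 ennreal_plus)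
      qed simp
      then have "w x * H x \<le> w x * (1 + enn_powr (H x) (enn2real r))" by (intro mult_left_mono) auto
      also have "\<dots> \<le> w x + 1 * enn_powr (H x) (enn2real r)"
        unfolding distrib_left using w by (intro add_mono mult_right_mono) auto
      finally show "w x * H x \<le> w x + enn_powr (H x) (enn2real r)" by simp
    qed
    also have "\<dots> = (\<integral>\<^sup>+x. w x \<partial>lborel) + (\<integral>\<^sup>+x. enn_powr (H x) (enn2real r) \<partial>lborel)" by (rule nn_integral_add) measurable
    also have "\<dots> \<le> ennreal (max 0 W) + enn_powr (ennreal (max 0 A)) (enn2real r)"
      using H False t order_trans[OF w(1), of "ennreal (max 0 W)"]
      by (intro add_mono) (auto simp: Lp_le_def intro: ennreal_leI elim!: order_trans intro!: enn_powr_mono)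
    also have "\<dots> = ennreal (max 0 W + max 0 A powr enn2real r)"
      by (subst enn_powr_ennreal, simp, rule ennreal_plus[symmetric]) auto
    finally show "(\<integral>\<^sup>+x. w x * H x \<partial>lborel) \<le> ennreal (max 0 W + max 0 A powr enn2real r)" .
  qed simp
qed

lemma Lp_le_tempered:
  fixes f :: "'a::euclidean_space \<Rightarrow> real"
  assumes p: "1 \<le> p" and [measurable]: "f \<in> borel_measurable borel" and f: "Lp_le lborel p (\<lambda>x. ennreal \<bar>f x\<bar>) (ennreal A)"
  shows "tempered f"
proof -
  let ?N = "DIM('a) + 2"
  have "(\<integral>\<^sup>+(x::'a). ennreal (wt ?N x) \<partial>lborel) = ennreal (\<integral>(x::'a). wt ?N x \<partial>lborel)"
    by (intro nn_integral_eq_integral wt_integrable) auto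
  then have W: "(\<integral>\<^sup>+(x::'a). ennreal (wt ?N x) \<partial>lborel) \<le> ennreal (\<integral>(x::'a). wt ?N x \<partial>lborel)" by simp
  have w1: "ennreal (wt ?N x) \<le> 1" for x :: 'a using wt_le_1[of ?N x] by simp
  obtain K where "\<And>H w. H \<in> borel_measurable lborel \<Longrightarrow> w \<in> borel_measurable lborel \<Longrightarrow>
     Lp_le (lborel :: 'a measure) p H (ennreal A) \<Longrightarrow> (\<And>x. w x \<le> 1) \<Longrightarrow> (\<integral>\<^sup>+x. w x \<partial>lborel) \<le> ennreal (\<integral>(x::'a). wt ?N x \<partial>lborel) \<Longrightarrow>
     (\<integral>\<^sup>+x. w x * H x \<partial>lborel) \<le> ennreal K"
    using Lp_le_weighted_L1[OF p] by blast
  from this[OF _ _ f w1 W] have "(\<integral>\<^sup>+x. ennreal (wt ?N x) * ennreal \<bar>f x\<bar> \<partial>lborel) \<le> ennreal K" by simp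
  moreover have "(\<integral>\<^sup>+x. ennreal (norm (f x * wt ?N x)) \<partial>lborel) = (\<integral>\<^sup>+x. ennreal (wt ?N x) * ennreal \<bar>f x\<bar> \<partial>lborel)"
    by (simp add: abs_mult ennreal_mult mult.commute)
  ultimately have "integrable lborel (\<lambda>x. f x * wt ?N x)"
    by (intro integrableI_bounded) (auto intro: le_less_trans)
  then show ?thesis unfolding tempered_def by auto
qed

lemma Lp_le_line_average:
  fixes F :: "'a::euclidean_space \<Rightarrow> ennreal"
  assumes p: "1 \<le> p" and [measurable]: "F \<in> borel_measurable borel" and F: "Lp_le lborel p F (ennreal A)" and A: "0 \<le> A"
  shows "Lp_le lborel p (\<lambda>x. \<integral>\<^sup>+(t::real). indicator {0..1} t * F (x - t *\<^sub>R h) \<partial>lborel) (ennreal A)"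
proof -
  have "Lp_le lborel p (\<lambda>x. \<integral>\<^sup>+(t::real). indicator {0..1} t * F (x - t *\<^sub>R h) \<partial>lborel) (ennreal (1 * A))"
    using Lp_le_shift[OF _ F] A
    by (intro Lp_le_Minkowski[OF lborel.sigma_finite_measure_axioms lborel.sigma_finite_measure_axioms p]) auto
  then show ?thesis by simp
qed

text \<open>The form in which the weak gradient \<open>g\<close> of \<open>v\<close> is used from
  here on. The exceptional null set may depend on \<open>h\<close>; Fubini's theorem or integration
  against a kernel removes this dependence where it matters.\<close>

definition has_increments :: "(real^'n \<Rightarrow> real) \<Rightarrow> ('n \<Rightarrow> real^'n \<Rightarrow> real) \<Rightarrow> bool" where
  "has_increments v g \<longleftrightarrow> (\<forall>h. AE x in lborel.
     v x - v (x - h) = (\<Sum>j\<in>UNIV. h $ j * (\<integral>(t::real). indicator {0..1} t * g j (x - t *\<^sub>R h) \<partial>lborel)))"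

lemma abs_line_average_le:
  "ennreal \<bar>\<integral>(t::real). indicator {0..1} t * f t \<partial>lborel\<bar> \<le> (\<integral>\<^sup>+(t::real). indicator {0..1} t * ennreal \<bar>f t\<bar> \<partial>lborel)"
proof (cases "integrable lborel (\<lambda>t::real. indicator {0..1} t * f t)")
  case True
  have "ennreal (norm (\<integral>(t::real). indicator {0..1} t * f t \<partial>lborel)) \<le> (\<integral>\<^sup>+(t::real). ennreal (norm (indicator {0..1} t * f t)) \<partial>lborel)"
    by (rule integral_norm_bound_ennreal[OF True])
  also have "\<dots> = (\<integral>\<^sup>+(t::real). indicator {0..1} t * ennreal \<bar>f t\<bar> \<partial>lborel)"
    by (intro nn_integral_cong) (auto split: split_indicator)
  finally show ?thesis by simp
qed (simp add: not_integrable_integral_eq)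

lemma has_increments_bound:
  fixes v :: "real^'n \<Rightarrow> real"
  assumes "has_increments v g"
  shows "AE x in lborel. ennreal \<bar>v x - v (x - h)\<bar> \<le> ennreal (norm h) * (\<Sum>j\<in>UNIV. \<integral>\<^sup>+(t::real). indicator {0..1} t * ennreal \<bar>g j (x - t *\<^sub>R h)\<bar> \<partial>lborel)"
proof -
  let ?a = "\<lambda>j x. \<integral>(t::real). indicator {0..1} t * g j (x - t *\<^sub>R h) \<partial>lborel"
  have "AE x in lborel. v x - v (x - h) = (\<Sum>j\<in>UNIV. h $ j * ?a j x)"
    using assms unfolding has_increments_def by blast
  then show ?thesis
  proof eventually_elim
    fix x assume eq: "v x - v (x - h) = (\<Sum>j\<in>UNIV. h $ j * ?a j x)"
    have "\<bar>v x - v (x - h)\<bar> \<le> (\<Sum>j\<in>UNIV. norm h * \<bar>?a j x\<bar>)"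
      unfolding eq by (intro order_trans[OF sum_abs] sum_mono) (auto simp: abs_mult component_le_norm_cart intro!: mult_right_mono)
    then have "ennreal \<bar>v x - v (x - h)\<bar> \<le> (\<Sum>j\<in>UNIV. ennreal (norm h) * ennreal \<bar>?a j x\<bar>)"
      by (simp add: ennreal_mult[symmetric] sum_ennreal ennreal_leI)
    also have "\<dots> \<le> (\<Sum>j\<in>UNIV. ennreal (norm h) * (\<integral>\<^sup>+(t::real). indicator {0..1} t * ennreal \<bar>g j (x - t *\<^sub>R h)\<bar> \<partial>lborel))"
      by (intro sum_mono mult_left_mono abs_line_average_le) auto
    finally show "ennreal \<bar>v x - v (x - h)\<bar> \<le> ennreal (norm h) * (\<Sum>j\<in>UNIV. \<integral>\<^sup>+(t::real). indicator {0..1} t * ennreal \<bar>g j (x - t *\<^sub>R h)\<bar> \<partial>lborel)"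
      by (simp add: sum_distrib_left)
  qed
qed

lemma Lp_le_sum_const:
  assumes "sigma_finite_measure M" "1 \<le> p" and "\<And>j::'n::finite. f j \<in> borel_measurable M"
    and "\<And>j. Lp_le M p (f j) (ennreal A)" "0 \<le> A"
  shows "Lp_le M p (\<lambda>x. \<Sum>j\<in>UNIV. f j x) (ennreal (real CARD('n) * A))"
  using Lp_le_sum[OF assms(1,2) finite[of "UNIV :: 'n set"], of f "\<lambda>_. A"] assms by simp

text \<open>Integrating the increment bound over the base points in the unit ball controls the growth of \<open>v\<close>.\<close>
lemma has_increments_mult_tempered:
  fixes v \<rho> :: "real^'n \<Rightarrow> real"
  assumes p: "1 \<le> p" "1 \<le> p'" "1 \<le> r" "inverse p + inverse p' = inverse r"
    and v: "loc_int v" and inc: "has_increments v g" and [measurable]: "\<And>j. g j \<in> borel_measurable borel"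
    and g: "\<And>j. Lp_le lborel p (\<lambda>x. ennreal \<bar>g j x\<bar>) (ennreal A)"
    and [measurable]: "\<rho> \<in> borel_measurable borel" and \<rho>: "Lp_le lborel p' (\<lambda>x. ennreal \<bar>\<rho> x\<bar>) (ennreal A')"
    and A: "0 \<le> A" "0 \<le> A'"
  shows "tempered (\<lambda>x. v x * \<rho> x)"
proof -
  note [measurable] = loc_int_measurable[OF v]
  note sf = lborel.sigma_finite_measure_axioms
  obtain N0 where N0: "integrable lborel (\<lambda>x. \<rho> x * wt N0 x)"
    using Lp_le_tempered[OF p(2) _ \<rho>] unfolding tempered_def by auto
  \<comment> \<open>One power beyond the d + 2 of \<open>wt_integrable\<close>, so that |z| times
    the weight is still integrable.\<close>
  define N where "N = max N0 (CARD('n) + 3)"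
  have N: "integrable lborel (\<lambda>x. \<rho> x * wt N x)"
    by (rule tempered_raise[OF _ N0]) (auto simp: N_def)
  have zN: "integrable lborel (\<lambda>z::real^'n. norm z * wt N z)"
  proof (rule Bochner_Integration.integrable_bound)
    show "integrable lborel (wt (DIM(real^'n) + 2) :: real^'n \<Rightarrow> real)" by (rule wt_integrable) simp
    show "AE z::real^'n in lborel. norm (norm z * wt N z) \<le> norm (wt (DIM(real^'n) + 2) z)"
    proof (rule AE_I2)
      fix z :: "real^'n"
      have "norm z * wt N z \<le> (1 + norm z) ^ 1 * wt (1 + (CARD('n) + 2)) z"
        by (intro mult_mono wt_mono) (auto simp: N_def)
      also have "\<dots> = ((1 + norm z) ^ 1 * wt 1 z) * wt (CARD('n) + 2) z" by (simp only: wt_add mult.assoc)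
      also have "\<dots> = wt (CARD('n) + 2) z" by (simp only: power_mult_wt mult_1)
      finally show "norm (norm z * wt N z) \<le> norm (wt (DIM(real^'n) + 2) z)" by simp
    qed
  qed measurable
  let ?B = "ball (0::real^'n) 1"
  define m where "m = measure lborel ?B"
  have m: "0 < m" "emeasure lborel ?B = ennreal m"
    unfolding m_def using emeasure_lborel_ball_finite[of "0::real^'n" 1]
    by (auto simp: content_ball_pos emeasure_eq_ennreal_measure less_top)
  define F where "F z y = (\<Sum>j\<in>UNIV. \<integral>\<^sup>+(t::real). indicator {0..1} t * ennreal \<bar>g j (y - t *\<^sub>R z)\<bar> \<partial>lborel)" for z y
  have [measurable]: "(\<lambda>(z, y). F z y) \<in> borel_measurable (borel \<Otimes>\<^sub>M borel)" unfolding F_def by measurable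
  have FL: "Lp_le lborel r (\<lambda>y. F z y * ennreal \<bar>\<rho> y\<bar>) (ennreal (real CARD('n) * A * A'))" for z
    unfolding F_def using A
    by (intro Lp_le_Holder[OF sf p] Lp_le_sum_const[OF sf p(1)] Lp_le_line_average[OF p(1)] g \<rho>) auto
  obtain K where K: "0 \<le> K" "\<And>H w. H \<in> borel_measurable lborel \<Longrightarrow> w \<in> borel_measurable lborel \<Longrightarrow>
     Lp_le (lborel :: (real^'n) measure) r H (ennreal (real CARD('n) * A * A')) \<Longrightarrow> (\<And>x. w x \<le> 1) \<Longrightarrow> (\<integral>\<^sup>+x. w x \<partial>lborel) \<le> ennreal m \<Longrightarrow>
     (\<integral>\<^sup>+x. w x * H x \<partial>lborel) \<le> ennreal K"
    using Lp_le_weighted_L1[OF p(3)] by blast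

  have BK: "(\<integral>\<^sup>+y. indicator ?B (y - z) * (F z y * ennreal \<bar>\<rho> y\<bar>) \<partial>lborel) \<le> ennreal K" for z
  proof (rule K(2)[OF _ _ FL])
    have "(\<integral>\<^sup>+y. indicator ?B (y - z) \<partial>lborel) = (\<integral>\<^sup>+y. indicator ?B y \<partial>lborel)"
      by (rule nn_integral_lborel_shift) simp
    then show "(\<integral>\<^sup>+y. indicator ?B (y - z) \<partial>lborel) \<le> ennreal m" using m by simp
  qed (auto simp: indicator_def)
  have "integrable lborel (\<lambda>x. v x * indicator ?B x)"
    by (rule loc_int_mult[OF v, where R=1 and B=1]) (auto simp: indicator_def)
  then have c: "(\<integral>\<^sup>+x. indicator ?B x * ennreal \<bar>v x\<bar> \<partial>lborel) < \<infinity>"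
  proof -
    assume i: "integrable lborel (\<lambda>x. v x * indicator ?B x)"
    have "(\<integral>\<^sup>+x. indicator ?B x * ennreal \<bar>v x\<bar> \<partial>lborel) = (\<integral>\<^sup>+x. ennreal (norm (v x * indicator ?B x)) \<partial>lborel)"
      by (intro nn_integral_cong) (auto split: split_indicator)
    then show ?thesis using i by (simp add: integrable_iff_bounded)
  qed
  let ?c = "\<integral>\<^sup>+x. indicator ?B x * ennreal \<bar>v x\<bar> \<partial>lborel"
  \<comment> \<open>The increment bound holds for each \<open>z\<close> and almost every
    \<open>y\<close>; exchanging the two quantifiers makes it available at a fixed \<open>y\<close>
    for almost every \<open>z\<close>.\<close>
  have "AE y in lborel. AE z in lborel. ennreal \<bar>v y - v (y - z)\<bar> \<le> ennreal (norm z) * F z y"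
  proof (subst lborel_pair.AE_commute)
    show "AE z in lborel. AE y in lborel. ennreal \<bar>v y - v (y - z)\<bar> \<le> ennreal (norm z) * F z y"
      using has_increments_bound[OF inc] unfolding F_def by simp
  qed measurable
  then have bd: "AE y in lborel. ennreal m * ennreal \<bar>v y\<bar> \<le> ?c + (\<integral>\<^sup>+z. indicator ?B (y - z) * (ennreal (norm z) * F z y) \<partial>lborel)"
  proof eventually_elim
    fix y assume ae: "AE z in lborel. ennreal \<bar>v y - v (y - z)\<bar> \<le> ennreal (norm z) * F z y"
    have rf: "(\<integral>\<^sup>+z. f (y - z) \<partial>lborel) = (\<integral>\<^sup>+z. f z \<partial>lborel)" if "f \<in> borel_measurable borel" for f :: "real^'n \<Rightarrow> ennreal"
      using nn_integral_lborel_diff_scale[OF that, of 1 y] by simp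
    have "ennreal m * ennreal \<bar>v y\<bar> = (\<integral>\<^sup>+z. indicator ?B (y - z) \<partial>lborel) * ennreal \<bar>v y\<bar>"
      using rf[of "indicator ?B"] m by simp
    also have "\<dots> = (\<integral>\<^sup>+z. indicator ?B (y - z) * ennreal \<bar>v y\<bar> \<partial>lborel)"
      by (rule nn_integral_multc[symmetric]) measurable
    also have "\<dots> \<le> (\<integral>\<^sup>+z. indicator ?B (y - z) * ennreal \<bar>v (y - z)\<bar> + indicator ?B (y - z) * (ennreal (norm z) * F z y) \<partial>lborel)"
    proof (rule nn_integral_mono_AE)
      show "AE z in lborel. indicator ?B (y - z) * ennreal \<bar>v y\<bar> \<le> indicator ?B (y - z) * ennreal \<bar>v (y - z)\<bar> + indicator ?B (y - z) * (ennreal (norm z) * F z y)"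
        using ae
      proof eventually_elim
        fix z assume *: "ennreal \<bar>v y - v (y - z)\<bar> \<le> ennreal (norm z) * F z y"
        have "ennreal \<bar>v y\<bar> \<le> ennreal (\<bar>v (y - z)\<bar> + \<bar>v y - v (y - z)\<bar>)" by (intro ennreal_leI) linarith
        also have "\<dots> = ennreal \<bar>v (y - z)\<bar> + ennreal \<bar>v y - v (y - z)\<bar>" by simp
        also have "\<dots> \<le> ennreal \<bar>v (y - z)\<bar> + ennreal (norm z) * F z y" by (intro add_left_mono *)
        finally show "indicator ?B (y - z) * ennreal \<bar>v y\<bar> \<le> indicator ?B (y - z) * ennreal \<bar>v (y - z)\<bar> + indicator ?B (y - z) * (ennreal (norm z) * F z y)"
          unfolding distrib_left[symmetric] by (intro mult_left_mono) auto
      qed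
    qed
    also have "\<dots> = (\<integral>\<^sup>+z. indicator ?B (y - z) * ennreal \<bar>v (y - z)\<bar> \<partial>lborel) + (\<integral>\<^sup>+z. indicator ?B (y - z) * (ennreal (norm z) * F z y) \<partial>lborel)"
      by (rule nn_integral_add) measurable
    also have "(\<integral>\<^sup>+z. indicator ?B (y - z) * ennreal \<bar>v (y - z)\<bar> \<partial>lborel) = ?c"
      using rf[of "\<lambda>x. indicator ?B x * ennreal \<bar>v x\<bar>"] by simp
    finally show "ennreal m * ennreal \<bar>v y\<bar> \<le> ?c + (\<integral>\<^sup>+z. indicator ?B (y - z) * (ennreal (norm z) * F z y) \<partial>lborel)" .
  qed
  have "ennreal m * (\<integral>\<^sup>+y. ennreal (norm (v y * \<rho> y * wt N y)) \<partial>lborel) = (\<integral>\<^sup>+y. (ennreal m * ennreal \<bar>v y\<bar>) * ennreal \<bar>\<rho> y * wt N y\<bar> \<partial>lborel)"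
    by (subst nn_integral_cmult[symmetric]) (auto simp: abs_mult ennreal_mult mult_ac)
  also have "\<dots> \<le> (\<integral>\<^sup>+y. (?c + (\<integral>\<^sup>+z. indicator ?B (y - z) * (ennreal (norm z) * F z y) \<partial>lborel)) * ennreal \<bar>\<rho> y * wt N y\<bar> \<partial>lborel)"
    using bd by (intro nn_integral_mono_AE) (auto elim!: eventually_mono intro!: mult_right_mono)
  also have "\<dots> = (\<integral>\<^sup>+y. ?c * ennreal \<bar>\<rho> y * wt N y\<bar> \<partial>lborel) + (\<integral>\<^sup>+y. (\<integral>\<^sup>+z. indicator ?B (y - z) * (ennreal (norm z) * F z y) \<partial>lborel) * ennreal \<bar>\<rho> y * wt N y\<bar> \<partial>lborel)"
    unfolding distrib_right by (rule nn_integral_add) measurable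
  also have "(\<integral>\<^sup>+y. ?c * ennreal \<bar>\<rho> y * wt N y\<bar> \<partial>lborel) = ?c * (\<integral>\<^sup>+y. ennreal \<bar>\<rho> y * wt N y\<bar> \<partial>lborel)"
    by (rule nn_integral_cmult) measurable
  also have "(\<integral>\<^sup>+y. (\<integral>\<^sup>+z. indicator ?B (y - z) * (ennreal (norm z) * F z y) \<partial>lborel) * ennreal \<bar>\<rho> y * wt N y\<bar> \<partial>lborel)
      = (\<integral>\<^sup>+y. \<integral>\<^sup>+z. indicator ?B (y - z) * (ennreal (norm z) * F z y) * ennreal \<bar>\<rho> y * wt N y\<bar> \<partial>lborel \<partial>lborel)"
    by (intro nn_integral_cong nn_integral_multc[symmetric]) measurable
  also have "\<dots> \<le> (\<integral>\<^sup>+y. \<integral>\<^sup>+z. ennreal (2 ^ N) * (ennreal (norm z * wt N z) * (indicator ?B (y - z) * (F z y * ennreal \<bar>\<rho> y\<bar>))) \<partial>lborel \<partial>lborel)"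
  proof (intro nn_integral_mono)
    fix y z :: "real^'n"
    show "indicator ?B (y - z) * (ennreal (norm z) * F z y) * ennreal \<bar>\<rho> y * wt N y\<bar>
       \<le> ennreal (2 ^ N) * (ennreal (norm z * wt N z) * (indicator ?B (y - z) * (F z y * ennreal \<bar>\<rho> y\<bar>)))"
    \<comment> \<open>If y and z are at distance less than 1, then 1 + |z| <= 2(1 + |y|). So the
      weight at \<open>y\<close> is at most 2^N times the weight at \<open>z\<close> and can leave
      the integral over \<open>y\<close>.\<close>
    proof (cases "y - z \<in> ?B")
      case True
      then have "norm (y - z) < 1" by simp
      then have "1 + norm z \<le> 2 * (1 + norm y)" by norm
      then have le: "(1 + norm z) ^ N \<le> 2 ^ N * (1 + norm y) ^ N"
        unfolding power_mult_distrib[symmetric] by (intro power_mono) (auto simp: add_nonneg_nonneg)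
      have "wt N y = (1 + norm z) ^ N * wt N z * wt N y" by (simp add: power_mult_wt)
      also have "\<dots> \<le> (2 ^ N * (1 + norm y) ^ N) * wt N z * wt N y" by (intro mult_right_mono le) auto
      also have "\<dots> = 2 ^ N * wt N z * ((1 + norm y) ^ N * wt N y)" by (simp only: mult_ac)
      finally have "wt N y \<le> 2 ^ N * wt N z" by (simp add: power_mult_wt)
      then have "norm z * (\<bar>\<rho> y\<bar> * wt N y) \<le> norm z * (\<bar>\<rho> y\<bar> * (2 ^ N * wt N z))" by (intro mult_left_mono) auto
      then have "ennreal (norm z) * ennreal \<bar>\<rho> y * wt N y\<bar> \<le> ennreal (2 ^ N) * (ennreal (norm z * wt N z) * ennreal \<bar>\<rho> y\<bar>)"
        by (simp add: ennreal_mult[symmetric] abs_mult ennreal_leI mult_ac)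
      then have "F z y * (ennreal (norm z) * ennreal \<bar>\<rho> y * wt N y\<bar>) \<le> F z y * (ennreal (2 ^ N) * (ennreal (norm z * wt N z) * ennreal \<bar>\<rho> y\<bar>))"
        by (intro mult_left_mono) auto
      then show ?thesis using True by (simp only: indicator_simps mult_1 mult_ac)
    qed simp
  qed
  also have "\<dots> = (\<integral>\<^sup>+z. \<integral>\<^sup>+y. ennreal (2 ^ N) * (ennreal (norm z * wt N z) * (indicator ?B (y - z) * (F z y * ennreal \<bar>\<rho> y\<bar>))) \<partial>lborel \<partial>lborel)"
    by (rule lborel_pair.Fubini') measurable
  also have "\<dots> = (\<integral>\<^sup>+z. ennreal (2 ^ N) * (ennreal (norm z * wt N z) * (\<integral>\<^sup>+y. indicator ?B (y - z) * (F z y * ennreal \<bar>\<rho> y\<bar>) \<partial>lborel)) \<partial>lborel)"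
    by (intro nn_integral_cong) (subst nn_integral_cmult, measurable, subst nn_integral_cmult, measurable)
  also have "\<dots> \<le> (\<integral>\<^sup>+z. ennreal (2 ^ N) * (ennreal (norm (z::real^'n) * wt N z) * ennreal K) \<partial>lborel)"
    by (intro nn_integral_mono mult_left_mono BK) auto
  also have "\<dots> = ennreal (2 ^ N) * ((\<integral>\<^sup>+(z::real^'n). ennreal (norm z * wt N z) \<partial>lborel) * ennreal K)"
    by (simp add: nn_integral_cmult nn_integral_multc)
  finally have "ennreal m * (\<integral>\<^sup>+y. ennreal (norm (v y * \<rho> y * wt N y)) \<partial>lborel)
     \<le> ?c * (\<integral>\<^sup>+y. ennreal \<bar>\<rho> y * wt N y\<bar> \<partial>lborel) + ennreal (2 ^ N) * ((\<integral>\<^sup>+(z::real^'n). ennreal (norm z * wt N z) \<partial>lborel) * ennreal K)"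
    by (simp add: add_left_mono)
  also have "\<dots> < \<infinity>"
    using c N zN by (auto simp: integrable_iff_bounded ennreal_mult_less_top)
  finally have "(\<integral>\<^sup>+y. ennreal (norm (v y * \<rho> y * wt N y)) \<partial>lborel) < \<infinity>"
    using m(1) by (auto simp: ennreal_mult_less_top)
  then have "integrable lborel (\<lambda>y. v y * \<rho> y * wt N y)" by (intro integrableI_bounded) auto
  then show ?thesis unfolding tempered_def by auto
qed

lemma has_increments_tempered:
  fixes v :: "real^'n \<Rightarrow> real"
  assumes p: "1 \<le> p" and v: "loc_int v" and inc: "has_increments v g" and g: "\<And>j. g j \<in> borel_measurable borel"
    "\<And>j. Lp_le lborel p (\<lambda>x. ennreal \<bar>g j x\<bar>) (ennreal A)" "0 \<le> A"
  shows "tempered v"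
proof -
  have "tempered (\<lambda>x. v x * 1)"
    by (rule has_increments_mult_tempered[OF p _ p _ v inc g(1,2) _ _ g(3), where p'=top and A'=1])
       (simp_all add: Lp_le_top_const[unfolded ennreal_1])
  then show ?thesis by simp
qed

subsection \<open>Mollification\<close>

lemma schwartz_dir_deriv_rapid:
  assumes \<phi>: "schwartz \<phi>" and vs: "set vs \<subseteq> Basis" shows "rapid (dir_deriv \<phi> vs)"
  unfolding rapid_def
proof (intro conjI allI)
  have "\<forall>x. dir_deriv \<phi> vs differentiable (at x)" using \<phi> vs by (auto simp: schwartz_def smooth_fun_def)
  then have "continuous_on UNIV (dir_deriv \<phi> vs)"
    by (intro continuous_at_imp_continuous_on ballI differentiable_imp_continuous_within) auto
  then show "dir_deriv \<phi> vs \<in> borel_measurable borel" by (rule borel_measurable_continuous_onI)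
  fix N
  have "bounded (range (\<lambda>x. (1 + norm x) ^ N * dir_deriv \<phi> vs x))" using \<phi> vs by (auto simp: schwartz_def)
  then obtain C where C: "\<And>x. \<bar>(1 + norm x) ^ N * dir_deriv \<phi> vs x\<bar> \<le> C" by (force simp: bounded_iff)
  have "\<bar>dir_deriv \<phi> vs x\<bar> \<le> C * wt N x" for x
  proof -
    have "\<bar>dir_deriv \<phi> vs x\<bar> = ((1 + norm x) ^ N * wt N x) * \<bar>dir_deriv \<phi> vs x\<bar>" by (simp only: power_mult_wt mult_1)
    also have "\<dots> = \<bar>(1 + norm x) ^ N * dir_deriv \<phi> vs x\<bar> * wt N x"
      by (simp add: abs_mult abs_of_nonneg add_nonneg_nonneg mult_ac)
    also have "\<dots> \<le> C * wt N x" by (intro mult_right_mono C) auto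
    finally show ?thesis .
  qed
  then show "\<exists>C. \<forall>x. \<bar>dir_deriv \<phi> vs x\<bar> \<le> C * wt N x" by blast
qed

lemma schwartz_rapid:
  assumes \<phi>: "schwartz \<phi>"
  shows "rapid \<phi>" "rapid (partial \<phi> i)" "rapid (partial (partial \<phi> j) i)"
  using schwartz_dir_deriv_rapid[OF \<phi>, of "[]"] schwartz_dir_deriv_rapid[OF \<phi>, of "[axis i 1]"]
    schwartz_dir_deriv_rapid[OF \<phi>, of "[axis i 1, axis j 1]"]
  by (auto simp: partial_def[abs_def] axis_in_Basis_iff)

lemma schwartz_smooth: "schwartz \<phi> \<Longrightarrow> smooth_fun \<phi>"
  by (simp add: schwartz_def)

text \<open>Differentiation under the integral lets the derivative fall on the mollifier, which
  yields the factor 1/d; the substitution y = x - d z turns the result into \<open>kop\<close>. For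
  points within distance 1 of \<open>x\<close>, \<open>wt_diff_scale\<close> bounds the integrand by
  one multiple of |f| \<open>wt N\<close>.\<close>

lemma conv_mollifier_has_derivative:
  fixes f \<phi> :: "real^'n \<Rightarrow> real"
  assumes \<phi>: "schwartz \<phi>" and f: "tempered f" and d: "0 < d"
  shows "(conv f (mollifier \<phi> d) has_derivative (\<lambda>h. (\<chi> i. kop (partial \<phi> i) d f x / d) \<bullet> h)) (at x)"
proof -
  note [measurable] = tempered_measurable[OF f] rapid_measurable[OF schwartz_rapid(1)[OF \<phi>]]
  let ?s = "d powr - real CARD('n)"
  have s: "?s = 1 / d ^ CARD('n)" using d by (simp add: powr_minus powr_realpow divide_inverse)
  have sm: "smooth_fun \<phi>" by (rule schwartz_smooth[OF \<phi>])
  have [measurable]: "grad \<phi> \<in> borel_measurable borel"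
    by (intro borel_measurable_continuous_onI smooth_fun_grad_continuous sm)
  have [measurable]: "mollifier \<phi> d \<in> borel_measurable borel" unfolding mollifier_def[abs_def] by measurable
  have conv_eq: "conv f (mollifier \<phi> d) x = (\<integral>y. f y * mollifier \<phi> d (x - y) \<partial>lborel)" for x
    unfolding conv_def by (rule integral_completion) measurable
  have cov: "(\<integral>y. F y \<partial>lborel) = d ^ CARD('n) *\<^sub>R (\<integral>z. F (x - d *\<^sub>R z) \<partial>lborel)" for F :: "real^'n \<Rightarrow> 'b::{banach, second_countable_topology}" and x
    using integral_lborel_affine[of "-d" F x] d by simp
  have icov: "integrable lborel F \<longleftrightarrow> integrable lborel (\<lambda>z. F (x - d *\<^sub>R z))" for F :: "real^'n \<Rightarrow> 'b::{banach, second_countable_topology}" and x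
    using integrable_lborel_affine_iff[of "-d" F x] d by simp
  let ?k' = "\<lambda>x y. (f y * (?s / d)) *\<^sub>R grad \<phi> ((1/d) *\<^sub>R (x - y))"
  have der: "((\<lambda>x. f y * mollifier \<phi> d (x - y)) has_derivative (\<lambda>h. ?k' x y \<bullet> h)) (at x)" for x y
  proof -
    have "((\<lambda>x. (1/d) *\<^sub>R (x - y)) has_derivative (\<lambda>h. (1/d) *\<^sub>R h)) (at x)" by (auto intro!: derivative_eq_intros)
    from diff_chain_at[OF this smooth_fun_has_derivative[OF sm]]
    have "((\<lambda>x. \<phi> ((1/d) *\<^sub>R (x - y))) has_derivative (\<lambda>h. (1/d) * (grad \<phi> ((1/d) *\<^sub>R (x - y)) \<bullet> h))) (at x)"
      by (simp add: o_def)
    then have "((\<lambda>x. (f y * ?s) * \<phi> ((1/d) *\<^sub>R (x - y))) has_derivative (\<lambda>h. (f y * ?s) * ((1/d) * (grad \<phi> ((1/d) *\<^sub>R (x - y)) \<bullet> h)))) (at x)"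
      by (rule has_derivative_mult_right)
    then show ?thesis by (simp add: mollifier_def mult.assoc)
  qed
  have int: "integrable lborel (\<lambda>y. f y * mollifier \<phi> d (x - y))" for x
  proof (subst icov[of _ x])
    have "integrable lborel (\<lambda>z. ?s * (\<phi> z * f (x - d *\<^sub>R z)))"
      by (intro integrable_mult_right rapid_tempered_integrable schwartz_rapid \<phi> f d)
    then show "integrable lborel (\<lambda>z. f (x - d *\<^sub>R z) * mollifier \<phi> d (x - (x - d *\<^sub>R z)))"
      using d by (simp add: mollifier_def mult_ac)
  qed
  obtain N where N: "integrable lborel (\<lambda>x. f x * wt N x)" using f unfolding tempered_def by blast
  have "rapid (\<lambda>x. \<Sum>i\<in>UNIV. \<bar>partial \<phi> i x\<bar>)" by (intro rapid_sum rapid_abs schwartz_rapid \<phi>) simp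
  then obtain C where C: "0 \<le> C" "\<And>x. \<bar>\<Sum>i\<in>UNIV. \<bar>partial \<phi> i x\<bar>\<bar> \<le> C * wt N x" using rapidD by blast
  have gC: "norm (grad \<phi> x) \<le> C * wt N x" for x
  proof -
    have "norm (grad \<phi> x) \<le> (\<Sum>i\<in>UNIV. \<bar>grad \<phi> x $ i\<bar>)" by (rule norm_le_l1_cart)
    then show ?thesis using C(2)[of x] by simp
  qed
  let ?B = "\<lambda>y. (?s / d * (C * ((2 + norm x) * (1 + d)) ^ N)) * \<bar>f y * wt N y\<bar>"
  have bound: "norm (?k' x' y) \<le> ?B y" if "dist x x' < 1" for x' y
  proof -
    have x': "norm x' \<le> norm x + 1" using that norm_triangle_ineq3[of x' x] by (simp add: dist_norm norm_minus_commute)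
    have "norm (grad \<phi> ((1/d) *\<^sub>R (x' - y))) \<le> C * wt N ((1/d) *\<^sub>R (x' - y))" by (rule gC)
    also have "\<dots> \<le> C * (((1 + norm x') * (1 + d)) ^ N * wt N (x' - d *\<^sub>R ((1/d) *\<^sub>R (x' - y))))"
      using d C(1) by (intro mult_left_mono wt_diff_scale) auto
    also have "x' - d *\<^sub>R ((1/d) *\<^sub>R (x' - y)) = y" using d by simp
    also have "C * (((1 + norm x') * (1 + d)) ^ N * wt N y) \<le> C * (((2 + norm x) * (1 + d)) ^ N * wt N y)"
      using C(1) d x' by (intro mult_left_mono mult_right_mono power_mono) auto
    finally have "\<bar>f y\<bar> * (?s / d) * norm (grad \<phi> ((1/d) *\<^sub>R (x' - y))) \<le> \<bar>f y\<bar> * (?s / d) * (C * (((2 + norm x) * (1 + d)) ^ N * wt N y))"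
      using d by (intro mult_left_mono) auto
    moreover have "norm (?k' x' y) = \<bar>f y\<bar> * (?s / d) * norm (grad \<phi> ((1/d) *\<^sub>R (x' - y)))"
      using d by (simp add: abs_mult)
    moreover have "?B y = \<bar>f y\<bar> * (?s / d) * (C * (((2 + norm x) * (1 + d)) ^ N * wt N y))"
      by (simp add: abs_mult mult_ac)
    ultimately show ?thesis by (simp only:)
  qed
  have meas: "?k' x \<in> borel_measurable lborel" by measurable
  have iB: "integrable lborel ?B" using N by (intro integrable_mult_right integrable_abs)
  note * = has_derivative_integral[where k="\<lambda>x y. f y * mollifier \<phi> d (x - y)" and k'="?k'", OF int der meas bound iB]
  have "(\<integral>y. ?k' x y \<partial>lborel) = (\<chi> i. kop (partial \<phi> i) d f x / d)"
  proof (unfold vec_eq_iff, intro allI)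
    fix i
    have "(\<integral>y. ?k' x y \<partial>lborel) $ i = (\<integral>y. ?k' x y $ i \<partial>lborel)"
      using integral_bounded_linear[OF bounded_linear_vec_nth *(2), of i] by simp
    also have "\<dots> = d ^ CARD('n) *\<^sub>R (\<integral>z. ?k' x (x - d *\<^sub>R z) $ i \<partial>lborel)" by (rule cov)
    also have "\<dots> = d ^ CARD('n) * (\<integral>z. (?s / d) * (partial \<phi> i z * f (x - d *\<^sub>R z)) \<partial>lborel)"
      using d by (simp add: mult_ac)
    also have "\<dots> = d ^ CARD('n) * ((?s / d) * kop (partial \<phi> i) d f x)" unfolding kop_def by (simp only: integral_mult_right_zero)
    also have "\<dots> = kop (partial \<phi> i) d f x / d" unfolding s using d by simp
    finally show "(\<integral>y. ?k' x y \<partial>lborel) $ i = (\<chi> i. kop (partial \<phi> i) d f x / d) $ i" by simp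
  qed
  with *(1) show ?thesis by (simp only: conv_eq[abs_def])
qed

text \<open>Both derivatives land on the mollifier, so only the temperedness of
  \<open>\<rho>\<close> and of its products with the components of \<open>u\<close> is involved. The
  identity holds at every point.\<close>

lemma commutator_eq:
  fixes u :: "real^'n \<Rightarrow> real^'n"
  assumes \<phi>: "schwartz \<phi>" and d: "0 < d" and \<rho>: "tempered \<rho>" and u\<rho>: "\<And>i. tempered (\<lambda>x. u x $ i * \<rho> x)"
  shows "commutator \<phi> d u \<rho> x = (\<Sum>i\<in>UNIV. (u x $ i * kop (partial \<phi> i) d \<rho> x - kop (partial \<phi> i) d (\<lambda>x. u x $ i * \<rho> x) x) / d)"
proof -
  have "frechet_derivative (conv \<rho> (mollifier \<phi> d)) (at x) (u x) = (\<Sum>i\<in>UNIV. u x $ i * kop (partial \<phi> i) d \<rho> x / d)"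
    using frechet_derivative_at[OF conv_mollifier_has_derivative[OF \<phi> \<rho> d, of x], symmetric]
    by (simp add: inner_vec_def mult.commute)
  moreover have "partial (conv (\<lambda>y. u y $ i * \<rho> y) (mollifier \<phi> d)) i x = kop (partial \<phi> i) d (\<lambda>x. u x $ i * \<rho> x) x / d" for i
    using partial_eqI[OF conv_mollifier_has_derivative[OF \<phi> u\<rho> d, of i x], of i] by simp
  ultimately show ?thesis
    unfolding commutator_def by (simp add: sum_subtractf diff_divide_distrib)
qed

lemma rapid_convolution:
  fixes K L :: "'a::euclidean_space \<Rightarrow> real"
  assumes K: "rapid K" and L: "rapid L" shows "rapid (\<lambda>y. \<integral>h. L h * K (y - h) \<partial>lborel)"
  unfolding rapid_def
proof (intro conjI allI)
  note [measurable] = rapid_measurable[OF K] rapid_measurable[OF L]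
  show "(\<lambda>y. \<integral>h. L h * K (y - h) \<partial>lborel) \<in> borel_measurable borel" by measurable
  fix N
  obtain C where C: "0 \<le> C" "\<And>x. \<bar>K x\<bar> \<le> C * wt N x" using rapidD[OF K] by blast
  have i: "integrable lborel (\<lambda>h. (1 + norm h) ^ N * \<bar>L h\<bar>)"
    by (intro rapid_integrable rapid_poly_mult[where C=1 and m=N] rapid_abs L) auto
  have "\<bar>\<integral>h. L h * K (y - h) \<partial>lborel\<bar> \<le> (C * 2 ^ N * (\<integral>h. (1 + norm h) ^ N * \<bar>L h\<bar> \<partial>lborel)) * wt N y" for y
  proof -
    have "\<bar>\<integral>h. L h * K (y - h) \<partial>lborel\<bar> \<le> (\<integral>h. \<bar>L h * K (y - h)\<bar> \<partial>lborel)" by (rule integral_abs_bound)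
    also have "\<dots> \<le> (\<integral>h. (C * 2 ^ N * wt N y) * ((1 + norm h) ^ N * \<bar>L h\<bar>) \<partial>lborel)"
    proof (rule integral_mono')
      show "integrable lborel (\<lambda>h. (C * 2 ^ N * wt N y) * ((1 + norm h) ^ N * \<bar>L h\<bar>))" by (intro integrable_mult_right i)
      show "0 \<le> (C * 2 ^ N * wt N y) * ((1 + norm h) ^ N * \<bar>L h\<bar>)" for h :: 'a using C(1) by auto
      fix h
      have "wt N (y - h) = wt N (h - y)" by (simp add: wt_def norm_minus_commute)
      also have "\<dots> \<le> ((1 + norm h) * (1 + 1)) ^ N * wt N (h - 1 *\<^sub>R (h - y))" by (rule wt_diff_scale) simp
      also have "\<dots> = 2 ^ N * (1 + norm h) ^ N * wt N y"
        unfolding power_mult_distrib by simp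
      finally have "wt N (y - h) \<le> 2 ^ N * (1 + norm h) ^ N * wt N y" .
      then have "\<bar>K (y - h)\<bar> \<le> C * (2 ^ N * (1 + norm h) ^ N * wt N y)"
        using C(2)[of "y - h"] mult_left_mono[OF _ C(1)] by (meson order_trans)
      then have "\<bar>L h\<bar> * \<bar>K (y - h)\<bar> \<le> \<bar>L h\<bar> * (C * (2 ^ N * (1 + norm h) ^ N * wt N y))" by (intro mult_left_mono) auto
      then show "\<bar>L h * K (y - h)\<bar> \<le> (C * 2 ^ N * wt N y) * ((1 + norm h) ^ N * \<bar>L h\<bar>)" by (simp add: abs_mult mult_ac)
    qed
    also have "\<dots> = (C * 2 ^ N * (\<integral>h. (1 + norm h) ^ N * \<bar>L h\<bar> \<partial>lborel)) * wt N y"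
      by (subst integral_mult_right_zero) (simp only: mult_ac)
    finally show ?thesis .
  qed
  then show "\<exists>C. \<forall>x. \<bar>\<integral>h. L h * K (x - h) \<partial>lborel\<bar> \<le> C * wt N x" by blast
qed

text \<open>Convolution commutes with translations, so \<open>kop K e v\<close> has gradient
  \<open>kop K e (g j)\<close>. Integration against the kernel turns the identity almost everywhere
  into one at every \<open>x\<close>.\<close>

lemma has_increments_kop:
  fixes v :: "real^'n \<Rightarrow> real"
  assumes K: "rapid K" and v: "tempered v" and g: "\<And>j. tempered (g j)" and inc: "has_increments v g" and e: "0 < e"
  shows "kop K e v x - kop K e v (x - k) = (\<Sum>j\<in>UNIV. k $ j * (\<integral>(t::real). indicator {0..1} t * kop K e (g j) (x - t *\<^sub>R k) \<partial>lborel))"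
proof -
  note [measurable] = rapid_measurable[OF K] tempered_measurable[OF v] tempered_measurable[OF g]
  let ?A = "\<lambda>j y. \<integral>(t::real). indicator {0..1} t * g j (y - t *\<^sub>R k) \<partial>lborel"
  have pair: "integrable (lborel \<Otimes>\<^sub>M lborel) (\<lambda>(t::real, z). indicator {0..1} t * (K z * g j (x - t *\<^sub>R k - e *\<^sub>R z)))" for j
  proof (rule integrableI_bounded)
    show "(\<lambda>(t::real, z). indicator {0..1} t * (K z * g j (x - t *\<^sub>R k - e *\<^sub>R z))) \<in> borel_measurable (lborel \<Otimes>\<^sub>M lborel)" by measurable
    obtain C N where C: "0 \<le> C" "\<And>x. (\<integral>\<^sup>+z. ennreal \<bar>K z * g j (x - e *\<^sub>R z)\<bar> \<partial>lborel) \<le> ennreal (C * (1 + norm x) ^ N)"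
      using rapid_tempered_bound[OF K g e] by blast
    have "(\<lambda>w. ennreal (norm (case w of (t::real, z) \<Rightarrow> indicator {0..1} t * (K z * g j (x - t *\<^sub>R k - e *\<^sub>R z))))) \<in> borel_measurable (lborel \<Otimes>\<^sub>M lborel)" by measurable
    from lborel.nn_integral_fst[OF this, symmetric]
    have "(\<integral>\<^sup>+w. ennreal (norm (case w of (t::real, z) \<Rightarrow> indicator {0..1} t * (K z * g j (x - t *\<^sub>R k - e *\<^sub>R z)))) \<partial>(lborel \<Otimes>\<^sub>M lborel))
      = (\<integral>\<^sup>+(t::real). \<integral>\<^sup>+z. indicator {0..1} t * ennreal \<bar>K z * g j (x - t *\<^sub>R k - e *\<^sub>R z)\<bar> \<partial>lborel \<partial>lborel)"
      by (auto intro!: nn_integral_cong split: split_indicator)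
    also have "\<dots> = (\<integral>\<^sup>+(t::real). indicator {0..1} t * (\<integral>\<^sup>+z. ennreal \<bar>K z * g j (x - t *\<^sub>R k - e *\<^sub>R z)\<bar> \<partial>lborel) \<partial>lborel)"
      by (intro nn_integral_cong nn_integral_cmult) measurable
    also have "\<dots> \<le> (\<integral>\<^sup>+(t::real). indicator {0..1} t * ennreal (C * (1 + (norm x + norm k)) ^ N) \<partial>lborel)"
    proof (intro nn_integral_mono)
      fix t :: real
      show "indicator {0..1} t * (\<integral>\<^sup>+z. ennreal \<bar>K z * g j (x - t *\<^sub>R k - e *\<^sub>R z)\<bar> \<partial>lborel) \<le> indicator {0..1} t * ennreal (C * (1 + (norm x + norm k)) ^ N)"
      proof (cases "t \<in> {0..1}")
        case True
        have "norm (x - t *\<^sub>R k) \<le> norm x + norm (t *\<^sub>R k)" by (rule norm_triangle_ineq4)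
        also have "norm (t *\<^sub>R k) \<le> norm k" using True by (auto simp: mult_left_le_one_le)
        finally have "C * (1 + norm (x - t *\<^sub>R k)) ^ N \<le> C * (1 + (norm x + norm k)) ^ N"
          using C(1) by (intro mult_left_mono power_mono) auto
        then show ?thesis using True order_trans[OF C(2) ennreal_leI] by simp
      qed simp
    qed
    also have "\<dots> < \<infinity>" by (simp add: nn_integral_multc)
    finally show "(\<integral>\<^sup>+w. ennreal (norm (case w of (t::real, z) \<Rightarrow> indicator {0..1} t * (K z * g j (x - t *\<^sub>R k - e *\<^sub>R z)))) \<partial>(lborel \<Otimes>\<^sub>M lborel)) < \<infinity>" .
  qed
  have inner: "(\<integral>(t::real). indicator {0..1} t * (K z * g j (x - t *\<^sub>R k - e *\<^sub>R z)) \<partial>lborel) = K z * ?A j (x - e *\<^sub>R z)" for j z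
    by (simp only: mult.left_commute[of _ "K z"] integral_mult_right_zero) (simp add: algebra_simps)
  have iA: "integrable lborel (\<lambda>z. K z * ?A j (x - e *\<^sub>R z))" for j
    using lborel_pair.integrable_snd[OF pair[of j]] by (simp only: inner)
  have i1: "integrable lborel (\<lambda>z. K z * v (x - e *\<^sub>R z))" by (rule rapid_tempered_integrable[OF K v e])
  have i2: "integrable lborel (\<lambda>z. K z * v (x - k - e *\<^sub>R z))" by (rule rapid_tempered_integrable[OF K v e])
  have "kop K e v x - kop K e v (x - k) = (\<integral>z. K z * v (x - e *\<^sub>R z) - K z * v (x - k - e *\<^sub>R z) \<partial>lborel)"
    unfolding kop_def using i1 i2 by (rule Bochner_Integration.integral_diff[symmetric])
  also have "\<dots> = (\<integral>z. (\<Sum>j\<in>UNIV. k $ j * (K z * ?A j (x - e *\<^sub>R z))) \<partial>lborel)"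
  proof (rule integral_cong_AE)
    have "AE y in lborel. v y - v (y - k) = (\<Sum>j\<in>UNIV. k $ j * ?A j y)" using inc unfolding has_increments_def by blast
    from AE_lborel_diff_scale[OF _ this, of e x] e
    have "AE z in lborel. v (x - e *\<^sub>R z) - v (x - e *\<^sub>R z - k) = (\<Sum>j\<in>UNIV. k $ j * ?A j (x - e *\<^sub>R z))" by simp
    then show "AE z in lborel. K z * v (x - e *\<^sub>R z) - K z * v (x - k - e *\<^sub>R z) = (\<Sum>j\<in>UNIV. k $ j * (K z * ?A j (x - e *\<^sub>R z)))"
    proof eventually_elim
      fix z assume *: "v (x - e *\<^sub>R z) - v (x - e *\<^sub>R z - k) = (\<Sum>j\<in>UNIV. k $ j * ?A j (x - e *\<^sub>R z))"
      have "K z * v (x - e *\<^sub>R z) - K z * v (x - k - e *\<^sub>R z) = K z * (v (x - e *\<^sub>R z) - v (x - e *\<^sub>R z - k))"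
        by (simp add: right_diff_distrib diff_diff_eq add.commute)
      then show "K z * v (x - e *\<^sub>R z) - K z * v (x - k - e *\<^sub>R z) = (\<Sum>j\<in>UNIV. k $ j * (K z * ?A j (x - e *\<^sub>R z)))"
        unfolding * by (simp add: sum_distrib_left mult.left_commute)
    qed
  qed measurable
  also have "\<dots> = (\<Sum>j\<in>UNIV. k $ j * (\<integral>z. K z * ?A j (x - e *\<^sub>R z) \<partial>lborel))"
    using iA by (subst Bochner_Integration.integral_sum) auto
  also have "\<dots> = (\<Sum>j\<in>UNIV. k $ j * (\<integral>(t::real). indicator {0..1} t * kop K e (g j) (x - t *\<^sub>R k) \<partial>lborel))"
  proof -
    have "(\<integral>z. K z * ?A j (x - e *\<^sub>R z) \<partial>lborel) = (\<integral>(t::real). indicator {0..1} t * kop K e (g j) (x - t *\<^sub>R k) \<partial>lborel)" for j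
      using lborel_pair.Fubini_integral[OF pair[of j]] by (simp only: inner kop_def integral_mult_right_zero)
    then show ?thesis by simp
  qed
  finally show ?thesis .
qed

subsection \<open>Dyadic decomposition\<close>

definition l1 :: "('a::euclidean_space \<Rightarrow> real) \<Rightarrow> real" where "l1 K = (\<integral>z. \<bar>K z\<bar> \<partial>lborel)"
definition m1 :: "('a::euclidean_space \<Rightarrow> real) \<Rightarrow> real" where "m1 K = (\<integral>z. norm z * \<bar>K z\<bar> \<partial>lborel)"

lemma l1_nonneg: "0 \<le> l1 K" and m1_nonneg: "0 \<le> m1 K"
  unfolding l1_def m1_def by (auto intro!: Bochner_Integration.integral_nonneg)

lemma nn_integral_l1: "rapid K \<Longrightarrow> (\<integral>\<^sup>+z. ennreal \<bar>K z\<bar> \<partial>lborel) = ennreal (l1 K)"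
  unfolding l1_def by (intro nn_integral_eq_integral rapid_integrable rapid_abs) auto

lemma nn_integral_m1: "rapid K \<Longrightarrow> (\<integral>\<^sup>+z. ennreal (norm z * \<bar>K z\<bar>) \<partial>lborel) = ennreal (m1 K)"
  unfolding m1_def by (intro nn_integral_eq_integral rapid_integrable rapid_norm_mult rapid_abs) auto

lemmas sf_lborel = lborel.sigma_finite_measure_axioms

lemma Lp_le_kop:
  fixes f :: "'a::euclidean_space \<Rightarrow> real"
  assumes p: "1 \<le> p" and K: "rapid K" and [measurable]: "f \<in> borel_measurable borel"
    and f: "Lp_le lborel p (\<lambda>x. ennreal \<bar>f x\<bar>) (ennreal A)" "0 \<le> A"
  shows "Lp_le lborel p (\<lambda>x. ennreal \<bar>kop K e f x\<bar>) (ennreal (l1 K * A))"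
proof -
  note [measurable] = rapid_measurable[OF K]
  have "Lp_le lborel p (\<lambda>x. \<integral>\<^sup>+z. ennreal \<bar>K z\<bar> * ennreal \<bar>f (x - e *\<^sub>R z)\<bar> \<partial>lborel) (ennreal (l1 K * A))"
    using Lp_le_shift[OF _ f(1)] f(2)
    by (intro Lp_le_Minkowski[OF sf_lborel sf_lborel p]) (auto simp: nn_integral_l1[OF K] l1_nonneg)
  then show ?thesis
    by (rule Lp_le_mono[OF p]) (use abs_kop_le[of K e f] in \<open>auto simp: abs_mult ennreal_mult\<close>)
qed

lemma abs_mean_diff_le:
  assumes K: "rapid K" and f: "tempered f" and e: "0 < e"
  shows "ennreal \<bar>(\<integral>z. K z \<partial>lborel) * f x - kop K e f x\<bar> \<le> (\<integral>\<^sup>+z. ennreal \<bar>K z\<bar> * ennreal \<bar>f x - f (x - e *\<^sub>R z)\<bar> \<partial>lborel)"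
proof -
  have i1: "integrable lborel (\<lambda>z. K z * f x)" by (intro integrable_mult_left rapid_integrable K)
  have i2: "integrable lborel (\<lambda>z. K z * f (x - e *\<^sub>R z))" by (rule rapid_tempered_integrable[OF K f e])
  have i: "integrable lborel (\<lambda>z. K z * (f x - f (x - e *\<^sub>R z)))"
    using Bochner_Integration.integrable_diff[OF i1 i2] by (simp add: right_diff_distrib)
  have "(\<integral>z. K z \<partial>lborel) * f x - kop K e f x = (\<integral>z. K z * (f x - f (x - e *\<^sub>R z)) \<partial>lborel)"
    unfolding kop_def right_diff_distrib Bochner_Integration.integral_diff[OF i1 i2] by simp
  then show ?thesis
    using integral_norm_bound_ennreal[OF i] by (simp add: abs_mult ennreal_mult)
qed

text \<open>The increment of \<open>v\<close> over e z is at most e |z| times a line average of the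
  gradient, so the first moment of \<open>K\<close> comes with one power of the scale. For a kernel
  of mean zero this bounds \<open>kop K e v\<close> itself; for one of mean 1 it bounds the error of
  mollifying \<open>v\<close>.\<close>

lemma Lp_le_mean_diff_increments:
  fixes v :: "real^'n \<Rightarrow> real"
  assumes p: "1 \<le> p" and K: "rapid K" and v: "tempered v" and inc: "has_increments v g"
    and [measurable]: "\<And>j. g j \<in> borel_measurable borel"
    and g: "\<And>j. Lp_le lborel p (\<lambda>x. ennreal \<bar>g j x\<bar>) (ennreal A)" and A: "0 \<le> A" and e: "0 < e"
  shows "Lp_le lborel p (\<lambda>x. ennreal \<bar>(\<integral>z. K z \<partial>lborel) * v x - kop K e v x\<bar>) (ennreal (m1 K * (e * (real CARD('n) * A))))"
proof -
  note [measurable] = rapid_measurable[OF K] tempered_measurable[OF v]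
  define F where "F z x = (\<Sum>j\<in>UNIV. \<integral>\<^sup>+(t::real). indicator {0..1} t * ennreal \<bar>g j (x - t *\<^sub>R (e *\<^sub>R z))\<bar> \<partial>lborel)" for z x
  have [measurable]: "(\<lambda>(z, x). F z x) \<in> borel_measurable (borel \<Otimes>\<^sub>M borel)" unfolding F_def by measurable
  have F: "Lp_le lborel p (\<lambda>x. ennreal e * F z x) (ennreal (e * (real CARD('n) * A)))" for z
  proof -
    have "Lp_le lborel p (F z) (ennreal (real CARD('n) * A))"
      unfolding F_def using A by (intro Lp_le_sum_const[OF sf_lborel p] Lp_le_line_average[OF p] g) auto
    from Lp_le_cmult[OF p _ this, of "ennreal e"] show ?thesis using e A by (simp add: ennreal_mult)
  qed
  have "AE x in lborel. AE z in lborel. ennreal \<bar>v x - v (x - e *\<^sub>R z)\<bar> \<le> ennreal (norm (e *\<^sub>R z)) * F z x"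
  proof (subst lborel_pair.AE_commute)
    show "AE z in lborel. AE x in lborel. ennreal \<bar>v x - v (x - e *\<^sub>R z)\<bar> \<le> ennreal (norm (e *\<^sub>R z)) * F z x"
      using has_increments_bound[OF inc, of "e *\<^sub>R _"] unfolding F_def by simp
  qed measurable
  then have ae: "AE x in lborel. ennreal \<bar>(\<integral>z. K z \<partial>lborel) * v x - kop K e v x\<bar> \<le> (\<integral>\<^sup>+z. ennreal (norm z * \<bar>K z\<bar>) * (ennreal e * F z x) \<partial>lborel)"
  proof eventually_elim
    fix x assume ae: "AE z in lborel. ennreal \<bar>v x - v (x - e *\<^sub>R z)\<bar> \<le> ennreal (norm (e *\<^sub>R z)) * F z x"
    have "ennreal \<bar>(\<integral>z. K z \<partial>lborel) * v x - kop K e v x\<bar> \<le> (\<integral>\<^sup>+z. ennreal \<bar>K z\<bar> * ennreal \<bar>v x - v (x - e *\<^sub>R z)\<bar> \<partial>lborel)"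
      by (rule abs_mean_diff_le[OF K v e])
    also have "\<dots> \<le> (\<integral>\<^sup>+z. ennreal \<bar>K z\<bar> * (ennreal (norm (e *\<^sub>R z)) * F z x) \<partial>lborel)"
      using ae by (intro nn_integral_mono_AE) (auto elim!: eventually_mono intro!: mult_left_mono)
    also have "\<dots> = (\<integral>\<^sup>+z. ennreal (norm z * \<bar>K z\<bar>) * (ennreal e * F z x) \<partial>lborel)"
      using e by (intro nn_integral_cong) (simp add: ennreal_mult mult_ac)
    finally show "ennreal \<bar>(\<integral>z. K z \<partial>lborel) * v x - kop K e v x\<bar> \<le> \<dots>" .
  qed
  have lp: "Lp_le lborel p (\<lambda>x. \<integral>\<^sup>+z. ennreal (norm z * \<bar>K z\<bar>) * (ennreal e * F z x) \<partial>lborel) (ennreal (m1 K * (e * (real CARD('n) * A))))"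
    using e A F by (intro Lp_le_Minkowski[OF sf_lborel sf_lborel p]) (auto simp: nn_integral_m1[OF K] m1_nonneg)
  show ?thesis by (rule Lp_le_mono_AE[OF p lp ae order_refl])
qed

text \<open>The same gain for a function without a gradient of its own: here
  \<open>kop k d f\<close> is smooth at scale \<open>d\<close> and its increments over e z cost |z|
  e/d times an average of |f|.\<close>

lemma Lp_le_mean_diff_kop:
  fixes f :: "'a::euclidean_space \<Rightarrow> real"
  assumes p: "1 \<le> p" and Q: "rapid Q" and k: "rapid k" "grad_bd k D" "rapid D" "\<And>x. 0 \<le> D x" and f: "tempered f"
    and fB: "Lp_le lborel p (\<lambda>x. ennreal \<bar>f x\<bar>) (ennreal B)" "0 \<le> B" and e: "0 < e" "0 < d"
  shows "Lp_le lborel p (\<lambda>x. ennreal \<bar>(\<integral>z. Q z \<partial>lborel) * kop k d f x - kop Q e (kop k d f) x\<bar>) (ennreal (m1 Q * (e / d * (l1 D * B))))"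
proof -
  note [measurable] = rapid_measurable[OF Q] rapid_measurable[OF k(1)] rapid_measurable[OF k(3)] tempered_measurable[OF f]
  have a: "Lp_le lborel p (avg D d h (\<lambda>y. ennreal \<bar>f y\<bar>)) (ennreal (l1 D * B))" for h
    using nn_integral_l1[OF k(3)] k(4) fB l1_nonneg by (intro Lp_le_avg[OF p]) auto
  have a': "Lp_le lborel p (\<lambda>x. ennreal (e / d) * avg D d (e *\<^sub>R z) (\<lambda>y. ennreal \<bar>f y\<bar>) x) (ennreal (e / d * (l1 D * B)))" for z
  proof -
    have "avg D d (e *\<^sub>R z) (\<lambda>y. ennreal \<bar>f y\<bar>) \<in> borel_measurable lborel" by measurable
    from Lp_le_cmult[OF p this a, of "ennreal (e / d)"] show ?thesis
      using e fB l1_nonneg[of D] by (simp add: ennreal_mult[symmetric])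
  qed
  have lp: "Lp_le lborel p (\<lambda>x. \<integral>\<^sup>+z. ennreal (norm z * \<bar>Q z\<bar>) * (ennreal (e / d) * avg D d (e *\<^sub>R z) (\<lambda>y. ennreal \<bar>f y\<bar>) x) \<partial>lborel) (ennreal (m1 Q * (e / d * (l1 D * B))))"
    using e fB a' l1_nonneg[of D] by (intro Lp_le_Minkowski[OF sf_lborel sf_lborel p]) (auto simp: nn_integral_m1[OF Q] m1_nonneg)
  have "ennreal \<bar>(\<integral>z. Q z \<partial>lborel) * kop k d f x - kop Q e (kop k d f) x\<bar>
     \<le> (\<integral>\<^sup>+z. ennreal (norm z * \<bar>Q z\<bar>) * (ennreal (e / d) * avg D d (e *\<^sub>R z) (\<lambda>y. ennreal \<bar>f y\<bar>) x) \<partial>lborel)" for x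
  proof -
    have "ennreal \<bar>(\<integral>z. Q z \<partial>lborel) * kop k d f x - kop Q e (kop k d f) x\<bar> \<le> (\<integral>\<^sup>+z. ennreal \<bar>Q z\<bar> * ennreal \<bar>kop k d f x - kop k d f (x - e *\<^sub>R z)\<bar> \<partial>lborel)"
      by (rule abs_mean_diff_le[OF Q tempered_kop[OF k(1) f e(2)] e(1)])
    also have "\<dots> \<le> (\<integral>\<^sup>+z. ennreal \<bar>Q z\<bar> * (ennreal (norm (e *\<^sub>R z) / d) * avg D d (e *\<^sub>R z) (\<lambda>y. ennreal \<bar>f y\<bar>) x) \<partial>lborel)"
    proof (intro nn_integral_mono mult_left_mono)
      fix z
      show "ennreal \<bar>kop k d f x - kop k d f (x - e *\<^sub>R z)\<bar> \<le> ennreal (norm (e *\<^sub>R z) / d) * avg D d (e *\<^sub>R z) (\<lambda>y. ennreal \<bar>f y\<bar>) x"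
        using kop_increment[OF k(1,2) f e(2), of x "e *\<^sub>R z"] by (simp only: abs_minus_commute)
    qed auto
    also have "\<dots> = (\<integral>\<^sup>+z. ennreal (norm z * \<bar>Q z\<bar>) * (ennreal (e / d) * avg D d (e *\<^sub>R z) (\<lambda>y. ennreal \<bar>f y\<bar>) x) \<partial>lborel)"
    proof (intro nn_integral_cong)
      fix z :: 'a
      have "ennreal (norm (e *\<^sub>R z) / d) = ennreal (norm z) * ennreal (e / d)" using e by (simp add: ennreal_mult[symmetric] mult.commute)
      then show "ennreal \<bar>Q z\<bar> * (ennreal (norm (e *\<^sub>R z) / d) * avg D d (e *\<^sub>R z) (\<lambda>y. ennreal \<bar>f y\<bar>) x)
        = ennreal (norm z * \<bar>Q z\<bar>) * (ennreal (e / d) * avg D d (e *\<^sub>R z) (\<lambda>y. ennreal \<bar>f y\<bar>) x)"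
        by (simp add: ennreal_mult mult_ac)
    qed
    finally show ?thesis .
  qed
  note le = this
  show ?thesis by (rule Lp_le_mono[OF p lp le order_refl])
qed

text \<open>The length belonging to the frequency 2^n.\<close>

abbreviation dy :: "int \<Rightarrow> real" where "dy n \<equiv> 2 powr (- real_of_int n)"

lemma dy_succ: "2 * dy (n + 1) = dy n"
proof -
  have "dy (n + 1) = 2 powr (- real_of_int n - 1)" by simp
  also have "\<dots> = dy n / 2" by (subst powr_diff) simp
  finally show ?thesis by simp
qed

context lp_kernels
begin

text \<open>Writes a block as a mean-zero kernel applied to blocks. The outer kernels
  \<open>a'\<close>, \<open>b'\<close> yield the gain or cost of a power of the scale, while the
  inner ones keep the Besov norm in the estimate.\<close>

lemma kop_a_repr:
  assumes f: "tempered f" and e: "0 < e"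
  shows "kop a e f x = kop a' e (kop a e f) x - kop b' e (kop b e f) x"
proof -
  have "kop a e f x = kop (\<lambda>y. (\<integral>h. a' h * a (y - h) \<partial>lborel) - (\<integral>h. b' h * b (y - h) \<partial>lborel)) e f x"
    by (rule arg_cong[where f="\<lambda>K. kop K e f x"], rule ext, rule a_repr)
  also have "\<dots> = kop (\<lambda>y. \<integral>h. a' h * a (y - h) \<partial>lborel) e f x - kop (\<lambda>y. \<integral>h. b' h * b (y - h) \<partial>lborel) e f x"
    by (intro kop_diff_kernel rapid_convolution rapid f e)
  finally show ?thesis by (simp only: kop_kop_eq[OF rapid(2,4) f e] kop_kop_eq[OF rapid(3,5) f e])
qed

text \<open>By \<open>a_eq\<close> a block at scale \<open>dy (n + 1)\<close> is the low-frequency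
  cut-off at that scale minus the one at twice the scale, which is \<open>dy n\<close>.\<close>

lemma kop_P_succ:
  assumes f: "tempered f"
  shows "kop P (dy (n + 1)) f x = kop P (dy n) f x + kop a (dy (n + 1)) f x"
proof -
  let ?e = "dy (n + 1)"
  have i: "integrable lborel (\<lambda>z. P z * f (x - ?e *\<^sub>R z))" by (rule rapid_tempered_integrable[OF rapid(1) f]) simp
  have i2: "integrable lborel (\<lambda>z. P z * f (x - (2 * ?e) *\<^sub>R z))" by (rule rapid_tempered_integrable[OF rapid(1) f]) simp
  have i3: "integrable lborel (\<lambda>z. P ((1/2) *\<^sub>R z) / 2 ^ CARD('n) * f (x - ?e *\<^sub>R z))"
    using integrable_mult_right[OF integrable_lborel_affine[OF i2, of "1/2" 0], of "1 / 2 ^ CARD('n)"] by simp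
  have "(\<integral>z. P ((1/2) *\<^sub>R z) / 2 ^ CARD('n) * f (x - ?e *\<^sub>R z) \<partial>lborel)
      = (1 / 2 ^ CARD('n)) * (\<integral>z. (\<lambda>y. P y * f (x - (2 * ?e) *\<^sub>R y)) (0 + (1/2) *\<^sub>R z) \<partial>lborel)"
    by (subst integral_mult_right_zero[symmetric]) simp
  also have "\<dots> = (\<integral>y. P y * f (x - (2 * ?e) *\<^sub>R y) \<partial>lborel)"
    by (subst integral_lborel_affine) (simp_all add: power_divide)
  finally have "(\<integral>z. P ((1/2) *\<^sub>R z) / 2 ^ CARD('n) * f (x - ?e *\<^sub>R z) \<partial>lborel) = kop P (dy n) f x"
    by (simp only: kop_def dy_succ)
  moreover have "kop a ?e f x = kop P ?e f x - (\<integral>z. P ((1/2) *\<^sub>R z) / 2 ^ CARD('n) * f (x - ?e *\<^sub>R z) \<partial>lborel)"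
    unfolding kop_def a_eq left_diff_distrib by (rule Bochner_Integration.integral_diff[OF i i3])
  ultimately show ?thesis by simp
qed

lemma kop_P_telescope:
  assumes f: "tempered f" and "M \<le> n"
  shows "kop P (dy n) f x = kop P (dy M) f x + (\<Sum>m\<in>{M<..n}. kop a (dy m) f x)"
  using \<open>M \<le> n\<close>
proof (induction n rule: int_ge_induct)
  case (step i)
  have "{M<..i+1} = insert (i+1) {M<..i}" using step.hyps by auto
  then show ?case using step kop_P_succ[OF f, of i x] by simp
qed simp

text \<open>A bound for the increments of the low frequencies of \<open>f\<close>, divided by |h|.
  Each block between \<open>M\<close> and \<open>n\<close> costs the inverse of its scale; the last
  term covers all frequencies below the cut-off \<open>M\<close> and uses \<open>f\<close> itself
  instead of blocks.\<close>

definition Jop :: "int \<Rightarrow> int \<Rightarrow> (real^'n \<Rightarrow> real) \<Rightarrow> real^'n \<Rightarrow> real^'n \<Rightarrow> ennreal" where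
  "Jop M n f h x = (\<Sum>m\<in>{M<..n}. ennreal (1 / dy m) *
       (avg Da (dy m) h (\<lambda>y. ennreal \<bar>kop a (dy m) f y\<bar>) x + avg Db (dy m) h (\<lambda>y. ennreal \<bar>kop b (dy m) f y\<bar>) x))
     + ennreal (1 / dy M) * avg DP (dy M) h (\<lambda>y. ennreal \<bar>f y\<bar>) x"

lemma Jop_measurable [measurable (raw)]:
  assumes [measurable]: "f \<in> borel_measurable borel" "g \<in> borel_measurable N" "h \<in> borel_measurable N"
  shows "(\<lambda>x. Jop M n f (h x) (g x)) \<in> borel_measurable N"
proof -
  note [measurable] = rapid[THEN rapid_measurable]
  show ?thesis unfolding Jop_def by measurable
qed

lemma kop_P_increment_le:
  assumes f: "tempered f" and "M \<le> n"
  shows "ennreal \<bar>kop P (dy n) f (x - h) - kop P (dy n) f x\<bar> \<le> ennreal (norm h) * Jop M n f h x"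
proof -
  have step: "ennreal \<bar>kop a (dy m) f (x - h) - kop a (dy m) f x\<bar> \<le> ennreal (norm h) * (ennreal (1 / dy m) *
       (avg Da (dy m) h (\<lambda>y. ennreal \<bar>kop a (dy m) f y\<bar>) x + avg Db (dy m) h (\<lambda>y. ennreal \<bar>kop b (dy m) f y\<bar>) x))" for m
  proof -
    have e: "0 < dy m" by simp
    have "ennreal \<bar>kop a (dy m) f (x - h) - kop a (dy m) f x\<bar>
       \<le> ennreal (\<bar>kop a' (dy m) (kop a (dy m) f) (x - h) - kop a' (dy m) (kop a (dy m) f) x\<bar> + \<bar>kop b' (dy m) (kop b (dy m) f) (x - h) - kop b' (dy m) (kop b (dy m) f) x\<bar>)"
      unfolding kop_a_repr[OF f e, of x] kop_a_repr[OF f e, of "x - h"] by (intro ennreal_leI) linarith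
    also have "\<dots> = ennreal \<bar>kop a' (dy m) (kop a (dy m) f) (x - h) - kop a' (dy m) (kop a (dy m) f) x\<bar> + ennreal \<bar>kop b' (dy m) (kop b (dy m) f) (x - h) - kop b' (dy m) (kop b (dy m) f) x\<bar>"
      by simp
    also have "\<dots> \<le> ennreal (norm h / dy m) * avg Da (dy m) h (\<lambda>y. ennreal \<bar>kop a (dy m) f y\<bar>) x + ennreal (norm h / dy m) * avg Db (dy m) h (\<lambda>y. ennreal \<bar>kop b (dy m) f y\<bar>) x"
      by (intro add_mono kop_increment rapid grad_bd tempered_kop f e)
    also have "ennreal (norm h / dy m) = ennreal (norm h) * ennreal (1 / dy m)" by (simp add: ennreal_mult[symmetric])
    finally show ?thesis by (simp add: distrib_left mult.assoc)
  qed
  have "\<bar>kop P (dy n) f (x - h) - kop P (dy n) f x\<bar> = \<bar>(kop P (dy M) f (x - h) - kop P (dy M) f x) + (\<Sum>m\<in>{M<..n}. kop a (dy m) f (x - h) - kop a (dy m) f x)\<bar>"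
    unfolding kop_P_telescope[OF f \<open>M \<le> n\<close>] by (simp add: sum_subtractf)
  also have "\<dots> \<le> \<bar>kop P (dy M) f (x - h) - kop P (dy M) f x\<bar> + (\<Sum>m\<in>{M<..n}. \<bar>kop a (dy m) f (x - h) - kop a (dy m) f x\<bar>)"
    by (intro order_trans[OF abs_triangle_ineq] add_left_mono sum_abs)
  finally have "ennreal \<bar>kop P (dy n) f (x - h) - kop P (dy n) f x\<bar> \<le> ennreal \<dots>" by (rule ennreal_leI)
  also have "\<dots> = ennreal \<bar>kop P (dy M) f (x - h) - kop P (dy M) f x\<bar> + (\<Sum>m\<in>{M<..n}. ennreal \<bar>kop a (dy m) f (x - h) - kop a (dy m) f x\<bar>)"
    by (simp add: sum_nonneg sum_ennreal)
  also have "\<dots> \<le> ennreal (norm h / dy M) * avg DP (dy M) h (\<lambda>y. ennreal \<bar>f y\<bar>) x + (\<Sum>m\<in>{M<..n}. ennreal (norm h) * (ennreal (1 / dy m) *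
       (avg Da (dy m) h (\<lambda>y. ennreal \<bar>kop a (dy m) f y\<bar>) x + avg Db (dy m) h (\<lambda>y. ennreal \<bar>kop b (dy m) f y\<bar>) x)))"
    by (intro add_mono sum_mono step kop_increment rapid grad_bd f) simp
  also have "ennreal (norm h / dy M) = ennreal (norm h) * ennreal (1 / dy M)" by (simp add: ennreal_mult[symmetric])
  finally show ?thesis unfolding Jop_def by (simp add: distrib_left sum_distrib_left mult.assoc add.commute)
qed

lemma Lp_le_Jop:
  assumes p: "1 \<le> p" and [measurable]: "f \<in> borel_measurable borel"
    and f: "Lp_le lborel p (\<lambda>x. ennreal \<bar>f x\<bar>) (ennreal A)" "0 \<le> A"
    and c: "\<And>m. Lp_le lborel p (\<lambda>x. ennreal \<bar>kop a (dy m) f x\<bar>) (ennreal (c m))" "\<And>m. Lp_le lborel p (\<lambda>x. ennreal \<bar>kop b (dy m) f x\<bar>) (ennreal (c m))" "\<And>m. 0 \<le> c m"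
  shows "Lp_le lborel p (Jop M n f h) (ennreal ((\<Sum>m\<in>{M<..n}. (1 / dy m) * (l1 Da * c m + l1 Db * c m)) + (1 / dy M) * (l1 DP * A)))"
proof -
  note [measurable] = rapid[THEN rapid_measurable]
  have abs: "\<bar>Da x\<bar> = Da x" "\<bar>Db x\<bar> = Db x" "\<bar>DP x\<bar> = DP x" for x using D_nonneg by auto
  have D: "(\<integral>\<^sup>+z. ennreal (Da z) \<partial>lborel) \<le> ennreal (l1 Da)" "(\<integral>\<^sup>+z. ennreal (Db z) \<partial>lborel) \<le> ennreal (l1 Db)" "(\<integral>\<^sup>+z. ennreal (DP z) \<partial>lborel) \<le> ennreal (l1 DP)"
    using nn_integral_l1[OF rapid(6)] nn_integral_l1[OF rapid(7)] nn_integral_l1[OF rapid(8)] by (auto simp: abs)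
  have cm: "Lp_le lborel p (\<lambda>x. ennreal C * H x) (ennreal (C * B))" if "Lp_le lborel p H (ennreal B)" "H \<in> borel_measurable lborel" "0 \<le> C" "0 \<le> B" for C B and H :: "real^'n \<Rightarrow> ennreal"
    using Lp_le_cmult[OF p that(2,1), of "ennreal C"] that by (simp add: ennreal_mult)
  have [measurable]: "(\<lambda>x. avg D e h F x) \<in> borel_measurable lborel" if "D \<in> borel_measurable borel" "F \<in> borel_measurable borel" for D e F and h :: "real^'n"
    using that by measurable
  show ?thesis unfolding Jop_def
    using c f D l1_nonneg[of Da] l1_nonneg[of Db] l1_nonneg[of DP]
    by (intro Lp_le_add[OF sf_lborel p] Lp_le_sum[OF sf_lborel p] cm Lp_le_avg[OF p] sum_nonneg)
       (auto intro!: sum_nonneg mult_nonneg_nonneg add_nonneg_nonneg divide_nonneg_nonneg)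
qed

end

section \<open>Bounds for sums and line averages of real functions\<close>

lemma Lp_le_abs_add:
  fixes f g :: "'a::euclidean_space \<Rightarrow> real"
  assumes p: "1 \<le> p" and [measurable]: "f \<in> borel_measurable borel" "g \<in> borel_measurable borel"
    and fg: "Lp_le lborel p (\<lambda>x. ennreal \<bar>f x\<bar>) (ennreal A)" "Lp_le lborel p (\<lambda>x. ennreal \<bar>g x\<bar>) (ennreal B)" "0 \<le> A" "0 \<le> B"
    and h: "\<And>x. \<bar>h x\<bar> \<le> \<bar>f x\<bar> + \<bar>g x\<bar>"
  shows "Lp_le lborel p (\<lambda>x. ennreal \<bar>h x\<bar>) (ennreal (A + B))"
proof (rule Lp_le_mono[OF p _ _ order_refl])
  show "Lp_le lborel p (\<lambda>x. ennreal \<bar>f x\<bar> + ennreal \<bar>g x\<bar>) (ennreal (A + B))"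
    using fg by (intro Lp_le_add[OF sf_lborel p]) auto
  show "ennreal \<bar>h x\<bar> \<le> ennreal \<bar>f x\<bar> + ennreal \<bar>g x\<bar>" for x
    using h[of x] by (simp add: ennreal_plus[symmetric] ennreal_leI del: ennreal_plus)
qed

lemma Lp_le_abs_sum:
  fixes f :: "'i \<Rightarrow> 'a::euclidean_space \<Rightarrow> real"
  assumes p: "1 \<le> p" and I: "finite I" and [measurable]: "\<And>i. i \<in> I \<Longrightarrow> f i \<in> borel_measurable borel"
    and f: "\<And>i. i \<in> I \<Longrightarrow> Lp_le lborel p (\<lambda>x. ennreal \<bar>f i x\<bar>) (ennreal (A i))" "\<And>i. i \<in> I \<Longrightarrow> 0 \<le> A i"
  shows "Lp_le lborel p (\<lambda>x. ennreal \<bar>\<Sum>i\<in>I. f i x\<bar>) (ennreal (\<Sum>i\<in>I. A i))"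
proof (rule Lp_le_mono[OF p _ _ order_refl])
  show "Lp_le lborel p (\<lambda>x. \<Sum>i\<in>I. ennreal \<bar>f i x\<bar>) (ennreal (\<Sum>i\<in>I. A i))"
    using f by (intro Lp_le_sum[OF sf_lborel p I]) auto
  show "ennreal \<bar>\<Sum>i\<in>I. f i x\<bar> \<le> (\<Sum>i\<in>I. ennreal \<bar>f i x\<bar>)" for x
    by (simp add: sum_ennreal ennreal_leI)
qed

lemma Lp_le_weaken: "1 \<le> p \<Longrightarrow> Lp_le M p f (ennreal A) \<Longrightarrow> A \<le> B \<Longrightarrow> Lp_le M p f (ennreal B)"
  by (erule Lp_le_mono) (auto intro: ennreal_leI)

text \<open>If \<open>f\<close> is not integrable on the segment, its integral has the default value
  0 and the left side is |c|; the right side is then infinite, since the constant \<open>c\<close>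
  is integrable there.\<close>

lemma abs_line_average_diff_le:
  assumes [measurable]: "f \<in> borel_measurable borel"
  shows "ennreal \<bar>(\<integral>(t::real). indicator {0..1} t * f t \<partial>lborel) - c\<bar> \<le> (\<integral>\<^sup>+(t::real). indicator {0..1} t * ennreal \<bar>f t - c\<bar> \<partial>lborel)"
proof (cases "integrable lborel (\<lambda>t::real. indicator {0..1} t * f t)")
  case True
  have ic: "integrable lborel (\<lambda>t::real. indicator {0..1} t * c)" by (intro integrable_mult_left) auto
  have "(\<integral>(t::real). indicator {0..1} t * (f t - c) \<partial>lborel) = (\<integral>(t::real). indicator {0..1} t * f t \<partial>lborel) - c"
    unfolding right_diff_distrib Bochner_Integration.integral_diff[OF True ic] by simp
  then show ?thesis using abs_line_average_le[of "\<lambda>t. f t - c"] by simp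
next
  case False
  have "(\<integral>\<^sup>+(t::real). indicator {0..1} t * ennreal \<bar>f t - c\<bar> \<partial>lborel) = \<infinity>"
  proof (rule ccontr)
    assume *: "(\<integral>\<^sup>+(t::real). indicator {0..1} t * ennreal \<bar>f t - c\<bar> \<partial>lborel) \<noteq> \<infinity>"
    have "(\<integral>\<^sup>+(t::real). ennreal (norm (indicator {0..1} t * (f t - c))) \<partial>lborel) = (\<integral>\<^sup>+(t::real). indicator {0..1} t * ennreal \<bar>f t - c\<bar> \<partial>lborel)"
      by (intro nn_integral_cong) (auto split: split_indicator)
    then have "integrable lborel (\<lambda>t::real. indicator {0..1} t * (f t - c))"
      using * by (intro integrableI_bounded) (auto simp: less_top)
    moreover have "integrable lborel (\<lambda>t::real. indicator {0..1} t * c)" by (intro integrable_mult_left) auto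
    ultimately have "integrable lborel (\<lambda>t::real. indicator {0..1} t * (f t - c) + indicator {0..1} t * c)"
      by (rule Bochner_Integration.integrable_add)
    then show False using False by (simp add: distrib_left[symmetric])
  qed
  then show ?thesis by simp
qed

lemma kop_sum:
  assumes K: "rapid K" and I: "finite I" and f: "\<And>i. i \<in> I \<Longrightarrow> tempered (f i)" and e: "0 < e"
  shows "kop K e (\<lambda>x. \<Sum>i\<in>I. f i x) x = (\<Sum>i\<in>I. kop K e (f i) x)"
  unfolding kop_def sum_distrib_left
  by (intro Bochner_Integration.integral_sum rapid_tempered_integrable K f e)

lemma tempered_sum: "finite I \<Longrightarrow> (\<And>i. i \<in> I \<Longrightarrow> tempered (f i)) \<Longrightarrow> tempered (\<lambda>x. \<Sum>i\<in>I. f i x)"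
proof (induction I rule: finite_induct)
  case empty then show ?case by (simp add: tempered_def)
next
  case (insert i I) then show ?case by (simp add: tempered_add)
qed

abbreviation dw :: "int \<Rightarrow> int \<Rightarrow> real" where "dw n m \<equiv> 2 powr (- real_of_int \<bar>m - n\<bar>)"

lemma dy_ratio: "n \<le> m \<Longrightarrow> dy m = dy n * dw n m" "m \<le> n \<Longrightarrow> dy n = dy m * dw n m"
  by (auto simp: powr_add[symmetric])

context lp_kernels
begin

text \<open>One constant above all moments of the Littlewood-Paley kernels, so that
  \<open>chi\<close> enters the final constant only through \<open>Q0\<close> and
  \<open>l1 P\<close>.\<close>

definition Q0 :: real where "Q0 = m1 P + m1 a' + m1 b' + l1 Da + l1 Db + l1 DP"

lemma Q0_ge: "0 \<le> Q0" "m1 P \<le> Q0" "m1 a' + m1 b' \<le> Q0" "l1 Da + l1 Db \<le> Q0" "l1 DP \<le> Q0"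
  using m1_nonneg[of P] m1_nonneg[of a'] m1_nonneg[of b'] l1_nonneg[of Da] l1_nonneg[of Db] l1_nonneg[of DP]
  by (auto simp: Q0_def)

text \<open>The difference v - P_n v is the sum of the blocks of \<open>v\<close> between
  \<open>n\<close> and \<open>N\<close> plus v - P_N v. A block of \<open>v\<close> is reproduced by
  the mean-zero kernels \<open>a'\<close> and \<open>b'\<close>, which gain \<open>dy m\<close>
  against the block of the gradient; the last term gains \<open>dy N\<close> against the full
  gradient. The bound involves the gradient only.\<close>

lemma high_frequency_bound:
  assumes p: "1 \<le> p" and v: "tempered v" and inc: "has_increments v g"
    and gt: "\<And>j. tempered (g j)"
    and g: "\<And>j. Lp_le lborel p (\<lambda>x. ennreal \<bar>g j x\<bar>) (ennreal A)" "0 \<le> A"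
    and c: "\<And>j m. Lp_le lborel p (\<lambda>x. ennreal \<bar>kop a (dy m) (g j) x\<bar>) (ennreal (c m))"
      "\<And>j m. Lp_le lborel p (\<lambda>x. ennreal \<bar>kop b (dy m) (g j) x\<bar>) (ennreal (c m))" "\<And>m. 0 \<le> c m"
    and N: "n \<le> N"
  shows "Lp_le lborel p (\<lambda>x. ennreal \<bar>v x - kop P (dy n) v x\<bar>)
      (ennreal (dy n * (real CARD('n) * Q0 * ((\<Sum>m\<in>{n<..N}. dw n m * c m) + dw n N * A))))"
proof -
  note [measurable] = rapid[THEN rapid_measurable] tempered_measurable[OF v] tempered_measurable[OF gt]
  let ?d = "real CARD('n)"
  \<comment> \<open>The gradient of a block of \<open>v\<close> is the block of the gradient, so
    \<open>c m\<close> bounds it.\<close>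
  have incK: "has_increments (kop K e v) (\<lambda>j. kop K e (g j))" if "rapid K" "0 < e" for K e
    unfolding has_increments_def using has_increments_kop[OF that(1) v gt inc that(2)] by simp
  have blk: "Lp_le lborel p (\<lambda>x. ennreal \<bar>kop a (dy m) v x\<bar>) (ennreal (m1 a' * (dy m * (?d * c m)) + m1 b' * (dy m * (?d * c m))))" for m
  proof (rule Lp_le_abs_add[OF p])
    have e: "0 < dy m" by simp
    show "Lp_le lborel p (\<lambda>x. ennreal \<bar>kop a' (dy m) (kop a (dy m) v) x\<bar>) (ennreal (m1 a' * (dy m * (?d * c m))))"
      using Lp_le_mean_diff_increments[OF p rapid(4) tempered_kop[OF rapid(2) v e] incK[OF rapid(2) e] _ c(1) c(3) e]
      by (simp add: mean_zero)
    show "Lp_le lborel p (\<lambda>x. ennreal \<bar>kop b' (dy m) (kop b (dy m) v) x\<bar>) (ennreal (m1 b' * (dy m * (?d * c m))))"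
      using Lp_le_mean_diff_increments[OF p rapid(5) tempered_kop[OF rapid(3) v e] incK[OF rapid(3) e] _ c(2) c(3) e]
      by (simp add: mean_zero)
    show "\<bar>kop a (dy m) v x\<bar> \<le> \<bar>kop a' (dy m) (kop a (dy m) v) x\<bar> + \<bar>kop b' (dy m) (kop b (dy m) v) x\<bar>" for x
      unfolding kop_a_repr[OF v e, of x] by (rule abs_triangle_ineq4)
    show "0 \<le> m1 a' * (dy m * (?d * c m))" "0 \<le> m1 b' * (dy m * (?d * c m))"
      by (simp_all add: c(3) m1_nonneg)
  qed measurable
  have sum: "Lp_le lborel p (\<lambda>x. ennreal \<bar>\<Sum>m\<in>{n<..N}. kop a (dy m) v x\<bar>) (ennreal (\<Sum>m\<in>{n<..N}. m1 a' * (dy m * (?d * c m)) + m1 b' * (dy m * (?d * c m))))"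
    by (intro Lp_le_abs_sum[OF p _ _ blk]) (simp_all add: c(3) m1_nonneg)
  have last: "Lp_le lborel p (\<lambda>x. ennreal \<bar>v x - kop P (dy N) v x\<bar>) (ennreal (m1 P * (dy N * (?d * A))))"
    using Lp_le_mean_diff_increments[OF p rapid(1) v inc _ g, of "dy N"] by (simp add: integral_P)
  have "Lp_le lborel p (\<lambda>x. ennreal \<bar>v x - kop P (dy n) v x\<bar>)
     (ennreal ((\<Sum>m\<in>{n<..N}. m1 a' * (dy m * (?d * c m)) + m1 b' * (dy m * (?d * c m))) + m1 P * (dy N * (?d * A))))"
  proof (rule Lp_le_abs_add[OF p _ _ sum last])
    show "\<bar>v x - kop P (dy n) v x\<bar> \<le> \<bar>\<Sum>m\<in>{n<..N}. kop a (dy m) v x\<bar> + \<bar>v x - kop P (dy N) v x\<bar>" for x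
      using kop_P_telescope[OF v N, of x] by linarith
    show "0 \<le> (\<Sum>m\<in>{n<..N}. m1 a' * (dy m * (?d * c m)) + m1 b' * (dy m * (?d * c m)))" "0 \<le> m1 P * (dy N * (?d * A))"
      by (simp_all add: c(3) m1_nonneg g(2) sum_nonneg)
  qed measurable
  then show ?thesis
  proof (rule Lp_le_weaken[OF p])
    have 1: "m1 a' * (dy m * (?d * c m)) + m1 b' * (dy m * (?d * c m)) \<le> dy n * (?d * Q0 * (dw n m * c m))" if "m \<in> {n<..N}" for m
    proof -
      have "m1 a' * (dy m * (?d * c m)) + m1 b' * (dy m * (?d * c m)) = (m1 a' + m1 b') * (dy m * (?d * c m))"
        by (simp only: distrib_right)
      also have "\<dots> \<le> Q0 * (dy m * (?d * c m))" using Q0_ge c(3) by (intro mult_right_mono) auto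
      also have "\<dots> = dy n * (?d * Q0 * (dw n m * c m))"
      proof -
        have r: "dy m = dy n * dw n m" using that by (intro dy_ratio) auto
        show ?thesis unfolding r by (simp only: mult_ac)
      qed
      finally show ?thesis .
    qed
    have "m1 P * (dy N * (?d * A)) \<le> Q0 * (dy N * (?d * A))" using Q0_ge g(2) by (intro mult_right_mono) auto
    also have "\<dots> = dy n * (?d * Q0 * (dw n N * A))"
    proof -
      have r: "dy N = dy n * dw n N" using N by (intro dy_ratio) auto
      show ?thesis unfolding r by (simp only: mult_ac)
    qed
    finally have 2: "m1 P * (dy N * (?d * A)) \<le> dy n * (?d * Q0 * (dw n N * A))" .
    have "(\<Sum>m\<in>{n<..N}. m1 a' * (dy m * (?d * c m)) + m1 b' * (dy m * (?d * c m))) \<le> (\<Sum>m\<in>{n<..N}. dy n * (?d * Q0 * (dw n m * c m)))"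
      by (rule sum_mono[OF 1])
    with 2 show "(\<Sum>m\<in>{n<..N}. m1 a' * (dy m * (?d * c m)) + m1 b' * (dy m * (?d * c m))) + m1 P * (dy N * (?d * A))
       \<le> dy n * (?d * Q0 * ((\<Sum>m\<in>{n<..N}. dw n m * c m) + dw n N * A))"
      by (simp only: distrib_left sum_distrib_left)
  qed
qed

text \<open>For m <= n the cost of a block is 1 / \<open>dy m\<close> = \<open>dw n m\<close> /
  \<open>dy n\<close>, which produces the off-diagonal weight. The bound is uniform in the
  displacement \<open>h\<close>, so it may be integrated over \<open>h\<close>.\<close>

lemma Jop_bound:
  assumes p: "1 \<le> p" and [measurable]: "f \<in> borel_measurable borel"
    and f: "Lp_le lborel p (\<lambda>x. ennreal \<bar>f x\<bar>) (ennreal A)" "0 \<le> A"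
    and c: "\<And>m. Lp_le lborel p (\<lambda>x. ennreal \<bar>kop a (dy m) f x\<bar>) (ennreal (c m))" "\<And>m. Lp_le lborel p (\<lambda>x. ennreal \<bar>kop b (dy m) f x\<bar>) (ennreal (c m))" "\<And>m. 0 \<le> c m"
    and M: "M \<le> n"
  shows "Lp_le lborel p (Jop M n f h) (ennreal (Q0 * ((\<Sum>m\<in>{M<..n}. dw n m * c m) + dw n M * A) / dy n))"
proof (rule Lp_le_weaken[OF p Lp_le_Jop[OF p assms(2) f c, of M n h]])
  have inv: "1 / dy m = dw n m / dy n" if "m \<le> n" for m using dy_ratio(2)[OF that] by (simp add: field_simps)
  have 1: "(1 / dy m) * (l1 Da * c m + l1 Db * c m) \<le> Q0 * (dw n m * c m) / dy n" if "m \<in> {M<..n}" for m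
  proof -
    have "(1 / dy m) * (l1 Da * c m + l1 Db * c m) = (1 / dy m) * ((l1 Da + l1 Db) * c m)" by (simp only: distrib_right)
    also have "\<dots> \<le> (1 / dy m) * (Q0 * c m)" using Q0_ge c(3) by (intro mult_left_mono mult_right_mono) auto
    also have "\<dots> = Q0 * (dw n m * c m) / dy n"
    proof -
      have r: "1 / dy m = dw n m / dy n" using that by (intro inv) auto
      show ?thesis unfolding r by simp
    qed
    finally show ?thesis .
  qed
  have "(1 / dy M) * (l1 DP * A) \<le> (1 / dy M) * (Q0 * A)" using Q0_ge f(2) by (intro mult_left_mono mult_right_mono) auto
  also have "\<dots> = Q0 * (dw n M * A) / dy n"
    unfolding inv[OF M] by simp
  finally have 2: "(1 / dy M) * (l1 DP * A) \<le> Q0 * (dw n M * A) / dy n" .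
  have "(\<Sum>m\<in>{M<..n}. (1 / dy m) * (l1 Da * c m + l1 Db * c m)) \<le> (\<Sum>m\<in>{M<..n}. Q0 * (dw n m * c m) / dy n)" by (rule sum_mono[OF 1])
  with 2 show "(\<Sum>m\<in>{M<..n}. (1 / dy m) * (l1 Da * c m + l1 Db * c m)) + (1 / dy M) * (l1 DP * A)
     \<le> Q0 * ((\<Sum>m\<in>{M<..n}. dw n m * c m) + dw n M * A) / dy n"
    by (simp only: distrib_left sum_distrib_left sum_divide_distrib[symmetric] add_divide_distrib)
qed

text \<open>Freezing the low frequencies of the gradient at \<open>x\<close> costs the high frequencies of \<open>v\<close> and the
  increments of the low frequencies of its gradient.\<close>
lemma commutator_component_le:
  assumes \<kappa>: "rapid \<kappa>" and \<rho>: "tempered \<rho>" and v: "tempered v" and v\<rho>: "tempered (\<lambda>x. v x * \<rho> x)"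
    and inc: "has_increments v g" and gt: "\<And>j. tempered (g j)" and d: "0 < d" and M: "M \<le> n"
  defines "\<omega> \<equiv> \<lambda>x. v x - kop P (dy n) v x"
  shows "ennreal \<bar>(v x * kop \<kappa> d \<rho> x - kop \<kappa> d (\<lambda>x. v x * \<rho> x) x) / d - (\<Sum>j\<in>UNIV. kop P (dy n) (g j) x * kop (\<lambda>z. z $ j * \<kappa> z) d \<rho> x)\<bar>
    \<le> ennreal (1 / d) * (\<integral>\<^sup>+z. ennreal \<bar>\<kappa> z\<bar> * (ennreal \<bar>\<rho> (x - d *\<^sub>R z)\<bar> * (ennreal \<bar>\<omega> x\<bar> + ennreal \<bar>\<omega> (x - d *\<^sub>R z)\<bar>)) \<partial>lborel)
     + ennreal d * (\<integral>\<^sup>+z. ennreal ((norm z)\<^sup>2 * \<bar>\<kappa> z\<bar>) * (ennreal \<bar>\<rho> (x - d *\<^sub>R z)\<bar> *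
          (\<Sum>j\<in>UNIV. \<integral>\<^sup>+(t::real). indicator {0..1} t * Jop M n (g j) (t *\<^sub>R (d *\<^sub>R z)) x \<partial>lborel)) \<partial>lborel)"
proof -
  note [measurable] = rapid[THEN rapid_measurable] tempered_measurable[OF v] tempered_measurable[OF gt] rapid_measurable[OF \<kappa>] tempered_measurable[OF \<rho>]
  let ?G = "\<lambda>j. kop P (dy n) (g j)" and ?w = "kop P (dy n) v"
  have [measurable]: "\<omega> \<in> borel_measurable borel" unfolding \<omega>_def by measurable
  have rk: "rapid (\<lambda>z. z $ j * \<kappa> z)" for j
    by (rule rapid_poly_mult[OF \<kappa>, where C=1 and m=1]) (auto intro: order_trans[OF component_le_norm_cart])
  \<comment> \<open>The difference quotient of \<open>v\<close> minus its frozen linear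
    approximation. The claim is that the integral of \<open>?b\<close> against \<kappa> z \<rho>(x -
    d z) equals the left side, with absolute convergence of each part.\<close>
  let ?b = "\<lambda>z. (v x - v (x - d *\<^sub>R z)) / d - (\<Sum>j\<in>UNIV. ?G j x * z $ j)"
  have i1: "integrable lborel (\<lambda>z. (v x / d) * (\<kappa> z * \<rho> (x - d *\<^sub>R z)))"
    by (intro integrable_mult_right rapid_tempered_integrable \<kappa> \<rho> d)
  have i2: "integrable lborel (\<lambda>z. (1 / d) * (\<kappa> z * (v (x - d *\<^sub>R z) * \<rho> (x - d *\<^sub>R z))))"
    by (intro integrable_mult_right rapid_tempered_integrable[OF \<kappa> v\<rho>] d)
  have i3: "integrable lborel (\<lambda>z. ?G j x * (z $ j * \<kappa> z * \<rho> (x - d *\<^sub>R z)))" for j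
    by (intro integrable_mult_right rapid_tempered_integrable rk \<rho> d)
  have i3': "integrable lborel (\<lambda>z. \<Sum>j\<in>UNIV. ?G j x * (z $ j * \<kappa> z * \<rho> (x - d *\<^sub>R z)))"
    by (intro Bochner_Integration.integrable_sum i3)
  have split: "(\<lambda>z. (\<kappa> z * \<rho> (x - d *\<^sub>R z)) * ?b z) = (\<lambda>z. (v x / d) * (\<kappa> z * \<rho> (x - d *\<^sub>R z)) - (1 / d) * (\<kappa> z * (v (x - d *\<^sub>R z) * \<rho> (x - d *\<^sub>R z))) - (\<Sum>j\<in>UNIV. ?G j x * (z $ j * \<kappa> z * \<rho> (x - d *\<^sub>R z))))"
    using d by (auto simp: fun_eq_iff field_simps sum_distrib_left)
  have ii: "integrable lborel (\<lambda>z. (\<kappa> z * \<rho> (x - d *\<^sub>R z)) * ?b z)"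
    unfolding split by (intro Bochner_Integration.integrable_diff i1 i2 i3')
  have eq: "(v x * kop \<kappa> d \<rho> x - kop \<kappa> d (\<lambda>x. v x * \<rho> x) x) / d - (\<Sum>j\<in>UNIV. ?G j x * kop (\<lambda>z. z $ j * \<kappa> z) d \<rho> x)
     = (\<integral>z. (\<kappa> z * \<rho> (x - d *\<^sub>R z)) * ?b z \<partial>lborel)"
    unfolding split
    by (simp only: Bochner_Integration.integral_diff[OF Bochner_Integration.integrable_diff[OF i1 i2] i3'] Bochner_Integration.integral_diff[OF i1 i2]
         Bochner_Integration.integral_sum[OF i3] integral_mult_right_zero) (simp add: kop_def diff_divide_distrib)
  \<comment> \<open>Split \<open>v\<close> into \<omega> and its low frequencies. The increment of
    \<omega> is bounded by its two values, at the price 1/d. For the low frequencies, the line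
    average of the gradient differs from its value at \<open>x\<close> by increments of length at
    most d |z|; a further factor |z| comes from the direction, whence the second moment of
    \<kappa>.\<close>
  have b: "ennreal \<bar>?b z\<bar> \<le> ennreal (1 / d) * (ennreal \<bar>\<omega> x\<bar> + ennreal \<bar>\<omega> (x - d *\<^sub>R z)\<bar>)
      + ennreal d * (ennreal ((norm z)\<^sup>2) * (\<Sum>j\<in>UNIV. \<integral>\<^sup>+(t::real). indicator {0..1} t * Jop M n (g j) (t *\<^sub>R (d *\<^sub>R z)) x \<partial>lborel))" for z
  proof -
    let ?a = "\<lambda>j. \<integral>(t::real). indicator {0..1} t * ?G j (x - t *\<^sub>R (d *\<^sub>R z)) \<partial>lborel"
    have "?w x - ?w (x - d *\<^sub>R z) = (\<Sum>j\<in>UNIV. (d *\<^sub>R z) $ j * ?a j)"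
      by (rule has_increments_kop[OF rapid(1) v gt inc]) simp
    also have "\<dots> = d * (\<Sum>j\<in>UNIV. z $ j * ?a j)" by (simp add: sum_distrib_left mult.assoc)
    finally have w: "?w x - ?w (x - d *\<^sub>R z) = d * (\<Sum>j\<in>UNIV. z $ j * ?a j)" .
    have "v x - v (x - d *\<^sub>R z) = (\<omega> x - \<omega> (x - d *\<^sub>R z)) + (?w x - ?w (x - d *\<^sub>R z))"
      unfolding \<omega>_def by simp
    then have "(v x - v (x - d *\<^sub>R z)) / d = (\<omega> x - \<omega> (x - d *\<^sub>R z)) / d + (\<Sum>j\<in>UNIV. z $ j * ?a j)"
      unfolding w using d by (simp add: add_divide_distrib)
    then have "?b z = (\<omega> x - \<omega> (x - d *\<^sub>R z)) / d + (\<Sum>j\<in>UNIV. z $ j * (?a j - ?G j x))"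
      by (simp add: right_diff_distrib sum_subtractf mult.commute)
    then have "\<bar>?b z\<bar> \<le> \<bar>\<omega> x - \<omega> (x - d *\<^sub>R z)\<bar> / d + \<bar>\<Sum>j\<in>UNIV. z $ j * (?a j - ?G j x)\<bar>"
      using d abs_triangle_ineq[of "(\<omega> x - \<omega> (x - d *\<^sub>R z)) / d" "\<Sum>j\<in>UNIV. z $ j * (?a j - ?G j x)"]
      by (simp only: abs_divide abs_of_pos)
    also have "\<dots> \<le> (\<bar>\<omega> x\<bar> + \<bar>\<omega> (x - d *\<^sub>R z)\<bar>) / d + (\<Sum>j\<in>UNIV. norm z * \<bar>?a j - ?G j x\<bar>)"
      using d by (intro add_mono divide_right_mono abs_triangle_ineq4 order_trans[OF sum_abs] sum_mono)
        (auto simp: abs_mult component_le_norm_cart intro!: mult_right_mono)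
    finally have "ennreal \<bar>?b z\<bar> \<le> ennreal ((\<bar>\<omega> x\<bar> + \<bar>\<omega> (x - d *\<^sub>R z)\<bar>) / d + (\<Sum>j\<in>UNIV. norm z * \<bar>?a j - ?G j x\<bar>))"
      by (rule ennreal_leI)
    also have "\<dots> = ennreal ((\<bar>\<omega> x\<bar> + \<bar>\<omega> (x - d *\<^sub>R z)\<bar>) / d) + (\<Sum>j\<in>UNIV. ennreal (norm z) * ennreal \<bar>?a j - ?G j x\<bar>)"
      using d by (subst ennreal_plus) (auto intro!: sum_nonneg simp: sum_ennreal[symmetric] ennreal_mult)
    also have "ennreal ((\<bar>\<omega> x\<bar> + \<bar>\<omega> (x - d *\<^sub>R z)\<bar>) / d) = ennreal (1 / d) * (ennreal \<bar>\<omega> x\<bar> + ennreal \<bar>\<omega> (x - d *\<^sub>R z)\<bar>)"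
      using d by (simp add: ennreal_mult[symmetric] ennreal_plus[symmetric] del: ennreal_plus)
    also have "(\<Sum>j\<in>UNIV. ennreal (norm z) * ennreal \<bar>?a j - ?G j x\<bar>)
      \<le> (\<Sum>j\<in>UNIV. ennreal (norm z) * (ennreal (d * norm z) * (\<integral>\<^sup>+(t::real). indicator {0..1} t * Jop M n (g j) (t *\<^sub>R (d *\<^sub>R z)) x \<partial>lborel)))"
    proof (intro sum_mono mult_left_mono)
      fix j
      have "ennreal \<bar>?a j - ?G j x\<bar> \<le> (\<integral>\<^sup>+(t::real). indicator {0..1} t * ennreal \<bar>?G j (x - t *\<^sub>R (d *\<^sub>R z)) - ?G j x\<bar> \<partial>lborel)"
        by (rule abs_line_average_diff_le) measurable
      also have "\<dots> \<le> (\<integral>\<^sup>+(t::real). ennreal (d * norm z) * (indicator {0..1} t * Jop M n (g j) (t *\<^sub>R (d *\<^sub>R z)) x) \<partial>lborel)"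
      proof (rule nn_integral_mono)
        fix t :: real
        show "indicator {0..1} t * ennreal \<bar>?G j (x - t *\<^sub>R (d *\<^sub>R z)) - ?G j x\<bar> \<le> ennreal (d * norm z) * (indicator {0..1} t * Jop M n (g j) (t *\<^sub>R (d *\<^sub>R z)) x)"
        proof (cases "t \<in> {0..1}")
          case True
          have "ennreal \<bar>?G j (x - t *\<^sub>R (d *\<^sub>R z)) - ?G j x\<bar> \<le> ennreal (norm (t *\<^sub>R (d *\<^sub>R z))) * Jop M n (g j) (t *\<^sub>R (d *\<^sub>R z)) x"
            by (rule kop_P_increment_le[OF gt M])
          also have "\<dots> \<le> ennreal (d * norm z) * Jop M n (g j) (t *\<^sub>R (d *\<^sub>R z)) x"
            using True d by (intro mult_right_mono ennreal_leI) (auto simp: mult_left_le_one_le)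
          finally show ?thesis using True by simp
        qed simp
      qed
      also have "\<dots> = ennreal (d * norm z) * (\<integral>\<^sup>+(t::real). indicator {0..1} t * Jop M n (g j) (t *\<^sub>R (d *\<^sub>R z)) x \<partial>lborel)"
        by (rule nn_integral_cmult) measurable
      finally show "ennreal \<bar>?a j - ?G j x\<bar> \<le> ennreal (d * norm z) * (\<integral>\<^sup>+(t::real). indicator {0..1} t * Jop M n (g j) (t *\<^sub>R (d *\<^sub>R z)) x \<partial>lborel)" .
    qed simp
    also have "\<dots> = ennreal d * (ennreal ((norm z)\<^sup>2) * (\<Sum>j\<in>UNIV. \<integral>\<^sup>+(t::real). indicator {0..1} t * Jop M n (g j) (t *\<^sub>R (d *\<^sub>R z)) x \<partial>lborel))"
      using d by (simp add: sum_distrib_left[symmetric] ennreal_mult power2_eq_square mult_ac)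
    finally show ?thesis by (simp add: add_left_mono)
  qed
  have "ennreal \<bar>(v x * kop \<kappa> d \<rho> x - kop \<kappa> d (\<lambda>x. v x * \<rho> x) x) / d - (\<Sum>j\<in>UNIV. ?G j x * kop (\<lambda>z. z $ j * \<kappa> z) d \<rho> x)\<bar>
     \<le> (\<integral>\<^sup>+z. ennreal \<bar>(\<kappa> z * \<rho> (x - d *\<^sub>R z)) * ?b z\<bar> \<partial>lborel)"
    unfolding eq using integral_norm_bound_ennreal[OF ii] by simp
  also have "\<dots> \<le> (\<integral>\<^sup>+z. ennreal (1 / d) * (ennreal \<bar>\<kappa> z\<bar> * (ennreal \<bar>\<rho> (x - d *\<^sub>R z)\<bar> * (ennreal \<bar>\<omega> x\<bar> + ennreal \<bar>\<omega> (x - d *\<^sub>R z)\<bar>)))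
     + ennreal d * (ennreal ((norm z)\<^sup>2 * \<bar>\<kappa> z\<bar>) * (ennreal \<bar>\<rho> (x - d *\<^sub>R z)\<bar> *
          (\<Sum>j\<in>UNIV. \<integral>\<^sup>+(t::real). indicator {0..1} t * Jop M n (g j) (t *\<^sub>R (d *\<^sub>R z)) x \<partial>lborel))) \<partial>lborel)"
  proof (rule nn_integral_mono)
    fix z
    have "ennreal \<bar>(\<kappa> z * \<rho> (x - d *\<^sub>R z)) * ?b z\<bar> = ennreal \<bar>\<kappa> z\<bar> * ennreal \<bar>\<rho> (x - d *\<^sub>R z)\<bar> * ennreal \<bar>?b z\<bar>"
      by (simp add: abs_mult ennreal_mult)
    also have "\<dots> \<le> ennreal \<bar>\<kappa> z\<bar> * ennreal \<bar>\<rho> (x - d *\<^sub>R z)\<bar> * (ennreal (1 / d) * (ennreal \<bar>\<omega> x\<bar> + ennreal \<bar>\<omega> (x - d *\<^sub>R z)\<bar>)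
      + ennreal d * (ennreal ((norm z)\<^sup>2) * (\<Sum>j\<in>UNIV. \<integral>\<^sup>+(t::real). indicator {0..1} t * Jop M n (g j) (t *\<^sub>R (d *\<^sub>R z)) x \<partial>lborel)))"
      by (intro mult_left_mono b) auto
    also have "\<dots> = ennreal (1 / d) * (ennreal \<bar>\<kappa> z\<bar> * (ennreal \<bar>\<rho> (x - d *\<^sub>R z)\<bar> * (ennreal \<bar>\<omega> x\<bar> + ennreal \<bar>\<omega> (x - d *\<^sub>R z)\<bar>)))
     + ennreal d * ((ennreal ((norm z)\<^sup>2) * ennreal \<bar>\<kappa> z\<bar>) * (ennreal \<bar>\<rho> (x - d *\<^sub>R z)\<bar> *
          (\<Sum>j\<in>UNIV. \<integral>\<^sup>+(t::real). indicator {0..1} t * Jop M n (g j) (t *\<^sub>R (d *\<^sub>R z)) x \<partial>lborel)))"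
      unfolding distrib_left[of "ennreal \<bar>\<kappa> z\<bar> * ennreal \<bar>\<rho> (x - d *\<^sub>R z)\<bar>"] by (simp only: mult_ac)
    also have "ennreal ((norm z)\<^sup>2) * ennreal \<bar>\<kappa> z\<bar> = ennreal ((norm z)\<^sup>2 * \<bar>\<kappa> z\<bar>)" by (simp add: ennreal_mult)
    finally show "ennreal \<bar>(\<kappa> z * \<rho> (x - d *\<^sub>R z)) * ?b z\<bar> \<le> ennreal (1 / d) * (ennreal \<bar>\<kappa> z\<bar> * (ennreal \<bar>\<rho> (x - d *\<^sub>R z)\<bar> * (ennreal \<bar>\<omega> x\<bar> + ennreal \<bar>\<omega> (x - d *\<^sub>R z)\<bar>)))
     + ennreal d * (ennreal ((norm z)\<^sup>2 * \<bar>\<kappa> z\<bar>) * (ennreal \<bar>\<rho> (x - d *\<^sub>R z)\<bar> *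
          (\<Sum>j\<in>UNIV. \<integral>\<^sup>+(t::real). indicator {0..1} t * Jop M n (g j) (t *\<^sub>R (d *\<^sub>R z)) x \<partial>lborel)))" .
  qed
  also have "\<dots> = ennreal (1 / d) * (\<integral>\<^sup>+z. ennreal \<bar>\<kappa> z\<bar> * (ennreal \<bar>\<rho> (x - d *\<^sub>R z)\<bar> * (ennreal \<bar>\<omega> x\<bar> + ennreal \<bar>\<omega> (x - d *\<^sub>R z)\<bar>)) \<partial>lborel)
     + ennreal d * (\<integral>\<^sup>+z. ennreal ((norm z)\<^sup>2 * \<bar>\<kappa> z\<bar>) * (ennreal \<bar>\<rho> (x - d *\<^sub>R z)\<bar> *
          (\<Sum>j\<in>UNIV. \<integral>\<^sup>+(t::real). indicator {0..1} t * Jop M n (g j) (t *\<^sub>R (d *\<^sub>R z)) x \<partial>lborel)) \<partial>lborel)"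
    by (subst nn_integral_add, measurable) (subst nn_integral_cmult, measurable, subst nn_integral_cmult, measurable)
  finally show ?thesis .
qed

end

context lp_kernels
begin

text \<open>With T = \<open>kop k d \<rho>\<close> and L = P_n \<rho> the difference has three
  parts: T - P_N T, the action of \<open>k\<close> on the blocks of \<rho> between \<open>n\<close>
  and \<open>N\<close>, and the change of L under \<open>k\<close>. In the first two, \<rho> has no
  gradient to be used; the smoothness of \<open>k\<close> at scale \<open>d\<close>, measured by
  \<open>l1 D\<close>, gives the factor \<open>dy m\<close> / d. The third uses the first moment of
  \<open>k\<close> and the increments of L, with d / \<open>dy n\<close> <= 2.\<close>

lemma frozen_factor_bound:
  fixes \<rho> k D :: "real^'n \<Rightarrow> real"
  assumes p: "1 \<le> p" and \<rho>: "tempered \<rho>" "Lp_le lborel p (\<lambda>x. ennreal \<bar>\<rho> x\<bar>) (ennreal A)" "0 \<le> A"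
    and c: "\<And>m. Lp_le lborel p (\<lambda>x. ennreal \<bar>kop a (dy m) \<rho> x\<bar>) (ennreal (c m))"
      "\<And>m. Lp_le lborel p (\<lambda>x. ennreal \<bar>kop b (dy m) \<rho> x\<bar>) (ennreal (c m))" "\<And>m. 0 \<le> c m"
    and k: "rapid k" "grad_bd k D" "rapid D" "\<And>x. 0 \<le> D x" "l1 D \<le> 2 * K" "m1 k \<le> K"
    and d: "dy n \<le> d" "d \<le> 2 * dy n" and MN: "M \<le> n" "n \<le> N"
  shows "Lp_le lborel p (\<lambda>x. ennreal \<bar>kop k d \<rho> x - (\<integral>z. k z \<partial>lborel) * kop P (dy n) \<rho> x\<bar>)
    (ennreal (2 * K * Q0 * ((\<Sum>m\<in>{M<..N}. dw n m * c m) + (dw n N + dw n M) * A)))"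
proof -
  have d0: "0 < d" by (rule less_le_trans[OF _ d(1)]) simp
  have K: "0 \<le> K" using m1_nonneg[of k] k(6) by simp
  note [measurable] = rapid[THEN rapid_measurable] tempered_measurable[OF \<rho>(1)] rapid_measurable[OF k(1)]
  let ?T = "kop k d \<rho>" and ?L = "kop P (dy n) \<rho>"
  have tL: "tempered ?L" by (rule tempered_kop[OF rapid(1) \<rho>(1)]) simp
  have ta: "tempered (kop a (dy m) \<rho>)" "tempered (kop b (dy m) \<rho>)" for m
    by (rule tempered_kop[OF rapid(2) \<rho>(1)], simp) (rule tempered_kop[OF rapid(3) \<rho>(1)], simp)
  have E1: "Lp_le lborel p (\<lambda>x. ennreal \<bar>?T x - kop P (dy N) ?T x\<bar>) (ennreal (m1 P * (dy N / d * (l1 D * A))))"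
    using Lp_le_mean_diff_kop[OF p rapid(1) k(1-4) \<rho>, of "dy N" d] d0 by (simp add: integral_P)
  have E2: "Lp_le lborel p (\<lambda>x. ennreal \<bar>kop k d (kop a (dy m) \<rho>) x\<bar>) (ennreal (m1 a' * (dy m / d * (l1 D * c m)) + m1 b' * (dy m / d * (l1 D * c m))))" for m
  proof (rule Lp_le_abs_add[OF p])
    have e: "0 < dy m" by simp
    show "Lp_le lborel p (\<lambda>x. ennreal \<bar>kop a' (dy m) (kop k d (kop a (dy m) \<rho>)) x\<bar>) (ennreal (m1 a' * (dy m / d * (l1 D * c m))))"
      using Lp_le_mean_diff_kop[OF p rapid(4) k(1-4) ta(1) c(1,3) e d0] by (simp add: mean_zero)
    show "Lp_le lborel p (\<lambda>x. ennreal \<bar>kop b' (dy m) (kop k d (kop b (dy m) \<rho>)) x\<bar>) (ennreal (m1 b' * (dy m / d * (l1 D * c m))))"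
      using Lp_le_mean_diff_kop[OF p rapid(5) k(1-4) ta(2) c(2,3) e d0] by (simp add: mean_zero)
    fix x
    \<comment> \<open>Commutation brings the mean-zero kernels outside, so that they act on a
      function already smoothed at scale \<open>d\<close>.\<close>
    have "kop k d (kop a (dy m) \<rho>) x = kop k d (\<lambda>x. kop a' (dy m) (kop a (dy m) \<rho>) x - kop b' (dy m) (kop b (dy m) \<rho>) x) x"
      by (rule arg_cong[where f="\<lambda>f. kop k d f x"], rule ext, rule kop_a_repr[OF \<rho>(1) e])
    also have "\<dots> = kop k d (kop a' (dy m) (kop a (dy m) \<rho>)) x - kop k d (kop b' (dy m) (kop b (dy m) \<rho>)) x"
      by (intro kop_diff k tempered_kop rapid ta d0 e)
    also have "\<dots> = kop a' (dy m) (kop k d (kop a (dy m) \<rho>)) x - kop b' (dy m) (kop k d (kop b (dy m) \<rho>)) x"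
      by (simp only: kop_commute[OF rapid(4) k(1) ta(1) d0 e] kop_commute[OF rapid(5) k(1) ta(2) d0 e])
    finally show "\<bar>kop k d (kop a (dy m) \<rho>) x\<bar> \<le> \<bar>kop a' (dy m) (kop k d (kop a (dy m) \<rho>)) x\<bar> + \<bar>kop b' (dy m) (kop k d (kop b (dy m) \<rho>)) x\<bar>"
      by (simp only: abs_triangle_ineq4)
  qed (use d0 in \<open>simp_all add: c(3) m1_nonneg l1_nonneg\<close>)
  have E3: "Lp_le lborel p (\<lambda>x. ennreal \<bar>(\<integral>z. k z \<partial>lborel) * ?L x - kop k d ?L x\<bar>)
      (ennreal (m1 k * (d * (Q0 * ((\<Sum>m\<in>{M<..n}. dw n m * c m) + dw n M * A) / dy n))))"
  proof (rule Lp_le_mono[OF p _ _ order_refl])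
    have J: "Lp_le lborel p (\<lambda>x. ennreal d * Jop M n \<rho> h x) (ennreal (d * (Q0 * ((\<Sum>m\<in>{M<..n}. dw n m * c m) + dw n M * A) / dy n)))" for h
    proof -
      have "Jop M n \<rho> h \<in> borel_measurable lborel" by measurable
      moreover have "0 \<le> Q0 * ((\<Sum>m\<in>{M<..n}. dw n m * c m) + dw n M * A) / dy n"
        by (simp add: Q0_ge(1) c(3) \<rho>(3) sum_nonneg)
      ultimately show ?thesis
        using Lp_le_cmult[OF p _ Jop_bound[OF p _ \<rho>(2,3) c MN(1)], of h "ennreal d"] d0
        by (simp only: ennreal_mult[symmetric] less_imp_le tempered_measurable[OF \<rho>(1)])
    qed
    show "Lp_le lborel p (\<lambda>x. \<integral>\<^sup>+z. ennreal (norm z * \<bar>k z\<bar>) * (ennreal d * Jop M n \<rho> (d *\<^sub>R z) x) \<partial>lborel)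
      (ennreal (m1 k * (d * (Q0 * ((\<Sum>m\<in>{M<..n}. dw n m * c m) + dw n M * A) / dy n))))"
      by (rule Lp_le_Minkowski[OF sf_lborel sf_lborel p _ _ J])
         (use d0 Q0_ge(1) c(3) \<rho>(3) in \<open>simp_all add: nn_integral_m1[OF k(1)] m1_nonneg sum_nonneg\<close>)
    fix x :: "real^'n"
    have "ennreal \<bar>(\<integral>z. k z \<partial>lborel) * ?L x - kop k d ?L x\<bar> \<le> (\<integral>\<^sup>+z. ennreal \<bar>k z\<bar> * ennreal \<bar>?L x - ?L (x - d *\<^sub>R z)\<bar> \<partial>lborel)"
      by (rule abs_mean_diff_le[OF k(1) tL d0])
    also have "\<dots> \<le> (\<integral>\<^sup>+z. ennreal \<bar>k z\<bar> * (ennreal (norm (d *\<^sub>R z)) * Jop M n \<rho> (d *\<^sub>R z) x) \<partial>lborel)"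
    proof (intro nn_integral_mono mult_left_mono)
      show "ennreal \<bar>?L x - ?L (x - d *\<^sub>R z)\<bar> \<le> ennreal (norm (d *\<^sub>R z)) * Jop M n \<rho> (d *\<^sub>R z) x" for z
        using kop_P_increment_le[OF \<rho>(1) MN(1), of x "d *\<^sub>R z"] by (simp only: abs_minus_commute)
    qed simp
    also have "\<dots> = (\<integral>\<^sup>+z. ennreal (norm z * \<bar>k z\<bar>) * (ennreal d * Jop M n \<rho> (d *\<^sub>R z) x) \<partial>lborel)"
      using d0 by (intro nn_integral_cong) (simp add: ennreal_mult mult_ac)
    finally show "ennreal \<bar>(\<integral>z. k z \<partial>lborel) * ?L x - kop k d ?L x\<bar> \<le> (\<integral>\<^sup>+z. ennreal (norm z * \<bar>k z\<bar>) * (ennreal d * Jop M n \<rho> (d *\<^sub>R z) x) \<partial>lborel)" .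
  qed
  have S2: "Lp_le lborel p (\<lambda>x. ennreal \<bar>\<Sum>m\<in>{n<..N}. kop k d (kop a (dy m) \<rho>) x\<bar>) (ennreal (\<Sum>m\<in>{n<..N}. m1 a' * (dy m / d * (l1 D * c m)) + m1 b' * (dy m / d * (l1 D * c m))))"
    by (intro Lp_le_abs_sum[OF p _ _ E2]) (use d0 in \<open>simp_all add: c(3) m1_nonneg l1_nonneg\<close>)
  have low: "?T x - kop k d ?L x = (?T x - kop P (dy N) ?T x) + (\<Sum>m\<in>{n<..N}. kop k d (kop a (dy m) \<rho>) x)" for x
  proof -
    have "kop P (dy N) ?T x = kop k d (kop P (dy N) \<rho>) x"
      by (rule kop_commute[OF k(1) rapid(1) \<rho>(1) _ d0]) simp
    also have "\<dots> = kop k d (\<lambda>x. ?L x + (\<Sum>m\<in>{n<..N}. kop a (dy m) \<rho> x)) x"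
      by (rule arg_cong[where f="\<lambda>f. kop k d f x"], rule ext, rule kop_P_telescope[OF \<rho>(1) MN(2)])
    also have "\<dots> = kop k d ?L x + (\<Sum>m\<in>{n<..N}. kop k d (kop a (dy m) \<rho>) x)"
      by (subst kop_add[OF k(1) tL tempered_sum[OF _ ta(1)] d0], simp) (simp add: kop_sum[OF k(1) _ ta(1) d0])
    finally show ?thesis by simp
  qed
  have E12: "Lp_le lborel p (\<lambda>x. ennreal \<bar>?T x - kop k d ?L x\<bar>) (ennreal (m1 P * (dy N / d * (l1 D * A)) + (\<Sum>m\<in>{n<..N}. m1 a' * (dy m / d * (l1 D * c m)) + m1 b' * (dy m / d * (l1 D * c m)))))"
  proof (rule Lp_le_abs_add[OF p _ _ E1 S2])
    show "\<bar>?T x - kop k d ?L x\<bar> \<le> \<bar>?T x - kop P (dy N) ?T x\<bar> + \<bar>\<Sum>m\<in>{n<..N}. kop k d (kop a (dy m) \<rho>) x\<bar>" for x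
      unfolding low[of x] by (rule abs_triangle_ineq)
  qed (use d0 in \<open>simp_all add: c(3) m1_nonneg l1_nonneg \<rho>(3) sum_nonneg\<close>)
  have "Lp_le lborel p (\<lambda>x. ennreal \<bar>?T x - (\<integral>z. k z \<partial>lborel) * ?L x\<bar>) (ennreal ((m1 P * (dy N / d * (l1 D * A)) + (\<Sum>m\<in>{n<..N}. m1 a' * (dy m / d * (l1 D * c m)) + m1 b' * (dy m / d * (l1 D * c m))))
     + m1 k * (d * (Q0 * ((\<Sum>m\<in>{M<..n}. dw n m * c m) + dw n M * A) / dy n))))"
  proof (rule Lp_le_abs_add[OF p _ _ E12 E3])
    show "\<bar>?T x - (\<integral>z. k z \<partial>lborel) * ?L x\<bar> \<le> \<bar>?T x - kop k d ?L x\<bar> + \<bar>(\<integral>z. k z \<partial>lborel) * ?L x - kop k d ?L x\<bar>" for x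
      by linarith
  qed (use d0 in \<open>simp_all add: c(3) m1_nonneg l1_nonneg \<rho>(3) sum_nonneg Q0_ge(1)\<close>)
  then show ?thesis
  proof (rule Lp_le_weaken[OF p])
    have rat: "dy m / d \<le> dw n m" if "n \<le> m" for m
    proof -
      have "dy m / d \<le> dy m / dy n" using d d0 by (intro divide_left_mono) auto
      also have "\<dots> = dw n m" using dy_ratio(1)[OF that] by simp
      finally show ?thesis .
    qed
    have lD: "0 \<le> l1 D" by (rule l1_nonneg)
    have 1: "m1 P * (dy N / d * (l1 D * A)) \<le> Q0 * (dw n N * (2 * K * A))"
      using Q0_ge d0 rat[OF MN(2)] k(5) \<rho>(3) lD K by (intro mult_mono mult_nonneg_nonneg) auto
    have 2: "m1 a' * (dy m / d * (l1 D * c m)) + m1 b' * (dy m / d * (l1 D * c m)) \<le> Q0 * (dw n m * (2 * K * c m))" if "m \<in> {n<..N}" for m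
    proof -
      have "m1 a' * (dy m / d * (l1 D * c m)) + m1 b' * (dy m / d * (l1 D * c m)) = (m1 a' + m1 b') * (dy m / d * (l1 D * c m))"
        by (simp only: distrib_right)
      also have "\<dots> \<le> Q0 * (dw n m * (2 * K * c m))"
        using Q0_ge d0 rat[of m] that k(5) c(3) lD K by (intro mult_mono mult_nonneg_nonneg) auto
      finally show ?thesis .
    qed
    let ?S = "(\<Sum>m\<in>{M<..n}. dw n m * c m) + dw n M * A"
    have S0: "0 \<le> ?S" using c(3) \<rho>(3) by (simp add: sum_nonneg)
    have "m1 k * (d * (Q0 * ?S / dy n)) = m1 k * (d / dy n * (Q0 * ?S))" by simp
    also have "\<dots> \<le> K * (2 * (Q0 * ?S))"
      using k(6) m1_nonneg[of k] d d0 K Q0_ge(1) S0 by (intro mult_mono mult_nonneg_nonneg) (auto simp: pos_divide_le_eq)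
    finally have 3: "m1 k * (d * (Q0 * ?S / dy n)) \<le> 2 * K * Q0 * ?S" by (simp add: mult_ac)
    have "(\<Sum>m\<in>{n<..N}. m1 a' * (dy m / d * (l1 D * c m)) + m1 b' * (dy m / d * (l1 D * c m))) \<le> (\<Sum>m\<in>{n<..N}. Q0 * (dw n m * (2 * K * c m)))"
      by (rule sum_mono[OF 2])
    also have "\<dots> = 2 * K * Q0 * (\<Sum>m\<in>{n<..N}. dw n m * c m)" by (simp add: sum_distrib_left mult_ac)
    finally have 4: "(\<Sum>m\<in>{n<..N}. m1 a' * (dy m / d * (l1 D * c m)) + m1 b' * (dy m / d * (l1 D * c m))) \<le> \<dots>" .
    have "{M<..N} = {M<..n} \<union> {n<..N}" using MN by auto
    then have "(\<Sum>m\<in>{M<..N}. dw n m * c m) = (\<Sum>m\<in>{M<..n}. dw n m * c m) + (\<Sum>m\<in>{n<..N}. dw n m * c m)"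
      by (simp only:) (intro sum.union_disjoint, auto)
    then have "2 * K * Q0 * ((\<Sum>m\<in>{M<..N}. dw n m * c m) + (dw n N + dw n M) * A) = Q0 * (dw n N * (2 * K * A)) + 2 * K * Q0 * (\<Sum>m\<in>{n<..N}. dw n m * c m) + 2 * K * Q0 * ?S"
      by (simp only:) (simp add: algebra_simps)
    then show "m1 P * (dy N / d * (l1 D * A)) + (\<Sum>m\<in>{n<..N}. m1 a' * (dy m / d * (l1 D * c m)) + m1 b' * (dy m / d * (l1 D * c m))) + m1 k * (d * (Q0 * ?S / dy n))
       \<le> 2 * K * Q0 * ((\<Sum>m\<in>{M<..N}. dw n m * c m) + (dw n N + dw n M) * A)"
      using 1 3 4 by linarith
  qed
qed

text \<open>For each fixed \<open>z\<close> the translate of \<rho> lies in L^p' and the other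
  factor in L^p, so the bilinear estimate integrates over \<open>z\<close>. The two occurrences of
  \<omega> give a factor 2 with \<open>dy n\<close> <= d; the Taylor remainder gives it through d <=
  2 \<open>dy n\<close>. Both parts thus share one constant, and their sums over m join at
  \<open>n\<close>.\<close>

lemma component_remainder_bound:
  fixes \<rho> v \<kappa> :: "real^'n \<Rightarrow> real"
  assumes p: "1 \<le> p" "1 \<le> p'" "1 \<le> r" "inverse p + inverse p' = inverse r"
    and \<kappa>: "rapid \<kappa>" "l1 \<kappa> \<le> K" "(\<integral>\<^sup>+z. ennreal ((norm z)\<^sup>2 * \<bar>\<kappa> z\<bar>) \<partial>lborel) \<le> ennreal K"
    and \<rho>: "tempered \<rho>" "Lp_le lborel p' (\<lambda>x. ennreal \<bar>\<rho> x\<bar>) (ennreal A')" "0 \<le> A'"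
    and v: "tempered v" "tempered (\<lambda>x. v x * \<rho> x)" "has_increments v g"
    and g: "\<And>j. tempered (g j)" "\<And>j. Lp_le lborel p (\<lambda>x. ennreal \<bar>g j x\<bar>) (ennreal A)" "0 \<le> A"
    and c: "\<And>j m. Lp_le lborel p (\<lambda>x. ennreal \<bar>kop a (dy m) (g j) x\<bar>) (ennreal (c m))"
      "\<And>j m. Lp_le lborel p (\<lambda>x. ennreal \<bar>kop b (dy m) (g j) x\<bar>) (ennreal (c m))" "\<And>m. 0 \<le> c m"
    and d: "dy n \<le> d" "d \<le> 2 * dy n" and MN: "M \<le> n" "n \<le> N"
  shows "Lp_le lborel r (\<lambda>x. ennreal \<bar>(v x * kop \<kappa> d \<rho> x - kop \<kappa> d (\<lambda>x. v x * \<rho> x) x) / d - (\<Sum>j\<in>UNIV. kop P (dy n) (g j) x * kop (\<lambda>z. z $ j * \<kappa> z) d \<rho> x)\<bar>)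
    (ennreal (2 * K * real CARD('n) * Q0 * A' * ((\<Sum>m\<in>{M<..N}. dw n m * c m) + (dw n N + dw n M) * A)))"
proof -
  have d0: "0 < d" by (rule less_le_trans[OF _ d(1)]) simp
  have K: "0 \<le> K" using l1_nonneg[of \<kappa>] \<kappa>(2) by simp
  note [measurable] = rapid[THEN rapid_measurable] tempered_measurable[OF \<rho>(1)] rapid_measurable[OF \<kappa>(1)] tempered_measurable[OF v(1)] tempered_measurable[OF g(1)]
  let ?d = "real CARD('n)"
  define \<omega> where "\<omega> = (\<lambda>x. v x - kop P (dy n) v x)"
  have [measurable]: "\<omega> \<in> borel_measurable borel" unfolding \<omega>_def by measurable
  define S1 where "S1 = (\<Sum>m\<in>{n<..N}. dw n m * c m) + dw n N * A"
  define S2 where "S2 = (\<Sum>m\<in>{M<..n}. dw n m * c m) + dw n M * A"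
  have S0: "0 \<le> S1" "0 \<le> S2" unfolding S1_def S2_def using c(3) g(3) by (simp_all add: sum_nonneg)
  have \<omega>: "Lp_le lborel p (\<lambda>x. ennreal \<bar>\<omega> x\<bar>) (ennreal (dy n * (?d * Q0 * S1)))"
    unfolding \<omega>_def S1_def by (rule high_frequency_bound[OF p(1) v(1,3) g c MN(2)])
  define I1 where "I1 x = (\<integral>\<^sup>+z. ennreal \<bar>\<kappa> z\<bar> * (ennreal \<bar>\<rho> (x - d *\<^sub>R z)\<bar> * (ennreal \<bar>\<omega> x\<bar> + ennreal \<bar>\<omega> (x - d *\<^sub>R z)\<bar>)) \<partial>lborel)" for x
  define I2 where "I2 x = (\<integral>\<^sup>+z. ennreal ((norm z)\<^sup>2 * \<bar>\<kappa> z\<bar>) * (ennreal \<bar>\<rho> (x - d *\<^sub>R z)\<bar> *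
          (\<Sum>j\<in>UNIV. \<integral>\<^sup>+(t::real). indicator {0..1} t * Jop M n (g j) (t *\<^sub>R (d *\<^sub>R z)) x \<partial>lborel)) \<partial>lborel)" for x
  have [measurable]: "I1 \<in> borel_measurable borel" "I2 \<in> borel_measurable borel" unfolding I1_def I2_def by measurable
  have p4': "inverse p' + inverse p = inverse r" using p(4) by (simp add: add.commute)
  have L1: "Lp_le lborel r I1 (ennreal (K * A' * (dy n * (?d * Q0 * S1) + dy n * (?d * Q0 * S1))))"
    unfolding I1_def
  proof (rule Lp_le_bilinear[OF sf_lborel sf_lborel p(2,1,3) p4'])
    fix z :: "real^'n"
    show "Lp_le lborel p' (\<lambda>x. ennreal \<bar>\<rho> (x - d *\<^sub>R z)\<bar>) (ennreal A')" by (rule Lp_le_shift[OF _ \<rho>(2)]) measurable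
    have "Lp_le lborel p (\<lambda>x. ennreal \<bar>\<omega> (x - d *\<^sub>R z)\<bar>) (ennreal (dy n * (?d * Q0 * S1)))" by (rule Lp_le_shift[OF _ \<omega>]) measurable
    then show "Lp_le lborel p (\<lambda>x. ennreal \<bar>\<omega> x\<bar> + ennreal \<bar>\<omega> (x - d *\<^sub>R z)\<bar>) (ennreal (dy n * (?d * Q0 * S1) + dy n * (?d * Q0 * S1)))"
      by (intro Lp_le_add[OF sf_lborel p(1) _ _ \<omega>]) (simp_all add: Q0_ge(1) S0)
    show "(\<integral>\<^sup>+z. ennreal \<bar>\<kappa> z\<bar> \<partial>lborel) \<le> ennreal K" unfolding nn_integral_l1[OF \<kappa>(1)] by (intro ennreal_leI \<kappa>(2))
  qed (simp_all add: Q0_ge(1) S0 \<rho>(3) K)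
  have L2: "Lp_le lborel r I2 (ennreal (K * A' * (?d * (Q0 * S2 / dy n))))"
    unfolding I2_def
  proof (rule Lp_le_bilinear[OF sf_lborel sf_lborel p(2,1,3) p4'])
    fix z :: "real^'n"
    show "Lp_le lborel p' (\<lambda>x. ennreal \<bar>\<rho> (x - d *\<^sub>R z)\<bar>) (ennreal A')" by (rule Lp_le_shift[OF _ \<rho>(2)]) measurable
    have J: "Lp_le lborel p (Jop M n (g j) h) (ennreal (Q0 * S2 / dy n))" for j h
      unfolding S2_def by (rule Jop_bound[OF p(1) _ g(2,3) c MN(1)]) measurable
    have "Lp_le lborel p (\<lambda>x. \<integral>\<^sup>+(t::real). indicator {0..1} t * Jop M n (g j) (t *\<^sub>R (d *\<^sub>R z)) x \<partial>lborel) (ennreal (1 * (Q0 * S2 / dy n)))" for j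
      by (rule Lp_le_Minkowski[OF sf_lborel sf_lborel p(1) _ _ J]) (simp_all add: Q0_ge(1) S0)
    then show "Lp_le lborel p (\<lambda>x. \<Sum>j\<in>UNIV. \<integral>\<^sup>+(t::real). indicator {0..1} t * Jop M n (g j) (t *\<^sub>R (d *\<^sub>R z)) x \<partial>lborel) (ennreal (?d * (Q0 * S2 / dy n)))"
      by (intro Lp_le_sum_const[OF sf_lborel p(1)]) (simp_all add: Q0_ge(1) S0)
  qed (simp_all add: Q0_ge(1) S0 \<rho>(3) K \<kappa>(3))
  have cm: "Lp_le lborel r (\<lambda>x. ennreal C * H x) (ennreal (C * B))" if "Lp_le lborel r H (ennreal B)" "H \<in> borel_measurable lborel" "0 \<le> C" "0 \<le> B" for C B and H :: "real^'n \<Rightarrow> ennreal"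
    using Lp_le_cmult[OF p(3) that(2,1), of "ennreal C"] that by (simp add: ennreal_mult)
  have "Lp_le lborel r (\<lambda>x. ennreal (1 / d) * I1 x + ennreal d * I2 x)
     (ennreal ((1 / d) * (K * A' * (dy n * (?d * Q0 * S1) + dy n * (?d * Q0 * S1))) + d * (K * A' * (?d * (Q0 * S2 / dy n)))))"
    using d0 by (intro Lp_le_add[OF sf_lborel p(3)] cm L1 L2) (simp_all add: Q0_ge(1) S0 \<rho>(3) K)
  then have "Lp_le lborel r (\<lambda>x. ennreal \<bar>(v x * kop \<kappa> d \<rho> x - kop \<kappa> d (\<lambda>x. v x * \<rho> x) x) / d - (\<Sum>j\<in>UNIV. kop P (dy n) (g j) x * kop (\<lambda>z. z $ j * \<kappa> z) d \<rho> x)\<bar>)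
     (ennreal ((1 / d) * (K * A' * (dy n * (?d * Q0 * S1) + dy n * (?d * Q0 * S1))) + d * (K * A' * (?d * (Q0 * S2 / dy n)))))"
    by (rule Lp_le_mono[OF p(3) _ _ order_refl])
       (use commutator_component_le[OF \<kappa>(1) \<rho>(1) v g(1) d0 MN(1)] in \<open>simp add: I1_def I2_def \<omega>_def\<close>)
  then show ?thesis
  proof (rule Lp_le_weaken[OF p(3)])
    let ?B = "K * A' * (?d * Q0)"
    have B0: "0 \<le> ?B" using K \<rho>(3) Q0_ge(1) by simp
    have "(1 / d) * (K * A' * (dy n * (?d * Q0 * S1) + dy n * (?d * Q0 * S1))) = (dy n / d) * (2 * ?B * S1)" by simp
    also have "\<dots> \<le> 1 * (2 * ?B * S1)" using d d0 B0 S0 by (intro mult_right_mono) auto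
    finally have 1: "(1 / d) * (K * A' * (dy n * (?d * Q0 * S1) + dy n * (?d * Q0 * S1))) \<le> 2 * ?B * S1" by simp
    have "d * (K * A' * (?d * (Q0 * S2 / dy n))) = (d / dy n) * (?B * S2)" by simp
    also have "\<dots> \<le> 2 * (?B * S2)" using d d0 B0 S0 by (intro mult_right_mono) (auto simp: pos_divide_le_eq)
    finally have 2: "d * (K * A' * (?d * (Q0 * S2 / dy n))) \<le> 2 * ?B * S2" by simp
    have "{M<..N} = {M<..n} \<union> {n<..N}" using MN by auto
    then have "(\<Sum>m\<in>{M<..N}. dw n m * c m) = (\<Sum>m\<in>{M<..n}. dw n m * c m) + (\<Sum>m\<in>{n<..N}. dw n m * c m)"
      by (simp only:) (intro sum.union_disjoint, auto)
    then have "2 * K * ?d * Q0 * A' * ((\<Sum>m\<in>{M<..N}. dw n m * c m) + (dw n N + dw n M) * A) = 2 * ?B * S1 + 2 * ?B * S2"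
      unfolding S1_def S2_def by (simp only:) (simp add: algebra_simps)
    with 1 2 show "(1 / d) * (K * A' * (dy n * (?d * Q0 * S1) + dy n * (?d * Q0 * S1))) + d * (K * A' * (?d * (Q0 * S2 / dy n)))
        \<le> 2 * K * ?d * Q0 * A' * ((\<Sum>m\<in>{M<..N}. dw n m * c m) + (dw n N + dw n M) * A)" by linarith
  qed
qed

end

subsection \<open>The commutator at a dyadic scale\<close>

text \<open>The i-th derivative of z_j \<phi> has integral zero, and the product rule gives its two
  terms.\<close>

lemma integral_nth_partial:
  fixes \<phi> :: "real^'n \<Rightarrow> real"
  assumes \<phi>: "schwartz \<phi>"
  shows "(\<integral>z. z $ j * partial \<phi> i z \<partial>lborel) = (if i = j then - (\<integral>z. \<phi> z \<partial>lborel) else 0)"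
proof -
  have rj: "rapid (\<lambda>z. z $ j * f z)" if "rapid f" for f :: "real^'n \<Rightarrow> real"
    by (rule rapid_poly_mult[OF that, where C=1 and m=1]) (auto intro: order_trans[OF component_le_norm_cart])
  have sm: "smooth_fun \<phi>" by (rule schwartz_smooth[OF \<phi>])
  let ?g = "\<lambda>z. \<phi> z *\<^sub>R axis j 1 + z $ j *\<^sub>R grad \<phi> z"
  have gi: "?g z $ i = (if i = j then \<phi> z else 0) + z $ j * partial \<phi> i z" for z
    by (simp add: axis_def)
  have i1: "integrable lborel (\<lambda>z. if i = j then \<phi> z else 0)"     using rapid_integrable[OF schwartz_rapid(1)[OF \<phi>]] by (cases "i = j") auto
  have i2: "integrable lborel (\<lambda>z. z $ j * partial \<phi> i z)" by (intro rapid_integrable rj schwartz_rapid \<phi>)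
  have "(\<integral>z. ?g z $ i \<partial>lborel) = 0"
  proof (rule integral_partial_eq_0[where f="\<lambda>z. z $ j * \<phi> z"])
    show "integrable lborel (\<lambda>z. z $ j * \<phi> z)" by (intro rapid_integrable rj schwartz_rapid \<phi>)
    show "((\<lambda>z. z $ j * \<phi> z) has_derivative (\<lambda>h. ?g z \<bullet> h)) (at z)" for z
      using has_derivative_mult[OF bounded_linear.has_derivative[OF bounded_linear_vec_nth has_derivative_ident, of j "at z"] smooth_fun_has_derivative[OF sm]]
      by (rule has_derivative_eq_rhs) (auto simp: inner_add_left inner_axis' fun_eq_iff)
    show "continuous_on UNIV ?g" by (intro continuous_intros smooth_fun_continuous smooth_fun_grad_continuous sm)
    show "integrable lborel (\<lambda>z. ?g z $ i)" unfolding gi by (intro Bochner_Integration.integrable_add i1 i2)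
  qed
  then have "(\<integral>z. (if i = j then \<phi> z else 0) \<partial>lborel) + (\<integral>z. z $ j * partial \<phi> i z \<partial>lborel) = 0"
    unfolding gi Bochner_Integration.integral_add[OF i1 i2] .
  then show ?thesis by (auto split: if_splits)
qed

definition hess :: "(real^'n \<Rightarrow> real) \<Rightarrow> real^'n \<Rightarrow> real" where
  "hess \<phi> x = sqrt (\<Sum>i\<in>UNIV. \<Sum>j\<in>UNIV. (partial (partial \<phi> j) i x)\<^sup>2)"

text \<open>The quantities of \<phi> that the estimates consume: mass and second moment of d_i
  \<phi>, and for the kernel z_j d_i \<phi> the mass of a bound for its gradient and its first
  moment. The 2 in the third stems from its two summands, each of mass at most
  \<open>K\<close>.\<close>

definition phi_kernel_bound :: "(real^'n \<Rightarrow> real) \<Rightarrow> real \<Rightarrow> bool" where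
  "phi_kernel_bound \<phi> K \<longleftrightarrow> (\<forall>i. l1 (partial \<phi> i) \<le> K) \<and>
     (\<forall>i. (\<integral>\<^sup>+z. ennreal ((norm z)\<^sup>2 * \<bar>partial \<phi> i z\<bar>) \<partial>lborel) \<le> ennreal K) \<and>
     (\<forall>i. l1 (\<lambda>z. \<bar>partial \<phi> i z\<bar> + norm z * hess \<phi> z) \<le> 2 * K) \<and>
     (\<forall>i j. m1 (\<lambda>z. z $ j * partial \<phi> i z) \<le> K)"

lemma hess_rapid: fixes \<phi> :: "real^'n \<Rightarrow> real" assumes \<phi>: "schwartz \<phi>" shows "rapid (hess \<phi>)"
proof (rule rapid_bound)
  note [measurable] = schwartz_rapid[OF \<phi>, THEN rapid_measurable]
  show "rapid (\<lambda>x. \<Sum>i\<in>UNIV. \<Sum>j\<in>UNIV. \<bar>partial (partial \<phi> j) i x\<bar>)"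
    by (intro rapid_sum rapid_abs schwartz_rapid \<phi>) auto
  show "hess \<phi> \<in> borel_measurable borel" unfolding hess_def[abs_def] by measurable
  fix x
  have "hess \<phi> x = sqrt (\<Sum>(i,j)\<in>UNIV \<times> UNIV. (partial (partial \<phi> j) i x)\<^sup>2)"
    unfolding hess_def by (simp add: sum.cartesian_product)
  also have "\<dots> = L2_set (\<lambda>(i,j). partial (partial \<phi> j) i x) (UNIV \<times> UNIV)"
    unfolding L2_set_def by (simp add: case_prod_beta)
  also have "\<dots> \<le> (\<Sum>ij\<in>UNIV \<times> UNIV. \<bar>case ij of (i,j) \<Rightarrow> partial (partial \<phi> j) i x\<bar>)" by (rule L2_set_le_sum_abs)
  also have "\<dots> = (\<Sum>i\<in>UNIV. \<Sum>j\<in>UNIV. \<bar>partial (partial \<phi> j) i x\<bar>)" by (simp add: sum.cartesian_product case_prod_beta)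
  finally show "\<bar>hess \<phi> x\<bar> \<le> \<bar>\<Sum>i\<in>UNIV. \<Sum>j\<in>UNIV. \<bar>partial (partial \<phi> j) i x\<bar>\<bar>"
    by (simp add: hess_def sum_nonneg)
qed

text \<open>The weight 1 + |x|^2 of the first integral dominates both 1 and |x|^2, which serves
  every condition on d_i \<phi> alone, including |z| |z_j| for the first moment of z_j d_i \<phi>.
  The second integral controls |z| times the Hessian.\<close>

lemma phi_quantity_kernel_bound:
  fixes \<phi> :: "real^'n \<Rightarrow> real"
  assumes \<phi>: "schwartz \<phi>"
  shows "phi_quantity \<phi> \<noteq> top" "phi_kernel_bound \<phi> (enn2real (phi_quantity \<phi>))"
proof -
  note [measurable] = schwartz_rapid[OF \<phi>, THEN rapid_measurable] rapid_measurable[OF hess_rapid[OF \<phi>]]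
  let ?s = "\<lambda>x. sqrt (\<Sum>i\<in>UNIV. (partial \<phi> i x)\<^sup>2)"
  let ?Q = "phi_quantity \<phi>"
  have s_eq: "?s x = L2_set (\<lambda>i. partial \<phi> i x) UNIV" for x by (simp add: L2_set_def)
  have rs: "rapid ?s"
  proof (rule rapid_bound)
    show "rapid (\<lambda>x. \<Sum>i\<in>UNIV. \<bar>partial \<phi> i x\<bar>)" by (intro rapid_sum rapid_abs schwartz_rapid \<phi>) auto
    show "\<bar>?s x\<bar> \<le> \<bar>\<Sum>i\<in>UNIV. \<bar>partial \<phi> i x\<bar>\<bar>" for x
      using L2_set_le_sum_abs[of "\<lambda>i. partial \<phi> i x" UNIV] by (simp add: s_eq[symmetric] sum_nonneg)
  qed measurable
  have si: "\<bar>partial \<phi> i x\<bar> \<le> ?s x" for i x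
    using member_le_L2_set[of UNIV i "\<lambda>i. partial \<phi> i x"] by (simp add: L2_set_def)
      (metis (no_types, lifting) abs_ge_zero finite member_le_sum iso_tuple_UNIV_I real_sqrt_le_mono real_sqrt_abs zero_le_power2)
  let ?I1 = "\<integral>\<^sup>+x. ennreal ((1 + (norm x)\<^sup>2) * ?s x) \<partial>lborel"
  let ?I2 = "\<integral>\<^sup>+x. ennreal (norm x * hess \<phi> x) \<partial>lborel"
  have Q: "?Q = ?I1 + ?I2"
    unfolding phi_quantity_def hess_def[symmetric] by (simp add: nn_integral_completion)
  have h0: "0 \<le> hess \<phi> x" for x by (simp add: hess_def sum_nonneg)
  have s0: "0 \<le> ?s x" for x by (simp add: sum_nonneg)
  have "integrable lborel (\<lambda>x. (1 + (norm x)\<^sup>2) * ?s x)"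
    by (intro rapid_integrable rapid_poly_mult[OF rs, where C=1 and m=2])
       (auto simp: power2_eq_square algebra_simps)
  then have f1: "?I1 < top" using s0 by (simp add: integrable_iff_bounded abs_mult)
  have "integrable lborel (\<lambda>x. norm x * hess \<phi> x)" by (intro rapid_integrable rapid_norm_mult hess_rapid \<phi>)
  then have f2: "?I2 < top" using h0 by (simp add: integrable_iff_bounded abs_mult)
  show fin: "?Q \<noteq> top" using f1 f2 unfolding Q by (auto simp: ennreal_add_eq_top)
  define K where "K = enn2real ?Q"
  have K: "?Q = ennreal K" "0 \<le> K" using fin by (auto simp: K_def less_top)
  have IK: "?I1 \<le> ennreal K" "?I2 \<le> ennreal K" unfolding K(1)[symmetric] Q by auto
  have le: "(\<integral>\<^sup>+x. ennreal (w x * \<bar>partial \<phi> i x\<bar>) \<partial>lborel) \<le> ennreal K" if "\<And>x. 0 \<le> w x" "\<And>x. w x \<le> 1 + (norm x)\<^sup>2" for w i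
    by (rule order_trans[OF nn_integral_mono IK(1)]) (intro ennreal_leI mult_mono that si, auto simp: that)
  have l1_le: "l1 f \<le> C" if "rapid f" "(\<integral>\<^sup>+x. ennreal \<bar>f x\<bar> \<partial>lborel) \<le> ennreal C" "0 \<le> C" for f :: "real^'n \<Rightarrow> real" and C
    using that nn_integral_l1[OF that(1)] by simp
  have rj: "rapid (\<lambda>z. z $ j * f z)" if "rapid f" for f :: "real^'n \<Rightarrow> real" and j
    by (rule rapid_poly_mult[OF that, where C=1 and m=1]) (auto intro: order_trans[OF component_le_norm_cart])

  show "phi_kernel_bound \<phi> (enn2real ?Q)"
    unfolding phi_kernel_bound_def K_def[symmetric]
  proof (intro conjI allI)
    fix i j
    show "l1 (partial \<phi> i) \<le> K" using le[of "\<lambda>_. 1" i] by (intro l1_le schwartz_rapid \<phi> K) auto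
    show "(\<integral>\<^sup>+z. ennreal ((norm z)\<^sup>2 * \<bar>partial \<phi> i z\<bar>) \<partial>lborel) \<le> ennreal K" by (rule le) auto
    show "l1 (\<lambda>z. \<bar>partial \<phi> i z\<bar> + norm z * hess \<phi> z) \<le> 2 * K"
    proof (rule l1_le)
      show "rapid (\<lambda>z. \<bar>partial \<phi> i z\<bar> + norm z * hess \<phi> z)"
        by (intro rapid_add rapid_abs schwartz_rapid rapid_norm_mult hess_rapid \<phi>)
      have "(\<integral>\<^sup>+x. ennreal \<bar>\<bar>partial \<phi> i x\<bar> + norm x * hess \<phi> x\<bar> \<partial>lborel) = (\<integral>\<^sup>+x. ennreal (1 * \<bar>partial \<phi> i x\<bar>) + ennreal (norm x * hess \<phi> x) \<partial>lborel)"
        using h0 by (intro nn_integral_cong) simp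
      also have "\<dots> = (\<integral>\<^sup>+x. ennreal (1 * \<bar>partial \<phi> i x\<bar>) \<partial>lborel) + ?I2" by (rule nn_integral_add) measurable
      also have "\<dots> \<le> ennreal K + ennreal K" by (intro add_mono le IK) auto
      also have "\<dots> = ennreal (2 * K)" using K by (simp add: ennreal_plus[symmetric] del: ennreal_plus)
      finally show "(\<integral>\<^sup>+x. ennreal \<bar>\<bar>partial \<phi> i x\<bar> + norm x * hess \<phi> x\<bar> \<partial>lborel) \<le> ennreal (2 * K)" .
    qed (use K in simp)
    have "ennreal (m1 (\<lambda>z. z $ j * partial \<phi> i z)) = (\<integral>\<^sup>+z. ennreal (norm z * \<bar>z $ j * partial \<phi> i z\<bar>) \<partial>lborel)"
      by (rule nn_integral_m1[symmetric]) (intro rj schwartz_rapid \<phi>)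
    also have "\<dots> \<le> (\<integral>\<^sup>+z. ennreal ((norm z)\<^sup>2 * \<bar>partial \<phi> i z\<bar>) \<partial>lborel)"
      by (intro nn_integral_mono ennreal_leI)
         (auto simp: abs_mult power2_eq_square mult.assoc component_le_norm_cart intro!: mult_left_mono mult_right_mono)
    also have "\<dots> \<le> ennreal K" by (rule le) auto
    finally show "m1 (\<lambda>z. z $ j * partial \<phi> i z) \<le> K" using K by simp
  qed
qed

text \<open>The product rule gives d_i \<phi> in direction j plus z_j times the gradient of d_i
  \<phi>; that gradient collects some of the second derivatives, so its length is at most
  \<open>hess\<close>.\<close>

lemma grad_bd_nth_partial:
  fixes \<phi> :: "real^'n \<Rightarrow> real"
  assumes \<phi>: "schwartz \<phi>"
  shows "grad_bd (\<lambda>z. z $ j * partial \<phi> i z) (\<lambda>z. \<bar>partial \<phi> i z\<bar> + norm z * hess \<phi> z)"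
proof (rule grad_bdI[where K'="\<lambda>z. partial \<phi> i z *\<^sub>R axis j 1 + z $ j *\<^sub>R grad (partial \<phi> i) z"])
  have sm: "smooth_fun (partial \<phi> i)" by (intro smooth_fun_partial schwartz_smooth \<phi>)
  note [measurable] = schwartz_rapid[OF \<phi>, THEN rapid_measurable] rapid_measurable[OF hess_rapid[OF \<phi>]]
  show "((\<lambda>z. z $ j * partial \<phi> i z) has_derivative (\<lambda>h. (partial \<phi> i z *\<^sub>R axis j 1 + z $ j *\<^sub>R grad (partial \<phi> i) z) \<bullet> h)) (at z)" for z
    using has_derivative_mult[OF bounded_linear.has_derivative[OF bounded_linear_vec_nth has_derivative_ident, of j "at z"] smooth_fun_has_derivative[OF sm]]
    by (rule has_derivative_eq_rhs) (auto simp: inner_add_left inner_axis' fun_eq_iff)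
  show "continuous_on UNIV (\<lambda>z. partial \<phi> i z *\<^sub>R axis j 1 + z $ j *\<^sub>R grad (partial \<phi> i) z)"
    by (intro continuous_intros smooth_fun_continuous smooth_fun_grad_continuous sm)
  show "(\<lambda>z. \<bar>partial \<phi> i z\<bar> + norm z * hess \<phi> z) \<in> borel_measurable borel" by measurable
  fix z
  have "norm (grad (partial \<phi> i) z) = sqrt (\<Sum>l\<in>UNIV. (partial (partial \<phi> i) l z)\<^sup>2)"
    by (simp add: norm_vec_def L2_set_def)
  also have "\<dots> \<le> hess \<phi> z"
    unfolding hess_def by (intro real_sqrt_le_mono sum_mono member_le_sum[of i UNIV "\<lambda>j. (partial (partial \<phi> j) _ z)\<^sup>2"]) auto
  finally have h: "norm (grad (partial \<phi> i) z) \<le> hess \<phi> z" .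
  have "norm (partial \<phi> i z *\<^sub>R axis j (1::real) + z $ j *\<^sub>R grad (partial \<phi> i) z) \<le> \<bar>partial \<phi> i z\<bar> + \<bar>z $ j\<bar> * norm (grad (partial \<phi> i) z)"
    by (rule order_trans[OF norm_triangle_ineq]) simp
  also have "\<bar>z $ j\<bar> * norm (grad (partial \<phi> i) z) \<le> norm z * hess \<phi> z"
    by (intro mult_mono h component_le_norm_cart) auto
  finally show "norm (partial \<phi> i z *\<^sub>R axis j 1 + z $ j *\<^sub>R grad (partial \<phi> i) z) \<le> \<bar>partial \<phi> i z\<bar> + norm z * hess \<phi> z" by simp
qed

lemma kop_AE_zero: "AE x in lborel. f x = 0 \<Longrightarrow> 0 < e \<Longrightarrow> kop K e f x = 0"
proof -
  assume f: "AE x in lborel. f x = 0" and e: "0 < e"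
  have "AE z in lborel. K z * f (x - e *\<^sub>R z) = 0"
    using AE_lborel_diff_scale[OF _ f, of e x] e by auto
  then show ?thesis unfolding kop_def by (simp add: integral_eq_zero_AE)
qed

context lp_kernels
begin

lemma commutator_finite_bound:
  fixes u :: "real^'n \<Rightarrow> real^'n" and \<rho> \<phi> :: "real^'n \<Rightarrow> real"
  assumes p: "1 \<le> p" "1 \<le> p'" "1 \<le> r" "inverse p + inverse p' = inverse r"
    and \<phi>: "schwartz \<phi>" "(\<integral>x. \<phi> x \<partial>lborel) = 1" "phi_kernel_bound \<phi> K"
    and \<rho>: "tempered \<rho>" "Lp_le lborel p' (\<lambda>x. ennreal \<bar>\<rho> x\<bar>) (ennreal A')" "0 \<le> A'"
    and u: "\<And>i. tempered (\<lambda>x. u x $ i)" "\<And>i. tempered (\<lambda>x. u x $ i * \<rho> x)" "\<And>i. has_increments (\<lambda>x. u x $ i) (g i)"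
    and g: "\<And>i j. tempered (g i j)" "\<And>i j. Lp_le lborel p (\<lambda>x. ennreal \<bar>g i j x\<bar>) (ennreal A)" "0 \<le> A"
    and tr: "AE x in lborel. (\<Sum>i\<in>UNIV. g i i x) = 0"
    and c: "\<And>i j m. Lp_le lborel p (\<lambda>x. ennreal \<bar>kop a (dy m) (g i j) x\<bar>) (ennreal (c m))"
      "\<And>i j m. Lp_le lborel p (\<lambda>x. ennreal \<bar>kop b (dy m) (g i j) x\<bar>) (ennreal (c m))" "\<And>m. 0 \<le> c m"
    and c': "\<And>m. Lp_le lborel p' (\<lambda>x. ennreal \<bar>kop a (dy m) \<rho> x\<bar>) (ennreal (c' m))"
      "\<And>m. Lp_le lborel p' (\<lambda>x. ennreal \<bar>kop b (dy m) \<rho> x\<bar>) (ennreal (c' m))" "\<And>m. 0 \<le> c' m"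
    and d: "dy n \<le> d" "d \<le> 2 * dy n" and MN: "M \<le> n" "n \<le> N"
  shows "Lp_le lborel r (\<lambda>x. ennreal \<bar>commutator \<phi> d u \<rho> x\<bar>)
    (ennreal (2 * K * (real CARD('n))\<^sup>2 * Q0 * (1 + l1 P) *
      (A' * ((\<Sum>m\<in>{M<..N}. dw n m * c m) + (dw n N + dw n M) * A) + A * ((\<Sum>m\<in>{M<..N}. dw n m * c' m) + (dw n N + dw n M) * A'))))"
proof -
  have d0: "0 < d" by (rule less_le_trans[OF _ d(1)]) simp
  note kb = \<phi>(3)[unfolded phi_kernel_bound_def]
  have K: "0 \<le> K" using l1_nonneg[of "partial \<phi> undefined"] kb by (meson order_trans)
  let ?d = "real CARD('n)" and ?G = "\<lambda>i j. kop P (dy n) (g i j)"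
  note [measurable] = rapid[THEN rapid_measurable] tempered_measurable[OF \<rho>(1)] tempered_measurable[OF g(1)]
    tempered_measurable[OF u(1)] schwartz_rapid[OF \<phi>(1), THEN rapid_measurable]
  define k where "k i j = (\<lambda>z. z $ j * partial \<phi> i z)" for i j
  have rk: "rapid (k i j)" for i j unfolding k_def
    by (rule rapid_poly_mult[OF schwartz_rapid(2)[OF \<phi>(1)], where C=1 and m=1]) (auto intro: order_trans[OF component_le_norm_cart])
  note [measurable] = rapid_measurable[OF rk]
  define E where "E i x = (u x $ i * kop (partial \<phi> i) d \<rho> x - kop (partial \<phi> i) d (\<lambda>x. u x $ i * \<rho> x) x) / d
      - (\<Sum>j\<in>UNIV. ?G i j x * kop (k i j) d \<rho> x)" for i x
  define X where "X i j x = kop (k i j) d \<rho> x - (\<integral>z. k i j z \<partial>lborel) * kop P (dy n) \<rho> x" for i j x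
  have [measurable]: "(\<lambda>x. u x $ i * \<rho> x) \<in> borel_measurable borel" for i using tempered_measurable[OF u(2)] .
  have [measurable]: "E i \<in> borel_measurable borel" "X i j \<in> borel_measurable borel" for i j
    unfolding E_def X_def by measurable
  define S where "S = (\<Sum>m\<in>{M<..N}. dw n m * c m) + (dw n N + dw n M) * A"
  define S' where "S' = (\<Sum>m\<in>{M<..N}. dw n m * c' m) + (dw n N + dw n M) * A'"
  have S0: "0 \<le> S" "0 \<le> S'" unfolding S_def S'_def by (simp_all add: sum_nonneg c(3) c'(3) g(3) \<rho>(3))
  have trG: "(\<Sum>i\<in>UNIV. ?G i i x) = 0" for x
  proof -
    have "(\<Sum>i\<in>UNIV. ?G i i x) = kop P (dy n) (\<lambda>x. \<Sum>i\<in>UNIV. g i i x) x"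
      by (rule kop_sum[symmetric]) (simp_all add: rapid g)
    also have "\<dots> = 0" by (rule kop_AE_zero[OF tr]) simp
    finally show ?thesis .
  qed
  have ik: "(\<integral>z. k i j z \<partial>lborel) = (if i = j then -1 else 0)" for i j
    unfolding k_def using integral_nth_partial[OF \<phi>(1), of j i] \<phi>(2) by simp
  have comm: "commutator \<phi> d u \<rho> x = (\<Sum>i\<in>UNIV. E i x) + (\<Sum>i\<in>UNIV. \<Sum>j\<in>UNIV. ?G i j x * X i j x)" for x
  proof -
    \<comment> \<open>The means of the kernels are minus the identity matrix, so the main term is
      minus the trace of the smoothed gradient times P_n \<rho>. Smoothing is linear, so this trace
      vanishes at every point.\<close>
    have "(\<Sum>i\<in>UNIV. \<Sum>j\<in>UNIV. ?G i j x * ((\<integral>z. k i j z \<partial>lborel) * kop P (dy n) \<rho> x)) = (\<Sum>i\<in>UNIV. - (?G i i x * kop P (dy n) \<rho> x))"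
      unfolding ik by (intro sum.cong refl) (simp add: if_distrib if_distribR sum.delta cong: if_cong)
    also have "\<dots> = - ((\<Sum>i\<in>UNIV. ?G i i x) * kop P (dy n) \<rho> x)" by (simp add: sum_distrib_right sum_negf)
    also have "\<dots> = 0" by (simp add: trG)
    finally have "(\<Sum>i\<in>UNIV. \<Sum>j\<in>UNIV. ?G i j x * X i j x) = (\<Sum>i\<in>UNIV. \<Sum>j\<in>UNIV. ?G i j x * kop (k i j) d \<rho> x)"
      unfolding X_def by (simp add: right_diff_distrib sum_subtractf)
    then show ?thesis
      unfolding commutator_eq[OF \<phi>(1) d0 \<rho>(1) u(2)] E_def by (simp add: sum_subtractf)
  qed
  have E: "Lp_le lborel r (\<lambda>x. ennreal \<bar>E i x\<bar>) (ennreal (2 * K * ?d * Q0 * A' * S))" for i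
    unfolding E_def k_def S_def
    by (rule component_remainder_bound[OF p schwartz_rapid(2)[OF \<phi>(1)] _ _ \<rho> u g c d MN]) (use kb in auto)
  have X: "Lp_le lborel p' (\<lambda>x. ennreal \<bar>X i j x\<bar>) (ennreal (2 * K * Q0 * S'))" for i j
    unfolding X_def S'_def
  proof (rule frozen_factor_bound[OF p(2) \<rho> c' rk _ _ _ _ _ d MN])
    show "grad_bd (k i j) (\<lambda>z. \<bar>partial \<phi> i z\<bar> + norm z * hess \<phi> z)" unfolding k_def by (rule grad_bd_nth_partial[OF \<phi>(1)])
    show "rapid (\<lambda>z. \<bar>partial \<phi> i z\<bar> + norm z * hess \<phi> z)"
      by (intro rapid_add rapid_abs schwartz_rapid rapid_norm_mult hess_rapid \<phi>)
    show "0 \<le> \<bar>partial \<phi> i x\<bar> + norm x * hess \<phi> x" for x by (simp add: hess_def sum_nonneg)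
  qed (use kb in \<open>auto simp: k_def\<close>)
  have GX: "Lp_le lborel r (\<lambda>x. ennreal \<bar>?G i j x * X i j x\<bar>) (ennreal (l1 P * A * (2 * K * Q0 * S')))" for i j
  proof -
    have "Lp_le lborel p (\<lambda>x. ennreal \<bar>?G i j x\<bar>) (ennreal (l1 P * A))"
      by (rule Lp_le_kop[OF p(1) rapid(1) _ g(2,3)]) measurable
    from Lp_le_Holder[OF sf_lborel p _ _ this X[of i j]] show ?thesis
      by (simp add: abs_mult ennreal_mult l1_nonneg g(3) K Q0_ge(1) S0)
  qed
  have "Lp_le lborel r (\<lambda>x. ennreal \<bar>\<Sum>i\<in>UNIV. E i x\<bar>) (ennreal (\<Sum>i\<in>(UNIV::'n set). 2 * K * ?d * Q0 * A' * S))"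
    by (rule Lp_le_abs_sum[OF p(3) _ _ E]) (simp_all add: K Q0_ge(1) S0 \<rho>(3))
  moreover have "Lp_le lborel r (\<lambda>x. ennreal \<bar>\<Sum>i\<in>UNIV. \<Sum>j\<in>UNIV. ?G i j x * X i j x\<bar>) (ennreal (\<Sum>i\<in>(UNIV::'n set). \<Sum>j\<in>(UNIV::'n set). l1 P * A * (2 * K * Q0 * S')))"
    by (intro Lp_le_abs_sum[OF p(3)] GX) (simp_all add: K Q0_ge(1) S0 g(3) l1_nonneg sum_nonneg)
  ultimately have "Lp_le lborel r (\<lambda>x. ennreal \<bar>commutator \<phi> d u \<rho> x\<bar>)
     (ennreal ((\<Sum>i\<in>(UNIV::'n set). 2 * K * ?d * Q0 * A' * S) + (\<Sum>i\<in>(UNIV::'n set). \<Sum>j\<in>(UNIV::'n set). l1 P * A * (2 * K * Q0 * S'))))"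
  proof (rule Lp_le_abs_add[OF p(3), rotated 2])
    show "\<bar>commutator \<phi> d u \<rho> x\<bar> \<le> \<bar>\<Sum>i\<in>UNIV. E i x\<bar> + \<bar>\<Sum>i\<in>UNIV. \<Sum>j\<in>UNIV. ?G i j x * X i j x\<bar>" for x
      unfolding comm by (rule abs_triangle_ineq)
  qed (simp_all add: K Q0_ge(1) S0 g(3) \<rho>(3) l1_nonneg)
  then show ?thesis
  proof (rule Lp_le_weaken[OF p(3)])
    let ?B = "2 * K * ?d\<^sup>2 * Q0"
    have B: "0 \<le> ?B" by (simp add: K Q0_ge(1))
    have "(\<Sum>i\<in>(UNIV::'n set). 2 * K * ?d * Q0 * A' * S) + (\<Sum>i\<in>(UNIV::'n set). \<Sum>j\<in>(UNIV::'n set). l1 P * A * (2 * K * Q0 * S'))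
       = ?B * (A' * S + l1 P * (A * S'))"
      by (simp add: power2_eq_square algebra_simps)
    also have "\<dots> \<le> ?B * ((1 + l1 P) * (A' * S + A * S'))"
      using l1_nonneg[of P] S0 g(3) \<rho>(3) by (intro mult_left_mono[OF _ B]) (simp add: algebra_simps)
    finally show "(\<Sum>i\<in>(UNIV::'n set). 2 * K * ?d * Q0 * A' * S) + (\<Sum>i\<in>(UNIV::'n set). \<Sum>j\<in>(UNIV::'n set). l1 P * A * (2 * K * Q0 * S'))
      \<le> 2 * K * ?d\<^sup>2 * Q0 * (1 + l1 P) * (A' * ((\<Sum>m\<in>{M<..N}. dw n m * c m) + (dw n N + dw n M) * A) + A * ((\<Sum>m\<in>{M<..N}. dw n m * c' m) + (dw n N + dw n M) * A'))"
      unfolding S_def S'_def by (simp only: mult.assoc)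
  qed
qed

end

section \<open>Removal of the frequency cut-offs\<close>

lemma dw_tendsto_0: "(\<lambda>k. dw n (n + int k)) \<longlonglongrightarrow> 0" "(\<lambda>k. dw n (n - int k)) \<longlonglongrightarrow> 0"
proof -
  have "dw n (n + int k) = (1/2) ^ k" "dw n (n - int k) = (1/2) ^ k" for k
    by (simp_all add: powr_minus powr_realpow power_one_over inverse_eq_divide)
  then show "(\<lambda>k. dw n (n + int k)) \<longlonglongrightarrow> 0" "(\<lambda>k. dw n (n - int k)) \<longlonglongrightarrow> 0"
    using LIMSEQ_realpow_zero[of "1/2::real"] by simp_all
qed

lemma sum_le_nn_integral_count_space:
  fixes f :: "'a::countable \<Rightarrow> ennreal"
  assumes "finite I" shows "(\<Sum>i\<in>I. f i) \<le> (\<integral>\<^sup>+i. f i \<partial>count_space UNIV)"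
proof -
  have "(\<Sum>i\<in>I. f i) = (\<integral>\<^sup>+i. f i \<partial>count_space I)" using assms by (simp add: nn_integral_count_space_finite)
  also have "\<dots> = (\<integral>\<^sup>+i. f i * indicator I i \<partial>count_space UNIV)"
    by (simp add: nn_integral_restrict_space[symmetric] restrict_count_space)
  also have "\<dots> \<le> (\<integral>\<^sup>+i. f i \<partial>count_space UNIV)"
    by (intro nn_integral_mono) (auto simp: indicator_def)
  finally show ?thesis .
qed

context lp_kernels
begin

text \<open>Symmetric cut-offs n - k and n + k are chosen so far apart that their tails contribute
  less than \<open>e\<close>; the finite sum is at most the full one, and \<open>Lp_le_limit\<close>
  removes \<open>e\<close>. If the full sum is infinite the claim is trivial.\<close>

lemma commutator_bound:
  fixes u :: "real^'n \<Rightarrow> real^'n" and \<rho> \<phi> :: "real^'n \<Rightarrow> real"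
  assumes p: "1 \<le> p" "1 \<le> p'" "1 \<le> r" "inverse p + inverse p' = inverse r"
    and \<phi>: "schwartz \<phi>" "(\<integral>x. \<phi> x \<partial>lborel) = 1" "phi_kernel_bound \<phi> K" "0 \<le> K"
    and \<rho>: "tempered \<rho>" "Lp_le lborel p' (\<lambda>x. ennreal \<bar>\<rho> x\<bar>) (ennreal A')" "0 \<le> A'"
    and u: "\<And>i. tempered (\<lambda>x. u x $ i)" "\<And>i. tempered (\<lambda>x. u x $ i * \<rho> x)" "\<And>i. has_increments (\<lambda>x. u x $ i) (g i)"
    and g: "\<And>i j. tempered (g i j)" "\<And>i j. Lp_le lborel p (\<lambda>x. ennreal \<bar>g i j x\<bar>) (ennreal A)" "0 \<le> A"
    and tr: "AE x in lborel. (\<Sum>i\<in>UNIV. g i i x) = 0"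
    and c: "\<And>i j m. Lp_le lborel p (\<lambda>x. ennreal \<bar>kop a (dy m) (g i j) x\<bar>) (ennreal (c m))"
      "\<And>i j m. Lp_le lborel p (\<lambda>x. ennreal \<bar>kop b (dy m) (g i j) x\<bar>) (ennreal (c m))" "\<And>m. 0 \<le> c m"
    and c': "\<And>m. Lp_le lborel p' (\<lambda>x. ennreal \<bar>kop a (dy m) \<rho> x\<bar>) (ennreal (c' m))"
      "\<And>m. Lp_le lborel p' (\<lambda>x. ennreal \<bar>kop b (dy m) \<rho> x\<bar>) (ennreal (c' m))" "\<And>m. 0 \<le> c' m"
    and d: "dy n \<le> d" "d \<le> 2 * dy n"
  shows "Lp_le lborel r (\<lambda>x. ennreal \<bar>commutator \<phi> d u \<rho> x\<bar>)
    (ennreal (2 * K * (real CARD('n))\<^sup>2 * Q0 * (1 + l1 P)) * (\<integral>\<^sup>+m. ennreal (dw n m) * ennreal (A' * c m + A * c' m) \<partial>count_space UNIV))"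
    (is "Lp_le _ _ ?R (ennreal ?C * ?T)")
proof (cases "ennreal ?C * ?T = top")
  case True
  then show ?thesis unfolding True by (simp add: Lp_le_def)
next
  case False
  have C0: "0 \<le> ?C" using \<phi>(4) Q0_ge(1) l1_nonneg[of P] by simp
  show ?thesis
  proof (rule Lp_le_limit[OF p(3) False])
    fix e :: real assume e: "0 < e"
    have "(\<lambda>k. ?C * ((dw n (n + int k) + dw n (n - int k)) * (2 * (A * A')))) \<longlonglongrightarrow> ?C * ((0 + 0) * (2 * (A * A')))"
      by (intro tendsto_intros dw_tendsto_0)
    then have "\<forall>\<^sub>F k in sequentially. ?C * ((dw n (n + int k) + dw n (n - int k)) * (2 * (A * A'))) < e"
      using e by (intro order_tendstoD) auto
    then obtain k where k: "?C * ((dw n (n + int k) + dw n (n - int k)) * (2 * (A * A'))) < e"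
      using eventually_happens'[OF sequentially_bot] by blast
    let ?I = "{n - int k<..n + int k}"
    let ?S = "\<Sum>m\<in>?I. dw n m * c m" and ?S' = "\<Sum>m\<in>?I. dw n m * c' m" and ?\<tau> = "dw n (n + int k) + dw n (n - int k)"
    have 1: "Lp_le lborel r ?R (ennreal (?C * (A' * (?S + ?\<tau> * A) + A * (?S' + ?\<tau> * A'))))"
      by (rule commutator_finite_bound[OF p \<phi>(1-3) \<rho> u g tr c c' d]) auto
    have 2: "ennreal (?C * (A' * (?S + ?\<tau> * A) + A * (?S' + ?\<tau> * A'))) \<le> ennreal ?C * ?T + ennreal e"
    proof -
      have eq: "?C * (A' * (?S + ?\<tau> * A) + A * (?S' + ?\<tau> * A')) = ?C * (A' * ?S + A * ?S') + ?C * (?\<tau> * (2 * (A * A')))"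
        by (simp add: algebra_simps)
      have s: "A' * ?S + A * ?S' = (\<Sum>m\<in>?I. dw n m * (A' * c m + A * c' m))"
        by (simp add: sum_distrib_left sum.distrib algebra_simps)
      have s0: "0 \<le> dw n m * (A' * c m + A * c' m)" for m
        using c(3) c'(3) g(3) \<rho>(3) by simp
      have "ennreal (A' * ?S + A * ?S') = (\<Sum>m\<in>?I. ennreal (dw n m) * ennreal (A' * c m + A * c' m))"
        unfolding s using c(3) c'(3) g(3) \<rho>(3) by (subst sum_ennreal[symmetric]) (simp_all add: ennreal_mult)
      also have "\<dots> \<le> ?T" by (rule sum_le_nn_integral_count_space) simp
      finally have le: "ennreal (A' * ?S + A * ?S') \<le> ?T" .
      have pos: "0 \<le> A' * ?S + A * ?S'" unfolding s by (intro sum_nonneg s0)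
      have "ennreal (?C * (A' * (?S + ?\<tau> * A) + A * (?S' + ?\<tau> * A'))) = ennreal (?C * (A' * ?S + A * ?S')) + ennreal (?C * (?\<tau> * (2 * (A * A'))))"
      proof -
        have "0 \<le> ?\<tau> * (2 * (A * A'))" using g(3) \<rho>(3) by simp
        then show ?thesis unfolding eq by (intro ennreal_plus mult_nonneg_nonneg[OF C0] pos)
      qed
      also have "\<dots> = ennreal ?C * ennreal (A' * ?S + A * ?S') + ennreal (?C * (?\<tau> * (2 * (A * A'))))"
        using C0 pos by (simp only: ennreal_mult)
      also have "\<dots> \<le> ennreal ?C * ?T + ennreal e"
        using k by (intro add_mono mult_left_mono le ennreal_leI) auto
      finally show ?thesis .
    qed
    show "Lp_le lborel r ?R (ennreal ?C * ?T + ennreal e)"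
      by (rule Lp_le_mono[OF p(3) 1 order_refl 2])
  qed
qed

end

subsection \<open>Summation over the scales\<close>

text \<open>Two geometric series of value 2, over the nonnegative and over the nonpositive integers;
  the index 0 is counted twice, hence 4 instead of 3.\<close>

lemma nn_integral_dyadic_weights: "(\<integral>\<^sup>+(k::int). ennreal (2 powr (- real_of_int \<bar>k\<bar>)) \<partial>count_space UNIV) \<le> 4"
proof -
  let ?w = "\<lambda>k::int. ennreal (2 powr (- real_of_int \<bar>k\<bar>))"
  have geo: "(\<integral>\<^sup>+(j::nat). ennreal ((1/2) ^ j) \<partial>count_space UNIV) = 2"
  proof -
    have "(\<Sum>j. ennreal ((1/2::real) ^ j)) = ennreal (\<Sum>j. (1/2) ^ j)"
      by (rule suminf_ennreal2) (auto simp: summable_geometric)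
    also have "(\<Sum>j. (1/2::real) ^ j) = 2" by (simp add: suminf_geometric)
    finally show ?thesis by (simp add: nn_integral_count_space_nat)
  qed
  have w: "?w (int j) = ennreal ((1/2) ^ j)" "?w (- int j) = ennreal ((1/2) ^ j)" for j
    by (simp_all add: powr_minus powr_realpow power_one_over inverse_eq_divide)
  have "bij_betw int UNIV {0..}"
    by (rule bij_betwI[where g=nat]) auto
  from nn_integral_bij_count_space[OF this, of ?w] have 1: "(\<integral>\<^sup>+k. ?w k \<partial>count_space {0..}) = 2"
    by (simp only: w geo)
  have "bij_betw (\<lambda>j. - int j) UNIV {..0}"
    by (rule bij_betwI[where g="\<lambda>k. nat (- k)"]) auto
  from nn_integral_bij_count_space[OF this, of ?w] have 2: "(\<integral>\<^sup>+k. ?w k \<partial>count_space {..0}) = 2"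
    by (simp only: w geo)
  have "(\<integral>\<^sup>+k. ?w k \<partial>count_space UNIV) \<le> (\<integral>\<^sup>+k. ?w k * indicator {0..} k + ?w k * indicator {..0} k \<partial>count_space UNIV)"
    by (intro nn_integral_mono) (auto simp: indicator_def)
  also have "\<dots> = (\<integral>\<^sup>+k. ?w k * indicator {0..} k \<partial>count_space UNIV) + (\<integral>\<^sup>+k. ?w k * indicator {..0} k \<partial>count_space UNIV)"
    by (rule nn_integral_add) auto
  also have "\<dots> = (\<integral>\<^sup>+k. ?w k \<partial>count_space {0..}) + (\<integral>\<^sup>+k. ?w k \<partial>count_space {..0})"
    by (simp add: nn_integral_count_space_indicator)
  also have "\<dots> = 2 + 2" by (simp only: 1 2)
  finally show ?thesis by simp
qed

lemmas sf_count_int = sigma_finite_measure_count_space[of "UNIV :: int set"]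

text \<open>Young's inequality as an instance of Minkowski's: the convolution is a superposition of
  translates of \<gamma> with weights of total mass at most 4, and translation on the integers
  preserves the q-norm.\<close>

lemma Lp_le_dyadic_convolution:
  assumes q: "1 \<le> q" and \<gamma>: "Lp_le (count_space UNIV) q (\<lambda>m::int. ennreal (\<gamma> m)) (ennreal \<Gamma>)" and \<Gamma>: "0 \<le> \<Gamma>"
  shows "Lp_le (count_space UNIV) q (\<lambda>n::int. \<integral>\<^sup>+m. ennreal (dw n m) * ennreal (\<gamma> m) \<partial>count_space UNIV) (ennreal (4 * \<Gamma>))"
proof -
  have sh: "Lp_le (count_space UNIV) q (\<lambda>n::int. ennreal (\<gamma> (n + k))) (ennreal \<Gamma>)" for k
  proof -
    have "bij_betw (\<lambda>n::int. n + k) UNIV UNIV" by (rule bij_betwI[where g="\<lambda>n. n - k"]) auto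
    from nn_integral_bij_count_space[OF this, of "\<lambda>m. enn_powr (ennreal (\<gamma> m)) (enn2real q)"] \<gamma>
    show ?thesis by (auto simp: Lp_le_def AE_count_space split: if_splits)
  qed
  have "Lp_le (count_space UNIV) q (\<lambda>n::int. \<integral>\<^sup>+(k::int). ennreal (2 powr (- real_of_int \<bar>k\<bar>)) * ennreal (\<gamma> (n + k)) \<partial>count_space UNIV) (ennreal (4 * \<Gamma>))"
  proof (rule Lp_le_Minkowski[OF sf_count_int sf_count_int q _ _ sh])
    show "(\<lambda>(k, n). ennreal (\<gamma> (n + k))) \<in> borel_measurable (count_space UNIV \<Otimes>\<^sub>M count_space UNIV)"
      by (rule measurable_pair_measure_countable1) auto
    show "(\<integral>\<^sup>+(k::int). ennreal (2 powr (- real_of_int \<bar>k\<bar>)) \<partial>count_space UNIV) \<le> ennreal 4"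
      using nn_integral_dyadic_weights by simp
  qed (use \<Gamma> in auto)
  moreover have "(\<integral>\<^sup>+(k::int). ennreal (2 powr (- real_of_int \<bar>k\<bar>)) * ennreal (\<gamma> (n + k)) \<partial>count_space UNIV)
      = (\<integral>\<^sup>+m. ennreal (dw n m) * ennreal (\<gamma> m) \<partial>count_space UNIV)" for n
  proof -
    have "bij_betw (\<lambda>k::int. n + k) UNIV UNIV" by (rule bij_betwI[where g="\<lambda>m. m - n"]) auto
    from nn_integral_bij_count_space[OF this, of "\<lambda>m. ennreal (dw n m) * ennreal (\<gamma> m)"] show ?thesis by simp
  qed
  ultimately show ?thesis by simp
qed

lemma ex_dyadic_scale: assumes d: "0 < d" obtains n where "dy n \<le> d" "d < 2 * dy n"
proof
  have d2: "d = 2 powr (log 2 d)" using d by simp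
  show "dy (- \<lfloor>log 2 d\<rfloor>) \<le> d"
  proof -
    have "dy (- \<lfloor>log 2 d\<rfloor>) \<le> 2 powr (log 2 d)" by (intro powr_mono) auto
    then show ?thesis using d by simp
  qed
  have "2 powr (log 2 d) < 2 powr (real_of_int \<lfloor>log 2 d\<rfloor> + 1)" by (intro powr_less_mono) auto
  then show "d < 2 * dy (- \<lfloor>log 2 d\<rfloor>)" using d by (simp add: powr_add mult.commute)
qed

text \<open>The half-line is the disjoint union of the intervals [2^-n, 2^(1-n)). On each of them
  1/\<delta> is at most 2^n while the length is 2^-n, so the mass of d\<delta>/\<delta> is bounded
  by 1. The majorant is a countable sum of step functions, so \<open>F\<close> may be any function
  of the scale.\<close>

lemma dlog_norm_le:
  assumes q: "1 \<le> q" and B: "Lp_le (count_space UNIV) q (B :: int \<Rightarrow> ennreal) C"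
    and F: "\<And>n d. dy n \<le> d \<Longrightarrow> d < 2 * dy n \<Longrightarrow> F d \<le> B n"
  shows "dlog_norm q F \<le> C"
proof (cases "q = top")
  case True
  have BC: "B n \<le> C" for n using B True by (simp add: Lp_le_def AE_count_space)
  have "F d \<le> C" if d: "0 < d" for d
  proof -
    obtain n where "dy n \<le> d" "d < 2 * dy n" by (rule ex_dyadic_scale[OF d])
    then show ?thesis using F[of n d] BC[of n] by simp
  qed
  then show ?thesis using True by (auto simp: dlog_norm_def intro!: SUP_least)
next
  case False
  let ?q = "enn2real q"
  note t = enn2real_ge_1[OF q False]
  have "(\<integral>\<^sup>+ d\<in>{0<..}. enn_powr (F d) ?q * ennreal (1 / d) \<partial>lborel)
     \<le> (\<integral>\<^sup>+d. (\<integral>\<^sup>+n. indicator {dy n..<2 * dy n} d * (enn_powr (B n) ?q * ennreal (1 / dy n)) \<partial>count_space UNIV) \<partial>lborel)"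
  proof (rule nn_integral_mono)
    fix d :: real
    show "enn_powr (F d) ?q * ennreal (1 / d) * indicator {0<..} d \<le> (\<integral>\<^sup>+n. indicator {dy n..<2 * dy n} d * (enn_powr (B n) ?q * ennreal (1 / dy n)) \<partial>count_space UNIV)"
    proof (cases "0 < d")
      case True
      obtain n where n: "dy n \<le> d" "d < 2 * dy n" by (rule ex_dyadic_scale[OF True])
      have "enn_powr (F d) ?q * ennreal (1 / d) \<le> enn_powr (B n) ?q * ennreal (1 / dy n)"
        using F[OF n] t n True by (intro mult_mono enn_powr_mono ennreal_leI divide_left_mono) auto
      also have "\<dots> = (\<Sum>n\<in>{n}. indicator {dy n..<2 * dy n} d * (enn_powr (B n) ?q * ennreal (1 / dy n)))"
        using n by simp
      also have "\<dots> \<le> (\<integral>\<^sup>+n. indicator {dy n..<2 * dy n} d * (enn_powr (B n) ?q * ennreal (1 / dy n)) \<partial>count_space UNIV)"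
        by (rule sum_le_nn_integral_count_space) simp
      finally show ?thesis using True by simp
    qed simp
  qed
  also have "\<dots> = (\<integral>\<^sup>+n. \<integral>\<^sup>+d. indicator {dy n..<2 * dy n} d * (enn_powr (B n) ?q * ennreal (1 / dy n)) \<partial>lborel \<partial>count_space UNIV)"
    by (rule nn_integral_count_space_nn_integral) auto
  also have "\<dots> = (\<integral>\<^sup>+n. enn_powr (B n) ?q \<partial>count_space UNIV)"
  proof (intro nn_integral_cong)
    fix n :: int
    have "(\<integral>\<^sup>+d. indicator {dy n..<2 * dy n} d * (enn_powr (B n) ?q * ennreal (1 / dy n)) \<partial>lborel)
      = ennreal (dy n) * (enn_powr (B n) ?q * ennreal (1 / dy n))"
      by (subst nn_integral_multc) auto
    also have "\<dots> = enn_powr (B n) ?q * (ennreal (dy n) * ennreal (1 / dy n))" by (simp only: mult_ac)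
    also have "ennreal (dy n) * ennreal (1 / dy n) = 1" by (subst ennreal_mult[symmetric]) auto
    finally show "(\<integral>\<^sup>+d. indicator {dy n..<2 * dy n} d * (enn_powr (B n) ?q * ennreal (1 / dy n)) \<partial>lborel) = enn_powr (B n) ?q" by simp
  qed
  also have "\<dots> \<le> enn_powr C ?q" using B False by (simp add: Lp_le_def)
  finally have "enn_powr (\<integral>\<^sup>+ d\<in>{0<..}. enn_powr (F d) ?q * ennreal (1 / d) \<partial>lborel) (1 / ?q) \<le> enn_powr (enn_powr C ?q) (1 / ?q)"
    using t by (intro enn_powr_mono) auto
  also have "\<dots> = C" using t by (simp add: enn_powr_powr)
  finally show ?thesis using False by (simp add: dlog_norm_def)
qed

text \<open>Connects the sum in \<open>besov_norm\<close> with integrals over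
  \<open>count_space\<close>. Along an enumeration of the integers the partial sums are finite sums,
  and \<open>infsum\<close> is the supremum of those.\<close>

lemma nn_integral_count_space_le_infsum:
  fixes f :: "int \<Rightarrow> ennreal" shows "(\<integral>\<^sup>+n. f n \<partial>count_space UNIV) \<le> infsum f UNIV"
proof -
  have sup: "infsum f UNIV = (SUP F\<in>{F. finite F \<and> F \<subseteq> UNIV}. sum f F)"
    by (rule nonneg_infsum_complete) simp
  have "(\<integral>\<^sup>+n. f n \<partial>count_space UNIV) = (\<integral>\<^sup>+k. f (int_decode k) \<partial>count_space UNIV)"
    by (rule nn_integral_bij_count_space[symmetric]) (rule bij_int_decode)
  also have "\<dots> = (\<Sum>k. f (int_decode k))" by (rule nn_integral_count_space_nat)
  also have "\<dots> = (SUP m. \<Sum>k<m. f (int_decode k))" by (rule suminf_eq_SUP)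
  also have "\<dots> \<le> infsum f UNIV"
  proof (rule SUP_least)
    fix m
    have "(\<Sum>k<m. f (int_decode k)) = sum f (int_decode ` {..<m})"
      by (subst sum.reindex) (auto intro!: inj_on_subset[OF inj_int_decode])
    also have "\<dots> \<le> infsum f UNIV" unfolding sup by (rule SUP_upper) auto
    finally show "(\<Sum>k<m. f (int_decode k)) \<le> infsum f UNIV" .
  qed
  finally show ?thesis .
qed

lemma infsum_ge_term: fixes f :: "int \<Rightarrow> ennreal" shows "f n \<le> infsum f UNIV"
  using order_trans[OF sum_le_nn_integral_count_space[of "{n}" f] nn_integral_count_space_le_infsum[of f]] by simp

text \<open>Finiteness of the Besov norm makes the norm of every block finite, so that the block
  bounds \<open>c m\<close> can be real numbers; the sequence of these norms then lies in the
  q-space. With regularity 0 the weights are 1.\<close>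

lemma besov_norm_Lp_le:
  fixes f :: "real^'n \<Rightarrow> 'b::euclidean_space"
  assumes q: "1 \<le> q" and fin: "besov_norm chi 0 p q f < top"
  shows "Lp_norm p (LP_block chi m f) < top"
    and "Lp_le (count_space UNIV) q (\<lambda>m::int. Lp_norm p (LP_block chi m f)) (besov_norm chi 0 p q f)"
proof -
  have "Lp_norm p (LP_block chi m f) < top \<and> Lp_le (count_space UNIV) q (\<lambda>m::int. Lp_norm p (LP_block chi m f)) (besov_norm chi 0 p q f)"
  proof (cases "q = top")
    case True
    have b: "besov_norm chi 0 p q f = (SUP m::int. Lp_norm p (LP_block chi m f))" using True by (simp add: besov_norm_def)
    have le: "Lp_norm p (LP_block chi m f) \<le> besov_norm chi 0 p q f" for m unfolding b by (rule SUP_upper) simp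
    then show ?thesis using True fin le_less_trans[OF le fin] by (simp add: Lp_le_def AE_count_space)
  next
    case False
    let ?q = "enn2real q"
    note t = enn2real_ge_1[OF q False]
    let ?g = "\<lambda>m::int. enn_powr (Lp_norm p (LP_block chi m f)) ?q"
    have b: "besov_norm chi 0 p q f = enn_powr (infsum ?g UNIV) (1 / ?q)" using False by (simp add: besov_norm_def)
    have bq: "enn_powr (besov_norm chi 0 p q f) ?q = infsum ?g UNIV" unfolding b using t by (subst enn_powr_powr) auto
    have "infsum ?g UNIV \<noteq> top" using fin unfolding b by auto
    then have "?g m < top" using infsum_ge_term[of ?g m] by (auto simp: less_top[symmetric] top_unique)
    then have "Lp_norm p (LP_block chi m f) \<noteq> top" by auto
    then show ?thesis using nn_integral_count_space_le_infsum[of ?g] False bq by (simp add: Lp_le_def less_top)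
  qed
  then show "Lp_norm p (LP_block chi m f) < top"
    "Lp_le (count_space UNIV) q (\<lambda>m::int. Lp_norm p (LP_block chi m f)) (besov_norm chi 0 p q f)" by auto
qed

subsection \<open>Borel representatives\<close>

lemma lebesgue_measurable_AE_eq:
  fixes g g' :: "'a::euclidean_space \<Rightarrow> real"
  assumes g': "g' \<in> borel_measurable borel" and ae: "AE x in lborel. g x = g' x"
  shows "g \<in> borel_measurable lebesgue"
proof (rule measurableI)
  fix S :: "real set" assume S: "S \<in> sets borel"
  obtain N where N: "{x \<in> space lborel. g x \<noteq> g' x} \<subseteq> N" "emeasure lborel N = 0" "N \<in> sets lborel"
    using ae by (rule AE_E)
  have Nn: "N \<in> null_sets lebesgue" using N by (auto intro!: null_sets_completionI simp: null_sets_def)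
  have eq: "g -` S \<inter> space lebesgue = (g' -` S - N) \<union> (g -` S \<inter> N)" using N(1) by auto
  have "g' -` S - N \<in> sets lborel" using measurable_sets[OF g' S] N(3) by simp
  then have 1: "g' -` S - N \<in> sets lebesgue" by (rule sets_completionI_sets)
  have 2: "g -` S \<inter> N \<in> sets lebesgue" using null_sets_completion_subset[OF _ Nn, of "g -` S \<inter> N"] by auto
  show "g -` S \<inter> space lebesgue \<in> sets lebesgue" unfolding eq by (rule sets.Un[OF 1 2])
qed simp

text \<open>Returns from \<open>lborel\<close> to the norm of the statement: \<open>g\<close> agrees
  almost everywhere with a Borel function, so completing the measure does not change the
  integrals.\<close>

lemma Lp_norm_le:
  fixes g g' :: "real^'n \<Rightarrow> real"
  assumes r: "1 \<le> r" and g': "g' \<in> borel_measurable borel" and ae: "AE x in lborel. g x = g' x"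
    and B: "Lp_le lborel r (\<lambda>x. ennreal \<bar>g' x\<bar>) B"
  shows "Lp_norm r (\<lambda>x. \<bar>g x\<bar>) \<le> B"
proof (cases "r = top")
  case True
  \<comment> \<open>On a function that is not measurable \<open>esssup\<close> takes the default
    value \<open>top\<close>, so measurability comes first.\<close>
  have [measurable]: "g \<in> borel_measurable lebesgue" by (rule lebesgue_measurable_AE_eq[OF g' ae])
  have "AE x in lborel. ennreal \<bar>g' x\<bar> \<le> B" using B True by (simp add: Lp_le_def)
  with ae have "AE x in lborel. ennreal \<bar>g x\<bar> \<le> B" by eventually_elim simp
  then have "AE x in lebesgue. ennreal \<bar>g x\<bar> \<le> B" by (rule AE_completion)
  then show ?thesis using True by (auto simp: Lp_norm_def intro!: esssup_I)
next
  case False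
  note t = enn2real_ge_1[OF r False]
  note [measurable] = g'
  have "(\<integral>\<^sup>+x. ennreal (\<bar>g x\<bar> powr enn2real r) \<partial>lebesgue) = (\<integral>\<^sup>+x. enn_powr (ennreal \<bar>g' x\<bar>) (enn2real r) \<partial>lebesgue)"
    using AE_completion[OF ae] by (intro nn_integral_cong_AE) (auto elim!: eventually_mono)
  also have "\<dots> = (\<integral>\<^sup>+x. enn_powr (ennreal \<bar>g' x\<bar>) (enn2real r) \<partial>lborel)" by (rule nn_integral_completion)
  also have "\<dots> \<le> enn_powr B (enn2real r)" using B False by (simp add: Lp_le_def)
  finally have "Lp_norm r (\<lambda>x. \<bar>g x\<bar>) \<le> enn_powr (enn_powr B (enn2real r)) (1 / enn2real r)"
    using False t by (auto simp: Lp_norm_def intro!: enn_powr_mono)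
  then show ?thesis using t by (simp add: enn_powr_powr)
qed

text \<open>Applied with \<open>g\<close> the norm of a vector field or an \<open>LP_block\<close>,
  and \<open>h\<close> a real component of it. An arbitrary \<open>g\<close> is admissible: for p =
  \<open>top\<close> the default value of \<open>esssup\<close> is harmless in this direction, and
  for finite p the integrals are compared by monotonicity.\<close>

lemma Lp_le_Lp_norm:
  fixes h g :: "real^'n \<Rightarrow> real"
  assumes p: "1 \<le> p" and h: "h \<in> borel_measurable borel" and le: "AE x in lborel. \<bar>h x\<bar> \<le> g x"
  shows "Lp_le lborel p (\<lambda>x. ennreal \<bar>h x\<bar>) (Lp_norm p g)"
proof (cases "p = top")
  case True
  have "AE x in lebesgue. ennreal (g x) \<le> Lp_norm p g" using True esssup_AE[of "\<lambda>x. ennreal (g x)" lebesgue] by (simp add: Lp_norm_def)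
  then have "AE x in lborel. ennreal (g x) \<le> Lp_norm p g" by (simp add: AE_completion_iff)
  with le have "AE x in lborel. ennreal \<bar>h x\<bar> \<le> Lp_norm p g" by eventually_elim (meson ennreal_leI order_trans)
  then show ?thesis using True by (simp add: Lp_le_def)
next
  case False
  note t = enn2real_ge_1[OF p False]
  note [measurable] = h
  have "(\<integral>\<^sup>+x. enn_powr (ennreal \<bar>h x\<bar>) (enn2real p) \<partial>lborel) = (\<integral>\<^sup>+x. enn_powr (ennreal \<bar>h x\<bar>) (enn2real p) \<partial>lebesgue)"
    by (rule nn_integral_completion[symmetric])
  also have "\<dots> \<le> (\<integral>\<^sup>+x. ennreal (g x powr enn2real p) \<partial>lebesgue)"
    using AE_completion[OF le] t by (intro nn_integral_mono_AE) (auto elim!: eventually_mono intro!: ennreal_leI powr_mono2)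
  also have "\<dots> = enn_powr (Lp_norm p g) (enn2real p)"
    using False t by (simp add: Lp_norm_def enn_powr_powr)
  finally show ?thesis using False by (simp add: Lp_le_def)
qed

lemma integral_lebesgue_AE_eq:
  fixes F F' :: "'a::euclidean_space \<Rightarrow> 'b::{banach, second_countable_topology}"
  assumes "F \<in> borel_measurable lebesgue" "F' \<in> borel_measurable borel" "AE x in lborel. F x = F' x"
  shows "(\<integral>x. F x \<partial>lebesgue) = (\<integral>x. F' x \<partial>lborel)"
proof -
  have F': "F' \<in> borel_measurable lborel" using assms(2) by simp
  have "(\<integral>x. F x \<partial>lebesgue) = (\<integral>x. F' x \<partial>lebesgue)"
    using assms measurable_completion[OF F'] AE_completion[OF assms(3)] by (intro integral_cong_AE)
  also have "\<dots> = (\<integral>x. F' x \<partial>lborel)" by (rule integral_completion[OF F'])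
  finally show ?thesis .
qed

text \<open>The substitution y = x - e z turns the convolution with \<open>LP_psi\<close> into
  \<open>kop\<close> with the kernel a + i b. The two real operators are its real and imaginary
  parts, hence at most its modulus, which is one of the terms under the root in
  \<open>LP_block\<close>.\<close>

lemma (in lp_kernels) kop_le_LP_block:
  fixes f :: "real^'n \<Rightarrow> 'b::euclidean_space"
  assumes B: "v \<in> Basis" and f': "tempered f'" and ae: "AE x in lborel. f x \<bullet> v = f' x"
  shows "\<bar>kop a (dy n) f' x\<bar> \<le> LP_block chi n f x" "\<bar>kop b (dy n) f' x\<bar> \<le> LP_block chi n f x"
proof -
  note [measurable] = rapid[THEN rapid_measurable] tempered_measurable[OF f']
  let ?e = "dy n"
  have e: "0 < ?e" by simp
  define psi where "psi y = complex_of_real (a ((1 / ?e) *\<^sub>R y) / ?e ^ CARD('n)) + \<i> * complex_of_real (b ((1 / ?e) *\<^sub>R y) / ?e ^ CARD('n))" for y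
  have psi: "LP_psi chi n = psi" by (rule ext) (simp add: psi_eq psi_def complex_eq_iff)
  have [measurable]: "psi \<in> borel_measurable borel" unfolding psi_def by measurable
  have m: "(\<lambda>x. f x \<bullet> v) \<in> borel_measurable lebesgue" by (rule lebesgue_measurable_AE_eq[OF _ ae]) measurable
  have mpsi: "(\<lambda>y. psi (x - y)) \<in> borel_measurable lebesgue" by (rule measurable_completion) measurable
  have "(\<integral>y. LP_psi chi n (x - y) * complex_of_real (f y \<bullet> v) \<partial>lebesgue) = (\<integral>y. psi (x - y) * complex_of_real (f' y) \<partial>lborel)"
    unfolding psi using ae m mpsi by (intro integral_lebesgue_AE_eq) (auto elim!: eventually_mono)
  also have "\<dots> = ?e ^ CARD('n) *\<^sub>R (\<integral>z. psi (x - (x + (- ?e) *\<^sub>R z)) * complex_of_real (f' (x + (- ?e) *\<^sub>R z)) \<partial>lborel)"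
    using e by (subst integral_lborel_affine[where c="- ?e" and t=x]) (simp_all add: scaleR_conv_of_real)
  also have "\<dots> = (\<integral>z. ?e ^ CARD('n) *\<^sub>R (psi (?e *\<^sub>R z) * complex_of_real (f' (x - ?e *\<^sub>R z))) \<partial>lborel)"
    by simp
  also have "\<dots> = (\<integral>z. complex_of_real (a z * f' (x - ?e *\<^sub>R z)) + \<i> * complex_of_real (b z * f' (x - ?e *\<^sub>R z)) \<partial>lborel)"
    using e by (intro Bochner_Integration.integral_cong refl) (simp add: psi_def complex_eq_iff)
  also have "\<dots> = complex_of_real (kop a ?e f' x) + \<i> * complex_of_real (kop b ?e f' x)"
    unfolding kop_def
    by (subst Bochner_Integration.integral_add)
       (auto intro!: integrable_mult_right integrable_of_real rapid_tempered_integrable rapid f' e simp del: of_real_mult)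
  finally have eq: "(\<integral>y. LP_psi chi n (x - y) * complex_of_real (f y \<bullet> v) \<partial>lebesgue) = Complex (kop a ?e f' x) (kop b ?e f' x)"
    by (simp add: complex_eq_iff)
  have "cmod (Complex (kop a ?e f' x) (kop b ?e f' x)) \<le> LP_block chi n f x"
    unfolding LP_block_def eq[symmetric]
    by (rule real_le_rsqrt) (rule member_le_sum[OF B], auto)
  then show "\<bar>kop a (dy n) f' x\<bar> \<le> LP_block chi n f x" "\<bar>kop b (dy n) f' x\<bar> \<le> LP_block chi n f x"
    using abs_Re_le_cmod[of "Complex (kop a ?e f' x) (kop b ?e f' x)"] abs_Im_le_cmod[of "Complex (kop a ?e f' x) (kop b ?e f' x)"]
    by (simp_all only: complex.sel)
qed

text \<open>Only the restrictions of \<open>f\<close> to compact sets are known to be measurable;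
  \<open>f\<close> is the pointwise limit of its restrictions to growing balls.\<close>

lemma loc_integrable_representative:
  fixes f :: "real^'n \<Rightarrow> real"
  assumes f: "loc_integrable f"
  obtains f' where "loc_int f'" "AE x in lborel. f x = f' x"
proof -
  have s: "integrable lebesgue (\<lambda>x. indicator (cball 0 R) x *\<^sub>R f x)" for R
    using f compact_cball[of 0 R] unfolding loc_integrable_def set_integrable_def by blast
  have "f \<in> borel_measurable lebesgue"
  proof (rule borel_measurable_LIMSEQ_real)
    fix x :: "real^'n"
    have "\<forall>\<^sub>F k in sequentially. indicator (cball 0 (real k)) x *\<^sub>R f x = f x"
      using eventually_ge_at_top[of "nat \<lceil>norm x\<rceil>"] by eventually_elim (auto simp: indicator_def nat_ceiling_le_eq)
    then show "(\<lambda>k. indicator (cball 0 (real k)) x *\<^sub>R f x) \<longlonglongrightarrow> f x" by (rule tendsto_eventually)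
  qed (use s in auto)
  then obtain f' where f': "f' \<in> borel_measurable lborel" "AE x in lborel. f x = f' x"
    by (rule completion_ex_borel_measurable_real[THEN bexE]) blast
  have "integrable lborel (\<lambda>x. indicator (cball 0 R) x * f' x)" for R
  proof -
    have m: "(\<lambda>x. indicator (cball 0 R) x * f' x) \<in> borel_measurable lborel" using f'(1) by measurable
    have "integrable lebesgue (\<lambda>x. indicator (cball 0 R) x * f' x)"
    proof (rule integrable_cong_AE_imp[OF s[of R] measurable_completion[OF m]])
      show "AE x in lebesgue. indicator (cball 0 R) x *\<^sub>R f x = indicator (cball 0 R) x * f' x"
        using AE_completion[OF f'(2)] by eventually_elim simp
    qed
    then show ?thesis using integrable_completion[OF m] by simp
  qed
  then have "loc_int f'" using f'(1) by (simp add: loc_int_def)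
  then show thesis using f'(2) that by blast
qed

lemma test_fun_measurable: "test_fun \<zeta> \<Longrightarrow> \<zeta> \<in> borel_measurable borel"
  by (rule rapid_measurable[OF test_fun_rapid])

lemma integral_mult_representative:
  fixes f f' k :: "'a::euclidean_space \<Rightarrow> real"
  assumes [measurable]: "f' \<in> borel_measurable borel" and ae: "AE x in lborel. f x = f' x" and [measurable]: "k \<in> borel_measurable borel"
  shows "(\<integral>x. f x * k x \<partial>lebesgue) = (\<integral>x. f' x * k x \<partial>lborel)"
proof (rule integral_lebesgue_AE_eq)
  have "f \<in> borel_measurable lebesgue" by (rule lebesgue_measurable_AE_eq[OF assms(1) ae])
  moreover have "k \<in> borel_measurable lebesgue" by (rule measurable_completion) simp
  ultimately show "(\<lambda>x. f x * k x) \<in> borel_measurable lebesgue" by (rule borel_measurable_times)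
  show "AE x in lborel. f x * k x = f' x * k x" using ae by eventually_elim simp
qed measurable

lemma conv_representative:
  assumes f': "f' \<in> borel_measurable borel" and ae: "AE x in lborel. f x = f' x" and [measurable]: "k \<in> borel_measurable borel"
  shows "conv f k = conv f' k"
proof
  fix x
  have k: "(\<lambda>y. k (x - y)) \<in> borel_measurable borel" by measurable
  show "conv f k x = conv f' k x"
    unfolding conv_def integral_mult_representative[OF f' ae k] integral_mult_representative[OF f' AE_I2[OF refl] k] ..
qed

lemma mollifier_measurable:
  fixes \<phi> :: "real^'n \<Rightarrow> real"
  assumes "schwartz \<phi>" shows "mollifier \<phi> d \<in> borel_measurable borel"
proof -
  have [measurable]: "\<phi> \<in> borel_measurable borel" by (rule rapid_measurable[OF schwartz_rapid(1)[OF assms]])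
  have "mollifier \<phi> d = (\<lambda>x. d powr (- real CARD('n)) * \<phi> ((1 / d) *\<^sub>R x))" by (simp add: mollifier_def fun_eq_iff)
  then show ?thesis by simp
qed

text \<open>The only place where the distributional hypotheses on \<open>u\<close> are used. They
  turn into increments for each component, and, since summing the weak derivatives over the diagonal
  reproduces the divergence condition, into a trace that vanishes almost everywhere.\<close>

lemma weak_grad_representative:
  fixes u :: "real^'n \<Rightarrow> real^'n" and \<theta> :: "real^'n \<Rightarrow> real"
  assumes w: "weak_grad u G" and df: "div_free u"
    and \<theta>: "test_fun \<theta>" "\<And>x. 0 \<le> \<theta> x" "\<And>x. norm x < 1 \<Longrightarrow> \<theta> x = 1"
  shows "\<exists>U g. (\<forall>i. loc_int (U i) \<and> (AE x in lborel. u x $ i = U i x) \<and> has_increments (U i) (g i)) \<and>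
    (\<forall>i j. loc_int (g i j) \<and> (AE x in lborel. G x $ i $ j = g i j x)) \<and> (AE x in lborel. (\<Sum>i\<in>UNIV. g i i x) = 0)"
proof -
  have rep: "\<exists>f'. loc_int f' \<and> (AE x in lborel. f x = f' x)" if "loc_integrable f" for f :: "real^'n \<Rightarrow> real"
    using loc_integrable_representative[OF that] by metis
  have "\<forall>i. \<exists>f'. loc_int f' \<and> (AE x in lborel. u x $ i = f' x)"
    using w unfolding weak_grad_def by (intro allI rep) blast
  then obtain U where U: "\<And>i. loc_int (U i)" "\<And>i. AE x in lborel. u x $ i = U i x" by metis
  have "\<forall>i j. \<exists>f'. loc_int f' \<and> (AE x in lborel. G x $ i $ j = f' x)"
    using w unfolding weak_grad_def by (intro allI rep) blast
  then obtain g where g: "\<And>i j. loc_int (g i j)" "\<And>i j. AE x in lborel. G x $ i $ j = g i j x" by metis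
  have weak: "(\<integral>x. U i x * partial \<zeta> j x \<partial>lborel) = - (\<integral>x. g i j x * \<zeta> x \<partial>lborel)" if \<zeta>: "test_fun \<zeta>" for \<zeta> i j
  proof -
    have "(\<integral>x. u x $ i * partial \<zeta> j x \<partial>lebesgue) = - (\<integral>x. G x $ i $ j * \<zeta> x \<partial>lebesgue)"
      using w \<zeta> by (simp add: weak_grad_def)
    then show ?thesis
      unfolding integral_mult_representative[OF loc_int_measurable[OF U(1)] U(2) test_fun_measurable[OF test_fun_partial[OF \<zeta>]]]
        integral_mult_representative[OF loc_int_measurable[OF g(1)] g(2) test_fun_measurable[OF \<zeta>]] .
  qed
  have inc: "has_increments (U i) (g i)" for i
    unfolding has_increments_def using weak_gradient_increment[OF U(1) g(1) weak \<theta>] by blast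
  have trace: "(\<integral>x. (\<Sum>i\<in>UNIV. g i i x) * \<zeta> x \<partial>lborel) = 0" if \<zeta>: "test_fun \<zeta>" for \<zeta>
  proof -
    note [measurable] = loc_int_measurable[OF U(1)]
    have mp [measurable]: "partial \<zeta> i \<in> borel_measurable borel" for i
      by (rule test_fun_measurable[OF test_fun_partial[OF \<zeta>]])
    have "(\<integral>x. (\<Sum>i\<in>UNIV. u x $ i * partial \<zeta> i x) \<partial>lebesgue) = (\<integral>x. (\<Sum>i\<in>UNIV. U i x * partial \<zeta> i x) \<partial>lborel)"
    proof (rule integral_lebesgue_AE_eq)
      have "(\<lambda>x. u x $ i) \<in> borel_measurable lebesgue" for i
        by (rule lebesgue_measurable_AE_eq[OF loc_int_measurable[OF U(1)] U(2)])
      moreover have "partial \<zeta> i \<in> borel_measurable lebesgue" for i by (rule measurable_completion) simp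
      ultimately show "(\<lambda>x. \<Sum>i\<in>UNIV. u x $ i * partial \<zeta> i x) \<in> borel_measurable lebesgue"
        by (intro borel_measurable_sum borel_measurable_times)
      have "AE x in lborel. \<forall>i. u x $ i = U i x" using U(2) by (simp add: AE_all_countable)
      then show "AE x in lborel. (\<Sum>i\<in>UNIV. u x $ i * partial \<zeta> i x) = (\<Sum>i\<in>UNIV. U i x * partial \<zeta> i x)"
        by eventually_elim simp
    qed measurable
    then have "(\<integral>x. (\<Sum>i\<in>UNIV. U i x * partial \<zeta> i x) \<partial>lborel) = 0" using df \<zeta> by (simp add: div_free_def)
    then have "(\<Sum>i\<in>UNIV. (\<integral>x. U i x * partial \<zeta> i x \<partial>lborel)) = 0"
      by (subst (asm) Bochner_Integration.integral_sum) (auto intro!: loc_int_test_mult U test_fun_partial \<zeta>)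
    then have "(\<Sum>i\<in>UNIV. (\<integral>x. g i i x * \<zeta> x \<partial>lborel)) = 0" by (simp add: weak[OF \<zeta>] sum_negf)
    moreover have "(\<integral>x. (\<Sum>i\<in>UNIV. g i i x * \<zeta> x) \<partial>lborel) = (\<Sum>i\<in>UNIV. (\<integral>x. g i i x * \<zeta> x \<partial>lborel))"
      by (rule Bochner_Integration.integral_sum) (intro loc_int_test_mult g \<zeta>)
    ultimately show ?thesis by (simp add: sum_distrib_right)
  qed
  have "AE x in lborel. (\<Sum>i\<in>UNIV. g i i x) = 0"
  proof (rule fundamental_lemma_calculus_of_variations[OF _ \<theta>])
    show "loc_int (\<lambda>x. \<Sum>i\<in>UNIV. g i i x)" by (intro loc_int_sum g) simp
    fix e :: real and y :: "real^'n" assume e: "0 < e"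
    have "test_fun (\<lambda>x. 1 * \<theta> ((1 / e) *\<^sub>R x + - ((1 / e) *\<^sub>R y)))" using e by (intro test_fun_affine \<theta>) simp
    then have "test_fun (\<lambda>x. \<theta> ((1 / e) *\<^sub>R (x - y)))" by (simp add: scaleR_diff_right)
    then show "(\<integral>x. (\<Sum>i\<in>UNIV. g i i x) * \<theta> ((1 / e) *\<^sub>R (x - y)) \<partial>lborel) = 0" by (rule trace)
  qed
  then show ?thesis using U g inc by blast
qed

text \<open>The convolutions, and with them their derivatives, do not change at any point when
  \<open>u\<close> and \<open>\<rho>\<close> change on null sets. The value \<open>u x\<close>
  enters directly, so the commutators agree only almost everywhere.\<close>

lemma commutator_representative:
  fixes u u' :: "real^'n \<Rightarrow> real^'n"
  assumes \<phi>: "schwartz \<phi>" and [measurable]: "\<rho>' \<in> borel_measurable borel" "\<And>i. (\<lambda>x. u' x $ i) \<in> borel_measurable borel"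
    and \<rho>: "AE x in lborel. \<rho> x = \<rho>' x" and u: "\<And>i. AE x in lborel. u x $ i = u' x $ i"
  shows "AE x in lborel. commutator \<phi> d u \<rho> x = commutator \<phi> d u' \<rho>' x"
proof -
  note m = mollifier_measurable[OF \<phi>]
  have 1: "conv \<rho> (mollifier \<phi> d) = conv \<rho>' (mollifier \<phi> d)"
    by (rule conv_representative[OF _ \<rho> m]) measurable
  have 2: "conv (\<lambda>y. u y $ i * \<rho> y) (mollifier \<phi> d) = conv (\<lambda>y. u' y $ i * \<rho>' y) (mollifier \<phi> d)" for i
  proof (rule conv_representative[OF _ _ m])
    show "AE x in lborel. u x $ i * \<rho> x = u' x $ i * \<rho>' x" using u[of i] \<rho> by eventually_elim simp
  qed measurable
  have "AE x in lborel. \<forall>i. u x $ i = u' x $ i" using u by (simp add: AE_all_countable)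
  then have "AE x in lborel. u x = u' x" by (simp add: vec_eq_iff)
  then show ?thesis by eventually_elim (simp add: commutator_def 1 2)
qed


text \<open>Assembles the estimate for Borel representatives. The constant is 8 = 2 * 4: the 2 comes
  from the bound at one dyadic scale, the 4 from the mass of the dyadic weights. The coefficient of
  block m is linear in the block norms of the gradient and of \<open>\<rho>\<close>, so its q-norm
  is at most the bracket of the statement.\<close>

lemma (in lp_kernels) dlog_norm_commutator_le:
  fixes u :: "real^'n \<Rightarrow> real^'n" and G :: "real^'n \<Rightarrow> real^'n^'n" and \<rho> \<phi> \<theta> :: "real^'n \<Rightarrow> real"
  assumes p: "1 \<le> p" "1 \<le> p'" "1 \<le> r" "inverse p + inverse p' = inverse r" and q: "1 \<le> q"
    and \<rho>: "\<rho> \<in> borel_measurable lebesgue" "Lp_norm p' (\<lambda>x. \<bar>\<rho> x\<bar>) < top" "besov_norm chi 0 p' q \<rho> < top"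
    and u: "weak_grad u G" "div_free u"
    and G: "Lp_norm p (\<lambda>x. norm (G x)) < top" "besov_norm chi 0 p q G < top"
    and \<phi>: "schwartz \<phi>" "(\<integral>x. \<phi> x \<partial>lebesgue) = 1"
    and \<theta>: "test_fun \<theta>" "\<And>x. 0 \<le> \<theta> x" "\<And>x. norm x < 1 \<Longrightarrow> \<theta> x = 1"
  shows "dlog_norm q (\<lambda>\<delta>. Lp_norm r (\<lambda>x. \<bar>commutator \<phi> \<delta> u \<rho> x\<bar>))
    \<le> ennreal (8 * enn2real (phi_quantity \<phi>) * (real CARD('n))\<^sup>2 * Q0 * (1 + l1 P)) *
       (besov_norm chi 0 p q G * Lp_norm p' (\<lambda>x. \<bar>\<rho> x\<bar>) + Lp_norm p (\<lambda>x. norm (G x)) * besov_norm chi 0 p' q \<rho>)"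
proof -
  define K where "K = enn2real (phi_quantity \<phi>)"
  define C where "C = 2 * K * (real CARD('n))\<^sup>2 * Q0 * (1 + l1 P)"
  have K0: "0 \<le> K" by (simp add: K_def)
  have C0: "0 \<le> C" using K0 Q0_ge(1) l1_nonneg[of P] by (simp add: C_def)
  obtain \<rho>' where \<rho>': "\<rho>' \<in> borel_measurable lborel" "AE x in lborel. \<rho> x = \<rho>' x"
    using completion_ex_borel_measurable_real[OF \<rho>(1)] by blast
  obtain U :: "'n \<Rightarrow> real^'n \<Rightarrow> real" and g :: "'n \<Rightarrow> 'n \<Rightarrow> real^'n \<Rightarrow> real"
    where U: "\<And>i. loc_int (U i)" "\<And>i. AE x in lborel. u x $ i = U i x"
    and g: "\<And>i j. loc_int (g i j)" "\<And>i j. AE x in lborel. G x $ i $ j = g i j x"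
    and inc: "\<And>i. has_increments (U i) (g i)" and tr: "AE x in lborel. (\<Sum>i\<in>UNIV. g i i x) = 0"
    using weak_grad_representative[OF u \<theta>] by blast
  have \<rho>'m [measurable]: "\<rho>' \<in> borel_measurable borel" using \<rho>'(1) by simp
  have gm [measurable]: "g i j \<in> borel_measurable borel" for i j by (rule loc_int_measurable[OF g(1)])
  have Um [measurable]: "U i \<in> borel_measurable borel" for i by (rule loc_int_measurable[OF U(1)])
  define u' where "u' x = (\<chi> i. U i x)" for x
  have u'_nth: "(\<lambda>x. u' x $ i) = U i" for i by (simp add: u'_def fun_eq_iff)
  define A where "A = enn2real (Lp_norm p (\<lambda>x. norm (G x)))"
  define A' where "A' = enn2real (Lp_norm p' (\<lambda>x. \<bar>\<rho> x\<bar>))"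
  define c where "c m = enn2real (Lp_norm p (LP_block chi m G))" for m
  define c' where "c' m = enn2real (Lp_norm p' (LP_block chi m \<rho>))" for m
  define bG where "bG = enn2real (besov_norm chi 0 p q G)"
  define b\<rho> where "b\<rho> = enn2real (besov_norm chi 0 p' q \<rho>)"
  have pos: "0 \<le> A" "0 \<le> A'" "0 \<le> c m" "0 \<le> c' m" "0 \<le> bG" "0 \<le> b\<rho>" for m
    by (simp_all add: A_def A'_def c_def c'_def bG_def b\<rho>_def)
  have e: "Lp_norm p (\<lambda>x. norm (G x)) = ennreal A" "Lp_norm p' (\<lambda>x. \<bar>\<rho> x\<bar>) = ennreal A'"
    "Lp_norm p (LP_block chi m G) = ennreal (c m)" "Lp_norm p' (LP_block chi m \<rho>) = ennreal (c' m)"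
    "besov_norm chi 0 p q G = ennreal bG" "besov_norm chi 0 p' q \<rho> = ennreal b\<rho>" for m
    using \<rho> G besov_norm_Lp_le(1)[OF q G(2)] besov_norm_Lp_le(1)[OF q \<rho>(3)]
    by (simp_all add: A_def A'_def c_def c'_def bG_def b\<rho>_def)
  have LG: "Lp_le lborel p (\<lambda>x. ennreal \<bar>g i j x\<bar>) (ennreal A)" for i j
    unfolding e(1)[symmetric]
  proof (rule Lp_le_Lp_norm[OF p(1) gm])
    show "AE x in lborel. \<bar>g i j x\<bar> \<le> norm (G x)"
      using g(2)[of i j]
    proof eventually_elim
      case (elim x)
      have "\<bar>G x $ i $ j\<bar> \<le> norm (G x $ i)" by (rule component_le_norm_cart)
      also have "\<dots> \<le> norm (G x)" by (rule Finite_Cartesian_Product.norm_nth_le)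
      finally show ?case using elim by simp
    qed
  qed
  have L\<rho>: "Lp_le lborel p' (\<lambda>x. ennreal \<bar>\<rho>' x\<bar>) (ennreal A')"
    unfolding e(2)[symmetric] by (rule Lp_le_Lp_norm[OF p(2) \<rho>'m]) (use \<rho>'(2) in \<open>eventually_elim, simp\<close>)
  have tg: "tempered (g i j)" for i j by (rule Lp_le_tempered[OF p(1) gm LG])
  have t\<rho>: "tempered \<rho>'" by (rule Lp_le_tempered[OF p(2) \<rho>'m L\<rho>])
  have tU: "tempered (U i)" for i by (rule has_increments_tempered[OF p(1) U(1) inc gm LG pos(1)])
  have tU\<rho>: "tempered (\<lambda>x. U i x * \<rho>' x)" for i
    by (rule has_increments_mult_tempered[OF p U(1) inc gm LG \<rho>'m L\<rho> pos(1,2)])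
  have bas: "axis i (axis j 1) \<in> (Basis :: (real^'n^'n) set)" for i j
    by (auto simp: Basis_vec_def)
  have aeG: "AE x in lborel. G x \<bullet> axis i (axis j 1) = g i j x" for i j
    using g(2)[of i j] by (simp add: inner_axis)
  have ae\<rho>: "AE x in lborel. \<rho> x \<bullet> 1 = \<rho>' x" using \<rho>'(2) by simp
  note rm [measurable] = rapid[THEN rapid_measurable]
  have cG: "Lp_le lborel p (\<lambda>x. ennreal \<bar>kop a (dy m) (g i j) x\<bar>) (ennreal (c m))"
    "Lp_le lborel p (\<lambda>x. ennreal \<bar>kop b (dy m) (g i j) x\<bar>) (ennreal (c m))" for i j m
    unfolding e(3)[symmetric]
    by (rule Lp_le_Lp_norm[OF p(1) _ AE_I2], measurable, rule kop_le_LP_block[OF bas tg aeG])+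
  have c\<rho>: "Lp_le lborel p' (\<lambda>x. ennreal \<bar>kop a (dy m) \<rho>' x\<bar>) (ennreal (c' m))"
    "Lp_le lborel p' (\<lambda>x. ennreal \<bar>kop b (dy m) \<rho>' x\<bar>) (ennreal (c' m))" for m
    unfolding e(4)[symmetric]
    by (rule Lp_le_Lp_norm[OF p(2) _ AE_I2], measurable, rule kop_le_LP_block[OF _ t\<rho> ae\<rho>], simp)+
  have \<phi>1: "(\<integral>x. \<phi> x \<partial>lborel) = 1"
    using \<phi>(2) integral_completion[of \<phi> lborel] rapid_measurable[OF schwartz_rapid(1)[OF \<phi>(1)]] by simp
  let ?T = "\<lambda>n. \<integral>\<^sup>+m. ennreal (dw n m) * ennreal (A' * c m + A * c' m) \<partial>count_space UNIV"
  have bound: "Lp_norm r (\<lambda>x. \<bar>commutator \<phi> d u \<rho> x\<bar>) \<le> ennreal C * ?T n" if d: "dy n \<le> d" "d < 2 * dy n" for n d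
  proof (rule Lp_norm_le[OF p(3)])
    have d0: "0 < d" using d(1) by (rule less_le_trans[rotated]) simp
    have u'\<rho>: "tempered (\<lambda>x. u' x $ i * \<rho>' x)" for i using tU\<rho>[of i] by (simp add: u'_def)
    show "AE x in lborel. commutator \<phi> d u \<rho> x = commutator \<phi> d u' \<rho>' x"
      by (rule commutator_representative[OF \<phi>(1) \<rho>'m _ \<rho>'(2)]) (use U(2) in \<open>simp_all add: u'_nth u'_def\<close>)
    note [measurable] = rapid_measurable[OF schwartz_rapid(2)[OF \<phi>(1)]]
    show "commutator \<phi> d u' \<rho>' \<in> borel_measurable borel"
      unfolding commutator_eq[OF \<phi>(1) d0 t\<rho> u'\<rho>, abs_def] by (simp add: u'_def)
    show "Lp_le lborel r (\<lambda>x. ennreal \<bar>commutator \<phi> d u' \<rho>' x\<bar>) (ennreal C * ?T n)"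
      unfolding C_def
      by (rule commutator_bound[where u=u' and \<rho>=\<rho>' and g=g and c=c and c'=c', OF p \<phi>(1) \<phi>1 phi_quantity_kernel_bound(2)[OF \<phi>(1), folded K_def] K0 t\<rho> L\<rho> pos(2)
            _ u'\<rho> _ tg LG pos(1) tr cG pos(3) c\<rho> pos(4) d(1) less_imp_le[OF d(2)]])
         (simp_all add: u'_nth tU inc)
  qed
  define \<Gamma> where "\<Gamma> = A' * bG + A * b\<rho>"
  have "Lp_le (count_space UNIV) q (\<lambda>m. ennreal A' * ennreal (c m) + ennreal A * ennreal (c' m)) (ennreal (A' * bG + A * b\<rho>))"
  proof (rule Lp_le_add[OF sf_count_int q])
    show "Lp_le (count_space UNIV) q (\<lambda>m. ennreal A' * ennreal (c m)) (ennreal (A' * bG))"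
      using Lp_le_cmult[OF q _ besov_norm_Lp_le(2)[OF q G(2)], of "ennreal A'"] pos by (simp add: e ennreal_mult)
    show "Lp_le (count_space UNIV) q (\<lambda>m. ennreal A * ennreal (c' m)) (ennreal (A * b\<rho>))"
      using Lp_le_cmult[OF q _ besov_norm_Lp_le(2)[OF q \<rho>(3)], of "ennreal A"] pos by (simp add: e ennreal_mult)
  qed (use pos in auto)
  then have "Lp_le (count_space UNIV) q (\<lambda>m. ennreal (A' * c m + A * c' m)) (ennreal \<Gamma>)"
    using pos by (simp add: \<Gamma>_def ennreal_mult)
  from Lp_le_dyadic_convolution[OF q this] have "Lp_le (count_space UNIV) q ?T (ennreal (4 * \<Gamma>))"
    using pos by (simp add: \<Gamma>_def)
  from Lp_le_cmult[OF q _ this, of "ennreal C"]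
  have "Lp_le (count_space UNIV) q (\<lambda>n. ennreal C * ?T n) (ennreal C * ennreal (4 * \<Gamma>))" by simp
  from dlog_norm_le[OF q this bound]
  have "dlog_norm q (\<lambda>\<delta>. Lp_norm r (\<lambda>x. \<bar>commutator \<phi> \<delta> u \<rho> x\<bar>)) \<le> ennreal C * ennreal (4 * \<Gamma>)" .
  also have "ennreal C * ennreal (4 * \<Gamma>) = ennreal (4 * C * \<Gamma>)"
    using C0 by (simp add: ennreal_mult'[symmetric] mult_ac)
  also have "\<dots> = ennreal (4 * C) * ennreal \<Gamma>" using C0 by (simp add: ennreal_mult')
  also have "4 * C = 8 * enn2real (phi_quantity \<phi>) * (real CARD('n))\<^sup>2 * Q0 * (1 + l1 P)"
    by (simp add: C_def K_def)
  also have "ennreal \<Gamma> = besov_norm chi 0 p q G * Lp_norm p' (\<lambda>x. \<bar>\<rho> x\<bar>) + Lp_norm p (\<lambda>x. norm (G x)) * besov_norm chi 0 p' q \<rho>"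
    unfolding e \<Gamma>_def using pos by (simp add: ennreal_mult mult.commute)
  finally show ?thesis .
qed

theorem theorem4p4:
  fixes chi :: "real^'n \<Rightarrow> real"
  assumes chi: "LP_symbol chi"
  shows "\<forall>K. \<exists>C>0. \<forall>(\<phi>::real^'n \<Rightarrow> real) (p::ennreal) (p'::ennreal) (q::ennreal) (r::ennreal)
           (\<rho>::real^'n \<Rightarrow> real) (u::real^'n \<Rightarrow> real^'n) (G::real^'n \<Rightarrow> real^'n^'n).
     1 \<le> p \<and> 1 \<le> p' \<and> 1 \<le> q \<and> 1 \<le> r \<and> inverse p + inverse p' = inverse r \<and>
     \<rho> \<in> borel_measurable lebesgue \<and> Lp_norm p' (\<lambda>x. \<bar>\<rho> x\<bar>) < top \<and> besov_norm chi 0 p' q \<rho> < top \<and>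
     weak_grad u G \<and> div_free u \<and>
     Lp_norm p (\<lambda>x. norm (G x)) < top \<and> besov_norm chi 0 p q G < top \<and>
     schwartz \<phi> \<and> (\<integral>x. \<phi> x \<partial>lebesgue) = 1 \<and> phi_quantity \<phi> = K
     \<longrightarrow> dlog_norm q (\<lambda>\<delta>. Lp_norm r (\<lambda>x. \<bar>commutator \<phi> \<delta> u \<rho> x\<bar>))
         \<le> ennreal C * (besov_norm chi 0 p q G * Lp_norm p' (\<lambda>x. \<bar>\<rho> x\<bar>)
                        + Lp_norm p (\<lambda>x. norm (G x)) * besov_norm chi 0 p' q \<rho>)"
proof
  fix K :: ennreal
  obtain P a b a' b' DP Da Db where k: "lp_kernels chi P a b a' b' DP Da Db" using ex_lp_kernels[OF chi] by blast
  interpret lp_kernels chi P a b a' b' DP Da Db by (rule k)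
  \<comment> \<open>Explicit in \<open>K\<close> and the dimension; \<open>chi\<close> enters
    through \<open>Q0\<close> and \<open>l1 P\<close>. For \<open>K\<close> = \<open>top\<close> the
    conversion gives 0, which does no harm because \<open>phi_quantity\<close> of a Schwartz
    function is finite.\<close>
  let ?C = "8 * enn2real K * (real CARD('n))\<^sup>2 * Q0 * (1 + l1 P)"
  have C0: "0 \<le> ?C" using Q0_ge(1) l1_nonneg[of P] by simp
  \<comment> \<open>The low-frequency symbol doubles as the bump function of the fundamental
    lemma.\<close>
  have \<theta>: "test_fun (LP_low chi)" "\<And>x. 0 \<le> LP_low chi x" "\<And>x. norm x < 1 \<Longrightarrow> LP_low chi x = 1"
    by (rule LP_low_test[OF chi], rule LP_low_nonneg[OF chi], simp add: LP_low_def)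
  show "\<exists>C>0. \<forall>(\<phi>::real^'n \<Rightarrow> real) (p::ennreal) (p'::ennreal) (q::ennreal) (r::ennreal)
           (\<rho>::real^'n \<Rightarrow> real) (u::real^'n \<Rightarrow> real^'n) (G::real^'n \<Rightarrow> real^'n^'n).
     1 \<le> p \<and> 1 \<le> p' \<and> 1 \<le> q \<and> 1 \<le> r \<and> inverse p + inverse p' = inverse r \<and>
     \<rho> \<in> borel_measurable lebesgue \<and> Lp_norm p' (\<lambda>x. \<bar>\<rho> x\<bar>) < top \<and> besov_norm chi 0 p' q \<rho> < top \<and>
     weak_grad u G \<and> div_free u \<and>
     Lp_norm p (\<lambda>x. norm (G x)) < top \<and> besov_norm chi 0 p q G < top \<and>
     schwartz \<phi> \<and> (\<integral>x. \<phi> x \<partial>lebesgue) = 1 \<and> phi_quantity \<phi> = K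
     \<longrightarrow> dlog_norm q (\<lambda>\<delta>. Lp_norm r (\<lambda>x. \<bar>commutator \<phi> \<delta> u \<rho> x\<bar>))
         \<le> ennreal C * (besov_norm chi 0 p q G * Lp_norm p' (\<lambda>x. \<bar>\<rho> x\<bar>)
                        + Lp_norm p (\<lambda>x. norm (G x)) * besov_norm chi 0 p' q \<rho>)"
  \<comment> \<open>The summand 1 only makes the constant strictly positive, as \<open>?C\<close> is
    merely known to be nonnegative.\<close>
  proof (intro exI[of _ "?C + 1"] conjI allI impI, goal_cases)
    case 1
    show ?case by (rule add_nonneg_pos[OF C0]) simp
  next
    case (2 \<phi> p p' q r \<rho> u G)
    then have "dlog_norm q (\<lambda>\<delta>. Lp_norm r (\<lambda>x. \<bar>commutator \<phi> \<delta> u \<rho> x\<bar>)) \<le> ennreal ?C *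
        (besov_norm chi 0 p q G * Lp_norm p' (\<lambda>x. \<bar>\<rho> x\<bar>) + Lp_norm p (\<lambda>x. norm (G x)) * besov_norm chi 0 p' q \<rho>)"
      using dlog_norm_commutator_le[OF _ _ _ _ _ _ _ _ _ _ _ _ _ _ \<theta>, of p p' r q \<rho> u G \<phi>] by blast
    also have "\<dots> \<le> ennreal (?C + 1) *
        (besov_norm chi 0 p q G * Lp_norm p' (\<lambda>x. \<bar>\<rho> x\<bar>) + Lp_norm p (\<lambda>x. norm (G x)) * besov_norm chi 0 p' q \<rho>)"
      by (intro mult_right_mono ennreal_leI) auto
    finally show ?case .
  qed
qed

end
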